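(* Let $\hbar>0$, let $H_0=H_0(x,p,t)$ be a smooth Hamiltonian function on $\mathbb{R}^{2n}\times\mathbb{R}$, and let $S=S(t,x)$ be a smooth real function of $x\in\mathbb{R}^n$ and $t\in\mathbb{R}$. Then the following statements are equivalent: (a) for every $\mathbb{R}^n$-valued diffusion $X$ satisfying $$DX(t)=\partial_pH_0\big(X(t),\nabla S(t,X(t)),t\big),\qquad QX(t)=\hbar I,$$ the $\mathbb{R}^{2n}$-valued process $(X,p)$ with $p(t)=\nabla S(t,X(t))$ solves the stochastic Hamilton's equations $$DX(t)=\partial_pH_0(X(t),p(t),t),\qquad \mathbf{D}_tp(t)=-\partial_xH_0(X(t),p(t),t);$$ (b) $S$ satisfies the second-order Hamilton--Jacobi equation $$\frac{\partial S}{\partial t}(t,x)+H_0\big(x,\nabla S(t,x),t\big)+\frac{\hbar}{2}\Delta S(t,x)=f(t)$$ for some function $f$ depending only on $t$.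
   Context: The probability space carries a usual nondecreasing filtration $\{\mathcal F_t\}$. For an $\mathbb{R}^n$-valued process $X$, the (forward) mean derivative and quadratic mean derivative are $$DX(t)=\lim_{\epsilon\to0^+}\mathbb{E}\Big[\tfrac{X(t+\epsilon)-X(t)}{\epsilon}\Big|\mathcal F_t\Big],\qquad QX(t)=\lim_{\epsilon\to0^+}\mathbb{E}\Big[\tfrac{(X(t+\epsilon)-X(t))\otimes(X(t+\epsilon)-X(t))}{\epsilon}\Big|\mathcal F_t\Big].$$ The total mean derivative with respect to $X$ (when $QX=\hbar I$), acting on functions of $(t,X(t))$, is $\mathbf{D}_t=\frac{\partial}{\partial t}+DX\cdot\nabla+\frac{\hbar}{2}\Delta$. $\nabla$ and $\Delta$ are taken in the space variable $x$. *)

theory Defs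
  imports "HOL-Probability.Probability" "HOL-Library.Equipollence"
begin

section \<open>Smooth functions and differential operators\<close>

primrec C_k :: "nat \<Rightarrow> ('a::euclidean_space \<Rightarrow> real) \<Rightarrow> bool" where
  "C_k 0 f \<longleftrightarrow> continuous_on UNIV f"
| "C_k (Suc k) f \<longleftrightarrow> (\<forall>x. f differentiable (at x)) \<and>
     (\<forall>e\<in>Basis. C_k k (\<lambda>x. frechet_derivative f (at x) e))"

definition smooth :: "('a::euclidean_space \<Rightarrow> real) \<Rightarrow> bool" where
  "smooth f \<longleftrightarrow> (\<forall>k. C_k k f)"

definition partial :: "'n \<Rightarrow> (real^'n \<Rightarrow> real) \<Rightarrow> real^'n \<Rightarrow> real" where
  "partial i f x = frechet_derivative f (at x) (axis i 1)"

definition grad :: "(real^'n \<Rightarrow> real) \<Rightarrow> real^'n \<Rightarrow> real^'n" where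
  "grad f x = (\<chi> i. partial i f x)"

definition laplacian :: "(real^'n \<Rightarrow> real) \<Rightarrow> real^'n \<Rightarrow> real" where
  "laplacian f x = (\<Sum>i\<in>UNIV. partial i (partial i f) x)"

section \<open>Filtered probability spaces and stochastic intervals\<close>

locale usual_filtered_space = prob_space M + filtration "space M" F
  for M :: "'w measure" and F :: "real \<Rightarrow> 'w measure" +
  assumes filtration_subalgebra: "\<And>t. subalgebra M (F t)"
    and filtration_complete: "\<And>t N A. N \<in> null_sets M \<Longrightarrow> A \<subseteq> N \<Longrightarrow> A \<in> sets (F t)"
    and filtration_right_continuous: "\<And>t. sets (F t) = (\<Inter>s\<in>{t<..}. sets (F s))"

text \<open>
  Since the coefficients of the diffusions below are only smooth, diffusions may explode.
  All processes are therefore considered on a stochastic interval \<open>[t0, \<tau>)\<close>, where \<open>t0\<close> is a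
  deterministic initial time and the lifetime \<open>\<tau>\<close> (possibly infinite) is announced by the
  stopping times \<open>\<sigma> k\<close>. In particular \<open>t0 < \<tau>\<close>, and \<open>\<tau>\<close> is a stopping time.
  The values of a process at times outside \<open>[t0, \<tau>)\<close> are irrelevant.
\<close>

definition localizing ::
  "'w measure \<Rightarrow> (real \<Rightarrow> 'w measure) \<Rightarrow> real \<Rightarrow> ('w \<Rightarrow> ereal) \<Rightarrow> (nat \<Rightarrow> 'w \<Rightarrow> real) \<Rightarrow> bool" where
  "localizing M F t0 \<tau> \<sigma> \<longleftrightarrow>
     (\<forall>k. stopping_time F (\<sigma> k)) \<and>
     (\<forall>\<omega>\<in>space M.
        (\<forall>k. t0 \<le> \<sigma> k \<omega> \<and> ereal (\<sigma> k \<omega>) < \<tau> \<omega>) \<and>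
        incseq (\<lambda>k. \<sigma> k \<omega>) \<and>
        (\<lambda>k. ereal (\<sigma> k \<omega>)) \<longlonglongrightarrow> \<tau> \<omega>)"

section \<open>Diffusions\<close>

definition martingale_from ::
  "'w measure \<Rightarrow> (real \<Rightarrow> 'w measure) \<Rightarrow> real \<Rightarrow> (real \<Rightarrow> 'w \<Rightarrow> real) \<Rightarrow> bool" where
  "martingale_from M F t0 Y \<longleftrightarrow>
     (\<forall>t\<ge>t0. Y t \<in> borel_measurable (F t) \<and> integrable M (Y t)) \<and>
     (\<forall>s t. t0 \<le> s \<and> s \<le> t \<longrightarrow> (AE \<omega> in M. real_cond_exp M (F s) (Y t) \<omega> = Y s \<omega>))"

definition diffusion_operator ::
  "(real \<Rightarrow> real^'n \<Rightarrow> real^'n) \<Rightarrow> (real \<Rightarrow> real^'n \<Rightarrow> real^'n^'n) \<Rightarrow>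
   real \<Rightarrow> (real^'n \<Rightarrow> real) \<Rightarrow> real^'n \<Rightarrow> real" where
  "diffusion_operator b a t f x =
     (\<Sum>i\<in>UNIV. b t x $ i * partial i f x) +
     (\<Sum>i\<in>UNIV. \<Sum>j\<in>UNIV. a t x $ i $ j * partial i (partial j f) x) / 2"

definition admissible_coefficients ::
  "(real \<Rightarrow> real^'n \<Rightarrow> real^'n) \<Rightarrow> (real \<Rightarrow> real^'n \<Rightarrow> real^'n^'n) \<Rightarrow> bool" where
  "admissible_coefficients b a \<longleftrightarrow>
     (\<lambda>(t, x). b t x) \<in> borel_measurable borel \<and>
     (\<lambda>(t, x). a t x) \<in> borel_measurable borel \<and>
     (\<forall>K. compact K \<longrightarrow> bounded ((\<lambda>(t, x). b t x) ` K) \<and> bounded ((\<lambda>(t, x). a t x) ` K)) \<and>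
     (\<forall>t x. transpose (a t x) = a t x \<and> (\<forall>v. 0 \<le> v \<bullet> (a t x *v v)))"

text \<open>
  A diffusion is a continuous adapted process that solves, up to its lifetime, the
  (Stroock--Varadhan) martingale problem of a time-dependent second-order operator; equivalently,
  it is a weak solution of an Ito stochastic differential equation with coefficients depending
  on \<open>(t, X(t))\<close>.
\<close>

definition diffusion ::
  "'w measure \<Rightarrow> (real \<Rightarrow> 'w measure) \<Rightarrow> real \<Rightarrow> ('w \<Rightarrow> ereal) \<Rightarrow>
   (real \<Rightarrow> 'w \<Rightarrow> real^'n) \<Rightarrow> bool" where
  "diffusion M F t0 \<tau> X \<longleftrightarrow>
     (\<forall>t\<ge>t0. (\<lambda>\<omega>. if ereal t < \<tau> \<omega> then X t \<omega> else 0) \<in> borel_measurable (F t)) \<and>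
     (\<forall>\<omega>\<in>space M. continuous_on {t. t0 \<le> t \<and> ereal t < \<tau> \<omega>} (\<lambda>t. X t \<omega>)) \<and>
     (\<exists>b a \<sigma>. admissible_coefficients b a \<and> localizing M F t0 \<tau> \<sigma> \<and>
        (\<forall>f K k. smooth f \<and> compact K \<and> (\<forall>x. x \<notin> K \<longrightarrow> f x = 0) \<longrightarrow>
           martingale_from M F t0 (\<lambda>t \<omega>.
             f (X (min t (\<sigma> k \<omega>)) \<omega>) -
             (LINT s:{t0..min t (\<sigma> k \<omega>)}|lborel. diffusion_operator b a s f (X s \<omega>)))))"

section \<open>Mean derivatives\<close>

text \<open>
  \<open>V\<close> is the limit, as \<open>h\<close> tends to 0 from the right, of the conditional expectation of \<open>Y h / h\<close>
  given \<open>G\<close>, in \<open>L\<^sup>1\<close> on the event \<open>A\<close>. (An almost sure limit would be ill-defined, because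
  conditional expectations are only determined up to null sets depending on \<open>h\<close>.)
\<close>

definition cond_rate ::
  "'w measure \<Rightarrow> 'w measure \<Rightarrow> 'w set \<Rightarrow> (real \<Rightarrow> 'w \<Rightarrow> real) \<Rightarrow> ('w \<Rightarrow> real) \<Rightarrow> bool" where
  "cond_rate M G A Y V \<longleftrightarrow>
     (\<forall>h>0. integrable M (Y h)) \<and>
     ((\<lambda>h. \<integral>\<^sup>+ \<omega>. ennreal \<bar>real_cond_exp M G (\<lambda>\<omega>. Y h \<omega> / h) \<omega> - V \<omega>\<bar> * indicator A \<omega> \<partial>M)
        \<longlongrightarrow> 0) (at_right 0)"

definition stopped_increment ::
  "(real \<Rightarrow> 'w \<Rightarrow> real^'n) \<Rightarrow> ('w \<Rightarrow> real) \<Rightarrow> real \<Rightarrow> real \<Rightarrow> 'w \<Rightarrow> real^'n" where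
  "stopped_increment X T t h \<omega> = X (min (t + h) (T \<omega>)) \<omega> - X (min t (T \<omega>)) \<omega>"

text \<open>
  \<open>DX(t) = V(t)\<close> and \<open>QX(t) = W(t)\<close> on \<open>[t0, \<tau>)\<close>. Because \<open>X(t + h)\<close> need not be defined or
  integrable when the lifetime is finite, the increments are those of the process stopped at
  \<open>\<sigma> k\<close>, the limits being taken on the event \<open>t < \<sigma> k\<close>.
\<close>

definition has_mean_derivative ::
  "'w measure \<Rightarrow> (real \<Rightarrow> 'w measure) \<Rightarrow> real \<Rightarrow> ('w \<Rightarrow> ereal) \<Rightarrow>
   (real \<Rightarrow> 'w \<Rightarrow> real^'n) \<Rightarrow> (real \<Rightarrow> 'w \<Rightarrow> real^'n) \<Rightarrow> bool" where
  "has_mean_derivative M F t0 \<tau> X V \<longleftrightarrow>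
     (\<exists>\<sigma>. localizing M F t0 \<tau> \<sigma> \<and>
       (\<forall>k. \<forall>t\<ge>t0. \<forall>i. cond_rate M (F t) {\<omega>. t < \<sigma> k \<omega>}
          (\<lambda>h \<omega>. stopped_increment X (\<sigma> k) t h \<omega> $ i) (\<lambda>\<omega>. V t \<omega> $ i)))"

definition has_quadratic_mean_derivative ::
  "'w measure \<Rightarrow> (real \<Rightarrow> 'w measure) \<Rightarrow> real \<Rightarrow> ('w \<Rightarrow> ereal) \<Rightarrow>
   (real \<Rightarrow> 'w \<Rightarrow> real^'n) \<Rightarrow> (real \<Rightarrow> 'w \<Rightarrow> real^'n^'n) \<Rightarrow> bool" where
  "has_quadratic_mean_derivative M F t0 \<tau> X W \<longleftrightarrow>
     (\<exists>\<sigma>. localizing M F t0 \<tau> \<sigma> \<and>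
       (\<forall>k. \<forall>t\<ge>t0. \<forall>i j. cond_rate M (F t) {\<omega>. t < \<sigma> k \<omega>}
          (\<lambda>h \<omega>. stopped_increment X (\<sigma> k) t h \<omega> $ i * stopped_increment X (\<sigma> k) t h \<omega> $ j)
          (\<lambda>\<omega>. W t \<omega> $ i $ j)))"

text \<open>The operator \<open>\<partial>/\<partial>t + v \<cdot> \<nabla> + hbar/2 \<Delta>\<close>, applied to each component of \<open>\<phi>\<close>, at \<open>(t, x)\<close>.\<close>

definition total_mean_derivative ::
  "real \<Rightarrow> real^'n \<Rightarrow> (real \<Rightarrow> real^'n \<Rightarrow> real^'m) \<Rightarrow> real \<Rightarrow> real^'n \<Rightarrow> real^'m" where
  "total_mean_derivative hbar v \<phi> t x =
     (\<chi> i. deriv (\<lambda>s. \<phi> s x $ i) t +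
           v \<bullet> grad (\<lambda>y. \<phi> t y $ i) x +
           hbar / 2 * laplacian (\<lambda>y. \<phi> t y $ i) x)"

section \<open>Stochastic Hamilton's equations\<close>

text \<open>
  The process \<open>(X, p)\<close> with \<open>p(t) = \<phi>(t, X(t))\<close> solves the stochastic Hamilton's equations on
  \<open>[t0, \<tau>)\<close>. The process \<open>V\<close> is \<open>DX\<close>; the condition \<open>QX = hbar I\<close> is what makes the total mean
  derivative the one with respect to \<open>X\<close>.
\<close>

definition solves_stochastic_Hamilton ::
  "real \<Rightarrow> (real^'n \<Rightarrow> real^'n \<Rightarrow> real \<Rightarrow> real) \<Rightarrow>
   'w measure \<Rightarrow> (real \<Rightarrow> 'w measure) \<Rightarrow> real \<Rightarrow> ('w \<Rightarrow> ereal) \<Rightarrow>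
   (real \<Rightarrow> 'w \<Rightarrow> real^'n) \<Rightarrow> (real \<Rightarrow> real^'n \<Rightarrow> real^'n) \<Rightarrow> bool" where
  "solves_stochastic_Hamilton hbar H M F t0 \<tau> X \<phi> \<longleftrightarrow>
     has_quadratic_mean_derivative M F t0 \<tau> X (\<lambda>t \<omega>. hbar *\<^sub>R mat 1) \<and>
     (\<exists>V. has_mean_derivative M F t0 \<tau> X V \<and>
       (\<forall>t\<ge>t0. AE \<omega> in M. ereal t < \<tau> \<omega> \<longrightarrow>
          (let x = X t \<omega>; p = \<phi> t x in
             V t \<omega> = grad (\<lambda>q. H x q t) p \<and>
             total_mean_derivative hbar (V t \<omega>) \<phi> t x = - grad (\<lambda>y. H y p t) x)))"

end

theory Submission
  imports Defs
begin

text \<open>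
  Let \<open>G t x\<close> be the left-hand side of the Hamilton-Jacobi equation, and let \<open>E t x\<close> be the defect
  \<open>D\<^sub>t (\<nabla>S) + \<partial>\<^sub>x H0\<close> of the second Hamilton equation, evaluated at the momentum \<open>\<nabla>S\<close> and the
  velocity \<open>\<partial>\<^sub>p H0\<close>. The chain rule and the symmetry of the higher derivatives of \<open>S\<close> give
  \<open>\<nabla>G = E\<close> (\<open>Hamilton_Jacobi_has_derivative\<close>). Hence (b), which says that \<open>G\<close> depends on time
  only, is equivalent to \<open>E = 0\<close> everywhere. If \<open>E = 0\<close>, then the second Hamilton equation holds
  at every point, in particular along every process, and (a) follows without any probability.

  For the converse, \<open>E t0 x0 = 0\<close> has to be extracted from (a) for each \<open>(t0, x0)\<close>. A diffusion as
  in (a) that starts at \<open>x0\<close> at time \<open>t0\<close> does it: its initial value is deterministic, so the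
  Hamilton equation at time \<open>t0\<close> is a statement about that one point
  (\<open>Hamilton_equation_at_start\<close>). Such a diffusion solves \<open>dX = \<beta> dt + sqrt hbar dB\<close>, where \<open>\<beta>\<close>
  is \<open>\<partial>\<^sub>p H0\<close> along \<open>\<nabla>S\<close>, and is followed until it leaves a small space-time cylinder around
  \<open>(t0, x0)\<close>. Most of the text constructs it.

  A Brownian motion comes from independent normal variables by Levy's midpoint interpolation. It
  rests on the invariance of the normal law under orthogonal maps of the plane
  (\<open>nn_integral_rotate_std_normal\<close>): such a map turns a normalised increment and a fresh
  displacement of the midpoint into the increments over the two halves. The variables live on
  the prescribed sample type, into which their product space embeds because that type has at
  least the cardinality of the continuum. The filtration is defined by insensitivity: an event
  belongs to the past of \<open>u\<close> if, up to null sets, it ignores a replacement of the noise after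
  any dyadic time beyond \<open>u\<close>. This makes the usual conditions immediate, and averaging over the
  replaced noise gives the conditional moments of the increments (\<open>past_expectation\<close>,
  \<open>brownian_levy\<close>).

  As the noise is additive, the equation is an integral equation for each path, and Picard
  iteration solves it once \<open>\<beta>\<close> is made globally Lipschitz by freezing it outside the cylinder.
  No stochastic integral is needed: for a test function \<open>f\<close>, the second-order Taylor expansion
  shows that the increment of \<open>N = f(X) - \<integral> L f(X)\<close> over \<open>[u, v]\<close> is orthogonal to the past of
  \<open>u\<close> up to an error of order \<open>(v - u) sqrt (v - u)\<close>, and errors of that order disappear when
  summed over finer and finer partitions (\<open>remainder_bound\<close>, \<open>N_martingale\<close>). Optional stopping
  carries this to the exit times of smaller cylinders. Compactly supported \<open>f\<close> then give the
  martingale problem that defines a diffusion, the coordinates give \<open>DX\<close>, and the products of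
  two coordinates give \<open>QX\<close>.
\<close>

section \<open>Calculus of smooth functions\<close>

text \<open>Allowing an arbitrary direction \<open>e\<close>, and not only a basis vector, makes \<open>dd\<close> linear in
  \<open>e\<close>, so that chain rules through linear maps become substitutions.\<close>

definition dd :: "'a::euclidean_space \<Rightarrow> ('a \<Rightarrow> real) \<Rightarrow> 'a \<Rightarrow> real" where
  "dd e f x = frechet_derivative f (at x) e"

lemma smooth_dd: "smooth f \<Longrightarrow> e \<in> Basis \<Longrightarrow> smooth (dd e f)"
  unfolding smooth_def dd_def by (metis C_k.simps(2))

lemma smooth_continuous: "smooth f \<Longrightarrow> continuous_on UNIV f"
  unfolding smooth_def by (metis C_k.simps(1))

lemma smooth_differentiable: "smooth f \<Longrightarrow> f differentiable (at x)"
  unfolding smooth_def by (metis C_k.simps(2))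

lemma smooth_has_derivative:
  assumes "smooth f"
  shows "(f has_derivative (\<lambda>v. \<Sum>e\<in>Basis. (v \<bullet> e) * dd e f x)) (at x)"
proof -
  have D: "(f has_derivative frechet_derivative f (at x)) (at x)"
    using smooth_differentiable[OF assms] frechet_derivative_works by blast
  then interpret D: linear "frechet_derivative f (at x)"
    by (rule has_derivative_linear)
  have "frechet_derivative f (at x) = (\<lambda>v. \<Sum>e\<in>Basis. (v \<bullet> e) * dd e f x)"
  proof
    fix v
    have "frechet_derivative f (at x) v = frechet_derivative f (at x) (\<Sum>e\<in>Basis. (v \<bullet> e) *\<^sub>R e)"
      by (simp add: euclidean_representation)
    also have "\<dots> = (\<Sum>e\<in>Basis. (v \<bullet> e) * dd e f x)"
      by (simp add: D.sum D.scaleR dd_def)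
    finally show "frechet_derivative f (at x) v = (\<Sum>e\<in>Basis. (v \<bullet> e) * dd e f x)" .
  qed
  with D show ?thesis by simp
qed

lemma smooth_has_derivative_frechet:
  assumes "smooth f"
  shows "(f has_derivative (\<lambda>v. dd v f x)) (at x)"
  using smooth_differentiable[OF assms] frechet_derivative_works unfolding dd_def by blast

lemma dd_linear: "smooth f \<Longrightarrow> linear (\<lambda>v. dd v f x)"
  using smooth_has_derivative_frechet has_derivative_linear by blast

lemma smooth_line_derivative:
  assumes "smooth f"
  shows "((\<lambda>s. f (x + s *\<^sub>R v)) has_real_derivative dd v f (x + s *\<^sub>R v)) (at s within A)"
proof -
  have "((\<lambda>s. x + s *\<^sub>R v) has_derivative (\<lambda>h. h *\<^sub>R v)) (at s within A)"
    by (auto intro!: derivative_eq_intros)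
  from has_derivative_compose[OF this smooth_has_derivative_frechet[OF assms]]
  have "((\<lambda>s. f (x + s *\<^sub>R v)) has_derivative (\<lambda>h. dd (h *\<^sub>R v) f (x + s *\<^sub>R v))) (at s within A)" .
  moreover have "dd (h *\<^sub>R v) f (x + s *\<^sub>R v) = dd v f (x + s *\<^sub>R v) * h" for h
    using linear_cmul[OF dd_linear[OF assms]] by simp
  ultimately show ?thesis
    by (simp add: has_field_derivative_def)
qed

text \<open>The mean value theorem is used twice: first in the direction \<open>e\<close> for the difference of \<open>f\<close>
  along \<open>d\<close>, and then in the direction \<open>d\<close> for the derivative of \<open>f\<close> along \<open>e\<close>.\<close>

lemma second_difference_mean_value:
  assumes f: "smooth f" and e: "e \<in> Basis" and h: "0 < h"
  obtains s t where "0 < s" "s < h" "0 < t" "t < h"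
    "f (x + h *\<^sub>R e + h *\<^sub>R d) - f (x + h *\<^sub>R e) - f (x + h *\<^sub>R d) + f x
       = h * h * dd d (dd e f) (x + s *\<^sub>R e + t *\<^sub>R d)"
proof -
  define g where "g s = f ((x + h *\<^sub>R d) + s *\<^sub>R e) - f (x + s *\<^sub>R e)" for s
  have "(g has_real_derivative dd e f ((x + h *\<^sub>R d) + s *\<^sub>R e) - dd e f (x + s *\<^sub>R e)) (at s)" for s
    unfolding g_def by (intro DERIV_diff smooth_line_derivative f)
  then obtain s where s: "0 < s" "s < h"
    "g h - g 0 = (h - 0) * (dd e f ((x + h *\<^sub>R d) + s *\<^sub>R e) - dd e f (x + s *\<^sub>R e))"
    using MVT2[OF h, of g "\<lambda>s. dd e f ((x + h *\<^sub>R d) + s *\<^sub>R e) - dd e f (x + s *\<^sub>R e)"] by blast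
  define k where "k t = dd e f ((x + s *\<^sub>R e) + t *\<^sub>R d)" for t
  have "(k has_real_derivative dd d (dd e f) ((x + s *\<^sub>R e) + t *\<^sub>R d)) (at t)" for t
    unfolding k_def by (intro smooth_line_derivative smooth_dd f e)
  then obtain t where t: "0 < t" "t < h"
    "k h - k 0 = (h - 0) * dd d (dd e f) ((x + s *\<^sub>R e) + t *\<^sub>R d)"
    using MVT2[OF h, of k "\<lambda>t. dd d (dd e f) ((x + s *\<^sub>R e) + t *\<^sub>R d)"] by blast
  show thesis
    by (rule that[OF s(1,2) t(1,2)]) (use s(3) t(3) in \<open>simp add: g_def k_def algebra_simps\<close>)
qed

text \<open>Both orders of differentiation are limits of the same second difference quotient, which is
  symmetric in \<open>d\<close> and \<open>e\<close>.\<close>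

lemma dd_commute:
  assumes f: "smooth f" and e: "e \<in> Basis" and d: "d \<in> Basis"
  shows "dd d (dd e f) x = dd e (dd d f) x"
proof -
  define q where "q h = (f (x + h *\<^sub>R e + h *\<^sub>R d) - f (x + h *\<^sub>R e) - f (x + h *\<^sub>R d) + f x) / (h * h)" for h :: real
  have lim: "(\<lambda>n. q (1 / Suc n)) \<longlonglongrightarrow> dd d' (dd e' f) x"
    if e': "e' \<in> Basis" and d': "d' \<in> Basis"
      and q: "\<And>h. q h = (f (x + h *\<^sub>R e' + h *\<^sub>R d') - f (x + h *\<^sub>R e') - f (x + h *\<^sub>R d') + f x) / (h * h)" for e' d'
  proof -
    have "\<exists>s t. 0 < s \<and> s < 1 / Suc n \<and> 0 < t \<and> t < 1 / Suc n \<and>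
       q (1 / Suc n) = dd d' (dd e' f) (x + s *\<^sub>R e' + t *\<^sub>R d')" for n
    proof -
      obtain s t where "0 < s" "s < 1 / Suc n" "0 < t" "t < 1 / Suc n"
        "f (x + (1 / Suc n) *\<^sub>R e' + (1 / Suc n) *\<^sub>R d') - f (x + (1 / Suc n) *\<^sub>R e') - f (x + (1 / Suc n) *\<^sub>R d') + f x
          = (1 / Suc n * (1 / Suc n)) * dd d' (dd e' f) (x + s *\<^sub>R e' + t *\<^sub>R d')"
        using second_difference_mean_value[OF f e', of "1 / Suc n" x d'] by (metis zero_less_divide_1_iff of_nat_0_less_iff zero_less_Suc)
      then show ?thesis
        unfolding q by (intro exI[of _ s] exI[of _ t]) (simp del: of_nat_Suc)
    qed
    then obtain s t where st: "\<And>n. 0 < s n" "\<And>n. s n < 1 / Suc n" "\<And>n. 0 < t n" "\<And>n. t n < 1 / Suc n"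
       "\<And>n. q (1 / Suc n) = dd d' (dd e' f) (x + s n *\<^sub>R e' + t n *\<^sub>R d')"
      by metis
    have s0: "s \<longlonglongrightarrow> 0"
      by (rule tendsto_sandwich[OF _ _ tendsto_const LIMSEQ_inverse_real_of_nat])
        (auto intro!: always_eventually less_imp_le[OF st(1)] less_imp_le[OF st(2)] simp: inverse_eq_divide simp del: of_nat_Suc)
    have t0: "t \<longlonglongrightarrow> 0"
      by (rule tendsto_sandwich[OF _ _ tendsto_const LIMSEQ_inverse_real_of_nat])
        (auto intro!: always_eventually less_imp_le[OF st(3)] less_imp_le[OF st(4)] simp: inverse_eq_divide simp del: of_nat_Suc)
    have "(\<lambda>n. x + s n *\<^sub>R e' + t n *\<^sub>R d') \<longlonglongrightarrow> x + 0 *\<^sub>R e' + 0 *\<^sub>R d'"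
      by (intro tendsto_intros s0 t0)
    moreover have "continuous_on UNIV (dd d' (dd e' f))"
      by (intro smooth_continuous smooth_dd f e' d')
    ultimately have "(\<lambda>n. dd d' (dd e' f) (x + s n *\<^sub>R e' + t n *\<^sub>R d')) \<longlonglongrightarrow> dd d' (dd e' f) x"
      using isCont_tendsto_compose[of x "dd d' (dd e' f)"] by (simp add: continuous_on_eq_continuous_at)
    then show ?thesis by (simp only: st(5))
  qed
  show ?thesis
    by (rule LIMSEQ_unique[OF lim[OF e d] lim[OF d e]]) (auto simp: q_def algebra_simps)
qed

subsection \<open>Slices\<close>

lemma slice_has_derivative:
  fixes F :: "real \<times> (real^'n) \<Rightarrow> real"
  assumes F: "smooth F"
  shows "((\<lambda>x. F (t, x)) has_derivative (\<lambda>v. \<Sum>i\<in>UNIV. v $ i * dd (0, axis i 1) F (t, x))) (at x)"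
proof -
  have "((\<lambda>x. (t, x)) has_derivative (\<lambda>v. (0, v))) (at x)"
    by (auto intro!: derivative_eq_intros)
  from has_derivative_compose[OF this smooth_has_derivative_frechet[OF F]]
  have *: "((\<lambda>x. F (t, x)) has_derivative (\<lambda>v. dd (0, v) F (t, x))) (at x)" .
  interpret L: linear "\<lambda>v. dd (0, v) F (t, x)"
    using * by (rule has_derivative_linear)
  have "dd (0, v) F (t, x) = (\<Sum>i\<in>UNIV. v $ i * dd (0, axis i 1) F (t, x))" for v
  proof -
    have v: "v = (\<Sum>i\<in>UNIV. (v $ i) *\<^sub>R axis i 1)"
      using basis_expansion[of v] by (simp add: scalar_mult_eq_scaleR)
    have "dd (0, v) F (t, x) = dd (0, \<Sum>i\<in>UNIV. (v $ i) *\<^sub>R axis i 1) F (t, x)"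
      by (rule arg_cong[where f="\<lambda>v. dd (0, v) F (t, x)", OF v])
    then show ?thesis by (simp only: L.sum L.scaleR real_scaleR_def)
  qed
  then show ?thesis
    by (intro has_derivative_eq_rhs[OF *] ext)
qed

lemma axis_Basis_prod: "(0, axis i 1) \<in> (Basis :: (real \<times> (real^'n)) set)" "(1, 0) \<in> (Basis :: (real \<times> (real^'n)) set)"
  by (auto simp: Basis_prod_def Basis_vec_def axis_eq_axis)

lemma partial_slice:
  fixes F :: "real \<times> (real^'n) \<Rightarrow> real"
  assumes F: "smooth F"
  shows "partial i (\<lambda>x. F (t, x)) x = dd (0, axis i 1) F (t, x)"
proof -
  have "partial i (\<lambda>x. F (t, x)) x = (\<Sum>j\<in>UNIV. axis i (1::real) $ j * dd (0, axis j 1) F (t, x))"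
    unfolding partial_def by (simp add: frechet_derivative_at[OF slice_has_derivative[OF F, of t x], symmetric])
  also have "\<dots> = dd (0, axis i 1) F (t, x)"
    by (simp add: axis_def if_distrib[of "\<lambda>z. z * _"] cong: if_cong)
  finally show ?thesis .
qed

lemma partial_slice_fun:
  fixes F :: "real \<times> (real^'n) \<Rightarrow> real"
  assumes F: "smooth F"
  shows "partial i (\<lambda>x. F (t, x)) = (\<lambda>x. dd (0, axis i 1) F (t, x))"
  using partial_slice[OF F] by auto

lemma deriv_slice:
  fixes F :: "real \<times> (real^'n) \<Rightarrow> real"
  assumes F: "smooth F"
  shows "deriv (\<lambda>s. F (s, x)) t = dd (1, 0) F (t, x)"
  using smooth_line_derivative[OF F, of "(0, x)" "(1, 0)" t UNIV] by (intro DERIV_imp_deriv) simp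

lemma laplacian_slice:
  fixes F :: "real \<times> (real^'n) \<Rightarrow> real"
  assumes F: "smooth F"
  shows "laplacian (\<lambda>x. F (t, x)) x = (\<Sum>i\<in>UNIV. dd (0, axis i 1) (dd (0, axis i 1) F) (t, x))"
  unfolding laplacian_def partial_slice_fun[OF F]
  by (intro sum.cong refl partial_slice smooth_dd[OF F] axis_Basis_prod)

lemma dd_pair_zero_sum:
  fixes K :: "(real^'n) \<times> (real^'n) \<times> real \<Rightarrow> real"
  assumes K: "smooth K"
  shows "dd (v, w, 0) K z = (\<Sum>i\<in>UNIV. v $ i * dd (axis i 1, 0, 0) K z) + (\<Sum>i\<in>UNIV. w $ i * dd (0, axis i 1, 0) K z)"
proof -
  interpret L: linear "\<lambda>u. dd u K z" by (rule dd_linear[OF K])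
  have v: "(v, w, 0) = (\<Sum>i\<in>UNIV. (v $ i) *\<^sub>R (axis i 1, 0, 0)) + (\<Sum>i\<in>UNIV. (w $ i) *\<^sub>R (0, axis i 1, 0 :: real))"
    using basis_expansion[of v] basis_expansion[of w]
    by (simp add: prod_eq_iff fst_sum snd_sum scalar_mult_eq_scaleR)
  show ?thesis by (subst v) (simp only: L.add L.sum L.scaleR real_scaleR_def)
qed

lemma partial_slice_position:
  fixes K :: "(real^'n) \<times> (real^'n) \<times> real \<Rightarrow> real"
  assumes K: "smooth K"
  shows "partial i (\<lambda>y. K (y, p, t)) x = dd (axis i 1, 0, 0) K (x, p, t)"
proof -
  have "((\<lambda>y. (y, p, t)) has_derivative (\<lambda>v. (v, 0, 0))) (at x)"
    by (auto intro!: derivative_eq_intros simp: zero_prod_def)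
  note D = has_derivative_compose[OF this smooth_has_derivative_frechet[OF K]]
  show ?thesis unfolding partial_def by (simp add: frechet_derivative_at[OF D, symmetric])
qed

lemma partial_slice_momentum:
  fixes K :: "(real^'n) \<times> (real^'n) \<times> real \<Rightarrow> real"
  assumes K: "smooth K"
  shows "partial i (\<lambda>q. K (x, q, t)) p = dd (0, axis i 1, 0) K (x, p, t)"
proof -
  have "((\<lambda>q. (x, q, t)) has_derivative (\<lambda>v. (0, v, 0))) (at p)"
    by (auto intro!: derivative_eq_intros)
  note D = has_derivative_compose[OF this smooth_has_derivative_frechet[OF K]]
  show ?thesis unfolding partial_def by (simp add: frechet_derivative_at[OF D, symmetric])
qed

subsection \<open>The gradient of the Hamilton-Jacobi expression\<close>

text \<open>Differentiating \<open>H0 x (grad (S t) x) t\<close> produces the Hessian of \<open>S\<close> applied to \<open>\<partial>\<^sub>p H0\<close>.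
  Since the Hessian is symmetric, this is the derivative of \<open>\<nabla>S\<close> along the velocity \<open>\<partial>\<^sub>p H0\<close>,
  the transport term of the total mean derivative. Likewise the space derivative of \<open>\<partial>S/\<partial>t\<close> is
  the time derivative of \<open>\<nabla>S\<close>, and that of \<open>\<Delta>S\<close> is \<open>\<Delta>\<nabla>S\<close>.\<close>

lemma Hamilton_Jacobi_has_derivative:
  fixes H0 :: "real^'n \<Rightarrow> real^'n \<Rightarrow> real \<Rightarrow> real" and S :: "real \<Rightarrow> real^'n \<Rightarrow> real"
  assumes H0: "smooth (\<lambda>(x, p, t). H0 x p t)" and S: "smooth (\<lambda>(t, x). S t x)"
  shows "((\<lambda>x. deriv (\<lambda>s. S s x) t + H0 x (grad (S t) x) t + hbar / 2 * laplacian (S t) x)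
     has_derivative (\<lambda>v. v \<bullet> (total_mean_derivative hbar (grad (\<lambda>q. H0 x q t) (grad (S t) x))
        (\<lambda>t x. grad (S t) x) t x + grad (\<lambda>y. H0 y (grad (S t) x) t) x))) (at x)"
proof -
  define F where "F = (\<lambda>(t, x). S t x)"
  define K where "K = (\<lambda>(x, p, t). H0 x p t)"
  have F: "smooth F" and K: "smooth K" using H0 S by (auto simp: F_def K_def)
  have SF: "S t = (\<lambda>x. F (t, x))" for t by (auto simp: F_def)
  have HK: "H0 x p t = K (x, p, t)" for x p t by (auto simp: K_def)
  define P where "P i = dd (0, axis i 1) F" for i
  define T where "T = dd (1, 0) F"
  have P: "smooth (P i)" for i unfolding P_def by (intro smooth_dd F axis_Basis_prod)
  have T: "smooth T" unfolding T_def by (intro smooth_dd F axis_Basis_prod)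
  have PP: "smooth (dd (0, axis j 1) (P i))" for i j by (intro smooth_dd P axis_Basis_prod)
  have gradS: "grad (S t) x = (\<chi> i. P i (t, x))" for t x
    by (simp add: grad_def SF partial_slice[OF F] P_def)
  let ?p = "grad (S t) x"
  have dgrad: "((\<lambda>x. grad (S t) x) has_derivative (\<lambda>v. \<chi> i. \<Sum>j\<in>UNIV. v $ j * dd (0, axis j 1) (P i) (t, x))) (at x)"
  proof -
    have "((\<lambda>x. \<Sum>i\<in>UNIV. P i (t, x) *\<^sub>R axis i (1::real)) has_derivative
      (\<lambda>v. \<Sum>i\<in>UNIV. (\<Sum>j\<in>UNIV. v $ j * dd (0, axis j 1) (P i) (t, x)) *\<^sub>R axis i 1)) (at x)"
      by (intro has_derivative_sum has_derivative_scaleR_left slice_has_derivative P)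
    moreover have "(\<Sum>i\<in>UNIV. c i *\<^sub>R axis i (1::real)) = (\<chi> i. c i)" for c :: "'n \<Rightarrow> real"
      using basis_expansion[of "\<chi> i. c i"] by (simp add: scalar_mult_eq_scaleR)
    ultimately show ?thesis by (simp add: gradS)
  qed
  have d1: "((\<lambda>x. deriv (\<lambda>s. S s x) t) has_derivative (\<lambda>v. \<Sum>i\<in>UNIV. v $ i * dd (0, axis i 1) T (t, x))) (at x)"
    unfolding SF deriv_slice[OF F] T_def[symmetric] by (rule slice_has_derivative[OF T])
  have "((\<lambda>x. (x, grad (S t) x, t)) has_derivative (\<lambda>v. (v, (\<chi> i. \<Sum>j\<in>UNIV. v $ j * dd (0, axis j 1) (P i) (t, x)), 0))) (at x)"
    by (intro has_derivative_Pair has_derivative_ident dgrad has_derivative_const)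
  from has_derivative_compose[OF this smooth_has_derivative_frechet[OF K]]
  have "((\<lambda>x. H0 x (grad (S t) x) t) has_derivative
     (\<lambda>v. dd (v, \<chi> i. \<Sum>j\<in>UNIV. v $ j * dd (0, axis j 1) (P i) (t, x), 0) K (x, ?p, t))) (at x)"
    by (simp add: HK)
  then have d2: "((\<lambda>x. H0 x (grad (S t) x) t) has_derivative
     (\<lambda>v. (\<Sum>i\<in>UNIV. v $ i * dd (axis i 1, 0, 0) K (x, ?p, t)) +
          (\<Sum>i\<in>UNIV. (\<Sum>j\<in>UNIV. v $ j * dd (0, axis j 1) (P i) (t, x)) * dd (0, axis i 1, 0) K (x, ?p, t)))) (at x)"
    by (rule has_derivative_eq_rhs) (rule ext, subst dd_pair_zero_sum[OF K], simp)
  have d3: "((\<lambda>x. hbar / 2 * laplacian (S t) x) has_derivative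
     (\<lambda>v. hbar / 2 * (\<Sum>i\<in>UNIV. \<Sum>j\<in>UNIV. v $ j * dd (0, axis j 1) (dd (0, axis i 1) (P i)) (t, x)))) (at x)"
    unfolding SF laplacian_slice[OF F] P_def[symmetric]
    by (intro has_derivative_mult_right has_derivative_sum slice_has_derivative PP)
  \<comment> \<open>Symmetry of second and third derivatives: here the three parts of the gradient become those
    of the total mean derivative of \<open>\<nabla>S\<close>.\<close>
  have comm: "dd (0, axis j 1) (P i) = dd (0, axis i 1) (P j)" for i j
    unfolding P_def by (intro ext dd_commute F axis_Basis_prod)
  have commT: "dd (0, axis j 1) T = dd (1, 0) (P j)" for j
    unfolding P_def T_def by (intro ext dd_commute F axis_Basis_prod)
  have comm3: "dd (0, axis j 1) (dd (0, axis i 1) (P i)) = dd (0, axis i 1) (dd (0, axis i 1) (P j))" for i j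
  proof -
    have "dd (0, axis j 1) (dd (0, axis i 1) (P i)) = dd (0, axis i 1) (dd (0, axis j 1) (P i))"
      by (intro ext dd_commute P axis_Basis_prod)
    then show ?thesis by (simp add: comm)
  qed
  have tm: "total_mean_derivative hbar (grad (\<lambda>q. H0 x q t) ?p) (\<lambda>t x. grad (S t) x) t x $ j =
     dd (1, 0) (P j) (t, x) + (\<Sum>i\<in>UNIV. dd (0, axis i 1, 0) K (x, ?p, t) * dd (0, axis i 1) (P j) (t, x))
     + hbar / 2 * (\<Sum>i\<in>UNIV. dd (0, axis i 1) (dd (0, axis i 1) (P j)) (t, x))" for j
    by (simp add: total_mean_derivative_def gradS deriv_slice[OF P] laplacian_slice[OF P]
      inner_vec_def grad_def[of "\<lambda>q. H0 x q t"] HK partial_slice_momentum[OF K])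
       (simp add: grad_def partial_slice[OF P] partial_slice_momentum[OF K])
  have hp: "grad (\<lambda>y. H0 y ?p t) x $ j = dd (axis j 1, 0, 0) K (x, ?p, t)" for j
    by (simp add: grad_def HK partial_slice_position[OF K])
  show ?thesis
  proof (rule has_derivative_eq_rhs[OF has_derivative_add[OF has_derivative_add[OF d1 d2] d3]], rule ext)
    fix v :: "real^'n"
    have sw: "(\<Sum>i\<in>UNIV. (\<Sum>j\<in>UNIV. v $ j * dd (0, axis j 1) (P i) (t, x)) * dd (0, axis i 1, 0) K (x, ?p, t))
       = (\<Sum>j\<in>UNIV. v $ j * (\<Sum>i\<in>UNIV. dd (0, axis i 1, 0) K (x, ?p, t) * dd (0, axis i 1) (P j) (t, x)))"
      unfolding sum_distrib_right sum_distrib_left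
      by (subst sum.swap, intro sum.cong refl, subst comm) simp
    have sw3: "(\<Sum>i\<in>UNIV. \<Sum>j\<in>UNIV. v $ j * dd (0, axis j 1) (dd (0, axis i 1) (P i)) (t, x))
       = (\<Sum>j\<in>UNIV. v $ j * (\<Sum>i\<in>UNIV. dd (0, axis i 1) (dd (0, axis i 1) (P j)) (t, x)))"
      unfolding sum_distrib_left by (subst sum.swap, intro sum.cong refl, subst comm3) simp
    show "(\<Sum>i\<in>UNIV. v $ i * dd (0, axis i 1) T (t, x)) +
          ((\<Sum>i\<in>UNIV. v $ i * dd (axis i 1, 0, 0) K (x, ?p, t)) +
           (\<Sum>i\<in>UNIV. (\<Sum>j\<in>UNIV. v $ j * dd (0, axis j 1) (P i) (t, x)) * dd (0, axis i 1, 0) K (x, ?p, t))) +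
          hbar / 2 * (\<Sum>i\<in>UNIV. \<Sum>j\<in>UNIV. v $ j * dd (0, axis j 1) (dd (0, axis i 1) (P i)) (t, x)) =
          v \<bullet> (total_mean_derivative hbar (grad (\<lambda>q. H0 x q t) ?p) (\<lambda>t x. grad (S t) x) t x + grad (\<lambda>y. H0 y ?p t) x)"
      unfolding sw sw3 inner_vec_def vector_add_component tm hp commT
      by (simp add: sum.distrib[symmetric] sum_distrib_left algebra_simps)
  qed
qed

section \<open>Rotations of a Gaussian sequence\<close>

definition std_normal :: "real measure" where
  "std_normal = density lborel (\<lambda>x. ennreal (std_normal_density x))"

definition white_noise :: "('i \<Rightarrow> real) measure" where
  "white_noise = (\<Pi>\<^sub>M i\<in>UNIV. std_normal)"

lemma sets_std_normal [measurable_cong, simp]: "sets std_normal = sets borel"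
  by (simp add: std_normal_def)

lemma space_std_normal [simp]: "space std_normal = UNIV"
  by (simp add: std_normal_def)

lemma prob_space_std_normal: "prob_space std_normal"
  unfolding std_normal_def by (rule prob_space_normal_density) simp

lemma sets_white_noise [measurable_cong]: "sets white_noise = sets (\<Pi>\<^sub>M i\<in>UNIV. borel :: real measure)"
  unfolding white_noise_def by (intro sets_PiM_cong) auto

lemma space_white_noise [simp]: "space white_noise = UNIV"
  by (simp add: white_noise_def space_PiM)

lemma prob_space_white_noise: "prob_space white_noise"
  unfolding white_noise_def by (intro prob_space_PiM prob_space_std_normal)

text \<open>The map \<open>(x, y) \<mapsto> ((x + y) / sqrt 2, (x - y) / sqrt 2)\<close> is orthogonal and preserves area.
  The transformation is split into two one-dimensional affine substitutions, with Jacobians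
  \<open>sqrt 2\<close> and \<open>1 / sqrt 2\<close>, separated by an exchange of the integrals.\<close>

lemma nn_integral_rotate_lborel:
  fixes h :: "real \<Rightarrow> real \<Rightarrow> ennreal"
  assumes [measurable]: "(\<lambda>(x, y). h x y) \<in> borel_measurable (borel \<Otimes>\<^sub>M borel)"
  shows "(\<integral>\<^sup>+x. \<integral>\<^sup>+y. h ((x + y) / sqrt 2) ((x - y) / sqrt 2) \<partial>lborel \<partial>lborel) = (\<integral>\<^sup>+x. \<integral>\<^sup>+y. h x y \<partial>lborel \<partial>lborel)"
proof -
  have s: "sqrt 2 * sqrt 2 = (2::real)" "sqrt 2 > (0::real)" by auto
  have "(\<integral>\<^sup>+x. \<integral>\<^sup>+y. h ((x + y) / sqrt 2) ((x - y) / sqrt 2) \<partial>lborel \<partial>lborel)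
      = (\<integral>\<^sup>+x. ennreal (sqrt 2) * (\<integral>\<^sup>+u. h u (sqrt 2 * x - u) \<partial>lborel) \<partial>lborel)"
  proof (intro nn_integral_cong)
    fix x :: real
    have "(\<integral>\<^sup>+y. h ((x + y) / sqrt 2) ((x - y) / sqrt 2) \<partial>lborel) =
       ennreal \<bar>sqrt 2\<bar> * (\<integral>\<^sup>+u. h ((x + (- x + sqrt 2 * u)) / sqrt 2) ((x - (- x + sqrt 2 * u)) / sqrt 2) \<partial>lborel)"
      by (rule nn_integral_real_affine) (auto intro!: measurable_compose[OF _ assms, unfolded split_beta', simplified])
    moreover have "(x - (- x + sqrt 2 * u)) / sqrt 2 = sqrt 2 * x - u" for u
      using s by (simp add: field_simps)
    ultimately show "(\<integral>\<^sup>+y. h ((x + y) / sqrt 2) ((x - y) / sqrt 2) \<partial>lborel) = ennreal (sqrt 2) * (\<integral>\<^sup>+u. h u (sqrt 2 * x - u) \<partial>lborel)"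
      by simp
  qed
  also have "\<dots> = ennreal (sqrt 2) * (\<integral>\<^sup>+x. (\<integral>\<^sup>+u. h u (sqrt 2 * x - u) \<partial>lborel) \<partial>lborel)"
    by (intro nn_integral_cmult) measurable
  also have "\<dots> = ennreal (sqrt 2) * (\<integral>\<^sup>+u. (\<integral>\<^sup>+x. h u (sqrt 2 * x - u) \<partial>lborel) \<partial>lborel)"
    by (subst lborel_pair.Fubini') (auto simp: split_beta')
  also have "\<dots> = ennreal (sqrt 2) * (\<integral>\<^sup>+u. ennreal (1 / sqrt 2) * (\<integral>\<^sup>+v. h u v \<partial>lborel) \<partial>lborel)"
  proof (intro arg_cong2[where f="(*)"] refl nn_integral_cong)
    fix u :: real
    have "(\<integral>\<^sup>+x. h u (sqrt 2 * x - u) \<partial>lborel) = ennreal \<bar>1 / sqrt 2\<bar> * (\<integral>\<^sup>+v. h u (sqrt 2 * (u / sqrt 2 + 1 / sqrt 2 * v) - u) \<partial>lborel)"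
      by (rule nn_integral_real_affine) auto
    moreover have "sqrt 2 * (u / sqrt 2 + 1 / sqrt 2 * v) - u = v" for v
      by (simp add: field_simps)
    ultimately show "(\<integral>\<^sup>+x. h u (sqrt 2 * x - u) \<partial>lborel) = ennreal (1 / sqrt 2) * (\<integral>\<^sup>+v. h u v \<partial>lborel)"
      by simp
  qed
  also have "\<dots> = ennreal (sqrt 2) * (ennreal (1 / sqrt 2) * (\<integral>\<^sup>+u. (\<integral>\<^sup>+v. h u v \<partial>lborel) \<partial>lborel))"
    by (subst nn_integral_cmult) auto
  also have "\<dots> = (\<integral>\<^sup>+u. (\<integral>\<^sup>+v. h u v \<partial>lborel) \<partial>lborel)"
    by (simp add: mult.assoc[symmetric] ennreal_mult[symmetric])
  finally show ?thesis .
qed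

text \<open>The product of two standard normal densities depends only on \<open>x\<^sup>2 + y\<^sup>2\<close>, which the
  orthogonal map preserves.\<close>

lemma nn_integral_rotate_std_normal:
  fixes f :: "real \<Rightarrow> real \<Rightarrow> ennreal"
  assumes [measurable]: "(\<lambda>(x, y). f x y) \<in> borel_measurable (borel \<Otimes>\<^sub>M borel)"
  shows "(\<integral>\<^sup>+x. \<integral>\<^sup>+y. f ((x + y) / sqrt 2) ((x - y) / sqrt 2) \<partial>std_normal \<partial>std_normal) = (\<integral>\<^sup>+x. \<integral>\<^sup>+y. f x y \<partial>std_normal \<partial>std_normal)"
proof -
  define g where "g x = ennreal (std_normal_density x)" for x
  have [measurable]: "g \<in> borel_measurable borel" unfolding g_def by measurable
  have N: "std_normal = density lborel g" unfolding std_normal_def g_def[abs_def] ..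
  have inv: "g ((x + y) / sqrt 2) * g ((x - y) / sqrt 2) = g x * g y" for x y
  proof -
    have "((x + y) / sqrt 2)\<^sup>2 / 2 + ((x - y) / sqrt 2)\<^sup>2 / 2 = x\<^sup>2 / 2 + y\<^sup>2 / 2"
      by (simp add: power_divide power2_eq_square field_simps)
    then have "exp (- ((x + y) / sqrt 2)\<^sup>2 / 2) * exp (- ((x - y) / sqrt 2)\<^sup>2 / 2) = exp (- x\<^sup>2 / 2) * exp (- y\<^sup>2 / 2)"
      by (simp add: exp_add[symmetric])
    then show ?thesis
      unfolding g_def by (simp add: ennreal_mult[symmetric] std_normal_density_def)
  qed
  have *: "(\<integral>\<^sup>+x. \<integral>\<^sup>+y. k x y \<partial>std_normal \<partial>std_normal) = (\<integral>\<^sup>+x. \<integral>\<^sup>+y. g x * g y * k x y \<partial>lborel \<partial>lborel)"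
    if [measurable]: "(\<lambda>(x, y). k x y) \<in> borel_measurable (borel \<Otimes>\<^sub>M borel)" for k :: "real \<Rightarrow> real \<Rightarrow> ennreal"
  proof -
    have "(\<integral>\<^sup>+x. \<integral>\<^sup>+y. k x y \<partial>std_normal \<partial>std_normal) = (\<integral>\<^sup>+x. \<integral>\<^sup>+y. g y * k x y \<partial>lborel \<partial>std_normal)"
      unfolding N by (intro nn_integral_cong nn_integral_density) auto
    also have "\<dots> = (\<integral>\<^sup>+x. g x * (\<integral>\<^sup>+y. g y * k x y \<partial>lborel) \<partial>lborel)"
      unfolding N by (intro nn_integral_density) auto
    also have "\<dots> = (\<integral>\<^sup>+x. \<integral>\<^sup>+y. g x * (g y * k x y) \<partial>lborel \<partial>lborel)"
      by (intro nn_integral_cong nn_integral_cmult[symmetric]) auto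
    finally show ?thesis by (simp add: mult.assoc)
  qed
  have "(\<integral>\<^sup>+x. \<integral>\<^sup>+y. f ((x + y) / sqrt 2) ((x - y) / sqrt 2) \<partial>std_normal \<partial>std_normal) =
    (\<integral>\<^sup>+x. \<integral>\<^sup>+y. g ((x + y) / sqrt 2) * g ((x - y) / sqrt 2) * f ((x + y) / sqrt 2) ((x - y) / sqrt 2) \<partial>lborel \<partial>lborel)"
    by (subst *) (auto simp: inv)
  also have "\<dots> = (\<integral>\<^sup>+x. \<integral>\<^sup>+y. g x * g y * f x y \<partial>lborel \<partial>lborel)"
    by (rule nn_integral_rotate_lborel[of "\<lambda>x y. g x * g y * f x y"]) measurable
  also have "\<dots> = (\<integral>\<^sup>+x. \<integral>\<^sup>+y. f x y \<partial>std_normal \<partial>std_normal)"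
    by (subst *) auto
  finally show ?thesis .
qed

definition rotate_pair :: "'i \<Rightarrow> 'i \<Rightarrow> ('i \<Rightarrow> real) \<Rightarrow> 'i \<Rightarrow> real" where
  "rotate_pair a b z = z(a := (z a + z b) / sqrt 2, b := (z a - z b) / sqrt 2)"

lemma measurable_white_noise_iff:
  "f \<in> N \<rightarrow>\<^sub>M (white_noise :: ('i \<Rightarrow> real) measure) \<longleftrightarrow> (\<forall>i. (\<lambda>x. f x i) \<in> borel_measurable N)"
proof -
  have "f \<in> N \<rightarrow>\<^sub>M (white_noise :: ('i \<Rightarrow> real) measure) \<longleftrightarrow> f \<in> N \<rightarrow>\<^sub>M (\<Pi>\<^sub>M i\<in>UNIV. borel)"
    by (simp only: measurable_cong_sets[OF refl sets_white_noise])
  also have "\<dots> \<longleftrightarrow> (\<forall>i. (\<lambda>x. f x i) \<in> borel_measurable N)"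
    by (auto intro!: measurable_PiM_single' simp: measurable_component_singleton[THEN measurable_compose, rotated])
  finally show ?thesis .
qed

lemma measurable_white_noise_component [measurable]: "(\<lambda>\<omega>. \<omega> i) \<in> borel_measurable white_noise"
  using measurable_white_noise_iff[of "\<lambda>\<omega>. \<omega>" white_noise] by simp

lemma measurable_rotate_pair [measurable]: "rotate_pair a b \<in> white_noise \<rightarrow>\<^sub>M white_noise"
  unfolding measurable_white_noise_iff rotate_pair_def by (auto simp: fun_upd_def)

lemma nn_integral_white_noise_split:
  assumes ab: "a \<noteq> b" and F[measurable]: "F \<in> borel_measurable white_noise"
  shows "(\<integral>\<^sup>+\<omega>. F \<omega> \<partial>white_noise) = (\<integral>\<^sup>+x. \<integral>\<^sup>+y. \<integral>\<^sup>+Z. F (Z(b := y, a := x)) \<partial>(\<Pi>\<^sub>M i\<in>UNIV - {a, b}. std_normal) \<partial>std_normal \<partial>std_normal)"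
    and "(\<lambda>(x, y). \<integral>\<^sup>+Z. F (Z(b := y, a := x)) \<partial>(\<Pi>\<^sub>M i\<in>UNIV - {a, b}. std_normal)) \<in> borel_measurable (borel \<Otimes>\<^sub>M borel)"
proof -
  interpret N: prob_space std_normal by (rule prob_space_std_normal)
  interpret A: prob_space "\<Pi>\<^sub>M i\<in>UNIV - {a}. std_normal" by (intro prob_space_PiM prob_space_std_normal)
  interpret B: prob_space "\<Pi>\<^sub>M i\<in>UNIV - {a, b}. std_normal" by (intro prob_space_PiM prob_space_std_normal)
  let ?A = "\<Pi>\<^sub>M i\<in>UNIV - {a}. std_normal"
  let ?B = "\<Pi>\<^sub>M i\<in>UNIV - {a, b}. std_normal"
  have FP: "F \<in> borel_measurable (\<Pi>\<^sub>M i\<in>insert a (UNIV - {a}). std_normal)"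
    using F by (simp add: white_noise_def insert_absorb)
  have ua: "(\<lambda>(x, X). X(a := x)) \<in> std_normal \<Otimes>\<^sub>M ?A \<rightarrow>\<^sub>M (\<Pi>\<^sub>M i\<in>insert a (UNIV - {a}). std_normal)"
    unfolding split_beta' by (rule measurable_fun_upd[OF _ measurable_snd measurable_fst]) auto
  have ub: "(\<lambda>(x, X). X(b := x)) \<in> std_normal \<Otimes>\<^sub>M ?B \<rightarrow>\<^sub>M (\<Pi>\<^sub>M i\<in>insert b (UNIV - {a, b}). std_normal)"
    unfolding split_beta' by (rule measurable_fun_upd[OF _ measurable_snd measurable_fst]) auto
  have ib: "insert b (UNIV - {a, b}) = UNIV - {a}" using ab by auto
  have ia: "insert a (UNIV - {a}) = UNIV" by auto
  have Fa: "(\<lambda>(x, X). F (X(a := x))) \<in> borel_measurable (std_normal \<Otimes>\<^sub>M ?A)"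
    using measurable_compose[OF ua FP] by (simp add: split_beta')
  have "(\<integral>\<^sup>+\<omega>. F \<omega> \<partial>white_noise) = (\<integral>\<^sup>+\<omega>. F \<omega> \<partial>distr (std_normal \<Otimes>\<^sub>M ?A) (\<Pi>\<^sub>M i\<in>insert a (UNIV - {a}). std_normal) (\<lambda>(x, X). X(a := x)))"
    by (subst distr_pair_PiM_eq_PiM) (auto simp: white_noise_def insert_absorb prob_space_std_normal)
  also have "\<dots> = (\<integral>\<^sup>+p. F ((snd p)(a := fst p)) \<partial>(std_normal \<Otimes>\<^sub>M ?A))"
    by (subst nn_integral_distr[OF ua]) (simp_all add: FP split_beta')
  also have "\<dots> = (\<integral>\<^sup>+x. \<integral>\<^sup>+X. F (X(a := x)) \<partial>?A \<partial>std_normal)"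
    using A.nn_integral_fst[OF Fa] by (simp add: split_beta')
  also have "\<dots> = (\<integral>\<^sup>+x. \<integral>\<^sup>+y. \<integral>\<^sup>+Z. F (Z(b := y, a := x)) \<partial>?B \<partial>std_normal \<partial>std_normal)"
  proof (intro nn_integral_cong)
    fix x :: real
    have Fx: "(\<lambda>X. F (X(a := x))) \<in> borel_measurable ?A"
      using measurable_compose[OF measurable_Pair1' Fa, of x] by simp
    then have Fx': "(\<lambda>X. F (X(a := x))) \<in> borel_measurable (\<Pi>\<^sub>M i\<in>insert b (UNIV - {a, b}). std_normal)"
      by (simp add: ib)
    have Fxb: "(\<lambda>(y, Z). F (Z(b := y, a := x))) \<in> borel_measurable (std_normal \<Otimes>\<^sub>M ?B)"
      using measurable_compose[OF ub Fx'] by (simp add: split_beta')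
    have "(\<integral>\<^sup>+X. F (X(a := x)) \<partial>?A) = (\<integral>\<^sup>+X. F (X(a := x)) \<partial>distr (std_normal \<Otimes>\<^sub>M ?B) (\<Pi>\<^sub>M i\<in>insert b (UNIV - {a, b}). std_normal) (\<lambda>(x, X). X(b := x)))"
      by (subst distr_pair_PiM_eq_PiM) (auto simp: ib prob_space_std_normal)
    also have "\<dots> = (\<integral>\<^sup>+p. F ((snd p)(b := fst p, a := x)) \<partial>(std_normal \<Otimes>\<^sub>M ?B))"
      by (subst nn_integral_distr[OF ub]) (simp_all add: Fx' split_beta')
    also have "\<dots> = (\<integral>\<^sup>+y. \<integral>\<^sup>+Z. F (Z(b := y, a := x)) \<partial>?B \<partial>std_normal)"
      using B.nn_integral_fst[OF Fxb] by (simp add: split_beta')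
    finally show "(\<integral>\<^sup>+X. F (X(a := x)) \<partial>?A) = (\<integral>\<^sup>+y. \<integral>\<^sup>+Z. F (Z(b := y, a := x)) \<partial>?B \<partial>std_normal)" .
  qed
  finally show "(\<integral>\<^sup>+\<omega>. F \<omega> \<partial>white_noise) = (\<integral>\<^sup>+x. \<integral>\<^sup>+y. \<integral>\<^sup>+Z. F (Z(b := y, a := x)) \<partial>?B \<partial>std_normal \<partial>std_normal)" .
  have "(\<lambda>(p, Z). Z(b := snd p, a := fst p)) \<in> (borel \<Otimes>\<^sub>M borel) \<Otimes>\<^sub>M ?B \<rightarrow>\<^sub>M white_noise"
    unfolding measurable_white_noise_iff split_beta'
  proof
    fix i
    show "(\<lambda>p. ((snd p)(b := snd (fst p), a := fst (fst p))) i) \<in> borel_measurable ((borel \<Otimes>\<^sub>M borel) \<Otimes>\<^sub>M ?B)"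
    proof (cases "i = a \<or> i = b")
      case True
      then show ?thesis by (cases "i = a") auto
    next
      case False
      then have "(\<lambda>Z. Z i) \<in> ?B \<rightarrow>\<^sub>M std_normal" by (intro measurable_component_singleton) auto
      then have "(\<lambda>Z. Z i) \<in> borel_measurable ?B"
        by (simp add: measurable_cong_sets[OF refl sets_std_normal])
      with False show ?thesis by (auto intro: measurable_compose[OF measurable_snd])
    qed
  qed
  from measurable_compose[OF this F]
  have "(\<lambda>(p, Z). F (Z(b := snd p, a := fst p))) \<in> borel_measurable ((borel \<Otimes>\<^sub>M borel) \<Otimes>\<^sub>M ?B)"
    by (simp add: split_beta')
  from B.borel_measurable_nn_integral[OF this]
  show "(\<lambda>(x, y). \<integral>\<^sup>+Z. F (Z(b := y, a := x)) \<partial>?B) \<in> borel_measurable (borel \<Otimes>\<^sub>M borel)"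
    by (simp add: split_beta')
qed

lemma distr_rotate_pair:
  assumes ab: "a \<noteq> b"
  shows "distr white_noise white_noise (rotate_pair a b) = white_noise"
proof (rule measure_eqI)
  fix A assume "A \<in> sets (distr white_noise white_noise (rotate_pair a b))"
  then have A[measurable]: "A \<in> sets white_noise" by simp
  let ?F = "indicator A :: _ \<Rightarrow> ennreal"
  have rp: "rotate_pair a b (Z(b := y, a := x)) = Z(b := (x - y) / sqrt 2, a := (x + y) / sqrt 2)" for x y Z
    using ab by (auto simp: rotate_pair_def fun_eq_iff)
  have "emeasure (distr white_noise white_noise (rotate_pair a b)) A = (\<integral>\<^sup>+\<omega>. ?F (rotate_pair a b \<omega>) \<partial>white_noise)"
    by (subst nn_integral_indicator[symmetric], simp, subst nn_integral_distr) auto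
  also have "\<dots> = (\<integral>\<^sup>+x. \<integral>\<^sup>+y. \<integral>\<^sup>+Z. ?F (rotate_pair a b (Z(b := y, a := x))) \<partial>(\<Pi>\<^sub>M i\<in>UNIV - {a, b}. std_normal) \<partial>std_normal \<partial>std_normal)"
    by (intro nn_integral_white_noise_split(1) ab measurable_compose[OF measurable_rotate_pair]) simp
  also have "\<dots> = (\<integral>\<^sup>+x. \<integral>\<^sup>+y. \<integral>\<^sup>+Z. ?F (Z(b := (x - y) / sqrt 2, a := (x + y) / sqrt 2)) \<partial>(\<Pi>\<^sub>M i\<in>UNIV - {a, b}. std_normal) \<partial>std_normal \<partial>std_normal)"
    by (simp only: rp)
  also have "(\<integral>\<^sup>+x. \<integral>\<^sup>+y. \<integral>\<^sup>+Z. ?F (Z(b := (x - y) / sqrt 2, a := (x + y) / sqrt 2)) \<partial>(\<Pi>\<^sub>M i\<in>UNIV - {a, b}. std_normal) \<partial>std_normal \<partial>std_normal)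
     = (\<integral>\<^sup>+x. \<integral>\<^sup>+y. \<integral>\<^sup>+Z. ?F (Z(b := y, a := x)) \<partial>(\<Pi>\<^sub>M i\<in>UNIV - {a, b}. std_normal) \<partial>std_normal \<partial>std_normal)"
    by (rule nn_integral_rotate_std_normal[OF nn_integral_white_noise_split(2)[OF ab]]) simp
  also have "\<dots> = (\<integral>\<^sup>+\<omega>. ?F \<omega> \<partial>white_noise)"
    by (intro nn_integral_white_noise_split(1)[symmetric] ab) simp
  finally show "emeasure (distr white_noise white_noise (rotate_pair a b)) A = emeasure white_noise A"
    by simp
qed simp

definition rotate_pairs :: "('i \<Rightarrow> 'i) \<Rightarrow> 'i set \<Rightarrow> ('i \<Rightarrow> real) \<Rightarrow> 'i \<Rightarrow> real" where
  "rotate_pairs \<beta> A \<omega> c =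
     (if c \<in> A then (\<omega> c + \<omega> (\<beta> c)) / sqrt 2
      else if c \<in> \<beta> ` A then (\<omega> (inv_into A \<beta> c) - \<omega> c) / sqrt 2
      else \<omega> c)"

text \<open>All pairs \<open>(c, \<beta> c)\<close> with \<open>c \<in> A\<close> are rotated at once. The pairs are disjoint, so this is
  a composition of rotations of single pairs, each of which preserves the product measure.\<close>

lemma rotate_pairs:
  assumes "finite A" "inj_on \<beta> A" "\<beta> ` A \<inter> A = {}"
  shows "rotate_pairs \<beta> A \<in> white_noise \<rightarrow>\<^sub>M white_noise \<and> distr white_noise white_noise (rotate_pairs \<beta> A) = white_noise"
  using assms
proof (induction A)
  case empty
  have "rotate_pairs \<beta> {} = (\<lambda>\<omega>. \<omega>)" by (auto simp: rotate_pairs_def fun_eq_iff)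
  then show ?case by (simp add: distr_id2)
next
  case (insert a A)
  have inj: "inj_on \<beta> A" "\<beta> a \<notin> \<beta> ` A" using insert by auto
  have disj: "\<beta> a \<noteq> a" "\<beta> a \<notin> A" "a \<notin> \<beta> ` A" "\<beta> ` A \<inter> A = {}" using insert.prems by auto
  have IH: "rotate_pairs \<beta> A \<in> white_noise \<rightarrow>\<^sub>M white_noise" "distr white_noise white_noise (rotate_pairs \<beta> A) = white_noise"
    using insert.IH inj disj by auto
  have inv: "inv_into (insert a A) \<beta> (\<beta> c) = c" if "c \<in> insert a A" for c
    using insert.prems(1) that by (rule inv_into_f_f)
  have inv': "inv_into A \<beta> (\<beta> c) = c" if "c \<in> A" for c
    using inj(1) that by (rule inv_into_f_f)
  have "rotate_pairs \<beta> (insert a A) = rotate_pair a (\<beta> a) \<circ> rotate_pairs \<beta> A"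
  proof (intro ext)
    fix \<omega> c
    show "rotate_pairs \<beta> (insert a A) \<omega> c = (rotate_pair a (\<beta> a) \<circ> rotate_pairs \<beta> A) \<omega> c"
      using insert.hyps disj inj inv inv' unfolding rotate_pairs_def rotate_pair_def o_def
      by (auto split: if_splits)
  qed
  moreover have "distr white_noise white_noise (rotate_pair a (\<beta> a) \<circ> rotate_pairs \<beta> A) = white_noise"
    using distr_distr[OF measurable_rotate_pair IH(1), of a "\<beta> a"] IH distr_rotate_pair[of a "\<beta> a"] disj(1)
    by simp
  ultimately show ?case
    using measurable_comp[OF IH(1) measurable_rotate_pair[of a "\<beta> a"]] by (simp only: simp_thms)
qed

section \<open>Levy's construction of Brownian paths\<close>

text \<open>The van der Corput sequence (reversal of the binary digits). For \<open>j < 2 ^ N\<close> the dyadic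
  interval \<open>[vdc j, vdc j + 1 / 2 ^ N]\<close> is called the cell \<open>j\<close> of level \<open>N\<close>. Bisecting it yields
  the cells \<open>j\<close> (left half) and \<open>2 ^ N + j\<close> (right half) of level \<open>N + 1\<close>. With this numbering
  the coordinate \<open>2 ^ N + j\<close> of the noise is the one that displaces the midpoint of cell \<open>j\<close>,
  and the left half inherits the number of the cell.\<close>

fun vdc :: "nat \<Rightarrow> real" where
  "vdc n = (if n = 0 then 0 else vdc (n div 2) / 2 + real (n mod 2) / 2)"

declare vdc.simps [simp del]

lemma vdc_0 [simp]: "vdc 0 = 0"
  by (simp add: vdc.simps)

lemma vdc_double: "vdc n = vdc (n div 2) / 2 + real (n mod 2) / 2"
  by (cases "n = 0") (simp_all add: vdc.simps[of n])

lemma vdc_nonneg: "0 \<le> vdc n"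
proof (induction n rule: less_induct)
  case (less n)
  then show ?case by (cases "n = 0") (simp_all add: vdc_double[of n])
qed

lemma vdc_add: "j < 2 ^ N \<Longrightarrow> vdc (2 ^ N + j) = vdc j + 1 / 2 ^ Suc N"
proof (induction N arbitrary: j)
  case 0
  then show ?case by (simp add: vdc_double[of "Suc 0"])
next
  case (Suc N)
  have "(2 ^ Suc N + j) div 2 = 2 ^ N + j div 2" "(2 ^ Suc N + j) mod 2 = j mod 2"
    by auto
  moreover have "j div 2 < 2 ^ N" using Suc.prems by (intro less_mult_imp_div_less) (simp add: mult.commute)
  then have "vdc (2 ^ N + j div 2) = vdc (j div 2) + 1 / 2 ^ Suc N"
    by (rule Suc.IH)
  ultimately have "vdc (2 ^ Suc N + j) = (vdc (j div 2) + 1 / 2 ^ Suc N) / 2 + real (j mod 2) / 2"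
    using vdc_double[of "2 ^ Suc N + j"] by (simp only:)
  then show ?case
    using vdc_double[of j] by (simp add: add_divide_distrib)
qed

lemma vdc_grid: "j < 2 ^ N \<Longrightarrow> \<exists>k::nat. vdc j = real k / 2 ^ N"
proof (induction N arbitrary: j)
  case 0
  then show ?case by (auto intro: exI[of _ 0])
next
  case (Suc N)
  obtain k :: nat where "vdc (j div 2) = real k / 2 ^ N"
    using Suc.IH[of "j div 2"] Suc.prems less_mult_imp_div_less[of j "2 ^ N" 2] by (auto simp: mult.commute)
  then have "vdc j = real (k + 2 ^ N * (j mod 2)) / 2 ^ Suc N"
    by (simp add: vdc_double[of j] field_simps)
  then show ?case by blast
qed

definition ramp :: "real \<Rightarrow> real" where
  "ramp s = max 0 (min 1 s)"

text \<open>The tent over \<open>[0, 1]\<close>, with height 1 at the midpoint.\<close>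

definition tent :: "real \<Rightarrow> real" where
  "tent s = ramp (2 * s) - ramp (2 * s - 1)"

lemma ramp_simps [simp]: "s \<le> 0 \<Longrightarrow> ramp s = 0" "1 \<le> s \<Longrightarrow> ramp s = 1"
  by (auto simp: ramp_def)

lemma ramp_split: "ramp s = (ramp (2 * s) + ramp (2 * s - 1)) / 2"
  by (auto simp: ramp_def max_def min_def)

lemma tent_range: "0 \<le> tent s" "tent s \<le> 1"
  by (auto simp: tent_def ramp_def)

lemma tent_outside [simp]: "s \<le> 0 \<Longrightarrow> tent s = 0" "1 \<le> s \<Longrightarrow> tent s = 0"
  by (auto simp: tent_def)

lemma tent_halves: "tent (2 * s) \<noteq> 0 \<or> tent (2 * s - 1) \<noteq> 0 \<Longrightarrow> tent s \<noteq> 0"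
  "tent (2 * s) = 0 \<or> tent (2 * s - 1) = 0"
  by (auto simp: tent_def ramp_def max_def min_def split: if_splits)

lemma continuous_on_ramp [continuous_intros]:
  "continuous_on A f \<Longrightarrow> continuous_on A (\<lambda>x. ramp (f x))"
  unfolding ramp_def by (intro continuous_intros)

lemma sum_double_power:
  fixes f :: "nat \<Rightarrow> 'a::comm_monoid_add"
  shows "(\<Sum>j<2 ^ Suc N. f j) = (\<Sum>j<2 ^ N. f j + f (2 ^ N + j))"
proof -
  have "{..<2 ^ Suc N} = {..<2 ^ N} \<union> (\<lambda>j. 2 ^ N + j) ` {..<(2::nat) ^ N}"
  proof (intro set_eqI iffI)
    fix x assume "x \<in> {..<(2::nat) ^ Suc N}"
    then show "x \<in> {..<2 ^ N} \<union> (\<lambda>j. 2 ^ N + j) ` {..<(2::nat) ^ N}"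
      by (cases "x < 2 ^ N") (auto intro!: image_eqI[of _ _ "x - 2 ^ N"])
  qed auto
  then have "(\<Sum>j<2 ^ Suc N. f j) = (\<Sum>j<2 ^ N. f j) + (\<Sum>j\<in>(\<lambda>j. 2 ^ N + j) ` {..<2 ^ N}. f j)"
    by (simp only:) (intro sum.union_disjoint, auto)
  also have "(\<Sum>j\<in>(\<lambda>j. 2 ^ N + j) ` {..<2 ^ N}. f j) = (\<Sum>j<2 ^ N. f (2 ^ N + j))"
    by (subst sum.reindex) auto
  finally show ?thesis by (simp add: sum.distrib)
qed

lemma vdc_scale:
  assumes "j < 2 ^ N"
  shows "2 ^ Suc N * (t - vdc j) = 2 * (2 ^ N * (t - vdc j))"
    and "2 ^ Suc N * (t - vdc (2 ^ N + j)) = 2 * (2 ^ N * (t - vdc j)) - 1"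
  using vdc_add[OF assms] by (simp_all add: field_simps)

lemma sum_ramp: "(\<Sum>j<2 ^ N. (1 / 2) ^ N * ramp (2 ^ N * (t - vdc j))) = ramp t"
proof (induction N)
  case (Suc N)
  have "(1 / 2) ^ Suc N * ramp (2 ^ Suc N * (t - vdc j)) + (1 / 2) ^ Suc N * ramp (2 ^ Suc N * (t - vdc (2 ^ N + j)))
     = (1 / 2) ^ N * ramp (2 ^ N * (t - vdc j))" if j: "j < 2 ^ N" for j
    unfolding vdc_scale[OF j] by (subst ramp_split[of "2 ^ N * (t - vdc j)"]) (simp add: algebra_simps)
  then have "(\<Sum>j<2 ^ Suc N. (1 / 2) ^ Suc N * ramp (2 ^ Suc N * (t - vdc j)))
     = (\<Sum>j<2 ^ N. (1 / 2) ^ N * ramp (2 ^ N * (t - vdc j)))"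
    unfolding sum_double_power by (intro sum.cong) auto
  with Suc show ?case by simp
qed simp

text \<open>The tents of one level stand on cells that overlap only in end points.\<close>

lemma tent_disjoint: "\<exists>j0. \<forall>j<2 ^ N. j \<noteq> j0 \<longrightarrow> tent (2 ^ N * (t - vdc j)) = 0"
proof (induction N)
  case (Suc N)
  then obtain j0 where j0: "\<And>j. j < 2 ^ N \<Longrightarrow> j \<noteq> j0 \<Longrightarrow> tent (2 ^ N * (t - vdc j)) = 0" by auto
  define s where "s = 2 ^ N * (t - vdc j0)"
  define j1 where "j1 = (if tent (2 * s) = 0 then 2 ^ N + j0 else j0)"
  have "tent (2 ^ Suc N * (t - vdc j)) = 0" if j: "j < 2 ^ Suc N" "j \<noteq> j1" for j
  proof (cases "j < 2 ^ N")
    case True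
    then show ?thesis
      unfolding vdc_scale(1)[OF True]
      using j0[OF True] tent_halves[of "2 ^ N * (t - vdc j)"] j(2)
      by (cases "j = j0") (auto simp: j1_def s_def split: if_splits)
  next
    case False
    then obtain k where k: "j = 2 ^ N + k" "k < 2 ^ N"
      using j(1) by (metis add_less_cancel_left le_Suc_ex linorder_not_less mult_2 power_Suc)
    then show ?thesis
      unfolding k(1) vdc_scale(2)[OF k(2)]
      using j0[OF k(2)] tent_halves[of "2 ^ N * (t - vdc k)"] j(2)
      by (cases "k = j0") (auto simp: k(1) j1_def s_def split: if_splits)
  qed
  then show ?case by blast
qed auto

subsection \<open>The rotated noise\<close>

abbreviation halving :: "nat \<Rightarrow> 'i \<times> nat \<Rightarrow> 'i \<times> nat" where
  "halving N \<equiv> \<lambda>(i, j). (i, 2 ^ N + j)"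

abbreviation coarse :: "nat \<Rightarrow> ('i \<times> nat) set" where
  "coarse N \<equiv> UNIV \<times> {..<2 ^ N}"

definition rotate_level :: "nat \<Rightarrow> ('i \<times> nat \<Rightarrow> real) \<Rightarrow> 'i \<times> nat \<Rightarrow> real" where
  "rotate_level N = rotate_pairs (halving N) (coarse N)"

text \<open>For \<open>j < 2 ^ N\<close> the value at \<open>(i, j)\<close> is the normalised increment of the component \<open>i\<close> of
  the path over the cell \<open>j\<close> of level \<open>N\<close>; the other coordinates are still untouched noise.\<close>

primrec increments :: "nat \<Rightarrow> ('i \<times> nat \<Rightarrow> real) \<Rightarrow> 'i \<times> nat \<Rightarrow> real" where
  "increments 0 z = z"
| "increments (Suc N) z = rotate_level N (increments N z)"

primrec noise_of_increments :: "nat \<Rightarrow> ('i \<times> nat \<Rightarrow> real) \<Rightarrow> 'i \<times> nat \<Rightarrow> real" where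
  "noise_of_increments 0 z = z"
| "noise_of_increments (Suc N) z = noise_of_increments N (rotate_level N z)"

lemma halving_coarse: "inj_on (halving N) (coarse N)" "halving N ` coarse N \<inter> coarse N = {}"
  by (auto simp: inj_on_def)

text \<open>This is the mechanism of the refinement: coordinate \<open>(i, j)\<close> holds the increment over the
  cell \<open>j\<close>, divided by the square root of the length of the cell, and \<open>(i, 2 ^ N + j)\<close> holds a
  fresh variable. After the rotation they hold the normalised increments over the two halves.\<close>

lemma rotate_level:
  assumes "j < 2 ^ N"
  shows "rotate_level N z (i, j) = (z (i, j) + z (i, 2 ^ N + j)) / sqrt 2"
    and "rotate_level N z (i, 2 ^ N + j) = (z (i, j) - z (i, 2 ^ N + j)) / sqrt 2"
proof -
  have c: "(i, j) \<in> coarse N" using assms by auto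
  then show "rotate_level N z (i, j) = (z (i, j) + z (i, 2 ^ N + j)) / sqrt 2"
    by (simp add: rotate_level_def rotate_pairs_def)
  have h: "halving N (i, j) = (i, 2 ^ N + j)" by simp
  have "(i, 2 ^ N + j) \<notin> coarse N" "(i, 2 ^ N + j) \<in> halving N ` coarse N"
    using c by (auto intro!: image_eqI[of _ _ "(i, j)"])
  moreover have "inv_into (coarse N) (halving N) (i, 2 ^ N + j) = (i, j)"
    using inv_into_f_f[OF halving_coarse(1) c] by simp
  ultimately show "rotate_level N z (i, 2 ^ N + j) = (z (i, j) - z (i, 2 ^ N + j)) / sqrt 2"
    by (simp add: rotate_level_def rotate_pairs_def)
qed

lemma rotate_level_fine: "2 ^ Suc N \<le> j \<Longrightarrow> rotate_level N z (i, j) = z (i, j)"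
  by (auto simp: rotate_level_def rotate_pairs_def)

lemma rotate_level_involution: "rotate_level N (rotate_level N z) = z"
proof (rule ext)
  fix c :: "'a \<times> nat"
  obtain i j where c: "c = (i, j)" by (cases c)
  have s: "(a / sqrt 2) / sqrt 2 = a / (2::real)" for a by (simp add: field_simps)
  consider "j < 2 ^ N" | k where "j = 2 ^ N + k" "k < 2 ^ N" | "2 ^ Suc N \<le> j"
    by (metis add_less_cancel_left le_Suc_ex linorder_not_less mult_2 power_Suc)
  then show "rotate_level N (rotate_level N z) c = z c"
  proof cases
    case 1
    then show ?thesis by (simp add: c rotate_level add_divide_distrib[symmetric] s)
  next
    case 2
    then show ?thesis by (simp add: c rotate_level diff_divide_distrib[symmetric] s)
  next
    case 3
    then show ?thesis by (simp add: c rotate_level_fine)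
  qed
qed

lemma increments_noise: "increments N (noise_of_increments N z) = z"
  by (induction N arbitrary: z) (auto simp: rotate_level_involution)

lemma increments_fine: "2 ^ N \<le> j \<Longrightarrow> increments N z (i, j) = z (i, j)"
  by (induction N) (auto simp: rotate_level_fine)

lemma rotate_level_preserving:
  "rotate_level N \<in> white_noise \<rightarrow>\<^sub>M (white_noise :: ('i::finite \<times> nat \<Rightarrow> real) measure)"
  "distr white_noise white_noise (rotate_level N :: ('i::finite \<times> nat \<Rightarrow> real) \<Rightarrow> _) = white_noise"
proof -
  have "finite (coarse N :: ('i \<times> nat) set)" by simp
  from rotate_pairs[OF this halving_coarse]
  show "rotate_level N \<in> white_noise \<rightarrow>\<^sub>M (white_noise :: ('i \<times> nat \<Rightarrow> real) measure)"
    "distr white_noise white_noise (rotate_level N :: ('i \<times> nat \<Rightarrow> real) \<Rightarrow> _) = white_noise"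
    by (simp_all add: rotate_level_def)
qed

lemma increments_preserving:
  "increments N \<in> white_noise \<rightarrow>\<^sub>M (white_noise :: ('i::finite \<times> nat \<Rightarrow> real) measure) \<and>
   distr white_noise white_noise (increments N :: ('i::finite \<times> nat \<Rightarrow> real) \<Rightarrow> _) = white_noise"
proof (induction N)
  case 0
  have "increments 0 = (\<lambda>z. z)" by auto
  then show ?case by (simp add: distr_id2)
next
  case (Suc N)
  have e: "increments (Suc N) = rotate_level N \<circ> increments N" by auto
  have "distr white_noise white_noise (rotate_level N \<circ> increments N :: ('i \<times> nat \<Rightarrow> real) \<Rightarrow> _) = white_noise"
    using distr_distr[OF rotate_level_preserving(1)[of N] conjunct1[OF Suc]] Suc rotate_level_preserving(2)[of N] by metis
  then show ?case
    unfolding e using measurable_comp[OF conjunct1[OF Suc] rotate_level_preserving(1)[of N]] by blast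
qed

lemma noise_of_increments_preserving:
  "noise_of_increments N \<in> white_noise \<rightarrow>\<^sub>M (white_noise :: ('i::finite \<times> nat \<Rightarrow> real) measure) \<and>
   distr white_noise white_noise (noise_of_increments N :: ('i::finite \<times> nat \<Rightarrow> real) \<Rightarrow> _) = white_noise"
proof (induction N)
  case 0
  have "noise_of_increments 0 = (\<lambda>z. z)" by auto
  then show ?case by (simp add: distr_id2)
next
  case (Suc N)
  have e: "noise_of_increments (Suc N) = noise_of_increments N \<circ> rotate_level N" by auto
  have "distr white_noise white_noise (noise_of_increments N \<circ> rotate_level N :: ('i \<times> nat \<Rightarrow> real) \<Rightarrow> _) = white_noise"
    using distr_distr[OF conjunct1[OF Suc] rotate_level_preserving(1)[of N]] Suc rotate_level_preserving(2)[of N] by metis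
  then show ?case
    unfolding e using measurable_comp[OF rotate_level_preserving(1)[of N] conjunct1[OF Suc]] by blast
qed

subsection \<open>Polygonal approximations\<close>

text \<open>The linear interpolation of the path between the grid points of level \<open>N\<close>. The factor
  \<open>(1 / sqrt 2) ^ N\<close>, the square root of the length of a cell, undoes the normalisation of the
  increments.\<close>

definition polygon :: "nat \<Rightarrow> ('i \<times> nat \<Rightarrow> real) \<Rightarrow> 'i \<Rightarrow> real \<Rightarrow> real" where
  "polygon N z i t = (\<Sum>j<2 ^ N. (1 / sqrt 2) ^ N * increments N z (i, j) * ramp (2 ^ N * (t - vdc j)))"

definition bumps :: "nat \<Rightarrow> ('i \<times> nat \<Rightarrow> real) \<Rightarrow> 'i \<Rightarrow> real \<Rightarrow> real" where
  "bumps N z i t = (\<Sum>j<2 ^ N. (1 / sqrt 2) ^ N / 2 * z (i, 2 ^ N + j) * tent (2 ^ N * (t - vdc j)))"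

lemma polygon_Suc: "polygon (Suc N) z i t = polygon N z i t + bumps N z i t"
proof -
  have "(1 / sqrt 2) ^ Suc N * increments (Suc N) z (i, j) * ramp (2 ^ Suc N * (t - vdc j)) +
        (1 / sqrt 2) ^ Suc N * increments (Suc N) z (i, 2 ^ N + j) * ramp (2 ^ Suc N * (t - vdc (2 ^ N + j))) =
        (1 / sqrt 2) ^ N * increments N z (i, j) * ramp (2 ^ N * (t - vdc j)) +
        (1 / sqrt 2) ^ N / 2 * z (i, 2 ^ N + j) * tent (2 ^ N * (t - vdc j))"
    if j: "j < 2 ^ N" for j
  proof -
    define s where "s = 2 ^ N * (t - vdc j)"
    define c where "c = (1 / sqrt 2) ^ N"
    define a where "a = increments N z (i, j)"
    define b where "b = z (i, 2 ^ N + j)"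
    have r: "(1 / sqrt 2) ^ Suc N * (x / sqrt 2) = c * x / 2" for x
      by (simp add: c_def field_simps)
    have "(1 / sqrt 2) ^ Suc N * ((a + b) / sqrt 2) * ramp (2 * s) + (1 / sqrt 2) ^ Suc N * ((a - b) / sqrt 2) * ramp (2 * s - 1)
        = c * a * ((ramp (2 * s) + ramp (2 * s - 1)) / 2) + c / 2 * b * (ramp (2 * s) - ramp (2 * s - 1))"
      unfolding r by (simp add: algebra_simps add_divide_distrib diff_divide_distrib)
    also have "\<dots> = c * a * ramp s + c / 2 * b * tent s"
      by (simp only: ramp_split[of s, symmetric] tent_def)
    finally show ?thesis
      using j by (simp only: vdc_scale[OF j] increments.simps rotate_level[OF j] increments_fine[of N "2 ^ N + j"]
        s_def a_def b_def c_def le_add1)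
  qed
  then show ?thesis
    unfolding polygon_def bumps_def sum_double_power sum.distrib[symmetric] by (intro sum.cong) auto
qed

lemma polygon_eq: "polygon M z i t = z (i, 0) * ramp t + (\<Sum>N<M. bumps N z i t)"
proof (induction M)
  case 0
  show ?case by (simp add: polygon_def)
next
  case (Suc M)
  then show ?case by (simp add: polygon_Suc)
qed

lemma grid_gap:
  assumes j: "j < 2 ^ M" and NM: "N \<le> M"
  shows "\<exists>k::int. 2 ^ M * (real m / 2 ^ N - vdc j) = of_int k"
proof -
  obtain k :: nat where k: "vdc j = real k / 2 ^ M" using vdc_grid[OF j] by blast
  have "2 ^ M * (real m / 2 ^ N) = real (m * 2 ^ (M - N))"
    using power_add[of "2::real" N "M - N"] NM by simp
  then have "2 ^ M * (real m / 2 ^ N - vdc j) = of_int (int (m * 2 ^ (M - N)) - int k)"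
    by (simp add: k right_diff_distrib)
  then show ?thesis by blast
qed

lemma grid_gap_ge_1:
  assumes j: "j < 2 ^ M" and NM: "N \<le> M" and "vdc j < real m / 2 ^ N"
  shows "1 \<le> 2 ^ M * (real m / 2 ^ N - vdc j)"
proof -
  obtain k :: int where k: "2 ^ M * (real m / 2 ^ N - vdc j) = of_int k"
    using grid_gap[OF j NM] by blast
  moreover have "0 < 2 ^ M * (real m / 2 ^ N - vdc j)" using assms(3) by simp
  ultimately show ?thesis by simp
qed

lemma grid_gap_le_0:
  assumes "\<not> vdc j < real m / 2 ^ N" "t \<le> real m / 2 ^ N"
  shows "2 ^ M * (t - vdc j) \<le> (0::real)"
  using assms by (simp add: mult_nonneg_nonpos)

lemma grid_ramp_01:
  assumes j: "j < 2 ^ M" and NM: "N \<le> M"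
  shows "ramp (2 ^ M * (real m / 2 ^ N - vdc j)) = (if vdc j < real m / 2 ^ N then 1 else 0)"
  using grid_gap_ge_1[OF assms] grid_gap_le_0[of j m N "real m / 2 ^ N" M] by auto

lemma bumps_grid:
  assumes "N \<le> M"
  shows "bumps M z i (real m / 2 ^ N) = 0"
  unfolding bumps_def
proof (intro sum.neutral ballI)
  fix j assume "j \<in> {..<(2::nat) ^ M}"
  then have j: "j < 2 ^ M" by simp
  have "tent (2 ^ M * (real m / 2 ^ N - vdc j)) = 0"
    using grid_gap_ge_1[OF j assms, of m] grid_gap_le_0[of j m N "real m / 2 ^ N" M] tent_outside
    by (cases "vdc j < real m / 2 ^ N") auto
  then show "(1 / sqrt 2) ^ M / 2 * z (i, 2 ^ M + j) * tent (2 ^ M * (real m / 2 ^ N - vdc j)) = 0" by simp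
qed

lemma polygon_grid: "N \<le> M \<Longrightarrow> polygon M z i (real m / 2 ^ N) = polygon N z i (real m / 2 ^ N)"
  by (induction M rule: dec_induct) (simp_all add: polygon_Suc bumps_grid)

text \<open>A grid point of level \<open>N\<close> never separates the left end of a cell of level \<open>N\<close> or finer
  from its midpoint.\<close>

lemma fine_midpoint:
  assumes j: "j < 2 ^ M" and NM: "N \<le> M"
  shows "vdc (2 ^ M + j) < real m / 2 ^ N \<longleftrightarrow> vdc j < real m / 2 ^ N"
proof
  assume "vdc (2 ^ M + j) < real m / 2 ^ N"
  then show "vdc j < real m / 2 ^ N"
    using vdc_add[OF j] by (smt (verit) divide_pos_pos zero_less_power)
next
  assume "vdc j < real m / 2 ^ N"
  from grid_gap_ge_1[OF j NM this] have "1 / 2 ^ M \<le> real m / 2 ^ N - vdc j"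
    by (simp add: field_simps)
  moreover have "1 / 2 ^ Suc M < (1 / 2 ^ M :: real)" by (simp add: field_simps)
  ultimately show "vdc (2 ^ M + j) < real m / 2 ^ N"
    using vdc_add[OF j] by linarith
qed

text \<open>Refining the polygon beyond level \<open>N\<close> adds tents. Those standing to the left of a grid
  point of level \<open>N\<close> are scaled by coordinates with numbers at least \<open>2 ^ N\<close>, which
  \<open>increments N\<close> leaves alone, so that the level-\<open>N\<close> increments to the left determine every
  refinement there.\<close>

lemma polygon_past:
  assumes eq: "\<And>c. vdc (snd c) < real m / 2 ^ N \<Longrightarrow> increments N z c = increments N z' c"
    and t: "t \<le> real m / 2 ^ N" and NM: "N \<le> M"
  shows "polygon M z i t = polygon M z' i t"
  using NM
proof (induction M rule: dec_induct)
  case base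
  show ?case unfolding polygon_def
  proof (intro sum.cong refl)
    fix j assume "j \<in> {..<(2::nat) ^ N}"
    show "(1 / sqrt 2) ^ N * increments N z (i, j) * ramp (2 ^ N * (t - vdc j)) =
       (1 / sqrt 2) ^ N * increments N z' (i, j) * ramp (2 ^ N * (t - vdc j))"
      using eq[of "(i, j)"] grid_gap_le_0[of j m N t N] t by (cases "vdc j < real m / 2 ^ N") auto
  qed
next
  case (step M)
  have "bumps M z i t = bumps M z' i t" unfolding bumps_def
  proof (intro sum.cong refl)
    fix j assume "j \<in> {..<(2::nat) ^ M}"
    then have j: "j < 2 ^ M" by simp
    have "(2::nat) ^ N \<le> 2 ^ M + j"
      using step(1) by (meson trans_le_add1 power_increasing one_le_numeral)
    then have "vdc j < real m / 2 ^ N \<Longrightarrow> z (i, 2 ^ M + j) = z' (i, 2 ^ M + j)"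
      using eq[of "(i, 2 ^ M + j)"] fine_midpoint[OF j step(1), of m] by (simp add: increments_fine)
    then show "(1 / sqrt 2) ^ M / 2 * z (i, 2 ^ M + j) * tent (2 ^ M * (t - vdc j)) =
       (1 / sqrt 2) ^ M / 2 * z' (i, 2 ^ M + j) * tent (2 ^ M * (t - vdc j))"
      using grid_gap_le_0[of j m N t M] t by (cases "vdc j < real m / 2 ^ N") auto
  qed
  with step show ?case by (simp add: polygon_Suc)
qed

lemma polygon_future:
  assumes eq: "\<And>c. \<not> vdc (snd c) < real m / 2 ^ N \<Longrightarrow> increments N z c = increments N z' c"
    and t: "real m / 2 ^ N \<le> t" and NM: "N \<le> M"
  shows "polygon M z i t - polygon M z i (real m / 2 ^ N) = polygon M z' i t - polygon M z' i (real m / 2 ^ N)"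
  using NM
proof (induction M rule: dec_induct)
  case base
  have "polygon N y i t - polygon N y i (real m / 2 ^ N) =
     (\<Sum>j<2 ^ N. (1 / sqrt 2) ^ N * increments N y (i, j) * (ramp (2 ^ N * (t - vdc j)) - ramp (2 ^ N * (real m / 2 ^ N - vdc j))))" for y
    unfolding polygon_def sum_subtractf[symmetric] by (simp add: right_diff_distrib)
  moreover have "increments N z (i, j) * (ramp (2 ^ N * (t - vdc j)) - ramp (2 ^ N * (real m / 2 ^ N - vdc j))) =
      increments N z' (i, j) * (ramp (2 ^ N * (t - vdc j)) - ramp (2 ^ N * (real m / 2 ^ N - vdc j)))"
    if j: "j < 2 ^ N" for j
  proof (cases "vdc j < real m / 2 ^ N")
    case True
    from grid_gap_ge_1[OF j order.refl True] have 1: "1 \<le> 2 ^ N * (real m / 2 ^ N - vdc j)" .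
    also have "\<dots> \<le> 2 ^ N * (t - vdc j)" using t by (intro mult_left_mono) auto
    finally show ?thesis using 1 by simp
  next
    case False
    then show ?thesis using eq[of "(i, j)"] by simp
  qed
  ultimately show ?case
    by (simp only: mult.assoc) (intro sum.cong, auto)
next
  case (step M)
  have "bumps M z i t = bumps M z' i t" unfolding bumps_def
  proof (intro sum.cong refl)
    fix j assume "j \<in> {..<(2::nat) ^ M}"
    then have j: "j < 2 ^ M" by simp
    show "(1 / sqrt 2) ^ M / 2 * z (i, 2 ^ M + j) * tent (2 ^ M * (t - vdc j)) =
       (1 / sqrt 2) ^ M / 2 * z' (i, 2 ^ M + j) * tent (2 ^ M * (t - vdc j))"
    proof (cases "vdc j < real m / 2 ^ N")
      case True
      from grid_gap_ge_1[OF j step(1) True] have 1: "1 \<le> 2 ^ M * (real m / 2 ^ N - vdc j)" .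
      also have "\<dots> \<le> 2 ^ M * (t - vdc j)" using t by (intro mult_left_mono) auto
      finally show ?thesis by simp
    next
      case False
      have "(2::nat) ^ N \<le> 2 ^ M + j"
        using step(1) by (meson trans_le_add1 power_increasing one_le_numeral)
      then show ?thesis
        using eq[of "(i, 2 ^ M + j)"] fine_midpoint[OF j step(1), of m] False by (simp add: increments_fine)
    qed
  qed
  with step show ?case by (simp add: polygon_Suc bumps_grid)
qed

subsection \<open>Uniform convergence\<close>

text \<open>The square of the sup norm of \<open>bumps N z i\<close>, divided by \<open>(9 / 10) ^ N\<close>, is at most this
  quantity. Only one tent is nonzero at a time, and the square \<open>y\<^sup>2\<close> of its coefficient is
  estimated by \<open>l + y ^ 4 / l\<close> with \<open>l = sqrt 2 ^ N\<close>, the choice for which the two parts have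
  expectations of the same size after summing the fourth powers over all cells. The weight
  \<open>9 / 10\<close> leaves room on both sides: its powers are summable, and so are the expectations
  \<open>(10 / (9 * sqrt 2)) ^ N\<close> of the bounds, because \<open>10 / 9 < sqrt 2\<close>.\<close>

definition bump_bound :: "nat \<Rightarrow> ('i \<times> nat \<Rightarrow> real) \<Rightarrow> 'i \<Rightarrow> real" where
  "bump_bound N z i = (1 / 2) ^ N / 4 * (sqrt 2 ^ N + (\<Sum>j<2 ^ N. z (i, 2 ^ N + j) ^ 4) / sqrt 2 ^ N) / (9 / 10) ^ N"

lemma bump_bound_nonneg: "0 \<le> bump_bound N z i"
  unfolding bump_bound_def by (intro divide_nonneg_nonneg mult_nonneg_nonneg add_nonneg_nonneg sum_nonneg) auto

lemma bumps_square_le: "(bumps N z i t)\<^sup>2 \<le> (9 / 10) ^ N * bump_bound N z i"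
proof -
  obtain j0 where j0: "\<And>j. j < 2 ^ N \<Longrightarrow> j \<noteq> j0 \<Longrightarrow> tent (2 ^ N * (t - vdc j)) = 0"
    using tent_disjoint[of N t] by auto
  let ?b = "\<lambda>j. (1 / sqrt 2) ^ N / 2 * z (i, 2 ^ N + j) * tent (2 ^ N * (t - vdc j))"
  let ?Q = "(1 / 2) ^ N / 4 * (sqrt 2 ^ N + (\<Sum>j<2 ^ N. z (i, 2 ^ N + j) ^ 4) / sqrt 2 ^ N)"
  have "((1 / sqrt 2) ^ N)\<^sup>2 = ((1 / sqrt 2)\<^sup>2) ^ N"
    by (simp only: power_mult[symmetric] mult.commute)
  then have c2: "((1 / sqrt 2) ^ N / 2)\<^sup>2 = (1 / 2) ^ N / 4"
    by (simp only: power_divide[of _ 2 2]) (simp add: power_divide[of 1 "sqrt 2" 2])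
  have "(bumps N z i t)\<^sup>2 \<le> ?Q"
  proof (cases "j0 < 2 ^ N")
    case True
    have "bumps N z i t = ?b j0 + (\<Sum>j\<in>{..<2 ^ N} - {j0}. ?b j)"
      unfolding bumps_def using True by (intro sum.remove) auto
    also have "(\<Sum>j\<in>{..<2 ^ N} - {j0}. ?b j) = 0"
      by (intro sum.neutral) (auto simp: j0)
    finally have "(bumps N z i t)\<^sup>2 = (1 / 2) ^ N / 4 * (z (i, 2 ^ N + j0))\<^sup>2 * (tent (2 ^ N * (t - vdc j0)))\<^sup>2"
      by (simp only: power_mult_distrib c2 add_0_right)
    also have "\<dots> \<le> (1 / 2) ^ N / 4 * (z (i, 2 ^ N + j0))\<^sup>2 * 1"
      by (intro mult_left_mono power_le_one tent_range) auto
    also have "\<dots> \<le> ?Q"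
    proof -
      define y where "y = z (i, 2 ^ N + j0)"
      define l where "l = sqrt 2 ^ N"
      have l: "l > 0" by (simp add: l_def)
      \<comment> \<open>The maximum over the cells is avoided by adding up the fourth powers of all
        coefficients.\<close>
      have "0 \<le> (y\<^sup>2 - l)\<^sup>2" by simp
      then have "2 * y\<^sup>2 * l \<le> l * l + y ^ 4" by (simp add: power2_diff power_mult[symmetric] power2_eq_square[of l])
      then have "y\<^sup>2 * l \<le> l * l + y ^ 4" using mult_nonneg_nonneg[of "y\<^sup>2" l] l zero_le_power2[of y] by linarith
      then have "y\<^sup>2 \<le> l + y ^ 4 / l" using l by (simp add: field_simps)
      also have "y ^ 4 \<le> (\<Sum>j<2 ^ N. z (i, 2 ^ N + j) ^ 4)"
        unfolding y_def using True by (intro member_le_sum) auto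
      finally have "y\<^sup>2 \<le> l + (\<Sum>j<2 ^ N. z (i, 2 ^ N + j) ^ 4) / l"
        using l by (simp add: divide_right_mono)
      then show ?thesis unfolding y_def l_def by (simp add: mult_left_mono)
    qed
    finally show ?thesis .
  next
    case False
    then have "bumps N z i t = 0" unfolding bumps_def by (intro sum.neutral) (auto simp: j0)
    then show ?thesis by (simp add: sum_nonneg)
  qed
  then show ?thesis by (simp add: bump_bound_def)
qed

text \<open>From \<open>2 x \<le> x\<^sup>2 / a + a\<close> with \<open>a = (9 / 10) ^ N\<close>. Both terms of the bound are summable for
  regular noise.\<close>

lemma bumps_abs_le: "\<bar>bumps N z i t\<bar> \<le> (9 / 10) ^ N + bump_bound N z i"
proof -
  define a :: real where "a = (9 / 10) ^ N"
  have a: "0 < a" by (simp add: a_def)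
  have "0 \<le> (\<bar>bumps N z i t\<bar> - a)\<^sup>2" by simp
  then have "2 * (\<bar>bumps N z i t\<bar> * a) \<le> (bumps N z i t)\<^sup>2 + a * a"
    by (simp add: power2_diff power2_eq_square[of a] mult.assoc)
  also have "\<dots> \<le> a * bump_bound N z i + a * a" using bumps_square_le[of N z i t] by (simp add: a_def)
  finally have "2 * \<bar>bumps N z i t\<bar> * a \<le> (bump_bound N z i + a) * a" by (simp add: algebra_simps)
  then have "2 * \<bar>bumps N z i t\<bar> \<le> bump_bound N z i + a" using a by simp
  then show ?thesis unfolding a_def by linarith
qed

definition regular_noise :: "('i \<times> nat \<Rightarrow> real) \<Rightarrow> bool" where
  "regular_noise z \<longleftrightarrow> (\<forall>i. summable (\<lambda>N. bump_bound N z i))"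

text \<open>On the null set of irregular noise the path is set to 0, so that every path is continuous
  and the square bounds hold everywhere.\<close>

definition levy_path :: "('i \<times> nat \<Rightarrow> real) \<Rightarrow> 'i \<Rightarrow> real \<Rightarrow> real" where
  "levy_path z i t = (if regular_noise z then z (i, 0) * ramp t + (\<Sum>N. bumps N z i t) else 0)"

lemma levy_path_uniform_limit:
  assumes z: "regular_noise z"
  shows "uniform_limit UNIV (\<lambda>M t. polygon M z i t) (levy_path z i) sequentially"
proof -
  have s: "summable (\<lambda>N. (9 / 10) ^ N + bump_bound N z i)"
    using z by (intro summable_add summable_geometric) (auto simp: regular_noise_def)
  have "uniform_limit UNIV (\<lambda>M t. \<Sum>N<M. bumps N z i t) (\<lambda>t. \<Sum>N. bumps N z i t) sequentially"
    by (rule Weierstrass_m_test[OF _ s]) (auto simp: bumps_abs_le)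
  then have "uniform_limit UNIV (\<lambda>M t. z (i, 0) * ramp t + (\<Sum>N<M. bumps N z i t)) (\<lambda>t. z (i, 0) * ramp t + (\<Sum>N. bumps N z i t)) sequentially"
    by (intro uniform_limit_add uniform_limit_const)
  then show ?thesis
    using z by (simp add: levy_path_def polygon_eq cong: uniform_limit_cong')
qed

lemma levy_path_lim: "regular_noise z \<Longrightarrow> (\<lambda>M. polygon M z i t) \<longlonglongrightarrow> levy_path z i t"
  by (rule tendsto_uniform_limitI[OF levy_path_uniform_limit]) auto

lemma continuous_levy_path: "continuous_on UNIV (levy_path z i)"
proof (cases "regular_noise z")
  case True
  show ?thesis
    by (rule uniform_limit_theorem[OF _ levy_path_uniform_limit[OF True]])
       (auto simp: polygon_def intro!: always_eventually continuous_intros)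
next
  case False
  then have "levy_path z i = (\<lambda>_. 0)" by (auto simp: levy_path_def)
  then show ?thesis by simp
qed

lemma levy_path_grid:
  assumes z: "regular_noise z"
  shows "levy_path z i (real m / 2 ^ N) = polygon N z i (real m / 2 ^ N)"
proof -
  have "(\<lambda>M. polygon M z i (real m / 2 ^ N)) \<longlonglongrightarrow> polygon N z i (real m / 2 ^ N)"
    by (rule tendsto_eventually) (rule eventually_sequentiallyI[of N], rule polygon_grid)
  with levy_path_lim[OF z] show ?thesis by (rule LIMSEQ_unique)
qed

lemma levy_path_0: "t \<le> 0 \<Longrightarrow> levy_path z i t = 0"
proof -
  assume t: "t \<le> 0"
  have "2 ^ N * (t - vdc j) \<le> 0" for N j
    using t vdc_nonneg[of j] by (intro mult_nonneg_nonpos) auto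
  then have "bumps N z i t = 0" for N unfolding bumps_def by (intro sum.neutral) auto
  with t show ?thesis by (simp add: levy_path_def)
qed

text \<open>The Cauchy-Schwarz inequality with the weights \<open>(9 / 10) ^ N\<close>, whose sum is 10. The bound
  does not depend on \<open>t\<close> and is integrable; it is the source of the envelope for dominated
  convergence.\<close>

lemma levy_path_square_le:
  "(levy_path z i t)\<^sup>2 \<le> 2 * (z (i, 0))\<^sup>2 + 20 * (\<Sum>N. bump_bound N z i)" if z: "regular_noise z"
proof -
  let ?B = "\<Sum>N. bump_bound N z i"
  have s: "summable (\<lambda>N. bump_bound N z i)" using z by (auto simp: regular_noise_def)
  have "(polygon M z i t)\<^sup>2 \<le> 2 * (z (i, 0))\<^sup>2 + 20 * ?B" for M
  proof -
    let ?a = "\<lambda>N. sqrt ((9 / 10) ^ N)"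
    have "(\<Sum>N<M. bumps N z i t)\<^sup>2 = (\<Sum>N<M. ?a N * (bumps N z i t / ?a N))\<^sup>2" by simp
    also have "\<dots> \<le> (\<Sum>N<M. (?a N)\<^sup>2) * (\<Sum>N<M. (bumps N z i t / ?a N)\<^sup>2)"
      by (rule Cauchy_Schwarz_ineq_sum)
    also have "\<dots> \<le> 10 * ?B"
    proof (intro mult_mono)
      have "(\<Sum>N<M. (?a N)\<^sup>2) = (\<Sum>N<M. (9 / 10) ^ N)" by simp
      also have "\<dots> \<le> (\<Sum>N. (9 / 10) ^ N)" by (intro sum_le_suminf summable_geometric) auto
      also have "\<dots> = 10" by (subst suminf_geometric) auto
      finally show "(\<Sum>N<M. (?a N)\<^sup>2) \<le> 10" .
      have "(\<Sum>N<M. (bumps N z i t / ?a N)\<^sup>2) \<le> (\<Sum>N<M. bump_bound N z i)"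
        using bumps_square_le[of _ z i t]
        by (intro sum_mono) (simp add: power_divide[of _ "sqrt _"] pos_divide_le_eq mult.commute del: power_divide)
      also have "\<dots> \<le> ?B" by (intro sum_le_suminf s) (auto simp: bump_bound_nonneg)
      finally show "(\<Sum>N<M. (bumps N z i t / ?a N)\<^sup>2) \<le> ?B" .
    qed (auto intro: sum_nonneg)
    finally have b: "(\<Sum>N<M. bumps N z i t)\<^sup>2 \<le> 10 * ?B" .
    have r: "(z (i, 0) * ramp t)\<^sup>2 \<le> (z (i, 0))\<^sup>2"
    proof -
      have "(ramp t)\<^sup>2 \<le> 1" by (intro power_le_one) (auto simp: ramp_def)
      from mult_left_mono[OF this, of "(z (i, 0))\<^sup>2"] show ?thesis by (simp add: power_mult_distrib)
    qed
    have "(u + v)\<^sup>2 \<le> 2 * u\<^sup>2 + 2 * v\<^sup>2" for u v :: real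
      using zero_le_power2[of "u - v"] by (simp add: power2_sum power2_diff)
    from this[of "z (i, 0) * ramp t" "\<Sum>N<M. bumps N z i t"] b r show ?thesis
      unfolding polygon_eq by linarith
  qed
  moreover have "(\<lambda>M. (polygon M z i t)\<^sup>2) \<longlonglongrightarrow> (levy_path z i t)\<^sup>2"
    by (intro tendsto_power levy_path_lim z)
  ultimately show ?thesis by (intro LIMSEQ_le_const2) auto
qed

section \<open>Moments of the noise and of the Brownian increments\<close>

global_interpretation white_noise: product_prob_space "\<lambda>_. std_normal" "UNIV :: 'i set"
  rewrites "Pi\<^sub>M UNIV (\<lambda>_. std_normal) = (white_noise :: ('i \<Rightarrow> real) measure)"
proof -
  interpret prob_space std_normal by (rule prob_space_std_normal)
  show "product_prob_space (\<lambda>_. std_normal)" by unfold_locales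
qed (simp add: white_noise_def)

lemma distr_component: "distr white_noise borel (\<lambda>z. z c) = std_normal"
proof -
  have "distr white_noise borel (\<lambda>z. z c) = distr white_noise std_normal (\<lambda>z. z c)"
    by (intro distr_cong) auto
  also have "\<dots> = std_normal" by (intro white_noise.PiM_component) simp
  finally show ?thesis .
qed

lemma indep_vars_component: "prob_space.indep_vars white_noise (\<lambda>_. borel) (\<lambda>c z. z c) (UNIV :: 'i set)"
proof -
  have "distr white_noise (\<Pi>\<^sub>M c\<in>(UNIV :: 'i set). borel) (\<lambda>z. \<lambda>c\<in>UNIV. z c) = distr white_noise white_noise (\<lambda>z. z)"
    by (intro distr_cong) (auto simp: sets_white_noise)
  also have "\<dots> = (\<Pi>\<^sub>M c\<in>(UNIV :: 'i set). distr white_noise borel (\<lambda>z. z c))"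
    unfolding distr_component by (subst distr_id2) (simp_all add: white_noise_def)
  finally show ?thesis
    by (subst white_noise.indep_vars_iff_distr_eq_PiM') auto
qed

lemma has_bochner_integral_std_normal:
  assumes "f \<in> borel_measurable borel" "has_bochner_integral lborel (\<lambda>x. std_normal_density x * f x) (v :: real)"
  shows "has_bochner_integral white_noise (\<lambda>z. f (z c)) v"
proof -
  have "has_bochner_integral std_normal f v"
    unfolding std_normal_def using assms by (intro has_bochner_integral_density) auto
  then have i: "integrable (distr white_noise borel (\<lambda>z. z c)) f" and v: "(\<integral>x. f x \<partial>distr white_noise borel (\<lambda>z. z c)) = v"
    unfolding distr_component by (auto simp: has_bochner_integral_iff)
  have "integrable white_noise (\<lambda>z. f (z c))"
    by (rule integrable_distr[OF _ i]) simp
  moreover have "(\<integral>z. f (z c) \<partial>white_noise) = v"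
    unfolding v[symmetric] by (rule integral_distr[symmetric]) (simp_all add: assms(1))
  ultimately show ?thesis by (simp add: has_bochner_integral_iff)
qed

lemma noise_moments:
  "has_bochner_integral white_noise (\<lambda>z. z c) (0 :: real)"
  "has_bochner_integral white_noise (\<lambda>z. (z c)\<^sup>2) (1 :: real)"
  "has_bochner_integral white_noise (\<lambda>z. z c ^ 4) (3 :: real)"
  using has_bochner_integral_std_normal[OF _ std_normal_moment_odd[of 0], of c]
    has_bochner_integral_std_normal[OF _ std_normal_moment_even[of 1], of c]
    has_bochner_integral_std_normal[OF _ std_normal_moment_even[of 2], of c]
  by (simp_all add: fact_numeral)

lemma noise_orthogonal:
  "has_bochner_integral white_noise (\<lambda>z. z c * z d) (if c = d then 1 else 0 :: real)"
proof (cases "c = d")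
  case True
  then show ?thesis using noise_moments(2)[of c] by (simp add: power2_eq_square)
next
  case False
  have i: "white_noise.indep_vars (\<lambda>_. borel) (\<lambda>c z. z c) {c, d}"
    by (rule white_noise.indep_vars_subset[OF indep_vars_component]) auto
  have int: "integrable white_noise (\<lambda>z. z c)" for c :: 'a
    using noise_moments(1)[of c] by (auto simp: has_bochner_integral_iff)
  show ?thesis
    using white_noise.indep_vars_lebesgue_integral[OF _ i] white_noise.indep_vars_integrable[OF _ i] int noise_moments(1)[of c] noise_moments(1)[of d] False
    by (auto simp: has_bochner_integral_iff)
qed

text \<open>A sum of independent standard normal variables is normal with variance \<open>card C\<close>.\<close>

lemma noise_sum_fourth_moment:
  assumes "finite C"
  shows "has_bochner_integral white_noise (\<lambda>z. (\<Sum>c\<in>C. z c) ^ 4) (3 * (real (card C))\<^sup>2)"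
proof (cases "C = {}")
  case False
  have d: "distributed white_noise lborel (\<lambda>z. z c) (normal_density 0 1)" for c :: 'a
  proof -
    have "distr white_noise lborel (\<lambda>z. z c) = distr white_noise borel (\<lambda>z. z c)"
      by (intro distr_cong) auto
    then show ?thesis
      unfolding distributed_def by (simp add: distr_component std_normal_def)
  qed
  have "distributed white_noise lborel (\<lambda>z. \<Sum>c\<in>C. z c) (normal_density (\<Sum>c\<in>C. 0) (sqrt (\<Sum>c\<in>C. 1\<^sup>2)))"
    using assms False
    by (intro white_noise.sum_indep_normal d white_noise.indep_vars_subset[OF indep_vars_component]) auto
  then have n: "distributed white_noise lborel (\<lambda>z. \<Sum>c\<in>C. z c) (normal_density 0 (sqrt (card C)))"
    by simp
  have "has_bochner_integral lborel (\<lambda>x. normal_density 0 (sqrt (card C)) x * (x - 0) ^ (2 * 2))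
     (fact (2 * 2) / ((2 / (sqrt (card C))\<^sup>2) ^ 2 * fact 2))"
    using assms False by (intro normal_moment_even) (simp add: card_gt_0_iff)
  moreover have "fact (2 * 2) / ((2 / (sqrt (card C))\<^sup>2) ^ 2 * fact 2) = 3 * (real (card C))\<^sup>2"
    by (simp add: fact_numeral power_divide)
  ultimately have m: "has_bochner_integral lborel (\<lambda>x. normal_density 0 (sqrt (card C)) x * x ^ 4) (3 * (real (card C))\<^sup>2)"
    by simp
  show ?thesis
    using m distributed_integrable[OF n, of "\<lambda>x. x ^ 4"] distributed_integral[OF n, of "\<lambda>x. x ^ 4"]
    by (auto simp: has_bochner_integral_iff)
qed (simp add: has_bochner_integral_zero)

subsection \<open>Almost sure regularity\<close>

lemma measurable_bump_bound [measurable]: "(\<lambda>z. bump_bound N z i) \<in> borel_measurable white_noise"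
  unfolding bump_bound_def by measurable

lemma measurable_bumps [measurable]: "(\<lambda>z. bumps N z i t) \<in> borel_measurable white_noise"
  unfolding bumps_def by measurable

lemma bump_bound_integral:
  "has_bochner_integral white_noise (\<lambda>z. bump_bound N z i) ((10 / (9 * sqrt 2)) ^ N)"
proof -
  have "has_bochner_integral white_noise (\<lambda>z :: 'a \<times> nat \<Rightarrow> real. \<Sum>j<(2::nat) ^ N. z (i, 2 ^ N + j) ^ 4) (\<Sum>j<(2::nat) ^ N. 3 :: real)"
    by (intro has_bochner_integral_sum noise_moments)
  then have "has_bochner_integral white_noise (\<lambda>z. (1 / 2) ^ N / 4 * (sqrt 2 ^ N + (\<Sum>j<(2::nat) ^ N. z (i, 2 ^ N + j) ^ 4) / sqrt 2 ^ N) / (9 / 10) ^ N)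
     ((1 / 2) ^ N / 4 * (sqrt 2 ^ N + (\<Sum>j<(2::nat) ^ N. 3 :: real) / sqrt 2 ^ N) / (9 / 10) ^ N)"
    by (auto simp: has_bochner_integral_iff white_noise.P.prob_space[simplified])
  moreover have "(1 / 2) ^ N / 4 * (sqrt 2 ^ N + (\<Sum>j<(2::nat) ^ N. 3 :: real) / sqrt 2 ^ N) / (9 / 10) ^ N = (10 / (9 * sqrt 2)) ^ N"
  proof -
    define s where "s = sqrt 2 ^ N"
    have s: "s > 0" by (simp add: s_def)
    have s2: "(2::real) ^ N = s * s" by (simp add: s_def power_mult_distrib[symmetric])
    show ?thesis
      using s by (simp add: power_divide power_mult_distrib s2 s_def[symmetric] field_simps)
  qed
  ultimately show ?thesis by (simp add: bump_bound_def)
qed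

lemma summable_bump_bound_integral: "summable (\<lambda>N. (10 / (9 * sqrt 2)) ^ N)"
proof (rule summable_geometric)
  have "10 / 9 < sqrt 2" by (rule real_less_rsqrt) (simp add: power2_eq_square)
  then show "norm (10 / (9 * sqrt 2)) < 1" by (simp add: field_simps)
qed

lemma AE_summable_bump_bound: "AE z in white_noise. summable (\<lambda>N. bump_bound N z i)"
proof -
  have "(\<integral>\<^sup>+z. (\<Sum>N. ennreal (bump_bound N z i)) \<partial>white_noise) = (\<Sum>N. \<integral>\<^sup>+z. ennreal (bump_bound N z i) \<partial>white_noise)"
    by (intro nn_integral_suminf) auto
  also have "\<dots> = (\<Sum>N. ennreal ((10 / (9 * sqrt 2)) ^ N))"
    using bump_bound_integral[of _ i]
    by (intro suminf_cong nn_integral_eq_integral[THEN trans]) (auto simp: has_bochner_integral_iff bump_bound_nonneg)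
  also have "\<dots> = ennreal (\<Sum>N. (10 / (9 * sqrt 2)) ^ N)"
    by (intro suminf_ennreal2 summable_bump_bound_integral) auto
  finally have "AE z in white_noise. (\<Sum>N. ennreal (bump_bound N z i)) \<noteq> \<infinity>"
    by (intro nn_integral_PInf_AE) auto
  then show ?thesis
    by eventually_elim (rule summable_suminf_not_top, auto simp: bump_bound_nonneg)
qed

lemma AE_regular_noise: "AE z in white_noise. regular_noise (z :: 'i::finite \<times> nat \<Rightarrow> real)"
  unfolding regular_noise_def AE_all_countable using AE_summable_bump_bound by blast

lemma measurable_regular_noise [measurable]: "Measurable.pred white_noise (regular_noise :: ('i::finite \<times> nat \<Rightarrow> real) \<Rightarrow> bool)"
proof -
  have "summable (\<lambda>N. bump_bound N z i) \<longleftrightarrow> (\<Sum>N. ennreal (bump_bound N z i)) < \<infinity>" for z and i :: 'i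
  proof
    assume "summable (\<lambda>N. bump_bound N z i)"
    then have "(\<Sum>N. ennreal (bump_bound N z i)) = ennreal (\<Sum>N. bump_bound N z i)"
      by (intro suminf_ennreal2 bump_bound_nonneg)
    then show "(\<Sum>N. ennreal (bump_bound N z i)) < \<infinity>" by simp
  qed (rule summable_suminf_not_top, auto simp: bump_bound_nonneg)
  then have "regular_noise = (\<lambda>z. \<forall>i::'i. (\<Sum>N. ennreal (bump_bound N z i)) < \<infinity>)"
    by (auto simp: regular_noise_def)
  moreover have "Measurable.pred white_noise (\<lambda>z. \<forall>i::'i. (\<Sum>N. ennreal (bump_bound N z i)) < \<infinity>)"
    by measurable
  ultimately show ?thesis by simp
qed

lemma measurable_levy_path [measurable]: "(\<lambda>z. levy_path z i t) \<in> borel_measurable (white_noise :: ('i::finite \<times> nat \<Rightarrow> real) measure)"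
  unfolding levy_path_def by measurable

definition path_bound :: "('i::finite \<times> nat \<Rightarrow> real) \<Rightarrow> real" where
  "path_bound z = (if regular_noise z then \<Sum>i\<in>UNIV. 2 * (z (i, 0))\<^sup>2 + 20 * (\<Sum>N. bump_bound N z i) else 0)"

lemma levy_path_bound: "(\<Sum>i\<in>UNIV. (levy_path z i t)\<^sup>2) \<le> path_bound z"
proof (cases "regular_noise z")
  case True
  then show ?thesis by (auto simp: path_bound_def intro!: sum_mono levy_path_square_le)
qed (simp add: path_bound_def levy_path_def)

lemma measurable_path_bound [measurable]: "path_bound \<in> borel_measurable white_noise"
  unfolding path_bound_def[abs_def] by measurable

lemma integrable_path_bound: "integrable white_noise path_bound"
proof -
  have B: "integrable white_noise (\<lambda>z. \<Sum>N. bump_bound N z i)" for i :: 'a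
    using AE_summable_bump_bound[of i] bump_bound_integral[of _ i] summable_bump_bound_integral
    by (intro integrable_suminf) (auto simp: has_bochner_integral_iff bump_bound_nonneg)
  then have "integrable white_noise (\<lambda>z. \<Sum>i\<in>UNIV. 2 * (z (i :: 'a, 0))\<^sup>2 + 20 * (\<Sum>N. bump_bound N z i))"
    using noise_moments(2)[where 'a = "'a \<times> nat"] by (intro Bochner_Integration.integrable_sum Bochner_Integration.integrable_add integrable_mult_right) (auto simp: has_bochner_integral_iff)
  then show ?thesis
  proof (rule integrable_cong_AE_imp[OF _ measurable_path_bound])
    show "AE z in white_noise. (\<Sum>i\<in>UNIV. 2 * (z (i :: 'a, 0))\<^sup>2 + 20 * (\<Sum>N. bump_bound N z i)) = path_bound z"
      using AE_regular_noise by eventually_elim (simp add: path_bound_def)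
  qed
qed

subsection \<open>Moments of increments between grid points\<close>

lemma polygon_increment:
  "polygon N z i (real m' / 2 ^ N) - polygon N z i (real m / 2 ^ N) =
    (1 / sqrt 2) ^ N * (\<Sum>j<2 ^ N. (ramp (2 ^ N * (real m' / 2 ^ N - vdc j)) - ramp (2 ^ N * (real m / 2 ^ N - vdc j))) * increments N z (i, j))"
  unfolding polygon_def sum_subtractf[symmetric] sum_distrib_left by (intro sum.cong refl) (simp add: algebra_simps)

context
  fixes N m m' :: nat
  assumes mm: "m \<le> m'"
begin

text \<open>The cells of level \<open>N\<close> between two grid points; a cell is identified by its left end.\<close>

definition block :: "nat set" where
  "block = {j. j < 2 ^ N \<and> \<not> vdc j < real m / 2 ^ N \<and> vdc j < real m' / 2 ^ N}"

lemma finite_block: "finite block"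
  unfolding block_def by (rule finite_subset[of _ "{..<2 ^ N}"]) auto

lemma grid_weight:
  assumes "j < 2 ^ N"
  shows "ramp (2 ^ N * (real m' / 2 ^ N - vdc j)) - ramp (2 ^ N * (real m / 2 ^ N - vdc j)) = (if j \<in> block then 1 else 0)"
proof -
  have "real m / 2 ^ N \<le> real m' / 2 ^ N" using mm by (simp add: divide_right_mono)
  then show ?thesis
    using assms by (subst (1 2) grid_ramp_01) (auto simp: block_def)
qed

text \<open>Each cell of the block contributes 1 to the increment of the sum of the ramps of level
  \<open>N\<close>, and that sum is a multiple of the ramp of level 0.\<close>

lemma card_block: "real (card block) * (1 / 2) ^ N = ramp (real m' / 2 ^ N) - ramp (real m / 2 ^ N)"
proof -
  have "ramp (real m' / 2 ^ N) - ramp (real m / 2 ^ N) = (\<Sum>j<2 ^ N. (1 / 2) ^ N * (if j \<in> block then 1 else 0))"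
  proof -
    have r: "ramp (real k / 2 ^ N) = (\<Sum>j<2 ^ N. (1 / 2) ^ N * ramp (2 ^ N * (real k / 2 ^ N - vdc j)))" for k
      by (rule sum_ramp[symmetric])
    have "ramp (real m' / 2 ^ N) - ramp (real m / 2 ^ N) =
       (\<Sum>j<2 ^ N. (1 / 2) ^ N * (ramp (2 ^ N * (real m' / 2 ^ N - vdc j)) - ramp (2 ^ N * (real m / 2 ^ N - vdc j))))"
      by (rule trans[OF arg_cong2[where f="(-)", OF r r]]) (simp only: sum_subtractf[symmetric] right_diff_distrib)
    also have "\<dots> = (\<Sum>j<2 ^ N. (1 / 2) ^ N * (if j \<in> block then 1 else 0))"
      by (intro sum.cong refl) (simp only: grid_weight lessThan_iff)
    finally show ?thesis .
  qed
  also have "\<dots> = (1 / 2) ^ N * (\<Sum>j\<in>{..<2 ^ N} \<inter> block. 1)"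
    unfolding sum_distrib_left[symmetric] by (subst sum.inter_restrict) auto
  also have "{..<2 ^ N} \<inter> block = block" by (auto simp: block_def)
  finally show ?thesis by simp
qed

lemma polygon_increment_block:
  "polygon N z i (real m' / 2 ^ N) - polygon N z i (real m / 2 ^ N) = (1 / sqrt 2) ^ N * (\<Sum>j\<in>block. increments N z (i, j))"
proof -
  have "(\<Sum>j<2 ^ N. (ramp (2 ^ N * (real m' / 2 ^ N - vdc j)) - ramp (2 ^ N * (real m / 2 ^ N - vdc j))) * increments N z (i, j))
     = (\<Sum>j<2 ^ N. if j \<in> block then increments N z (i, j) else 0)"
    by (intro sum.cong refl) (simp only: grid_weight lessThan_iff, simp)
  also have "\<dots> = (\<Sum>j\<in>{..<2 ^ N} \<inter> block. increments N z (i, j))"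
    by (subst sum.inter_restrict) auto
  also have "{..<2 ^ N} \<inter> block = block" by (auto simp: block_def)
  finally show ?thesis by (simp only: polygon_increment)
qed

text \<open>At the grid points the path agrees with the polygon, so its increment between two of them
  is a multiple of a sum of normalised increments over cells. These are again white noise,
  because \<open>increments N\<close> preserves the law; hence the moments may be computed for the noise
  itself.\<close>

lemma levy_increment_moments:
  fixes i k :: "'i::finite"
  defines "W \<equiv> \<lambda>z i. levy_path z i (real m' / 2 ^ N) - levy_path z i (real m / 2 ^ N)"
  shows "has_bochner_integral white_noise (\<lambda>z. W z i) 0"
    and "has_bochner_integral white_noise (\<lambda>z. W z i * W z k) (if i = k then ramp (real m' / 2 ^ N) - ramp (real m / 2 ^ N) else 0)"
    and "has_bochner_integral white_noise (\<lambda>z. W z i ^ 4) (3 * (ramp (real m' / 2 ^ N) - ramp (real m / 2 ^ N))\<^sup>2)"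
proof -
  define c :: real where "c = (1 / sqrt 2) ^ N"
  define V where "V z i = c * (\<Sum>j\<in>block. z (i, j))" for z and i :: 'i
  have cc: "c * c = (1 / 2) ^ N" unfolding c_def by (simp add: power_mult_distrib[symmetric])
  have c4: "c ^ 4 = (1 / 2) ^ N * (1 / 2) ^ N"
    using cc by (simp add: power4_eq_xxxx)
  have [measurable]: "(\<lambda>z. V z i) \<in> borel_measurable white_noise" for i unfolding V_def by measurable
  have [measurable]: "increments N \<in> white_noise \<rightarrow>\<^sub>M (white_noise :: ('i \<times> nat \<Rightarrow> real) measure)"
    and d: "distr white_noise white_noise (increments N) = (white_noise :: ('i \<times> nat \<Rightarrow> real) measure)"
    using increments_preserving[of N, where 'i = 'i] by auto
  have [measurable]: "(\<lambda>z. W z i) \<in> borel_measurable white_noise" for i unfolding W_def by measurable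
  have AE: "AE z in white_noise. \<forall>i. W z i = V (increments N z) i"
    using AE_regular_noise
  proof eventually_elim
    case (elim z)
    show ?case
      unfolding W_def V_def c_def levy_path_grid[OF elim] polygon_increment_block by simp
  qed
  \<comment> \<open>The path increment \<open>W\<close> is almost surely the function \<open>V\<close> of \<open>increments N z\<close>, which has the
    law of \<open>z\<close>.\<close>
  have transfer: "has_bochner_integral white_noise (\<lambda>z. \<phi> (W z)) v"
    if V: "has_bochner_integral white_noise (\<lambda>z. \<phi> (V z)) v" and [measurable]: "(\<lambda>z. \<phi> (W z)) \<in> borel_measurable white_noise"
    for \<phi> :: "('i \<Rightarrow> real) \<Rightarrow> real" and v
  proof -
    have m[measurable]: "(\<lambda>z. \<phi> (V z)) \<in> borel_measurable white_noise"
      using V by (auto simp: has_bochner_integral_iff)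
    have "has_bochner_integral (distr white_noise white_noise (increments N)) (\<lambda>z. \<phi> (V z)) v"
      using V by (simp add: d)
    then have "has_bochner_integral white_noise (\<lambda>z. \<phi> (V (increments N z))) v"
      by (simp add: has_bochner_integral_iff integral_distr integrable_distr_eq)
    moreover have "AE z in white_noise. \<phi> (V (increments N z)) = \<phi> (W z)"
      using AE by eventually_elim (rule arg_cong[where f=\<phi>], auto)
    ultimately show ?thesis
      by (subst (asm) has_bochner_integral_cong_AE[where g = "\<lambda>z. \<phi> (W z)"]) auto
  qed
  show "has_bochner_integral white_noise (\<lambda>z. W z i) 0"
  proof (rule transfer)
    have "has_bochner_integral white_noise (\<lambda>z. V z i) (c * (\<Sum>j\<in>block. 0))"
      unfolding V_def by (intro has_bochner_integral_mult_right has_bochner_integral_sum noise_moments)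
    then show "has_bochner_integral white_noise (\<lambda>z. V z i) 0" by simp
  qed measurable
  show "has_bochner_integral white_noise (\<lambda>z. W z i * W z k) (if i = k then ramp (real m' / 2 ^ N) - ramp (real m / 2 ^ N) else 0)"
  proof (rule transfer)
    have "has_bochner_integral white_noise (\<lambda>z. c * c * (\<Sum>j\<in>block. \<Sum>l\<in>block. z (i, j) * z (k, l)))
      (c * c * (\<Sum>j\<in>block. \<Sum>l\<in>block. if (i, j) = (k, l) then 1 else 0))"
      by (intro has_bochner_integral_mult_right has_bochner_integral_sum noise_orthogonal)
    moreover have "V z i * V z k = c * c * (\<Sum>j\<in>block. \<Sum>l\<in>block. z (i, j) * z (k, l))" for z
      unfolding V_def by (simp add: sum_product algebra_simps)
    moreover have "(\<Sum>j\<in>block. \<Sum>l\<in>block. if (i, j) = (k, l) then 1 else 0) = (if i = k then real (card block) else 0)"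
      using finite_block by (auto simp: sum.delta cong: if_cong)
    moreover have "c * c * (if i = k then real (card block) else 0) = (if i = k then ramp (real m' / 2 ^ N) - ramp (real m / 2 ^ N) else 0)"
      by (simp add: cc card_block[symmetric])
    ultimately show "has_bochner_integral white_noise (\<lambda>z. V z i * V z k) (if i = k then ramp (real m' / 2 ^ N) - ramp (real m / 2 ^ N) else 0)"
      by (simp only:)
  qed measurable
  show "has_bochner_integral white_noise (\<lambda>z. W z i ^ 4) (3 * (ramp (real m' / 2 ^ N) - ramp (real m / 2 ^ N))\<^sup>2)"
  proof (rule transfer)
    have "has_bochner_integral white_noise (\<lambda>z. (\<Sum>e\<in>Pair i ` block. z e) ^ 4) (3 * (real (card (Pair i ` block)))\<^sup>2)"
      by (intro noise_sum_fourth_moment finite_imageI finite_block)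
    then have "has_bochner_integral white_noise (\<lambda>z. (\<Sum>j\<in>block. z (i, j)) ^ 4) (3 * (real (card block))\<^sup>2)"
      by (simp add: sum.reindex inj_on_def card_image)
    then have "has_bochner_integral white_noise (\<lambda>z. c ^ 4 * (\<Sum>j\<in>block. z (i, j)) ^ 4) (c ^ 4 * (3 * (real (card block))\<^sup>2))"
      by (intro has_bochner_integral_mult_right)
    then show "has_bochner_integral white_noise (\<lambda>z. V z i ^ 4) (3 * (ramp (real m' / 2 ^ N) - ramp (real m / 2 ^ N))\<^sup>2)"
      by (simp add: V_def power_mult_distrib c4 card_block[symmetric] power2_eq_square mult.commute mult.left_commute)
  qed measurable
qed

end

subsection \<open>Resampling the future\<close>

definition graft :: "'i set \<Rightarrow> ('i \<Rightarrow> real) \<times> ('i \<Rightarrow> real) \<Rightarrow> 'i \<Rightarrow> real" where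
  "graft J p c = (if c \<in> J then fst p c else snd p c)"

lemma graft_preserving:
  "graft J \<in> white_noise \<Otimes>\<^sub>M white_noise \<rightarrow>\<^sub>M white_noise"
  "distr (white_noise \<Otimes>\<^sub>M white_noise) white_noise (graft J) = white_noise"
proof -
  have fs: "(\<lambda>p. fst p c) \<in> borel_measurable (white_noise \<Otimes>\<^sub>M white_noise)"
    "(\<lambda>p. snd p c) \<in> borel_measurable (white_noise \<Otimes>\<^sub>M white_noise)" for c :: 'a
    by (auto intro: measurable_compose[OF measurable_fst] measurable_compose[OF measurable_snd])
  show [measurable]: "graft J \<in> white_noise \<Otimes>\<^sub>M white_noise \<rightarrow>\<^sub>M white_noise"
    unfolding measurable_white_noise_iff graft_def using fs by simp
  show "distr (white_noise \<Otimes>\<^sub>M white_noise) white_noise (graft J) = white_noise"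
  proof (rule white_noise.PiM_eq)
    fix I and A :: "'a \<Rightarrow> real set"
    assume I: "finite I" "I \<subseteq> UNIV" "\<And>j. j \<in> I \<Longrightarrow> A j \<in> sets std_normal"
    let ?E = "\<lambda>K. {z. \<forall>j\<in>K. z j \<in> A j}"
    have E: "emeasure white_noise (?E K) = (\<Prod>j\<in>K. emeasure std_normal (A j))" "?E K \<in> sets white_noise"
      if "K \<subseteq> I" for K
    proof -
      have K: "finite K" "\<And>j. j \<in> K \<Longrightarrow> A j \<in> sets std_normal" using that I finite_subset by auto
      show "emeasure white_noise (?E K) = (\<Prod>j\<in>K. emeasure std_normal (A j))"
        using white_noise.emeasure_PiM_Collect[of K A] K by simp
      have "{z \<in> space white_noise. \<forall>j\<in>K. z j \<in> A j} \<in> sets white_noise"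
        using K by (intro sets.sets_Collect_finite_All measurable_sets_Collect[OF measurable_white_noise_component]) auto
      then show "?E K \<in> sets white_noise" by simp
    qed
    have emb: "prod_emb UNIV (\<lambda>_. std_normal) I (Pi\<^sub>E I A) = ?E I"
      by (auto simp: prod_emb_def PiE_iff restrict_def)
    \<comment> \<open>A box for the grafted sequence is a product of two boxes, one for each of the independent
      sequences.\<close>
    have "graft J -` ?E I \<inter> space (white_noise \<Otimes>\<^sub>M white_noise) = ?E (I \<inter> J) \<times> ?E (I - J)"
      by (auto simp: graft_def space_pair_measure split: if_splits)
    then have "emeasure (distr (white_noise \<Otimes>\<^sub>M white_noise) white_noise (graft J)) (?E I) = emeasure (white_noise \<Otimes>\<^sub>M white_noise) (?E (I \<inter> J) \<times> ?E (I - J))"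
      using E(2)[of I] by (simp add: emeasure_distr)
    also have "\<dots> = (\<Prod>j\<in>I \<inter> J. emeasure std_normal (A j)) * (\<Prod>j\<in>I - J. emeasure std_normal (A j))"
      using E[of "I \<inter> J"] E[of "I - J"] by (subst white_noise.emeasure_pair_measure_Times) auto
    also have "\<dots> = (\<Prod>j\<in>I. emeasure std_normal (A j))"
      using I(1) by (simp add: prod.Int_Diff[symmetric])
    finally show "emeasure (distr (white_noise \<Otimes>\<^sub>M white_noise) white_noise (graft J)) (prod_emb UNIV (\<lambda>_. std_normal) I (Pi\<^sub>E I A)) = (\<Prod>j\<in>I. emeasure std_normal (A j))"
      by (simp add: emb)
  qed (simp add: white_noise_def)
qed

text \<open>Keeps the increments over the cells of level \<open>N\<close> to the left of \<open>m / 2 ^ N\<close> and replaces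
  the others by those of a second noise. In the noise coordinates themselves this has no such
  simple description, because coarse coordinates influence the path on both sides.\<close>

definition resample :: "nat \<Rightarrow> nat \<Rightarrow> ('i \<times> nat \<Rightarrow> real) \<times> ('i \<times> nat \<Rightarrow> real) \<Rightarrow> 'i \<times> nat \<Rightarrow> real" where
  "resample N m p = noise_of_increments N (graft {c. vdc (snd c) < real m / 2 ^ N} (increments N (fst p), increments N (snd p)))"

lemma resample_preserving:
  fixes N m :: nat
  defines "\<kappa> \<equiv> resample N m :: _ \<Rightarrow> 'i::finite \<times> nat \<Rightarrow> real"
  shows "\<kappa> \<in> white_noise \<Otimes>\<^sub>M white_noise \<rightarrow>\<^sub>M white_noise"
    and "distr (white_noise \<Otimes>\<^sub>M white_noise) white_noise \<kappa> = white_noise"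
proof -
  let ?w = "white_noise :: ('i \<times> nat \<Rightarrow> real) measure"
  let ?J = "{c :: 'i \<times> nat. vdc (snd c) < real m / 2 ^ N}"
  have inc: "increments N \<in> ?w \<rightarrow>\<^sub>M ?w" "distr ?w ?w (increments N) = ?w"
    using increments_preserving[of N, where 'i = 'i] by auto
  have noi: "noise_of_increments N \<in> ?w \<rightarrow>\<^sub>M ?w" "distr ?w ?w (noise_of_increments N) = ?w"
    using noise_of_increments_preserving[of N, where 'i = 'i] by auto
  let ?d = "\<lambda>p :: ('i \<times> nat \<Rightarrow> real) \<times> ('i \<times> nat \<Rightarrow> real). (increments N (fst p), increments N (snd p))"
  have dm: "?d \<in> ?w \<Otimes>\<^sub>M ?w \<rightarrow>\<^sub>M ?w \<Otimes>\<^sub>M ?w"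
    by (intro measurable_Pair measurable_compose[OF measurable_fst inc(1)] measurable_compose[OF measurable_snd inc(1)])
  have dd: "distr (?w \<Otimes>\<^sub>M ?w) (?w \<Otimes>\<^sub>M ?w) ?d = ?w \<Otimes>\<^sub>M ?w"
  proof -
    have "distr ?w ?w (increments N) \<Otimes>\<^sub>M distr ?w ?w (increments N) = distr (?w \<Otimes>\<^sub>M ?w) (?w \<Otimes>\<^sub>M ?w) (\<lambda>(x, y). (increments N x, increments N y))"
      by (rule pair_measure_distr[OF inc(1) inc(1)]) (simp add: inc(2) prob_space_imp_sigma_finite prob_space_white_noise)
    then show ?thesis by (simp only: inc(2) split_beta')
  qed
  have k: "\<kappa> = noise_of_increments N \<circ> (graft ?J \<circ> ?d)"
    by (auto simp: \<kappa>_def resample_def)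
  have sd: "graft ?J \<circ> ?d \<in> ?w \<Otimes>\<^sub>M ?w \<rightarrow>\<^sub>M ?w"
    by (rule measurable_comp[OF dm graft_preserving(1)])
  have "distr (?w \<Otimes>\<^sub>M ?w) ?w (graft ?J \<circ> ?d) = ?w"
    using distr_distr[OF graft_preserving(1) dm, of ?J] dd graft_preserving(2)[of ?J] by metis
  then show "distr (?w \<Otimes>\<^sub>M ?w) ?w \<kappa> = ?w"
    using distr_distr[OF noi(1) sd] noi(2) unfolding k by metis
  show "\<kappa> \<in> ?w \<Otimes>\<^sub>M ?w \<rightarrow>\<^sub>M ?w"
    unfolding k by (rule measurable_comp[OF sd noi(1)])
qed

lemma increments_resample: "increments N (resample N m p) = graft {c. vdc (snd c) < real m / 2 ^ N} (increments N (fst p), increments N (snd p))"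
  by (simp add: resample_def increments_noise)

lemma AE_pair_regular:
  fixes N m :: nat
  shows "AE p in (white_noise \<Otimes>\<^sub>M white_noise :: (('i::finite \<times> nat \<Rightarrow> real) \<times> ('i \<times> nat \<Rightarrow> real)) measure).
     regular_noise (fst p) \<and> regular_noise (snd p) \<and> regular_noise (resample N m p)"
proof -
  let ?w = "white_noise :: ('i \<times> nat \<Rightarrow> real) measure"
  have "graft UNIV = (fst :: ('i \<times> nat \<Rightarrow> real) \<times> ('i \<times> nat \<Rightarrow> real) \<Rightarrow> _)" "graft {} = (snd :: ('i \<times> nat \<Rightarrow> real) \<times> ('i \<times> nat \<Rightarrow> real) \<Rightarrow> _)"
    by (auto simp: graft_def intro!: ext)
  then have f: "distr (?w \<Otimes>\<^sub>M ?w) ?w fst = ?w" and s: "distr (?w \<Otimes>\<^sub>M ?w) ?w snd = ?w"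
    using graft_preserving(2)[where 'a = "'i \<times> nat"] by metis+
  have "AE p in ?w \<Otimes>\<^sub>M ?w. regular_noise (g p)"
    if "g \<in> ?w \<Otimes>\<^sub>M ?w \<rightarrow>\<^sub>M ?w" "distr (?w \<Otimes>\<^sub>M ?w) ?w g = ?w" for g
    using AE_distrD[OF that(1)] AE_regular_noise that(2) by metis
  from this[OF measurable_fst f] this[OF measurable_snd s] this[OF resample_preserving]
  show ?thesis by eventually_elim simp
qed

lemma levy_path_resample_past:
  assumes "t \<le> real m / 2 ^ N" "regular_noise (fst p)" "regular_noise (resample N m p)"
  shows "levy_path (resample N m p) i t = levy_path (fst p) i t"
proof (rule LIMSEQ_unique[OF levy_path_lim[OF assms(3)]])
  have "polygon M (fst p) i t = polygon M (resample N m p) i t" if "N \<le> M" for M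
    by (rule polygon_past[OF _ assms(1) that]) (simp add: increments_resample graft_def)
  then have "\<forall>\<^sub>F M in sequentially. polygon M (fst p) i t = polygon M (resample N m p) i t"
    by (auto simp: eventually_sequentially)
  from Lim_transform_eventually[OF levy_path_lim[OF assms(2)] this]
  show "(\<lambda>M. polygon M (resample N m p) i t) \<longlonglongrightarrow> levy_path (fst p) i t" .
qed

lemma levy_path_resample_future:
  assumes "real m / 2 ^ N \<le> t" "regular_noise (snd p)" "regular_noise (resample N m p)"
  shows "levy_path (resample N m p) i t - levy_path (resample N m p) i (real m / 2 ^ N) = levy_path (snd p) i t - levy_path (snd p) i (real m / 2 ^ N)"
proof (rule LIMSEQ_unique[OF tendsto_diff[OF levy_path_lim[OF assms(3)] levy_path_lim[OF assms(3)]]])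
  let ?d = "\<lambda>M z. polygon M z i t - polygon M z i (real m / 2 ^ N)"
  have "?d M (snd p) = ?d M (resample N m p)" if "N \<le> M" for M
    by (rule polygon_future[OF _ assms(1) that]) (simp add: increments_resample graft_def)
  then have "\<forall>\<^sub>F M in sequentially. ?d M (snd p) = ?d M (resample N m p)"
    by (auto simp: eventually_sequentially)
  from Lim_transform_eventually[OF tendsto_diff[OF levy_path_lim[OF assms(2)] levy_path_lim[OF assms(2)]] this]
  show "(\<lambda>M. ?d M (resample N m p)) \<longlonglongrightarrow> levy_path (snd p) i t - levy_path (snd p) i (real m / 2 ^ N)" .
qed

section \<open>A Brownian motion on a space satisfying the usual conditions\<close>

lemma borel_measurable_vec:
  fixes f :: "'a \<Rightarrow> real^'n"
  assumes "\<And>i. (\<lambda>x. f x $ i) \<in> borel_measurable N"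
  shows "f \<in> borel_measurable N"
  using assms by (subst borel_measurable_euclidean_space) (auto simp: Basis_vec_def inner_axis)

text \<open>Exactly what the martingale problem needs of a Brownian motion on \<open>[t0, t0 + 1]\<close>: the
  first two conditional moments of its increments, a bound of their fourth moments, and one
  integrable variable \<open>R\<close> that dominates the square of the path at all times.\<close>

locale brownian = usual_filtered_space M F
  for M :: "'w measure" and F :: "real \<Rightarrow> 'w measure" +
  fixes t0 :: real and B :: "real \<Rightarrow> 'w \<Rightarrow> real^'n" and R :: "'w \<Rightarrow> real"
  assumes B_adapted: "B t \<in> borel_measurable (F t)"
    and B_continuous: "\<omega> \<in> space M \<Longrightarrow> continuous_on UNIV (\<lambda>t. B t \<omega>)"
    and B_start: "t \<le> t0 \<Longrightarrow> B t \<omega> = 0"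
    and B_bound: "(norm (B t \<omega>))\<^sup>2 \<le> R \<omega>"
    and R_integrable: "integrable M R"
    and B_mean: "t0 \<le> u \<Longrightarrow> u \<le> w \<Longrightarrow> w \<le> t0 + 1 \<Longrightarrow> A \<in> sets (F u) \<Longrightarrow>
      (\<integral>\<omega>. indicator A \<omega> * (B w \<omega> - B u \<omega>) $ i \<partial>M) = 0"
    and B_covariance: "t0 \<le> u \<Longrightarrow> u \<le> w \<Longrightarrow> w \<le> t0 + 1 \<Longrightarrow> A \<in> sets (F u) \<Longrightarrow>
      (\<integral>\<omega>. indicator A \<omega> * ((B w \<omega> - B u \<omega>) $ i * (B w \<omega> - B u \<omega>) $ j) \<partial>M) = (if i = j then (w - u) * measure M A else 0)"
    and B_fourth_moment: "t0 \<le> u \<Longrightarrow> u \<le> w \<Longrightarrow> w \<le> t0 + 1 \<Longrightarrow>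
      (\<integral>\<^sup>+\<omega>. ennreal ((B w \<omega> - B u \<omega>) $ i ^ 4) \<partial>M) \<le> ennreal (3 * (w - u)\<^sup>2)"

text \<open>White noise realised on an arbitrary complete probability space. Completeness is needed
  because the filtration has to contain all subsets of null sets.\<close>

locale noise_source = prob_space M
  for M :: "'w measure" +
  fixes q :: "'w \<Rightarrow> 'n::finite \<times> nat \<Rightarrow> real"
  assumes null_subset: "N \<in> null_sets M \<Longrightarrow> A \<subseteq> N \<Longrightarrow> A \<in> sets M"
    and q_measurable [measurable]: "q \<in> M \<rightarrow>\<^sub>M white_noise"
    and q_distr: "distr M white_noise q = white_noise"

text \<open>A countable family of reals is determined by the set of rationals below each of its
  members.\<close>

lemma noise_space_lepoll_reals: "(UNIV :: ('c::countable \<Rightarrow> real) set) \<lesssim> (UNIV :: real set)"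
proof -
  define g where "g z = {to_nat (c, r) | c r. real_of_rat r < z c}" for z :: "'c \<Rightarrow> real"
  have "inj g"
  proof (rule injI, rule ext, rule ccontr)
    fix z y :: "'c \<Rightarrow> real" and c
    assume g: "g z = g y" and ne: "z c \<noteq> y c"
    have mem: "to_nat (c, r) \<in> g z \<longleftrightarrow> real_of_rat r < z c" for z :: "'c \<Rightarrow> real" and r
      unfolding g_def by (auto dest: injD[OF inj_to_nat])
    have "\<exists>r. (z c < real_of_rat r) \<noteq> (y c < real_of_rat r) \<and> real_of_rat r \<noteq> z c \<and> real_of_rat r \<noteq> y c"
    proof (cases "z c < y c")
      case True
      then show ?thesis using of_rat_dense[of "z c" "y c"] by force
    next
      case False
      then show ?thesis using of_rat_dense[of "y c" "z c"] ne by force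
    qed
    then obtain r where r: "(z c < real_of_rat r) \<noteq> (y c < real_of_rat r)" "real_of_rat r \<noteq> z c" "real_of_rat r \<noteq> y c"
      by blast
    have "to_nat (c, r) \<in> g y \<longleftrightarrow> real_of_rat r < z c" using mem[of r z] unfolding g .
    with mem[of r y] have "real_of_rat r < y c \<longleftrightarrow> real_of_rat r < z c" by simp
    with r show False by linarith
  qed
  then have "(UNIV :: ('c \<Rightarrow> real) set) \<lesssim> (UNIV :: nat set set)"
    unfolding lepoll_def by blast
  then show ?thesis
    using nat_sets_eqpoll_reals by (meson eqpoll_imp_lepoll lepoll_trans)
qed

text \<open>The noise space embeds into the sample type by cardinality. Its law is pushed forward
  along the injection to the sigma-algebra generated by the inverse, and the result is
  completed.\<close>

lemma noise_source_exists:
  assumes "(UNIV :: real set) \<lesssim> (UNIV :: 'w set)"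
  shows "\<exists>(M :: 'w measure) (q :: 'w \<Rightarrow> 'n::finite \<times> nat \<Rightarrow> real). noise_source M q"
proof -
  obtain f :: "('n \<times> nat \<Rightarrow> real) \<Rightarrow> 'w" where f: "inj f"
    using lepoll_trans[OF noise_space_lepoll_reals assms] unfolding lepoll_def by blast
  define q where "q = inv f"
  have qf: "q (f z) = z" for z using f by (simp add: q_def)
  define N where "N = distr white_noise (vimage_algebra UNIV q white_noise) f"
  have fm: "f \<in> white_noise \<rightarrow>\<^sub>M vimage_algebra UNIV q white_noise"
    by (rule measurable_vimage_algebra2) (auto simp: qf)
  have qm: "q \<in> N \<rightarrow>\<^sub>M white_noise"
    unfolding N_def by (simp add: measurable_vimage_algebra1)
  have "distr N white_noise q = distr white_noise white_noise (q \<circ> f)"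
    unfolding N_def by (rule distr_distr[OF _ fm]) (simp add: measurable_vimage_algebra1)
  also have "q \<circ> f = (\<lambda>z. z)" using qf by auto
  finally have qd: "distr N white_noise q = white_noise" by (simp add: distr_id2)
  have "prob_space N" unfolding N_def by (intro white_noise.P.prob_space_distr fm)
  then interpret N: prob_space N .
  have "prob_space (completion N)" by (rule N.prob_space_completion)
  then interpret C: prob_space "completion N" .
  have "noise_source (completion N) q"
  proof
    show "A \<in> sets (completion N)" if "Z \<in> null_sets (completion N)" "A \<subseteq> Z" for A Z
      using null_sets_completion_subset[OF that(2,1)] by auto
    show "q \<in> completion N \<rightarrow>\<^sub>M white_noise" by (rule measurable_completion[OF qm])
    show "distr (completion N) white_noise q = white_noise"
      using distr_completion[OF qm] qd by simp
  qed
  then show ?thesis by blast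
qed

text \<open>The least grid point of level \<open>k\<close> that is strictly above \<open>u\<close>; the past of \<open>u\<close> is defined
  by grid points strictly above \<open>u\<close>.\<close>

definition dyadic_above :: "nat \<Rightarrow> real \<Rightarrow> nat" where
  "dyadic_above k u = nat (\<lfloor>2 ^ k * u\<rfloor> + 1)"

lemma dyadic_above:
  assumes "0 \<le> u"
  shows "u < real (dyadic_above k u) / 2 ^ k" "real (dyadic_above k u) / 2 ^ k \<le> u + (1 / 2) ^ k"
proof -
  have "0 \<le> \<lfloor>2 ^ k * u\<rfloor>" using assms by simp
  then have e: "real (dyadic_above k u) = of_int \<lfloor>2 ^ k * u\<rfloor> + 1" by (simp add: dyadic_above_def)
  have "2 ^ k * u < real (dyadic_above k u)" "real (dyadic_above k u) \<le> 2 ^ k * u + 1"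
    unfolding e by linarith+
  then show "u < real (dyadic_above k u) / 2 ^ k" "real (dyadic_above k u) / 2 ^ k \<le> u + (1 / 2) ^ k"
    by (simp_all add: field_simps power_divide)
qed

lemma dyadic_above_mono: "u \<le> w \<Longrightarrow> dyadic_above k u \<le> dyadic_above k w"
  unfolding dyadic_above_def by (intro nat_mono add_mono floor_mono mult_left_mono) auto

lemma dyadic_above_tendsto:
  assumes "0 \<le> u"
  shows "(\<lambda>k. real (dyadic_above k u) / 2 ^ k) \<longlonglongrightarrow> u"
proof (rule tendsto_sandwich[where f = "\<lambda>_. u" and h = "\<lambda>k. u + (1 / 2) ^ k"])
  show "(\<lambda>k. u + (1 / 2) ^ k) \<longlonglongrightarrow> u"
    by (intro tendsto_eq_intros LIMSEQ_power_zero) auto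
  show "\<forall>\<^sub>F k in sequentially. u \<le> real (dyadic_above k u) / 2 ^ k"
    using dyadic_above(1)[OF assms] by (intro always_eventually) (auto intro: less_imp_le)
  show "\<forall>\<^sub>F k in sequentially. real (dyadic_above k u) / 2 ^ k \<le> u + (1 / 2) ^ k"
    using dyadic_above(2)[OF assms] by (intro always_eventually) auto
qed simp

context noise_source
begin

text \<open>An event is past at \<open>u\<close> if for every grid time after \<open>u\<close> it agrees almost surely with an
  event on the noise that does not notice the resampling of everything after that grid time.
  Quantifying over grid times strictly after \<open>u\<close> makes the family right-continuous, and the
  almost sure clauses let it contain all null sets, so neither property has to be added by an
  augmentation.\<close>

definition past :: "real \<Rightarrow> 'w set set" where
  "past u = {A \<in> sets M. \<forall>N m. u < real m / 2 ^ N \<longrightarrow>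
     (\<exists>B\<in>sets white_noise. (AE \<omega> in M. \<omega> \<in> A \<longleftrightarrow> q \<omega> \<in> B) \<and>
        (AE p in white_noise \<Otimes>\<^sub>M white_noise. resample N m p \<in> B \<longleftrightarrow> fst p \<in> B))}"

lemma pastI:
  assumes "A \<in> sets M"
    and "\<And>N m. u < real m / 2 ^ N \<Longrightarrow> \<exists>B\<in>sets white_noise. (AE \<omega> in M. \<omega> \<in> A \<longleftrightarrow> q \<omega> \<in> B) \<and>
        (AE p in white_noise \<Otimes>\<^sub>M white_noise. resample N m p \<in> B \<longleftrightarrow> fst p \<in> B)"
  shows "A \<in> past u"
  using assms unfolding past_def by auto

lemma pastD:
  assumes "A \<in> past u" "u < real m / 2 ^ N"
  obtains B where "B \<in> sets white_noise" "AE \<omega> in M. \<omega> \<in> A \<longleftrightarrow> q \<omega> \<in> B"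
    "AE p in white_noise \<Otimes>\<^sub>M white_noise. resample N m p \<in> B \<longleftrightarrow> fst p \<in> B"
  using assms unfolding past_def by blast

lemma sigma_algebra_past: "sigma_algebra (space M) (past u)"
  unfolding sigma_algebra_iff2
proof (intro conjI ballI allI impI)
  show "past u \<subseteq> Pow (space M)" using sets.sets_into_space by (auto simp: past_def)
  show "{} \<in> past u" by (rule pastI) (auto intro!: bexI[of _ "{}"])
  fix A assume A: "A \<in> past u"
  show "space M - A \<in> past u"
  proof (rule pastI)
    show "space M - A \<in> sets M" using A by (auto simp: past_def)
    fix N m assume "u < real m / 2 ^ N"
    then obtain B where B: "B \<in> sets white_noise" "AE \<omega> in M. \<omega> \<in> A \<longleftrightarrow> q \<omega> \<in> B"
      "AE p in white_noise \<Otimes>\<^sub>M white_noise. resample N m p \<in> B \<longleftrightarrow> fst p \<in> B"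
      using pastD[OF A] by blast
    have "- B \<in> sets white_noise" using sets.compl_sets[OF B(1)] by (simp add: Compl_eq_Diff_UNIV)
    moreover have "AE \<omega> in M. \<omega> \<in> space M - A \<longleftrightarrow> q \<omega> \<in> - B" using B(2) by auto
    moreover have "AE p in white_noise \<Otimes>\<^sub>M white_noise. resample N m p \<in> - B \<longleftrightarrow> fst p \<in> - B" using B(3) by auto
    ultimately show "\<exists>B\<in>sets white_noise. (AE \<omega> in M. \<omega> \<in> space M - A \<longleftrightarrow> q \<omega> \<in> B) \<and>
        (AE p in white_noise \<Otimes>\<^sub>M white_noise. resample N m p \<in> B \<longleftrightarrow> fst p \<in> B)" by blast
  qed
next
  fix A :: "nat \<Rightarrow> 'w set" assume A: "range A \<subseteq> past u"
  show "(\<Union>k. A k) \<in> past u"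
  proof (rule pastI)
    show "(\<Union>k. A k) \<in> sets M" using A by (auto simp: past_def)
    fix N m assume "u < real m / 2 ^ N"
    then have "\<forall>k. \<exists>B. B \<in> sets white_noise \<and> (AE \<omega> in M. \<omega> \<in> A k \<longleftrightarrow> q \<omega> \<in> B) \<and>
      (AE p in white_noise \<Otimes>\<^sub>M white_noise. resample N m p \<in> B \<longleftrightarrow> fst p \<in> B)"
      using A unfolding past_def by (simp add: image_subset_iff) blast
    from choice[OF this] obtain B where "\<forall>k. B k \<in> sets white_noise \<and> (AE \<omega> in M. \<omega> \<in> A k \<longleftrightarrow> q \<omega> \<in> B k) \<and>
      (AE p in white_noise \<Otimes>\<^sub>M white_noise. resample N m p \<in> B k \<longleftrightarrow> fst p \<in> B k)"
      by (rule exE)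
    then have B: "\<And>k. B k \<in> sets white_noise" "\<And>k. AE \<omega> in M. \<omega> \<in> A k \<longleftrightarrow> q \<omega> \<in> B k"
      "\<And>k. AE p in white_noise \<Otimes>\<^sub>M white_noise. resample N m p \<in> B k \<longleftrightarrow> fst p \<in> B k"
      by blast+
    have "(\<Union>k. B k) \<in> sets white_noise" using B(1) by auto
    moreover have "AE \<omega> in M. \<forall>k. \<omega> \<in> A k \<longleftrightarrow> q \<omega> \<in> B k" using B(2) by (simp add: AE_all_countable)
    then have "AE \<omega> in M. \<omega> \<in> (\<Union>k. A k) \<longleftrightarrow> q \<omega> \<in> (\<Union>k. B k)" by eventually_elim auto
    moreover have "AE p in white_noise \<Otimes>\<^sub>M white_noise. \<forall>k. resample N m p \<in> B k \<longleftrightarrow> fst p \<in> B k"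
      using B(3) by (simp add: AE_all_countable)
    then have "AE p in white_noise \<Otimes>\<^sub>M white_noise. resample N m p \<in> (\<Union>k. B k) \<longleftrightarrow> fst p \<in> (\<Union>k. B k)"
      by eventually_elim auto
    ultimately show "\<exists>B\<in>sets white_noise. (AE \<omega> in M. \<omega> \<in> (\<Union>k. A k) \<longleftrightarrow> q \<omega> \<in> B) \<and>
        (AE p in white_noise \<Otimes>\<^sub>M white_noise. resample N m p \<in> B \<longleftrightarrow> fst p \<in> B)" by blast
  qed
qed

definition filt :: "real \<Rightarrow> 'w measure" where
  "filt u = sigma (space M) (past u)"

lemma space_filt [simp]: "space (filt u) = space M"
  unfolding filt_def using sigma_algebra.space_measure_of_eq[OF sigma_algebra_past] by simp

lemma sets_filt [simp]: "sets (filt u) = past u"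
  unfolding filt_def using sigma_algebra.sets_measure_of_eq[OF sigma_algebra_past] by simp

lemma past_mono: "u \<le> w \<Longrightarrow> past u \<subseteq> past w"
  unfolding past_def by (auto dest: order.strict_trans1)

lemma past_right_continuous: "past u = (\<Inter>s\<in>{u<..}. past s)"
proof
  show "past u \<subseteq> (\<Inter>s\<in>{u<..}. past s)" using past_mono by (auto dest: less_imp_le)
  show "(\<Inter>s\<in>{u<..}. past s) \<subseteq> past u"
  proof
    fix A assume A: "A \<in> (\<Inter>s\<in>{u<..}. past s)"
    show "A \<in> past u"
    proof (rule pastI)
      show "A \<in> sets M" using A by (auto simp: past_def dest!: bspec[of _ _ "u + 1"])
      fix N m assume "u < real m / 2 ^ N"
      then obtain s where s: "u < s" "s < real m / 2 ^ N" using dense by blast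
      then have "A \<in> past s" using A by auto
      from pastD[OF this s(2)]
      show "\<exists>B\<in>sets white_noise. (AE \<omega> in M. \<omega> \<in> A \<longleftrightarrow> q \<omega> \<in> B) \<and>
        (AE p in white_noise \<Otimes>\<^sub>M white_noise. resample N m p \<in> B \<longleftrightarrow> fst p \<in> B)" by blast
    qed
  qed
qed

lemma past_null: "N \<in> null_sets M \<Longrightarrow> A \<subseteq> N \<Longrightarrow> A \<in> past u"
proof (rule pastI)
  assume N: "N \<in> null_sets M" "A \<subseteq> N"
  show "A \<in> sets M" using null_subset[OF N] .
  have "AE \<omega> in M. \<omega> \<notin> N" by (rule AE_not_in[OF N(1)])
  then have "AE \<omega> in M. \<omega> \<in> A \<longleftrightarrow> q \<omega> \<in> {}" by eventually_elim (use N in auto)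
  then show "\<exists>B\<in>sets white_noise. (AE \<omega> in M. \<omega> \<in> A \<longleftrightarrow> q \<omega> \<in> B) \<and>
        (AE p in white_noise \<Otimes>\<^sub>M white_noise. resample k m p \<in> B \<longleftrightarrow> fst p \<in> B)" for k m
    by (intro bexI[of _ "{}"]) auto
qed

lemma usual_filt: "usual_filtered_space M (\<lambda>t. filt (t - t0))"
proof
  show "sets (filt (i - t0)) \<subseteq> sets (filt (j - t0))" if "i \<le> j" for i j
    using that past_mono by simp
  show "subalgebra M (filt (t - t0))" for t
    unfolding subalgebra_def by (auto simp: past_def)
  show "A \<in> sets (filt (t - t0))" if "N \<in> null_sets M" "A \<subseteq> N" for t N A
    using past_null[OF that] by simp
  show "sets (filt (t - t0)) = (\<Inter>s\<in>{t<..}. sets (filt (s - t0)))" for t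
  proof -
    have "(\<lambda>s. s - t0) ` {t<..} = {t - t0<..}"
    proof (intro set_eqI iffI)
      fix x assume "x \<in> {t - t0<..}"
      then show "x \<in> (\<lambda>s. s - t0) ` {t<..}" by (intro image_eqI[of _ _ "x + t0"]) auto
    qed auto
    then show ?thesis
      unfolding sets_filt by (subst past_right_continuous) (metis image_image)
  qed
qed simp

lemma levy_path_adapted: "(\<lambda>\<omega>. levy_path (q \<omega>) i t) \<in> borel_measurable (filt t)"
proof (rule measurableI)
  fix S :: "real set" assume S: "S \<in> sets borel"
  have [measurable]: "{z. levy_path z i t \<in> S} \<in> sets white_noise"
    using measurable_sets[OF measurable_levy_path S, of i t] by (simp add: vimage_def)
  have "(\<lambda>\<omega>. levy_path (q \<omega>) i t) -` S \<inter> space M \<in> past t"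
  proof (rule pastI)
    show "(\<lambda>\<omega>. levy_path (q \<omega>) i t) -` S \<inter> space M \<in> sets M"
      using measurable_sets[OF measurable_compose[OF q_measurable measurable_levy_path] S] .
    fix N m assume t: "t < real m / 2 ^ N"
    have "AE p in white_noise \<Otimes>\<^sub>M white_noise. resample N m p \<in> {z. levy_path z i t \<in> S} \<longleftrightarrow> fst p \<in> {z. levy_path z i t \<in> S}"
      using AE_pair_regular[of N m] by eventually_elim (use t in \<open>simp add: levy_path_resample_past\<close>)
    then show "\<exists>B\<in>sets white_noise. (AE \<omega> in M. \<omega> \<in> (\<lambda>\<omega>. levy_path (q \<omega>) i t) -` S \<inter> space M \<longleftrightarrow> q \<omega> \<in> B) \<and>
        (AE p in white_noise \<Otimes>\<^sub>M white_noise. resample N m p \<in> B \<longleftrightarrow> fst p \<in> B)"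
      by (intro bexI[of _ "{z. levy_path z i t \<in> S}"]) auto
  qed
  then show "(\<lambda>\<omega>. levy_path (q \<omega>) i t) -` S \<inter> space (filt t) \<in> sets (filt t)" by simp
qed simp

text \<open>If \<open>Y\<close> only sees the resampled part of the noise, it is independent of the past.
  Resampling preserves the law, so the noise may be replaced by the resampled pair; then \<open>A\<close>
  depends on the first noise only and \<open>Y\<close> on the second one, and the expectation factorises.\<close>

lemma past_expectation:
  fixes Y :: "('n \<times> nat \<Rightarrow> real) \<Rightarrow> real"
  assumes A: "A \<in> past u" and u: "u < real m / 2 ^ N" and Y: "integrable white_noise Y"
    and future: "AE p in white_noise \<Otimes>\<^sub>M white_noise. Y (resample N m p) = Y (snd p)"
  shows "(\<integral>\<omega>. indicator A \<omega> * Y (q \<omega>) \<partial>M) = measure M A * (\<integral>z. Y z \<partial>white_noise)"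
proof -
  let ?w = "white_noise :: ('n \<times> nat \<Rightarrow> real) measure"
  obtain B where B[measurable]: "B \<in> sets ?w" and AB: "AE \<omega> in M. \<omega> \<in> A \<longleftrightarrow> q \<omega> \<in> B"
    and inv: "AE p in ?w \<Otimes>\<^sub>M ?w. resample N m p \<in> B \<longleftrightarrow> fst p \<in> B"
    using pastD[OF A u] .
  have [measurable]: "A \<in> sets M" using A by (auto simp: past_def)
  note [measurable] = borel_measurable_integrable[OF Y] resample_preserving(1)[of N m, where 'i = 'n]
  have BY: "integrable ?w (\<lambda>z. indicator B z * Y z)"
    using integrable_mult_indicator[OF B Y] by (simp add: mult.commute)
  have eq: "AE p in ?w \<Otimes>\<^sub>M ?w. indicator B (resample N m p) * Y (resample N m p) = indicator B (fst p) * Y (snd p)"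
    using inv future by eventually_elim (simp add: indicator_def)
  have BYr: "integrable (?w \<Otimes>\<^sub>M ?w) (\<lambda>p. indicator B (resample N m p) * Y (resample N m p))"
    by (rule integrable_distr[OF resample_preserving(1)]) (simp add: resample_preserving(2) BY)
  have BYp: "integrable (?w \<Otimes>\<^sub>M ?w) (\<lambda>p. indicator B (fst p) * Y (snd p))"
    by (rule integrable_cong_AE_imp[OF BYr _ eq]) measurable
  interpret P: pair_sigma_finite ?w ?w ..
  have "(\<integral>\<omega>. indicator A \<omega> * Y (q \<omega>) \<partial>M) = (\<integral>\<omega>. indicator B (q \<omega>) * Y (q \<omega>) \<partial>M)"
  proof (rule integral_cong_AE)
    show "AE \<omega> in M. indicator A \<omega> * Y (q \<omega>) = indicator B (q \<omega>) * Y (q \<omega>)"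
      using AB by eventually_elim (simp add: indicator_def)
  qed measurable
  also have "\<dots> = (\<integral>z. indicator B z * Y z \<partial>distr M ?w q)"
    by (rule integral_distr[symmetric]) measurable
  also have "\<dots> = (\<integral>z. indicator B z * Y z \<partial>distr (?w \<Otimes>\<^sub>M ?w) ?w (resample N m))"
    by (simp only: q_distr resample_preserving(2))
  also have "\<dots> = (\<integral>p. indicator B (resample N m p) * Y (resample N m p) \<partial>(?w \<Otimes>\<^sub>M ?w))"
    by (rule integral_distr) measurable
  also have "\<dots> = (\<integral>p. indicator B (fst p) * Y (snd p) \<partial>(?w \<Otimes>\<^sub>M ?w))"
    by (rule integral_cong_AE[OF _ _ eq]) measurable
  also have "\<dots> = (\<integral>z. (\<integral>z'. indicator B z * Y z' \<partial>?w) \<partial>?w)"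
    using P.integral_fst'[OF BYp] by simp
  also have "\<dots> = measure ?w B * (\<integral>z. Y z \<partial>?w)"
    by simp
  also have "measure ?w B = measure M A"
  proof -
    have "measure ?w B = measure (distr M ?w q) B" by (simp add: q_distr)
    also have "\<dots> = measure M (q -` B \<inter> space M)" by (rule measure_distr) measurable
    also have "\<dots> = measure M A"
    proof (rule measure_eq_AE)
      show "AE \<omega> in M. \<omega> \<in> q -` B \<inter> space M \<longleftrightarrow> \<omega> \<in> A" using AB by auto
    qed measurable
    finally show ?thesis .
  qed
  finally show ?thesis .
qed

lemma integrable_path_bound_q: "integrable M (\<lambda>\<omega>. path_bound (q \<omega>))"
  by (rule integrable_distr[OF q_measurable]) (simp add: q_distr integrable_path_bound)

lemma levy_path_square_bound: "(levy_path z i t)\<^sup>2 \<le> path_bound z"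
  using levy_path_bound[of z t] member_le_sum[of i UNIV "\<lambda>i. (levy_path z i t)\<^sup>2"] by simp

lemma levy_increment_bounds:
  "\<bar>levy_path z i w - levy_path z i u\<bar> \<le> 1 + 4 * path_bound z"
  "\<bar>(levy_path z i w - levy_path z i u) * (levy_path z j w - levy_path z j u)\<bar> \<le> 4 * path_bound z"
proof -
  have sq: "(levy_path z i w - levy_path z i u)\<^sup>2 \<le> 4 * path_bound z" for i
  proof -
    have "(a - b)\<^sup>2 \<le> 2 * a\<^sup>2 + 2 * b\<^sup>2" for a b :: real
      using zero_le_power2[of "a + b"] by (simp add: power2_sum power2_diff)
    from this[of "levy_path z i w" "levy_path z i u"] show ?thesis
      using levy_path_square_bound[of z i w] levy_path_square_bound[of z i u] by linarith
  qed
  have mean: "(a + b) / 2 \<le> c" if "a \<le> c" "b \<le> c" for a b c :: real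
    using add_mono[OF that] by (simp add: divide_le_eq)
  have ab: "\<bar>a * b\<bar> \<le> (a\<^sup>2 + b\<^sup>2) / 2" for a b :: real
    using zero_le_power2[of "a + b"] zero_le_power2[of "a - b"] by (simp add: power2_sum power2_diff abs_le_iff)
  show "\<bar>(levy_path z i w - levy_path z i u) * (levy_path z j w - levy_path z j u)\<bar> \<le> 4 * path_bound z"
    by (rule order_trans[OF ab[of _ _]], rule mean[OF sq sq])
  show "\<bar>levy_path z i w - levy_path z i u\<bar> \<le> 1 + 4 * path_bound z"
  proof -
    have p: "0 \<le> 4 * path_bound z" by (rule order_trans[OF zero_le_power2 sq[of i]])
    have "\<bar>levy_path z i w - levy_path z i u\<bar> \<le> ((levy_path z i w - levy_path z i u)\<^sup>2 + 1) / 2"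
      using ab[of "levy_path z i w - levy_path z i u" 1] by simp
    also have "\<dots> \<le> 1 + 4 * path_bound z"
      by (rule mean) (use sq[of i] p in auto)
    finally show ?thesis .
  qed
qed

context
  fixes u w :: real and A
  assumes uw: "0 \<le> u" "u \<le> w" "w \<le> 1" and A: "A \<in> past u"
begin

abbreviation "u' k \<equiv> real (dyadic_above k u) / 2 ^ k"
abbreviation "w' k \<equiv> real (dyadic_above k w) / 2 ^ k"

lemma grid_le: "u' k \<le> w' k"
  using dyadic_above_mono[OF uw(2), of k] by (simp add: divide_right_mono)

lemma grid_limits: "u' \<longlonglongrightarrow> u" "w' \<longlonglongrightarrow> w"
  using uw by (auto intro!: dyadic_above_tendsto)

lemma levy_grid_limit: "(\<lambda>k. levy_path z i (w' k) - levy_path z i (u' k)) \<longlonglongrightarrow> levy_path z i w - levy_path z i u"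
  using continuous_levy_path[of z i] grid_limits
  by (intro tendsto_diff) (auto simp: continuous_on_eq_continuous_at intro: isCont_tendsto_compose)

lemma ramp_grid_limit: "(\<lambda>k. ramp (w' k) - ramp (u' k)) \<longlonglongrightarrow> w - u"
proof -
  have "isCont ramp x" for x
    using continuous_on_ramp[OF continuous_on_id, of UNIV] by (simp add: continuous_on_eq_continuous_at)
  then have "(\<lambda>k. ramp (w' k) - ramp (u' k)) \<longlonglongrightarrow> ramp w - ramp u"
    using grid_limits by (intro tendsto_diff) (auto intro: isCont_tendsto_compose)
  with uw show ?thesis by (simp add: ramp_def)
qed

lemma resample_increment:
  "AE p in white_noise \<Otimes>\<^sub>M white_noise. \<forall>i. levy_path (resample k (dyadic_above k u) p) i (w' k) - levy_path (resample k (dyadic_above k u) p) i (u' k)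
     = levy_path (snd p) i (w' k) - levy_path (snd p :: 'n \<times> nat \<Rightarrow> real) i (u' k)"
  using AE_pair_regular[of k "dyadic_above k u"]
  by eventually_elim (use grid_le in \<open>simp add: levy_path_resample_future\<close>)

text \<open>Moments of increments are known between grid points, where resampling applies. The grid
  points strictly above \<open>u\<close> and \<open>w\<close> converge to them, and the integrals converge by continuity
  of the paths under the envelope \<open>path_bound\<close>.\<close>

lemma past_increment_limit:
  fixes \<phi> :: "('n \<Rightarrow> real) \<Rightarrow> real"
  defines "Y \<equiv> \<lambda>s t z. \<phi> (\<lambda>i. levy_path z i t - levy_path z i s)"
  assumes meas: "\<And>s t. Y s t \<in> borel_measurable white_noise"
    and bound: "\<And>s t z. \<bar>Y s t z\<bar> \<le> 1 + 4 * path_bound z"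
    and lim: "\<And>z. (\<lambda>k. Y (u' k) (w' k) z) \<longlonglongrightarrow> Y u w z"
    and moments: "\<And>k. (\<integral>z. Y (u' k) (w' k) z \<partial>white_noise) = c * (ramp (w' k) - ramp (u' k))"
  shows "(\<integral>\<omega>. indicator A \<omega> * Y u w (q \<omega>) \<partial>M) = measure M A * (c * (w - u))"
proof -
  note [measurable] = meas
  have [measurable]: "A \<in> sets M" using A by (auto simp: past_def)
  have int: "integrable white_noise (Y s t)" for s t
    by (rule Bochner_Integration.integrable_bound[of _ "\<lambda>z. 1 + 4 * path_bound z"])
       (auto intro!: integrable_path_bound bound[THEN order_trans])
  have "(\<integral>\<omega>. indicator A \<omega> * Y (u' k) (w' k) (q \<omega>) \<partial>M) = measure M A * (c * (ramp (w' k) - ramp (u' k)))" for k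
  proof -
    have "AE p in white_noise \<Otimes>\<^sub>M white_noise. Y (u' k) (w' k) (resample k (dyadic_above k u) p) = Y (u' k) (w' k) (snd p)"
      using resample_increment[of k] by eventually_elim (simp add: Y_def)
    from past_expectation[OF A dyadic_above(1)[OF uw(1)] int this] show ?thesis by (simp add: moments)
  qed
  moreover have "(\<lambda>k. measure M A * (c * (ramp (w' k) - ramp (u' k)))) \<longlonglongrightarrow> measure M A * (c * (w - u))"
    by (intro tendsto_mult tendsto_const ramp_grid_limit)
  moreover have "(\<lambda>k. \<integral>\<omega>. indicator A \<omega> * Y (u' k) (w' k) (q \<omega>) \<partial>M) \<longlonglongrightarrow> (\<integral>\<omega>. indicator A \<omega> * Y u w (q \<omega>) \<partial>M)"
  proof (rule integral_dominated_convergence[where w = "\<lambda>\<omega>. 1 + 4 * path_bound (q \<omega>)"])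
    show "AE \<omega> in M. norm (indicator A \<omega> * Y (u' k) (w' k) (q \<omega>)) \<le> 1 + 4 * path_bound (q \<omega>)" for k
      using bound[of "u' k" "w' k"] by (intro AE_I2) (auto simp: indicator_def intro: order_trans[OF abs_ge_zero])
  qed (auto intro!: integrable_path_bound_q tendsto_mult lim)
  ultimately show ?thesis using LIMSEQ_unique by auto
qed

lemma past_mean: "(\<integral>\<omega>. indicator A \<omega> * (levy_path (q \<omega>) i w - levy_path (q \<omega>) i u) \<partial>M) = 0"
proof -
  have "(\<integral>\<omega>. indicator A \<omega> * (levy_path (q \<omega>) i w - levy_path (q \<omega>) i u) \<partial>M) = measure M A * (0 * (w - u))"
    by (rule past_increment_limit[where \<phi> = "\<lambda>y. y i"])
       (auto intro!: levy_increment_bounds levy_grid_limit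
         simp: has_bochner_integral_integral_eq[OF levy_increment_moments(1)[OF dyadic_above_mono[OF uw(2)]]])
  then show ?thesis by simp
qed

lemma past_covariance:
  "(\<integral>\<omega>. indicator A \<omega> * ((levy_path (q \<omega>) i w - levy_path (q \<omega>) i u) * (levy_path (q \<omega>) j w - levy_path (q \<omega>) j u)) \<partial>M)
     = measure M A * ((if i = j then 1 else 0) * (w - u))"
proof (rule past_increment_limit[where \<phi> = "\<lambda>y. y i * y j"])
  show "\<bar>(levy_path z i t - levy_path z i s) * (levy_path z j t - levy_path z j s)\<bar> \<le> 1 + 4 * path_bound z" for s t z
    using levy_increment_bounds(2)[of z i t s j] by linarith
qed (auto intro!: tendsto_mult levy_grid_limit
       simp: has_bochner_integral_integral_eq[OF levy_increment_moments(2)[OF dyadic_above_mono[OF uw(2)]]])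

text \<open>Only an upper bound is claimed, so Fatou's lemma takes the place of dominated
  convergence.\<close>

lemma past_fourth_moment:
  "(\<integral>\<^sup>+\<omega>. ennreal ((levy_path (q \<omega>) i w - levy_path (q \<omega>) i u) ^ 4) \<partial>M) \<le> ennreal (3 * (w - u)\<^sup>2)"
proof -
  let ?D = "\<lambda>k z. levy_path z i (w' k) - levy_path z i (u' k)"
  have "(\<integral>\<^sup>+\<omega>. ennreal ((levy_path (q \<omega>) i w - levy_path (q \<omega>) i u) ^ 4) \<partial>M) = (\<integral>\<^sup>+\<omega>. liminf (\<lambda>k. ennreal (?D k (q \<omega>) ^ 4)) \<partial>M)"
    by (intro nn_integral_cong lim_imp_Liminf[symmetric] tendsto_ennrealI tendsto_power levy_grid_limit) auto
  also have "\<dots> \<le> liminf (\<lambda>k. \<integral>\<^sup>+\<omega>. ennreal (?D k (q \<omega>) ^ 4) \<partial>M)"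
    by (rule nn_integral_liminf) measurable
  also have "(\<lambda>k. \<integral>\<^sup>+\<omega>. ennreal (?D k (q \<omega>) ^ 4) \<partial>M) = (\<lambda>k. ennreal (3 * (ramp (w' k) - ramp (u' k))\<^sup>2))"
  proof
    fix k
    have "(\<integral>\<^sup>+\<omega>. ennreal (?D k (q \<omega>) ^ 4) \<partial>M) = (\<integral>\<^sup>+z. ennreal (?D k z ^ 4) \<partial>distr M white_noise q)"
      by (rule nn_integral_distr[symmetric]) measurable
    also have "\<dots> = ennreal (3 * (ramp (w' k) - ramp (u' k))\<^sup>2)"
      unfolding q_distr using levy_increment_moments(3)[OF dyadic_above_mono[OF uw(2), of k], where N = k and i = i]
      by (subst nn_integral_eq_integral) (auto simp: has_bochner_integral_iff)
    finally show "(\<integral>\<^sup>+\<omega>. ennreal (?D k (q \<omega>) ^ 4) \<partial>M) = ennreal (3 * (ramp (w' k) - ramp (u' k))\<^sup>2)" .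
  qed
  also have "liminf (\<lambda>k. ennreal (3 * (ramp (w' k) - ramp (u' k))\<^sup>2)) = ennreal (3 * (w - u)\<^sup>2)"
    by (intro lim_imp_Liminf tendsto_ennrealI tendsto_mult tendsto_const tendsto_power ramp_grid_limit) auto
  finally show ?thesis .
qed

end

lemma brownian_levy:
  "brownian M (\<lambda>t. filt (t - t0)) t0 (\<lambda>t \<omega>. \<chi> i. levy_path (q \<omega>) i (t - t0)) (\<lambda>\<omega>. path_bound (q \<omega>))"
proof -
  interpret U: usual_filtered_space M "\<lambda>t. filt (t - t0)" by (rule usual_filt)
  show ?thesis
  proof
    show "(\<lambda>\<omega>. \<chi> i. levy_path (q \<omega>) i (t - t0)) \<in> borel_measurable (filt (t - t0))" for t
      by (rule borel_measurable_vec) (simp add: levy_path_adapted)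
    show "continuous_on UNIV (\<lambda>t. \<chi> i. levy_path (q \<omega>) i (t - t0))" for \<omega>
      by (intro continuous_on_vec_lambda continuous_on_compose2[OF continuous_levy_path] continuous_intros) auto
    show "(\<chi> i. levy_path (q \<omega>) i (t - t0)) = 0" if "t \<le> t0" for t \<omega>
      using that by (simp add: vec_eq_iff levy_path_0)
    show "(norm (\<chi> i. levy_path (q \<omega>) i (t - t0)))\<^sup>2 \<le> path_bound (q \<omega>)" for t \<omega>
      using levy_path_bound[of "q \<omega>" "t - t0"] by (simp only: power2_norm_eq_inner) (simp add: inner_vec_def power2_eq_square)
    show "integrable M (\<lambda>\<omega>. path_bound (q \<omega>))" by (rule integrable_path_bound_q)
  next
    fix u w A i j assume uw: "t0 \<le> u" "u \<le> w" "w \<le> t0 + 1" and A: "A \<in> sets (filt (u - t0))"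
    then have *: "0 \<le> u - t0" "u - t0 \<le> w - t0" "w - t0 \<le> 1" "A \<in> past (u - t0)" by auto
    show "(\<integral>\<omega>. indicator A \<omega> * ((\<chi> i. levy_path (q \<omega>) i (w - t0)) - (\<chi> i. levy_path (q \<omega>) i (u - t0))) $ i \<partial>M) = 0"
      using past_mean[OF *] by simp
    show "(\<integral>\<omega>. indicator A \<omega> * (((\<chi> i. levy_path (q \<omega>) i (w - t0)) - (\<chi> i. levy_path (q \<omega>) i (u - t0))) $ i *
        ((\<chi> i. levy_path (q \<omega>) i (w - t0)) - (\<chi> i. levy_path (q \<omega>) i (u - t0))) $ j) \<partial>M) = (if i = j then (w - u) * measure M A else 0)"
      using past_covariance[OF *, of i j] by simp
  next
    fix u w i assume uw: "t0 \<le> u" "u \<le> w" "w \<le> t0 + 1"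
    then have *: "0 \<le> u - t0" "u - t0 \<le> w - t0" "w - t0 \<le> 1" by auto
    show "(\<integral>\<^sup>+\<omega>. ennreal (((\<chi> i. levy_path (q \<omega>) i (w - t0)) - (\<chi> i. levy_path (q \<omega>) i (u - t0))) $ i ^ 4) \<partial>M) \<le> ennreal (3 * (w - u)\<^sup>2)"
      using past_fourth_moment[OF *, of "{}"] past_null[of "{}"] by simp
  qed
qed

end

lemma brownian_exists:
  assumes "(UNIV :: real set) \<lesssim> (UNIV :: 'w set)"
  shows "\<exists>(M :: 'w measure) F (B :: real \<Rightarrow> 'w \<Rightarrow> real^'n) R. brownian M F t0 B R"
proof -
  obtain M :: "'w measure" and q :: "'w \<Rightarrow> 'n \<times> nat \<Rightarrow> real" where "noise_source M q"
    using noise_source_exists[OF assms] by blast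
  then show ?thesis using noise_source.brownian_levy by blast
qed

section \<open>Additive-noise equations, solved path by path\<close>

text \<open>The time horizon \<open>\<delta>\<close> is so short that the integral operator contracts sup-norm distances
  by the factor 1/2.\<close>

locale lipschitz_drift =
  fixes \<beta> :: "real \<Rightarrow> real^'n \<Rightarrow> real^'n" and K \<Lambda> \<delta> t0 :: real and x0 :: "real^'n"
  assumes drift_continuous: "continuous_on UNIV (\<lambda>(t, x). \<beta> t x)"
    and drift_bounded: "norm (\<beta> t x) \<le> K"
    and drift_lipschitz: "norm (\<beta> t x - \<beta> t y) \<le> \<Lambda> * norm (x - y)"
    and \<Lambda>_nonneg: "0 \<le> \<Lambda>"
    and \<delta>: "0 < \<delta>" "\<delta> \<le> 1" "\<Lambda> * \<delta> \<le> 1 / 2"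
begin

text \<open>All paths are extended to the whole line as constants outside \<open>[t0, t0 + \<delta>]\<close>; continuity
  and uniform convergence can then be stated on \<open>UNIV\<close>.\<close>

definition clip :: "real \<Rightarrow> real" where
  "clip t = max t0 (min t (t0 + \<delta>))"

lemma clip_range: "t0 \<le> clip t" "clip t \<le> t0 + \<delta>" "clip t \<in> {t0..t0 + \<delta>}"
  using \<delta> by (auto simp: clip_def)

lemma clip_id [simp]: "t0 \<le> t \<Longrightarrow> t \<le> t0 + \<delta> \<Longrightarrow> clip t = t"
  by (auto simp: clip_def)

lemma clip_before [simp]: "t \<le> t0 \<Longrightarrow> clip t = t0"
  using \<delta> by (auto simp: clip_def)

lemma clip_le: "t0 \<le> t \<Longrightarrow> clip t \<le> t"
  by (auto simp: clip_def)

lemma continuous_clip: "continuous_on A clip"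
  unfolding clip_def by (intro continuous_intros)

lemma K_nonneg: "0 \<le> K"
  using order_trans[OF norm_ge_zero drift_bounded] by blast

lemma continuous_drift:
  "continuous_on A y \<Longrightarrow> continuous_on A (\<lambda>s. \<beta> s (y s))"
  using continuous_on_compose2[OF drift_continuous, of A "\<lambda>s. (s, y s)"] by (simp add: continuous_on_Pair)

definition integral_map :: "(real \<Rightarrow> real^'n) \<Rightarrow> (real \<Rightarrow> real^'n) \<Rightarrow> real \<Rightarrow> real^'n" where
  "integral_map w y t = x0 + integral {t0..clip t} (\<lambda>s. \<beta> s (y s)) + w (clip t)"

primrec picard :: "nat \<Rightarrow> (real \<Rightarrow> real^'n) \<Rightarrow> real \<Rightarrow> real^'n" where
  "picard 0 w = (\<lambda>_. x0)"
| "picard (Suc m) w = integral_map w (picard m w)"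

text \<open>The limit of the Picard iterates, written as a telescoping series in order to be defined
  for every path \<open>w\<close>.\<close>

definition solution :: "(real \<Rightarrow> real^'n) \<Rightarrow> real \<Rightarrow> real^'n" where
  "solution w t = x0 + (\<Sum>k. picard (Suc k) w t - picard k w t)"

context
  fixes w :: "real \<Rightarrow> real^'n"
  assumes w: "continuous_on UNIV w"
begin

lemma continuous_integral_map:
  assumes y: "continuous_on UNIV y"
  shows "continuous_on UNIV (integral_map w y)"
proof -
  have "continuous_on {t0..t0 + \<delta>} (\<lambda>t. integral {t0..t} (\<lambda>s. \<beta> s (y s)))"
    by (intro indefinite_integral_continuous_1 integrable_continuous_interval continuous_drift continuous_on_subset[OF y]) auto
  then have "continuous_on UNIV (\<lambda>t. integral {t0..clip t} (\<lambda>s. \<beta> s (y s)))"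
    by (rule continuous_on_compose2[OF _ continuous_clip]) (use clip_range in auto)
  then show ?thesis
    unfolding integral_map_def
    by (intro continuous_intros continuous_on_compose2[OF w continuous_clip]) auto
qed

lemma continuous_picard: "continuous_on UNIV (picard m w)"
  by (induction m) (auto intro: continuous_integral_map)

lemma integral_drift_diff:
  assumes y: "continuous_on UNIV y" "continuous_on UNIV y'" and c: "\<And>s. norm (y s - y' s) \<le> c"
  shows "norm (integral {t0..clip t} (\<lambda>s. \<beta> s (y s)) - integral {t0..clip t} (\<lambda>s. \<beta> s (y' s))) \<le> c / 2"
proof -
  have int: "(\<lambda>s. \<beta> s (y s)) integrable_on {t0..clip t}" "(\<lambda>s. \<beta> s (y' s)) integrable_on {t0..clip t}"
    by (intro integrable_continuous_interval continuous_drift continuous_on_subset[OF y(1)] continuous_on_subset[OF y(2)]; simp)+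
  have c0: "0 \<le> c" using order_trans[OF norm_ge_zero c] by blast
  have "norm (integral {t0..clip t} (\<lambda>s. \<beta> s (y s) - \<beta> s (y' s))) \<le> \<Lambda> * c * (clip t - t0)"
  proof (rule integral_bound)
    show "continuous_on {t0..clip t} (\<lambda>s. \<beta> s (y s) - \<beta> s (y' s))"
      by (intro continuous_intros continuous_drift continuous_on_subset[OF y(1)] continuous_on_subset[OF y(2)]) auto
    show "norm (\<beta> s (y s) - \<beta> s (y' s)) \<le> \<Lambda> * c" for s
      using drift_lipschitz[of s "y s" "y' s"] mult_left_mono[OF c \<Lambda>_nonneg, of s] by linarith
  qed (use clip_range in auto)
  also have "\<dots> \<le> \<Lambda> * c * \<delta>"
    using clip_range[of t] \<Lambda>_nonneg c0 by (intro mult_left_mono) auto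
  also have "\<dots> = c * (\<Lambda> * \<delta>)" by simp
  also have "\<dots> \<le> c * (1 / 2)" by (intro mult_left_mono \<delta> c0)
  finally show ?thesis by (simp add: integral_diff[OF int])
qed

lemma picard_step_bound: "\<exists>C. \<forall>m t. norm (picard (Suc m) w t - picard m w t) \<le> C * (1 / 2) ^ m"
proof -
  have "compact (w ` {t0..t0 + \<delta>})"
    by (intro compact_continuous_image continuous_on_subset[OF w]) auto
  from compact_imp_bounded[OF this] obtain b where "\<forall>y\<in>w ` {t0..t0 + \<delta>}. norm y \<le> b"
    unfolding bounded_iff by (rule exE)
  then have b: "\<And>t. t \<in> {t0..t0 + \<delta>} \<Longrightarrow> norm (w t) \<le> b"
    by blast
  have "norm (picard (Suc m) w t - picard m w t) \<le> (K * \<delta> + b) * (1 / 2) ^ m" for m t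
  proof (induction m arbitrary: t)
    case 0
    have "norm (integral {t0..clip t} (\<lambda>s. \<beta> s x0)) \<le> K * (clip t - t0)"
      using clip_range by (intro integral_bound drift_bounded continuous_drift continuous_intros) auto
    also have "\<dots> \<le> K * \<delta>" using clip_range[of t] by (intro mult_left_mono K_nonneg) auto
    finally have "norm (integral {t0..clip t} (\<lambda>s. \<beta> s x0)) \<le> K * \<delta>" .
    with b[OF clip_range(3)[of t]] show ?case
      by (simp add: integral_map_def norm_triangle_mono)
  next
    case (Suc m)
    have "picard (Suc (Suc m)) w t - picard (Suc m) w t =
      integral {t0..clip t} (\<lambda>s. \<beta> s (picard (Suc m) w s)) - integral {t0..clip t} (\<lambda>s. \<beta> s (picard m w s))"
    proof -
      have "integral_map w y t - integral_map w y' t = integral {t0..clip t} (\<lambda>s. \<beta> s (y s)) - integral {t0..clip t} (\<lambda>s. \<beta> s (y' s))" for y y'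
        by (simp add: integral_map_def)
      from this[of "picard (Suc m) w" "picard m w"] show ?thesis by (simp only: picard.simps(2))
    qed
    also have "norm \<dots> \<le> (K * \<delta> + b) * (1 / 2) ^ m / 2"
      by (intro integral_drift_diff continuous_picard Suc)
    finally show ?case by simp
  qed
  then show ?thesis by blast
qed

lemma picard_uniform_limit: "uniform_limit UNIV (\<lambda>m. picard m w) (solution w) sequentially"
proof -
  obtain C where C: "\<And>m t. norm (picard (Suc m) w t - picard m w t) \<le> C * (1 / 2) ^ m"
    using picard_step_bound by blast
  have "uniform_limit UNIV (\<lambda>m t. \<Sum>k<m. picard (Suc k) w t - picard k w t) (\<lambda>t. \<Sum>k. picard (Suc k) w t - picard k w t) sequentially"
    by (rule Weierstrass_m_test[OF C]) (intro summable_mult summable_geometric, simp)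
  then have "uniform_limit UNIV (\<lambda>m t. x0 + (\<Sum>k<m. picard (Suc k) w t - picard k w t)) (\<lambda>t. x0 + (\<Sum>k. picard (Suc k) w t - picard k w t)) sequentially"
    by (intro uniform_limit_add uniform_limit_const)
  moreover have "x0 + (\<Sum>k<m. picard (Suc k) w t - picard k w t) = picard m w t" for m t
    using sum_lessThan_telescope[of "\<lambda>k. picard k w t" m] by (simp del: picard.simps(2))
  ultimately show ?thesis
    by (simp only: solution_def[abs_def])
qed

lemma picard_tendsto: "(\<lambda>m. picard m w t) \<longlonglongrightarrow> solution w t"
  by (rule tendsto_uniform_limitI[OF picard_uniform_limit]) auto

lemma continuous_solution: "continuous_on UNIV (solution w)"
  by (rule uniform_limit_theorem[OF _ picard_uniform_limit]) (auto intro!: always_eventually continuous_picard)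

lemma solution_fixed_point: "solution w t = integral_map w (solution w) t"
proof (rule LIMSEQ_unique)
  show "(\<lambda>m. picard (Suc m) w t) \<longlonglongrightarrow> solution w t"
    using picard_tendsto by (rule LIMSEQ_Suc)
  have "(\<lambda>m. integral {t0..clip t} (\<lambda>s. \<beta> s (picard m w s))) \<longlonglongrightarrow> integral {t0..clip t} (\<lambda>s. \<beta> s (solution w s))"
  proof (rule metric_LIMSEQ_I)
    fix e :: real assume e: "0 < e"
    obtain N where N: "\<And>m s. m \<ge> N \<Longrightarrow> dist (picard m w s) (solution w s) < e"
      using uniform_limitD[OF picard_uniform_limit e] by (auto simp: eventually_sequentially)
    have "dist (integral {t0..clip t} (\<lambda>s. \<beta> s (picard m w s))) (integral {t0..clip t} (\<lambda>s. \<beta> s (solution w s))) < e"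
      if m: "m \<ge> N" for m
    proof -
      have "norm (integral {t0..clip t} (\<lambda>s. \<beta> s (picard m w s)) - integral {t0..clip t} (\<lambda>s. \<beta> s (solution w s))) \<le> e / 2"
        using N[OF m] by (intro integral_drift_diff continuous_picard continuous_solution) (auto simp: dist_norm less_imp_le)
      with e show ?thesis by (simp add: dist_norm)
    qed
    then show "\<exists>N. \<forall>m\<ge>N. dist (integral {t0..clip t} (\<lambda>s. \<beta> s (picard m w s))) (integral {t0..clip t} (\<lambda>s. \<beta> s (solution w s))) < e"
      by blast
  qed
  then show "(\<lambda>m. picard (Suc m) w t) \<longlonglongrightarrow> integral_map w (solution w) t"
    unfolding picard.simps integral_map_def by (intro tendsto_intros)
qed

lemma solution_increment:
  assumes "t0 \<le> u" "u \<le> v" "v \<le> t0 + \<delta>"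
  shows "solution w v - solution w u = integral {u..v} (\<lambda>s. \<beta> s (solution w s)) + (w v - w u)"
proof -
  have "(\<lambda>s. \<beta> s (solution w s)) integrable_on {t0..v}"
    by (intro integrable_continuous_interval continuous_drift continuous_on_subset[OF continuous_solution]) auto
  from Henstock_Kurzweil_Integration.integral_combine[OF assms(1,2) this]
  show ?thesis
    using assms by (subst (1 2) solution_fixed_point) (simp add: integral_map_def algebra_simps)
qed

lemma solution_start: "w t0 = 0 \<Longrightarrow> t \<le> t0 \<Longrightarrow> solution w t = x0"
  by (subst solution_fixed_point) (simp add: integral_map_def)

end

end

subsection \<open>Progressive measurability\<close>

lemma floor_grid_tendsto: "(\<lambda>m. of_int \<lfloor>real (Suc m) * s\<rfloor> / real (Suc m)) \<longlonglongrightarrow> s"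
proof (rule tendsto_sandwich[where f = "\<lambda>m. s - 1 / real (Suc m)" and h = "\<lambda>_. s"])
  show "\<forall>\<^sub>F m in sequentially. s - 1 / real (Suc m) \<le> of_int \<lfloor>real (Suc m) * s\<rfloor> / real (Suc m)"
  proof (intro always_eventually allI)
    fix m
    have "real (Suc m) * s - 1 \<le> of_int \<lfloor>real (Suc m) * s\<rfloor>" by linarith
    from divide_right_mono[OF this, of "real (Suc m)"] show "s - 1 / real (Suc m) \<le> of_int \<lfloor>real (Suc m) * s\<rfloor> / real (Suc m)"
      by (simp add: diff_divide_distrib del: of_nat_Suc)
  qed
  show "\<forall>\<^sub>F m in sequentially. of_int \<lfloor>real (Suc m) * s\<rfloor> / real (Suc m) \<le> s"
    by (intro always_eventually allI) (simp add: divide_le_eq mult.commute del: of_nat_Suc)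
  have "(\<lambda>m. 1 / real (Suc m)) \<longlonglongrightarrow> 0" using LIMSEQ_inverse_real_of_nat by (simp add: inverse_eq_divide)
  from tendsto_diff[OF tendsto_const[of s] this] show "(\<lambda>m. s - 1 / real (Suc m)) \<longlonglongrightarrow> s" by simp
qed simp

text \<open>A continuous process is the limit of the processes that are constant on the intervals of
  length \<open>1 / (m + 1)\<close>, and these are jointly measurable because they take countably many time
  values.\<close>

lemma continuous_process_jointly_measurable:
  fixes Y :: "real \<Rightarrow> 'w \<Rightarrow> 'b::{metric_space, second_countable_topology}"
  assumes Y: "\<And>s. Y s \<in> borel_measurable G" and cont: "\<And>\<omega>. \<omega> \<in> space G \<Longrightarrow> continuous_on UNIV (\<lambda>s. Y s \<omega>)"
  shows "(\<lambda>(s, \<omega>). Y s \<omega>) \<in> borel_measurable (borel \<Otimes>\<^sub>M G)"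
proof (rule borel_measurable_LIMSEQ_metric)
  fix m :: nat
  have "(\<lambda>p. Y (of_int k / real (Suc m)) (snd p)) \<in> borel_measurable (borel \<Otimes>\<^sub>M G)" for k :: int
    by (rule measurable_compose[OF measurable_snd Y])
  moreover have "(\<lambda>p. \<lfloor>real (Suc m) * fst p\<rfloor>) \<in> borel \<Otimes>\<^sub>M G \<rightarrow>\<^sub>M count_space UNIV"
    by measurable
  ultimately show "(\<lambda>p. Y (of_int \<lfloor>real (Suc m) * fst p\<rfloor> / real (Suc m)) (snd p)) \<in> borel_measurable (borel \<Otimes>\<^sub>M G)"
    by (rule measurable_compose_countable)
next
  fix p :: "real \<times> 'w" assume "p \<in> space (borel \<Otimes>\<^sub>M G)"
  then have "isCont (\<lambda>s. Y s (snd p)) (fst p)"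
    using cont[of "snd p"] by (auto simp: space_pair_measure continuous_on_eq_continuous_at)
  from isCont_tendsto_compose[OF this floor_grid_tendsto]
  show "(\<lambda>m. Y (of_int \<lfloor>real (Suc m) * fst p\<rfloor> / real (Suc m)) (snd p)) \<longlonglongrightarrow> (case p of (s, \<omega>) \<Rightarrow> Y s \<omega>)"
    by (simp add: split_beta')
qed

subsection \<open>The solution as an adapted process\<close>

locale brownian_drift = brownian M F t0 B R + lipschitz_drift \<beta> K \<Lambda> \<delta> t0 x0
  for M :: "'w measure" and F t0 and B :: "real \<Rightarrow> 'w \<Rightarrow> real^'n" and R
    and \<beta> :: "real \<Rightarrow> real^'n \<Rightarrow> real^'n" and K \<Lambda> \<delta> and x0 :: "real^'n" +
  fixes hbar :: real
  assumes hbar: "0 < hbar"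
begin

abbreviation "T \<equiv> t0 + \<delta>"

definition noise :: "'w \<Rightarrow> real \<Rightarrow> real^'n" where
  "noise \<omega> t = sqrt hbar *\<^sub>R B t \<omega>"

definition X :: "real \<Rightarrow> 'w \<Rightarrow> real^'n" where
  "X t \<omega> = solution (noise \<omega>) t"

lemma sets_F_subset: "sets (F t) \<subseteq> sets M" and space_F_M [simp]: "space (F t) = space M"
  using filtration_subalgebra[of t] by (auto simp: subalgebra_def)

lemma F_measurable_mono: "s \<le> t \<Longrightarrow> f \<in> F s \<rightarrow>\<^sub>M N \<Longrightarrow> f \<in> F t \<rightarrow>\<^sub>M N"
  using sets_F_mono[of s t] unfolding measurable_def by auto

lemma F_measurable_M: "f \<in> F s \<rightarrow>\<^sub>M N \<Longrightarrow> f \<in> M \<rightarrow>\<^sub>M N"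
  using filtration_subalgebra measurable_from_subalg by blast

lemma continuous_noise: "\<omega> \<in> space M \<Longrightarrow> continuous_on UNIV (noise \<omega>)"
  unfolding noise_def by (intro continuous_intros B_continuous)

lemma continuous_X: "\<omega> \<in> space M \<Longrightarrow> continuous_on UNIV (\<lambda>t. X t \<omega>)"
  unfolding X_def by (intro continuous_solution continuous_noise)

lemma measurable_drift: "(\<lambda>(t, x). \<beta> t x) \<in> borel_measurable (borel \<Otimes>\<^sub>M borel)"
  using borel_measurable_continuous_onI[OF drift_continuous] by (simp add: borel_prod)

lemma measurable_integral_process:
  fixes g :: "real \<Rightarrow> 'w \<Rightarrow> 'b::euclidean_space"
  assumes [measurable]: "(\<lambda>(s, \<omega>). g s \<omega>) \<in> borel_measurable (borel \<Otimes>\<^sub>M G)"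
    and c: "\<And>\<omega>. \<omega> \<in> space G \<Longrightarrow> continuous_on {a..b} (\<lambda>s. g s \<omega>)"
  shows "(\<lambda>\<omega>. integral {a..b} (\<lambda>s. g s \<omega>)) \<in> borel_measurable G"
proof -
  have "(\<lambda>\<omega>. \<integral>s. indicator {a..b} s *\<^sub>R g s \<omega> \<partial>lborel) \<in> borel_measurable G"
    by (rule lborel.borel_measurable_lebesgue_integral) measurable
  moreover have "(\<integral>s. indicator {a..b} s *\<^sub>R g s \<omega> \<partial>lborel) = integral {a..b} (\<lambda>s. g s \<omega>)" if "\<omega> \<in> space G" for \<omega>
    using set_borel_integral_eq_integral(2)[OF borel_integrable_atLeastAtMost'[OF c[OF that]]]
    by (simp add: set_lebesgue_integral_def)
  ultimately show ?thesis by (subst measurable_cong) (auto simp: eq_commute)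
qed

text \<open>The iterate at time \<open>t\<close> reads the previous iterate only on \<open>[t0, t]\<close>. The previous
  iterate, frozen outside that interval, is jointly measurable with respect to \<open>F t\<close>, and so its
  time integral is \<open>F t\<close>-measurable.\<close>

lemma picard_adapted:
  assumes "t0 \<le> t"
  shows "(\<lambda>\<omega>. picard m (noise \<omega>) t) \<in> borel_measurable (F t)"
  using assms
proof (induction m arbitrary: t)
  case (Suc m)
  let ?y = "\<lambda>s \<omega>. picard m (noise \<omega>) (max t0 (min s t))"
  have "?y s \<in> borel_measurable (F t)" for s
    using Suc.prems by (intro F_measurable_mono[OF _ Suc.IH]) auto
  moreover have "continuous_on UNIV (\<lambda>s. ?y s \<omega>)" if "\<omega> \<in> space (F t)" for \<omega>
    using that by (intro continuous_on_compose2[OF continuous_picard[OF continuous_noise]] continuous_intros) auto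
  ultimately have y[measurable]: "(\<lambda>(s, \<omega>). ?y s \<omega>) \<in> borel_measurable (borel \<Otimes>\<^sub>M F t)"
    by (rule continuous_process_jointly_measurable)
  have "(\<lambda>(s, \<omega>). \<beta> s (?y s \<omega>)) \<in> borel_measurable (borel \<Otimes>\<^sub>M F t)"
    using measurable_compose[OF measurable_Pair[OF measurable_fst y] measurable_drift] by (simp add: split_beta')
  moreover have "continuous_on {t0..clip t} (\<lambda>s. \<beta> s (?y s \<omega>))" if "\<omega> \<in> space (F t)" for \<omega>
    using that by (intro continuous_drift continuous_on_compose2[OF continuous_picard[OF continuous_noise]] continuous_intros) auto
  ultimately have "(\<lambda>\<omega>. integral {t0..clip t} (\<lambda>s. \<beta> s (?y s \<omega>))) \<in> borel_measurable (F t)"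
    by (rule measurable_integral_process)
  moreover have "integral {t0..clip t} (\<lambda>s. \<beta> s (?y s \<omega>)) = integral {t0..clip t} (\<lambda>s. \<beta> s (picard m (noise \<omega>) s))" for \<omega>
    using clip_le[OF Suc.prems] by (intro Henstock_Kurzweil_Integration.integral_cong) (auto simp: max_def min_def)
  moreover have "(\<lambda>\<omega>. noise \<omega> (clip t)) \<in> borel_measurable (F t)"
    unfolding noise_def
    by (intro borel_measurable_scaleR borel_measurable_const F_measurable_mono[OF clip_le[OF Suc.prems] B_adapted])
  ultimately show ?case
    by (simp add: integral_map_def borel_measurable_add)
qed simp

lemma X_adapted: "t0 \<le> t \<Longrightarrow> X t \<in> borel_measurable (F t)"
  unfolding X_def[abs_def]
  by (rule borel_measurable_LIMSEQ_metric[OF picard_adapted picard_tendsto[OF continuous_noise]]) auto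

lemma X_start: "t \<le> t0 \<Longrightarrow> \<omega> \<in> space M \<Longrightarrow> X t \<omega> = x0"
  unfolding X_def by (rule solution_start[OF continuous_noise]) (auto simp: noise_def B_start)

lemma X_increment:
  assumes "\<omega> \<in> space M" "t0 \<le> u" "u \<le> v" "v \<le> T"
  shows "X v \<omega> - X u \<omega> = integral {u..v} (\<lambda>s. \<beta> s (X s \<omega>)) + sqrt hbar *\<^sub>R (B v \<omega> - B u \<omega>)"
  using solution_increment[OF continuous_noise[OF assms(1)] assms(2-4)]
  by (simp add: X_def noise_def scaleR_diff_right)

lemma X_adapted_le: "s \<le> t \<Longrightarrow> t0 \<le> t \<Longrightarrow> X (max t0 s) \<in> borel_measurable (F t)"
  by (rule F_measurable_mono[OF _ X_adapted]) auto

lemma X_jointly_measurable: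
  assumes "t0 \<le> t"
  shows "(\<lambda>(s, \<omega>). X (max t0 (min s t)) \<omega>) \<in> borel_measurable (borel \<Otimes>\<^sub>M F t)"
proof (rule continuous_process_jointly_measurable)
  show "X (max t0 (min s t)) \<in> borel_measurable (F t)" for s
    using assms by (intro X_adapted_le) auto
  show "continuous_on UNIV (\<lambda>s. X (max t0 (min s t)) \<omega>)" if "\<omega> \<in> space (F t)" for \<omega>
    using that by (intro continuous_on_compose2[OF continuous_X] continuous_intros) auto
qed

end

section \<open>The martingale property\<close>

text \<open>A function with gradient \<open>g\<close> and Hessian \<open>H\<close> for which the second-order Taylor expansion
  has a global cubic error. Growth of order two is allowed in order to include the coordinates
  and their products besides compactly supported smooth functions.\<close>

locale test_function =
  fixes f :: "real^'n \<Rightarrow> real" and g :: "'n \<Rightarrow> real^'n \<Rightarrow> real" and H :: "'n \<Rightarrow> 'n \<Rightarrow> real^'n \<Rightarrow> real" and C :: real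
  assumes C_nonneg: "0 \<le> C"
    and taylor: "\<bar>f (x + v) - f x - (\<Sum>i\<in>UNIV. v $ i * g i x) - (\<Sum>i\<in>UNIV. \<Sum>j\<in>UNIV. v $ i * v $ j * H i j x) / 2\<bar> \<le> C * norm v ^ 3"
    and g_lipschitz: "\<bar>g i x - g i y\<bar> \<le> C * norm (x - y)"
    and H_lipschitz: "\<bar>H i j x - H i j y\<bar> \<le> C * norm (x - y)"
    and H_bounded: "\<bar>H i j x\<bar> \<le> C"
    and f_continuous: "continuous_on UNIV f"
    and f_growth: "\<bar>f x\<bar> \<le> C * (1 + (norm x)\<^sup>2)"
begin

lemma lipschitz_continuous:
  assumes "\<And>x y. \<bar>h x - h y\<bar> \<le> C * norm (x - y)"
  shows "continuous_on UNIV (h :: real^'n \<Rightarrow> real)"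
proof -
  have "C-lipschitz_on UNIV h"
    by (rule lipschitz_onI) (use assms C_nonneg in \<open>auto simp: dist_norm\<close>)
  then show ?thesis by (rule lipschitz_on_continuous_on)
qed

lemma g_continuous: "continuous_on UNIV (g i)" and H_continuous: "continuous_on UNIV (H i j)"
  by (rule lipschitz_continuous, rule g_lipschitz, rule lipschitz_continuous, rule H_lipschitz)

lemma test_function_measurable [measurable]:
  "f \<in> borel_measurable borel" "g i \<in> borel_measurable borel" "H i j \<in> borel_measurable borel"
  by (auto intro: borel_measurable_continuous_onI f_continuous g_continuous H_continuous)

lemma g_growth: "\<exists>G\<ge>0. \<forall>i x. \<bar>g i x\<bar> \<le> G * (1 + norm x)"
proof (intro exI conjI allI)
  let ?G = "C + (\<Sum>i\<in>UNIV. \<bar>g i 0\<bar>)"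
  show "0 \<le> ?G" using C_nonneg by (simp add: sum_nonneg)
  fix i x
  have "\<bar>g i 0\<bar> \<le> (\<Sum>i\<in>UNIV. \<bar>g i 0\<bar>)" by (rule member_le_sum) auto
  moreover have "\<bar>g i x - g i 0\<bar> \<le> C * norm x" using g_lipschitz[of i x 0] by simp
  then have "\<bar>g i x\<bar> \<le> \<bar>g i 0\<bar> + C * norm x" by linarith
  moreover have "0 \<le> (\<Sum>i\<in>UNIV. \<bar>g i 0\<bar>) * norm x" by (simp add: sum_nonneg)
  ultimately have "\<bar>g i x\<bar> \<le> C + (\<Sum>i\<in>UNIV. \<bar>g i 0\<bar>) + (C * norm x + (\<Sum>i\<in>UNIV. \<bar>g i 0\<bar>) * norm x)"
    using C_nonneg by linarith
  then show "\<bar>g i x\<bar> \<le> ?G * (1 + norm x)" by (simp add: algebra_simps)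
qed

end

lemma vec_nth_measurable [measurable]: "(\<lambda>x :: real^'n. x $ i) \<in> borel_measurable borel"
  by (intro borel_measurable_continuous_onI continuous_intros)

lemma square_sum_le: "(a + b)\<^sup>2 \<le> 2 * a\<^sup>2 + 2 * (b :: real)\<^sup>2"
  using zero_le_power2[of "a - b"] by (simp add: power2_sum power2_diff)

lemma abs_sum_mult_le:
  fixes a b :: "'i \<Rightarrow> real"
  assumes "\<And>i. i \<in> I \<Longrightarrow> \<bar>a i\<bar> \<le> p" "\<And>i. i \<in> I \<Longrightarrow> \<bar>b i\<bar> \<le> r" "0 \<le> p"
  shows "\<bar>\<Sum>i\<in>I. a i * b i\<bar> \<le> real (card I) * (p * r)"
proof -
  have "\<bar>\<Sum>i\<in>I. a i * b i\<bar> \<le> (\<Sum>i\<in>I. \<bar>a i * b i\<bar>)" by (rule sum_abs)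
  also have "\<dots> \<le> (\<Sum>i\<in>I. p * r)"
    using assms by (intro sum_mono) (auto simp: abs_mult intro!: mult_mono)
  finally show ?thesis by simp
qed

locale martingale_problem = brownian_drift M F t0 B R \<beta> K \<Lambda> \<delta> x0 hbar + test_function f g H C
  for M :: "'w measure" and F t0 and B :: "real \<Rightarrow> 'w \<Rightarrow> real^'n" and R
    and \<beta> :: "real \<Rightarrow> real^'n \<Rightarrow> real^'n" and K \<Lambda> \<delta> and x0 :: "real^'n" and hbar
    and f :: "real^'n \<Rightarrow> real" and g H C
begin

text \<open>The generator \<open>\<beta> \<cdot> \<nabla> + hbar/2 \<Delta>\<close> of the diffusion, applied to the test function.\<close>

definition L :: "real \<Rightarrow> real^'n \<Rightarrow> real" where
  "L s x = (\<Sum>i\<in>UNIV. \<beta> s x $ i * g i x) + hbar / 2 * (\<Sum>i\<in>UNIV. H i i x)"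

definition N :: "real \<Rightarrow> 'w \<Rightarrow> real" where
  "N t \<omega> = f (X t \<omega>) - integral {t0..t} (\<lambda>s. L s (X s \<omega>))"

lemma L_continuous:
  assumes "continuous_on A y"
  shows "continuous_on A (\<lambda>s. L s (y s))"
  unfolding L_def
  by (intro continuous_intros continuous_drift assms continuous_on_compose2[OF g_continuous assms] continuous_on_compose2[OF H_continuous assms]) auto

lemma L_X_continuous: "\<omega> \<in> space M \<Longrightarrow> continuous_on A (\<lambda>s. L s (X s \<omega>))"
  by (intro L_continuous continuous_on_subset[OF continuous_X]) auto

lemma R_nonneg: "0 \<le> R \<omega>"
  using order_trans[OF zero_le_power2 B_bound] .

lemma X_bound: "\<exists>c\<ge>0. \<forall>\<omega>\<in>space M. \<forall>t. (norm (X t \<omega>))\<^sup>2 \<le> c * (1 + R \<omega>)"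
proof (intro exI conjI ballI allI)
  let ?k = "norm x0 + K * \<delta>"
  show "0 \<le> 2 * ?k\<^sup>2 + 2 * hbar" using hbar by simp
  fix \<omega> t assume \<omega>: "\<omega> \<in> space M"
  have "norm (integral {t0..clip t} (\<lambda>s. \<beta> s (X s \<omega>))) \<le> K * (clip t - t0)"
    using clip_range by (intro integral_bound drift_bounded continuous_drift continuous_on_subset[OF continuous_X[OF \<omega>]]) auto
  also have "\<dots> \<le> K * \<delta>" using clip_range[of t] by (intro mult_left_mono K_nonneg) auto
  finally have i: "norm (integral {t0..clip t} (\<lambda>s. \<beta> s (X s \<omega>))) \<le> K * \<delta>" .
  have x: "X t \<omega> = x0 + integral {t0..clip t} (\<lambda>s. \<beta> s (X s \<omega>)) + noise \<omega> (clip t)"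
    using solution_fixed_point[OF continuous_noise[OF \<omega>], of t] by (simp add: X_def integral_map_def)
  have "norm (X t \<omega>) \<le> ?k + sqrt hbar * norm (B (clip t) \<omega>)"
    unfolding x using i norm_triangle_ineq[of "x0 + integral {t0..clip t} (\<lambda>s. \<beta> s (X s \<omega>))" "noise \<omega> (clip t)"]
      norm_triangle_ineq[of x0 "integral {t0..clip t} (\<lambda>s. \<beta> s (X s \<omega>))"] hbar
    by (simp add: noise_def)
  then have "(norm (X t \<omega>))\<^sup>2 \<le> (?k + sqrt hbar * norm (B (clip t) \<omega>))\<^sup>2" by (intro power_mono) auto
  also have "\<dots> \<le> 2 * ?k\<^sup>2 + 2 * (sqrt hbar * norm (B (clip t) \<omega>))\<^sup>2"
    by (rule square_sum_le)
  also have "(sqrt hbar * norm (B (clip t) \<omega>))\<^sup>2 \<le> hbar * R \<omega>"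
    using B_bound[of "clip t" \<omega>] hbar by (simp add: power_mult_distrib)
  also have "2 * ?k\<^sup>2 + 2 * (hbar * R \<omega>) \<le> (2 * ?k\<^sup>2 + 2 * hbar) * (1 + R \<omega>)"
    using hbar R_nonneg[of \<omega>] zero_le_power2[of ?k] by (simp add: algebra_simps)
  finally show "(norm (X t \<omega>))\<^sup>2 \<le> (2 * ?k\<^sup>2 + 2 * hbar) * (1 + R \<omega>)" by simp
qed

lemma g_X_bound: "\<exists>c\<ge>0. \<forall>\<omega>\<in>space M. \<forall>t i. (g i (X t \<omega>))\<^sup>2 \<le> c * (1 + R \<omega>)"
proof -
  obtain c where c: "c \<ge> 0" "\<And>\<omega> t. \<omega> \<in> space M \<Longrightarrow> (norm (X t \<omega>))\<^sup>2 \<le> c * (1 + R \<omega>)" using X_bound by blast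
  obtain G where G: "G \<ge> 0" "\<And>i x. \<bar>g i x\<bar> \<le> G * (1 + norm x)" using g_growth by blast
  have "(g i (X t \<omega>))\<^sup>2 \<le> (2 * G\<^sup>2 * (1 + c)) * (1 + R \<omega>)" if \<omega>: "\<omega> \<in> space M" for \<omega> t i
  proof -
    have "\<bar>g i (X t \<omega>)\<bar>\<^sup>2 \<le> (G * (1 + norm (X t \<omega>)))\<^sup>2" using G by (intro power_mono) auto
    also have "\<dots> \<le> G\<^sup>2 * (2 * (1 + (norm (X t \<omega>))\<^sup>2))"
      unfolding power_mult_distrib
      using zero_le_power2[of "1 - norm (X t \<omega>)"] by (intro mult_left_mono) (auto simp: power2_sum power2_diff)
    also have "\<dots> \<le> G\<^sup>2 * (2 * ((1 + R \<omega>) + c * (1 + R \<omega>)))"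
      using c(2)[OF \<omega>, of t] R_nonneg[of \<omega>] by (intro mult_left_mono) auto
    also have "\<dots> = (2 * G\<^sup>2 * (1 + c)) * (1 + R \<omega>)" by (simp add: algebra_simps)
    finally show ?thesis by simp
  qed
  moreover have "0 \<le> 2 * G\<^sup>2 * (1 + c)" using c(1) by simp
  ultimately show ?thesis by blast
qed

lemma L_X_bound: "\<exists>c\<ge>0. \<forall>\<omega>\<in>space M. \<forall>s. \<bar>L s (X s \<omega>)\<bar> \<le> c * (1 + R \<omega>)"
proof -
  obtain c where c: "c \<ge> 0" "\<And>\<omega> t i. \<omega> \<in> space M \<Longrightarrow> (g i (X t \<omega>))\<^sup>2 \<le> c * (1 + R \<omega>)" using g_X_bound by blast
  let ?n = "real CARD('n)"
  have "\<bar>L s (X s \<omega>)\<bar> \<le> (?n * (K * (1 + c)) + hbar / 2 * (?n * C)) * (1 + R \<omega>)" if \<omega>: "\<omega> \<in> space M" for \<omega> s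
  proof -
    have R1: "1 \<le> 1 + R \<omega>" using R_nonneg by simp
    have g1: "\<bar>g i (X s \<omega>)\<bar> \<le> (1 + c) * (1 + R \<omega>)" for i
    proof -
      have "2 * \<bar>g i (X s \<omega>)\<bar> \<le> 1 + (g i (X s \<omega>))\<^sup>2"
        using zero_le_power2[of "\<bar>g i (X s \<omega>)\<bar> - 1"] by (simp add: power2_diff)
      then have "\<bar>g i (X s \<omega>)\<bar> \<le> 1 + (g i (X s \<omega>))\<^sup>2" by simp
      with c(2)[OF \<omega>, of i s] R1 show ?thesis by (simp add: algebra_simps)
    qed
    have b1: "\<bar>\<beta> s (X s \<omega>) $ i\<bar> \<le> K" for i
      using component_le_norm_cart[of "\<beta> s (X s \<omega>)" i] drift_bounded[of s "X s \<omega>"] by linarith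
    have "\<bar>\<Sum>i\<in>UNIV. \<beta> s (X s \<omega>) $ i * g i (X s \<omega>)\<bar> \<le> ?n * (K * ((1 + c) * (1 + R \<omega>)))"
      by (rule abs_sum_mult_le[OF b1 g1 K_nonneg])
    moreover have "\<bar>\<Sum>i\<in>UNIV. H i i (X s \<omega>)\<bar> \<le> ?n * C"
      by (intro order_trans[OF sum_abs] sum_bounded_above[THEN order_trans]) (auto intro: H_bounded)
    then have "\<bar>hbar / 2 * (\<Sum>i\<in>UNIV. H i i (X s \<omega>))\<bar> \<le> hbar / 2 * (?n * C)"
      using hbar by (simp add: abs_mult)
    moreover have "hbar / 2 * (?n * C) * 1 \<le> hbar / 2 * (?n * C) * (1 + R \<omega>)"
      using hbar C_nonneg R1 by (intro mult_left_mono) auto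
    ultimately have "\<bar>L s (X s \<omega>)\<bar> \<le> ?n * (K * ((1 + c) * (1 + R \<omega>))) + hbar / 2 * (?n * C) * (1 + R \<omega>)"
      unfolding L_def by linarith
    also have "\<dots> = (?n * (K * (1 + c)) + hbar / 2 * (?n * C)) * (1 + R \<omega>)" by (simp add: algebra_simps)
    finally show ?thesis .
  qed
  moreover have "0 \<le> ?n * (K * (1 + c)) + hbar / 2 * (?n * C)"
    using c(1) K_nonneg hbar C_nonneg by simp
  ultimately show ?thesis by blast
qed

lemma N_bound: "\<exists>c\<ge>0. \<forall>\<omega>\<in>space M. \<forall>t\<in>{t0..T}. \<bar>N t \<omega>\<bar> \<le> c * (1 + R \<omega>)"
proof -
  obtain c where c: "c \<ge> 0" "\<And>\<omega> t. \<omega> \<in> space M \<Longrightarrow> (norm (X t \<omega>))\<^sup>2 \<le> c * (1 + R \<omega>)" using X_bound by blast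
  obtain d where d: "d \<ge> 0" "\<And>\<omega> s. \<omega> \<in> space M \<Longrightarrow> \<bar>L s (X s \<omega>)\<bar> \<le> d * (1 + R \<omega>)" using L_X_bound by blast
  have "\<bar>N t \<omega>\<bar> \<le> (C * (1 + c) + d) * (1 + R \<omega>)" if \<omega>: "\<omega> \<in> space M" and t: "t \<in> {t0..T}" for \<omega> t
  proof -
    have R1: "1 \<le> 1 + R \<omega>" using R_nonneg by simp
    have "\<bar>f (X t \<omega>)\<bar> \<le> C * ((1 + R \<omega>) + c * (1 + R \<omega>))"
      using c(2)[OF \<omega>, of t] R1 C_nonneg by (intro order_trans[OF f_growth] mult_left_mono) auto
    moreover have "norm (integral {t0..t} (\<lambda>s. L s (X s \<omega>))) \<le> d * (1 + R \<omega>) * (t - t0)"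
      using t d(2)[OF \<omega>] by (intro integral_bound L_X_continuous[OF \<omega>]) auto
    moreover have "d * (1 + R \<omega>) * (t - t0) \<le> d * (1 + R \<omega>) * 1"
      using t \<delta> d(1) R1 by (intro mult_left_mono) auto
    ultimately have "\<bar>N t \<omega>\<bar> \<le> C * ((1 + R \<omega>) + c * (1 + R \<omega>)) + d * (1 + R \<omega>)"
      unfolding N_def by (simp add: abs_le_iff)
    then show ?thesis by (simp add: algebra_simps)
  qed
  moreover have "0 \<le> C * (1 + c) + d" using C_nonneg c d by simp
  ultimately show ?thesis by blast
qed

lemma N_continuous: "\<omega> \<in> space M \<Longrightarrow> continuous_on {t0..T} (\<lambda>t. N t \<omega>)"
  unfolding N_def
  by (intro continuous_intros continuous_on_compose2[OF f_continuous] continuous_on_subset[OF continuous_X]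
      indefinite_integral_continuous_1 integrable_continuous_interval L_X_continuous) auto

lemma measurable_L [measurable]: "(\<lambda>(s, x). L s x) \<in> borel_measurable (borel \<Otimes>\<^sub>M borel)"
proof -
  have [measurable]: "(\<lambda>p. \<beta> (fst p) (snd p) $ i) \<in> borel_measurable (borel \<Otimes>\<^sub>M borel)" for i
    using measurable_compose[OF measurable_drift vec_nth_measurable[of i]]
    by (simp add: split_beta')
  show ?thesis unfolding L_def by measurable
qed

lemma integral_L_adapted:
  assumes "t0 \<le> t"
  shows "(\<lambda>\<omega>. integral {t0..t} (\<lambda>s. L s (X s \<omega>))) \<in> borel_measurable (F t)"
proof -
  have "(\<lambda>(s, \<omega>). L s (X (max t0 (min s t)) \<omega>)) \<in> borel_measurable (borel \<Otimes>\<^sub>M F t)"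
    using measurable_compose[OF measurable_Pair[OF measurable_fst X_jointly_measurable[OF assms]] measurable_L]
    by (simp add: split_beta')
  then have "(\<lambda>\<omega>. integral {t0..t} (\<lambda>s. L s (X (max t0 (min s t)) \<omega>))) \<in> borel_measurable (F t)"
    by (rule measurable_integral_process)
       (auto intro!: L_continuous continuous_on_compose2[OF continuous_X] continuous_intros)
  moreover have "integral {t0..t} (\<lambda>s. L s (X (max t0 (min s t)) \<omega>)) = integral {t0..t} (\<lambda>s. L s (X s \<omega>))" for \<omega>
    by (intro Henstock_Kurzweil_Integration.integral_cong) (auto simp: max_def min_def)
  ultimately show ?thesis by simp
qed

lemma N_adapted: "t0 \<le> t \<Longrightarrow> N t \<in> borel_measurable (F t)"
  unfolding N_def[abs_def]
  by (intro borel_measurable_diff integral_L_adapted measurable_compose[OF X_adapted test_function_measurable(1)])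

lemma integrable_dominated:
  assumes "Y \<in> borel_measurable M" "\<And>\<omega>. \<omega> \<in> space M \<Longrightarrow> \<bar>Y \<omega>\<bar> \<le> c * (1 + R \<omega>)"
  shows "integrable M (Y :: 'w \<Rightarrow> real)"
  by (rule Bochner_Integration.integrable_bound[of _ "\<lambda>\<omega>. c * (1 + R \<omega>)"])
     (auto intro!: R_integrable assms(1) AE_I2 assms(2)[THEN order_trans])

lemma N_integrable: "t \<in> {t0..T} \<Longrightarrow> integrable M (N t)"
proof -
  assume t: "t \<in> {t0..T}"
  obtain c where "\<And>\<omega>. \<omega> \<in> space M \<Longrightarrow> \<bar>N t \<omega>\<bar> \<le> c * (1 + R \<omega>)" using N_bound t by blast
  then show ?thesis
    using t by (intro integrable_dominated[of _ c] F_measurable_M[OF N_adapted]) auto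
qed

subsection \<open>The increment over a short interval\<close>

text \<open>A variable whose integrals over all events of the past vanish has conditional expectation
  0.\<close>

lemma orthogonal_to_past:
  assumes V: "integrable M V" "\<And>A. A \<in> sets (F u) \<Longrightarrow> (\<integral>\<omega>. indicator A \<omega> * V \<omega> \<partial>M) = 0"
    and \<Phi>: "\<Phi> \<in> borel_measurable (F u)" "integrable M (\<lambda>\<omega>. \<Phi> \<omega> * V \<omega>)"
  shows "(\<integral>\<omega>. \<Phi> \<omega> * V \<omega> \<partial>M) = (0 :: real)"
proof -
  interpret sub: finite_measure_subalgebra M "F u"
    by unfold_locales (rule filtration_subalgebra)
  have "AE \<omega> in M. real_cond_exp M (F u) V \<omega> = 0"
    by (rule sub.real_cond_exp_charact) (use V in \<open>auto simp: set_lebesgue_integral_def\<close>)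
  then have "AE \<omega> in M. \<Phi> \<omega> * real_cond_exp M (F u) V \<omega> = 0" by eventually_elim simp
  then have "(\<integral>\<omega>. \<Phi> \<omega> * real_cond_exp M (F u) V \<omega> \<partial>M) = 0"
    by (intro integral_eq_zero_AE)
  then show ?thesis
    using sub.real_cond_exp_intg(2)[OF \<Phi>(2,1)] V(1) by auto
qed

lemma B_measurable [measurable]: "B t \<in> borel_measurable M"
  by (rule F_measurable_M[OF B_adapted])

lemma B_increment_square: "(norm (B v \<omega> - B u \<omega>))\<^sup>2 \<le> 4 * R \<omega>"
proof -
  have "(norm (B v \<omega> - B u \<omega>))\<^sup>2 \<le> (norm (B v \<omega>) + norm (B u \<omega>))\<^sup>2"
    by (intro power_mono norm_triangle_ineq4) auto
  also have "\<dots> \<le> 2 * (norm (B v \<omega>))\<^sup>2 + 2 * (norm (B u \<omega>))\<^sup>2"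
    by (rule square_sum_le)
  finally show ?thesis using B_bound[of v \<omega>] B_bound[of u \<omega>] by simp
qed

lemma B_component_product:
  "\<bar>(B v \<omega> - B u \<omega>) $ i * (B v \<omega> - B u \<omega>) $ j\<bar> \<le> 4 * R \<omega>"
proof -
  have "\<bar>(B v \<omega> - B u \<omega>) $ i * (B v \<omega> - B u \<omega>) $ j\<bar> \<le> norm (B v \<omega> - B u \<omega>) * norm (B v \<omega> - B u \<omega>)"
    unfolding abs_mult by (intro mult_mono component_le_norm_cart) auto
  then show ?thesis using B_increment_square[where v = v and u = u and \<omega> = \<omega>] by (simp add: power2_eq_square)
qed

text \<open>The part of the increment of \<open>N\<close> over \<open>[u, v]\<close> whose conditional mean given the past
  vanishes exactly: the Taylor expansion of \<open>f\<close> at \<open>X u\<close> to second order in the increment of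
  \<open>B\<close>, with the square of that increment replaced by its deviation from the mean \<open>(v - u) I\<close>.\<close>

definition main_part :: "real \<Rightarrow> real \<Rightarrow> 'w \<Rightarrow> real" where
  "main_part u v \<omega> = sqrt hbar * (\<Sum>i\<in>UNIV. g i (X u \<omega>) * (B v \<omega> - B u \<omega>) $ i) +
     hbar / 2 * (\<Sum>i\<in>UNIV. \<Sum>j\<in>UNIV. H i j (X u \<omega>) * ((B v \<omega> - B u \<omega>) $ i * (B v \<omega> - B u \<omega>) $ j - (if i = j then v - u else 0)))"

lemma main_part_orthogonal:
  assumes uv: "t0 \<le> u" "u \<le> v" "v \<le> T" and A: "A \<in> sets (F u)"
  shows "integrable M (\<lambda>\<omega>. indicator A \<omega> * main_part u v \<omega>)" "(\<integral>\<omega>. indicator A \<omega> * main_part u v \<omega> \<partial>M) = 0"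
proof -
  have v1: "v \<le> t0 + 1" using uv \<delta> by simp
  have [measurable]: "X u \<in> borel_measurable (F u)" by (rule X_adapted[OF uv(1)])
  have [measurable]: "X u \<in> borel_measurable M" by (rule F_measurable_M[OF X_adapted[OF uv(1)]])
  have A'[measurable]: "A \<in> sets (F u)" "A \<in> sets M" using A sets_F_subset by auto
  obtain c where c: "c \<ge> 0" "\<And>\<omega> t i. \<omega> \<in> space M \<Longrightarrow> (g i (X t \<omega>))\<^sup>2 \<le> c * (1 + R \<omega>)" using g_X_bound by blast
  let ?W = "\<lambda>i \<omega>. (B v \<omega> - B u \<omega>) $ i"
  let ?V = "\<lambda>i j \<omega>. ?W i \<omega> * ?W j \<omega> - (if i = j then v - u else 0)"
  have Wsq: "(?W i \<omega>)\<^sup>2 \<le> 4 * R \<omega>" for i \<omega>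
    using B_component_product[where v = v and u = u and \<omega> = \<omega> and i = i and j = i] by (simp add: power2_eq_square)
  have W: "integrable M (?W i)" for i
  proof (rule integrable_dominated[where c = 4])
    fix \<omega>
    have "2 * \<bar>?W i \<omega>\<bar> \<le> 1 + (?W i \<omega>)\<^sup>2" using zero_le_power2[of "\<bar>?W i \<omega>\<bar> - 1"] by (simp add: power2_diff)
    with Wsq[of \<omega> i] R_nonneg[of \<omega>] show "\<bar>?W i \<omega>\<bar> \<le> 4 * (1 + R \<omega>)" by simp
  qed simp
  have WW: "integrable M (\<lambda>\<omega>. ?W i \<omega> * ?W j \<omega>)" for i j
  proof (rule integrable_dominated[where c = 4])
    show "\<bar>?W i \<omega> * ?W j \<omega>\<bar> \<le> 4 * (1 + R \<omega>)" for \<omega>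
      using B_component_product[where v = v and u = u and \<omega> = \<omega> and i = i and j = j] by simp
  qed simp
  have 1: "integrable M (\<lambda>\<omega>. (indicator A \<omega> * g i (X u \<omega>)) * ?W i \<omega>)" for i
  proof (rule integrable_dominated[where c = "c + 4"])
    fix \<omega> assume \<omega>: "\<omega> \<in> space M"
    have "2 * \<bar>g i (X u \<omega>) * ?W i \<omega>\<bar> \<le> (g i (X u \<omega>))\<^sup>2 + (?W i \<omega>)\<^sup>2"
      using zero_le_power2[of "\<bar>g i (X u \<omega>)\<bar> - \<bar>?W i \<omega>\<bar>"] by (simp add: power2_diff abs_mult)
    also have "\<dots> \<le> c * (1 + R \<omega>) + 4 * R \<omega>" using c(2)[OF \<omega>, of i u] Wsq[of \<omega> i] by linarith
    finally have "2 * \<bar>g i (X u \<omega>) * ?W i \<omega>\<bar> \<le> (c + 4) * (1 + R \<omega>)" by (simp add: algebra_simps)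
    moreover have "0 \<le> \<bar>g i (X u \<omega>) * ?W i \<omega>\<bar>" by simp
    ultimately have "\<bar>g i (X u \<omega>) * ?W i \<omega>\<bar> \<le> (c + 4) * (1 + R \<omega>)" by linarith
    then show "\<bar>indicator A \<omega> * g i (X u \<omega>) * ?W i \<omega>\<bar> \<le> (c + 4) * (1 + R \<omega>)"
      using c(1) R_nonneg[of \<omega>] by (auto simp: indicator_def)
  qed measurable
  have 2: "integrable M (\<lambda>\<omega>. (indicator A \<omega> * H i j (X u \<omega>)) * ?V i j \<omega>)" for i j
  proof (rule integrable_dominated[where c = "C * (4 + \<bar>v - u\<bar>)"])
    fix \<omega>
    have "\<bar>?V i j \<omega>\<bar> \<le> 4 * R \<omega> + \<bar>v - u\<bar>"
      by (rule order_trans[OF abs_triangle_ineq4 add_mono[OF B_component_product]]) auto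
    also have "\<dots> \<le> (4 + \<bar>v - u\<bar>) * (1 + R \<omega>)" using R_nonneg[of \<omega>] by (simp add: algebra_simps)
    finally have "\<bar>H i j (X u \<omega>)\<bar> * \<bar>?V i j \<omega>\<bar> \<le> C * ((4 + \<bar>v - u\<bar>) * (1 + R \<omega>))"
      by (intro mult_mono H_bounded C_nonneg) auto
    then show "\<bar>indicator A \<omega> * H i j (X u \<omega>) * ?V i j \<omega>\<bar> \<le> C * (4 + \<bar>v - u\<bar>) * (1 + R \<omega>)"
      using C_nonneg R_nonneg[of \<omega>] by (auto simp: indicator_def abs_mult mult.assoc)
  qed measurable
  have eq: "indicator A \<omega> * main_part u v \<omega> = sqrt hbar * (\<Sum>i\<in>UNIV. (indicator A \<omega> * g i (X u \<omega>)) * ?W i \<omega>) +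
     hbar / 2 * (\<Sum>i\<in>UNIV. \<Sum>j\<in>UNIV. (indicator A \<omega> * H i j (X u \<omega>)) * ?V i j \<omega>)" for \<omega>
    unfolding main_part_def by (simp add: sum_distrib_left distrib_left mult.left_commute mult.assoc)
  show "integrable M (\<lambda>\<omega>. indicator A \<omega> * main_part u v \<omega>)"
    unfolding eq by (intro Bochner_Integration.integrable_add integrable_mult_right Bochner_Integration.integrable_sum 1 2)
  have z1: "(\<integral>\<omega>. (indicator A \<omega> * g i (X u \<omega>)) * ?W i \<omega> \<partial>M) = 0" for i
    by (rule orthogonal_to_past[OF W _ _ 1]) (auto simp del: vector_minus_component intro!: B_mean uv v1)
  have z2: "(\<integral>\<omega>. (indicator A \<omega> * H i j (X u \<omega>)) * ?V i j \<omega> \<partial>M) = 0" for i j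
  proof (rule orthogonal_to_past[OF _ _ _ 2])
    show "integrable M (?V i j)" using WW[of i j] by simp
    fix E assume E: "E \<in> sets (F u)"
    then have E'[measurable]: "E \<in> sets M" using sets_F_subset by auto
    have i1: "integrable M (\<lambda>\<omega>. indicator E \<omega> * (?W i \<omega> * ?W j \<omega>))"
      using integrable_mult_indicator[OF E' WW[of i j]] by simp
    have "(\<integral>\<omega>. indicator E \<omega> * ?V i j \<omega> \<partial>M) = (\<integral>\<omega>. indicator E \<omega> * (?W i \<omega> * ?W j \<omega>) - indicator E \<omega> * (if i = j then v - u else 0) \<partial>M)"
      by (simp only: right_diff_distrib)
    also have "\<dots> = (\<integral>\<omega>. indicator E \<omega> * (?W i \<omega> * ?W j \<omega>) \<partial>M) - (\<integral>\<omega>. indicator E \<omega> * (if i = j then v - u else 0) \<partial>M)"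
      by (rule Bochner_Integration.integral_diff[OF i1]) (simp add: less_top[symmetric])
    also have "\<dots> = 0"
      by (subst B_covariance[OF uv(1,2) v1 E]) (simp add: mult.commute)
    finally show "(\<integral>\<omega>. indicator E \<omega> * ?V i j \<omega> \<partial>M) = 0" .
  qed measurable
  show "(\<integral>\<omega>. indicator A \<omega> * main_part u v \<omega> \<partial>M) = 0"
    unfolding eq
    by (subst Bochner_Integration.integral_add)
       (auto simp del: vector_minus_component intro!: integrable_mult_right Bochner_Integration.integrable_sum 1 2
         simp: Bochner_Integration.integral_sum[OF 1] Bochner_Integration.integral_sum[OF Bochner_Integration.integrable_sum[OF 2]]
           Bochner_Integration.integral_sum[OF 2] z1 z2)
qed

end

text \<open>Here \<open>r\<close> stands for \<open>sqrt (v - u)\<close> and \<open>a\<close> for the norm of the increment of \<open>B\<close>, which is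
  of the same order. The bounds dominate the products of order at least three that occur in the
  remainder by the four terms of \<open>increment_scale\<close>.\<close>

lemma half_power_bounds:
  fixes a r :: real
  assumes r: "0 < r" "r \<le> 1" and a: "0 \<le> a"
  shows "(r\<^sup>2) ^ 3 \<le> r\<^sup>2 * r" "r\<^sup>2 * r\<^sup>2 \<le> r\<^sup>2 * r" "a ^ 3 \<le> r * a\<^sup>2 + a ^ 4 / r" "r\<^sup>2 * a \<le> r\<^sup>2 * r + r * a\<^sup>2" "a \<le> (r + a\<^sup>2 / r) / 2"
proof -
  have "r ^ 6 \<le> r ^ 3" "r ^ 4 \<le> r ^ 3" using r by (intro power_decreasing; simp)+
  then show "(r\<^sup>2) ^ 3 \<le> r\<^sup>2 * r" "r\<^sup>2 * r\<^sup>2 \<le> r\<^sup>2 * r"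
    by (simp_all add: power_mult[symmetric] power_add[symmetric] eval_nat_numeral ac_simps)
  have q: "0 \<le> r\<^sup>2 - a * r + a\<^sup>2"
    using zero_le_power2[of "a - r"] mult_nonneg_nonneg[OF a less_imp_le[OF r(1)]] by (simp add: power2_diff algebra_simps)
  have "0 \<le> a\<^sup>2 * (r\<^sup>2 - a * r + a\<^sup>2)" by (intro mult_nonneg_nonneg q) simp
  then have "a ^ 3 * r \<le> r * a\<^sup>2 * r + a ^ 4" by (simp add: algebra_simps power2_eq_square eval_nat_numeral)
  then show "a ^ 3 \<le> r * a\<^sup>2 + a ^ 4 / r" using r(1) by (simp add: field_simps)
  have "0 \<le> r * (r\<^sup>2 - a * r + a\<^sup>2)" using q r(1) by simp
  then show "r\<^sup>2 * a \<le> r\<^sup>2 * r + r * a\<^sup>2" by (simp add: algebra_simps power2_eq_square)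
  have "0 \<le> (a - r)\<^sup>2" by simp
  then show "a \<le> (r + a\<^sup>2 / r) / 2" using r(1) by (simp add: power2_diff field_simps power2_eq_square)
qed

lemma cube_sum_le:
  fixes p q :: real
  assumes "0 \<le> p" "0 \<le> q"
  shows "(p + q) ^ 3 \<le> 4 * p ^ 3 + 4 * q ^ 3"
proof -
  have "0 \<le> (p + q) * (p - q)\<^sup>2" using assms by simp
  then show ?thesis by (simp add: algebra_simps power2_eq_square power3_eq_cube)
qed

context martingale_problem
begin

text \<open>Each of the four terms has expectation of order \<open>(v - u) sqrt (v - u)\<close>. The powers of
  \<open>sqrt (v - u)\<close> are arranged so that only even powers of increments of \<open>B\<close> occur, whose moments
  are known.\<close>

definition increment_scale :: "real \<Rightarrow> real \<Rightarrow> 'w \<Rightarrow> real" where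
  "increment_scale u v \<omega> = (v - u) * sqrt (v - u) + sqrt (v - u) * (norm (B v \<omega> - B u \<omega>))\<^sup>2
     + norm (B v \<omega> - B u \<omega>) ^ 4 / sqrt (v - u) + integral {u..v} (\<lambda>s. (norm (B s \<omega> - B u \<omega>))\<^sup>2) / sqrt (v - u)"

text \<open>Subtracting \<open>main_part\<close> from the increment of \<open>N\<close> leaves three errors: the cubic Taylor
  error, the second-order terms that involve the drift, and the variation of \<open>L s (X s \<omega>)\<close> over
  \<open>[u, v]\<close>.\<close>

lemma remainder_bound:
  "\<exists>c\<ge>0. \<forall>\<omega>\<in>space M. \<forall>u v. t0 \<le> u \<and> u < v \<and> v \<le> T \<longrightarrow>
     \<bar>N v \<omega> - N u \<omega> - main_part u v \<omega>\<bar> \<le> c * increment_scale u v \<omega>"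
proof -
  define n where "n = real CARD('n)"
  define s0 where "s0 = sqrt hbar"
  define c1 where "c1 = n * (K * C) + hbar / 2 * (n * C)"
  define c where "c = C * (4 * K ^ 3 + 4 * s0 ^ 3) + n * (n * C) * (K * K + 2 * s0 * K) / 2 + c1 * (K + s0)"
  have s0: "0 \<le> s0" "s0 * s0 = hbar" using hbar by (auto simp: s0_def)
  have n0: "0 \<le> n" by (simp add: n_def)
  have c1: "0 \<le> c1" using K_nonneg C_nonneg hbar n0 by (simp add: c1_def)
  have c0: "0 \<le> c" unfolding c_def using K_nonneg C_nonneg s0 n0 c1 by simp
  have "\<bar>N v \<omega> - N u \<omega> - main_part u v \<omega>\<bar> \<le> c * increment_scale u v \<omega>"
    if \<omega>: "\<omega> \<in> space M" and uv: "t0 \<le> u" "u < v" "v \<le> T" for \<omega> u v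
  proof -
    define h where "h = v - u"
    define r where "r = sqrt h"
    define W where "W = B v \<omega> - B u \<omega>"
    define a where "a = norm W"
    define D where "D = X v \<omega> - X u \<omega>"
    define x where "x = X u \<omega>"
    define b where "b = integral {u..v} (\<lambda>s. \<beta> s (X s \<omega>))"
    define Y where "Y = integral {u..v} (\<lambda>s. (norm (B s \<omega> - B u \<omega>))\<^sup>2)"
    define \<gamma> where "\<gamma> = (\<chi> i. g i x)"
    define Q where "Q s = L s (X s \<omega>) - \<beta> s (X s \<omega>) \<bullet> \<gamma> - hbar / 2 * (\<Sum>i\<in>UNIV. H i i x)" for s
    have h: "0 < h" "h \<le> 1" using uv \<delta> by (auto simp: h_def)
    have r: "0 < r" "r \<le> 1" "r\<^sup>2 = h" using h by (auto simp: r_def)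
    have a: "0 \<le> a" by (simp add: a_def)
    have contX: "continuous_on {u..v} (\<lambda>s. X s \<omega>)" by (rule continuous_on_subset[OF continuous_X[OF \<omega>]]) simp
    have contB: "continuous_on {u..v} (\<lambda>s. (norm (B s \<omega> - B u \<omega>))\<^sup>2)"
      by (intro continuous_intros continuous_on_subset[OF B_continuous[OF \<omega>]]) auto
    have Y: "0 \<le> Y" unfolding Y_def by (intro integral_nonneg integrable_continuous_interval contB) auto
    have D: "D = b + s0 *\<^sub>R W"
      using X_increment[OF \<omega> uv(1) less_imp_le[OF uv(2)] uv(3)] by (simp add: D_def b_def s0_def W_def)
    have b: "norm b \<le> K * h"
      unfolding b_def h_def using uv by (intro integral_bound drift_bounded continuous_drift contX) auto
    have scale: "increment_scale u v \<omega> = r\<^sup>2 * r + r * a\<^sup>2 + a ^ 4 / r + Y / r"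
      unfolding increment_scale_def h_def[symmetric] r_def[symmetric] W_def[symmetric] a_def[symmetric] Y_def[symmetric] by (simp add: r(3))
    \<comment> \<open>\<open>P\<close> is the scale expressed by \<open>r = sqrt (v - u)\<close>; each error below is bounded by a
      constant times \<open>P\<close>.\<close>
    define P where "P = r\<^sup>2 * r + r * a\<^sup>2 + a ^ 4 / r + Y / r"
    have nn: "0 \<le> r\<^sup>2 * r" "0 \<le> r * a\<^sup>2" "0 \<le> a ^ 4 / r" "0 \<le> Y / r" using r a Y by auto
    note hp = half_power_bounds[OF r(1,2) a]
    have P: "(r\<^sup>2) ^ 3 \<le> P" "r\<^sup>2 * r\<^sup>2 \<le> P" "a ^ 3 \<le> P" "r\<^sup>2 * a \<le> P" "r\<^sup>2 * r + Y / r \<le> P" "0 \<le> P"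
      unfolding P_def using hp nn by linarith+
    have e1: "\<bar>f (x + D) - f x - (\<Sum>i\<in>UNIV. D $ i * g i x) - (\<Sum>i\<in>UNIV. \<Sum>j\<in>UNIV. D $ i * D $ j * H i j x) / 2\<bar>
      \<le> C * (4 * K ^ 3 + 4 * s0 ^ 3) * P"
    proof -
      have "norm D \<le> K * r\<^sup>2 + s0 * a"
        using norm_triangle_ineq[of b "s0 *\<^sub>R W"] b s0 by (simp add: D a_def r(3))
      then have "norm D ^ 3 \<le> (K * r\<^sup>2 + s0 * a) ^ 3" by (intro power_mono) auto
      also have "\<dots> \<le> 4 * (K * r\<^sup>2) ^ 3 + 4 * (s0 * a) ^ 3"
        using K_nonneg s0 a by (intro cube_sum_le) auto
      also have "\<dots> = 4 * K ^ 3 * (r\<^sup>2) ^ 3 + 4 * s0 ^ 3 * a ^ 3" by (simp add: power_mult_distrib)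
      also have "\<dots> \<le> 4 * K ^ 3 * P + 4 * s0 ^ 3 * P"
        using P K_nonneg s0 by (intro add_mono mult_left_mono) auto
      finally have "C * norm D ^ 3 \<le> C * ((4 * K ^ 3 + 4 * s0 ^ 3) * P)"
        by (intro mult_left_mono C_nonneg) (simp add: algebra_simps)
      with taylor[of x D] show ?thesis by simp
    qed
    \<comment> \<open>The second-order terms in which the increment \<open>b\<close> of the drift integral occurs.\<close>
    define E3 where "E3 = (\<Sum>i\<in>UNIV. \<Sum>j\<in>UNIV. (b $ i * b $ j + s0 * (b $ i * W $ j + W $ i * b $ j)) * H i j x) / 2"
    have E3: "\<bar>E3\<bar> \<le> n * (n * C) * (K * K + 2 * s0 * K) / 2 * P"
    proof -
      have bi: "\<bar>b $ i\<bar> \<le> K * h" for i using component_le_norm_cart[of b i] b by linarith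
      have Wi: "\<bar>W $ i\<bar> \<le> a" for i using component_le_norm_cart[of W i] by (simp add: a_def)
      have Kh: "0 \<le> K * h" using K_nonneg h by simp
      have t: "\<bar>b $ i * b $ j + s0 * (b $ i * W $ j + W $ i * b $ j)\<bar> \<le> (K * K + 2 * s0 * K) * P" for i j
      proof -
        have "\<bar>b $ i * b $ j\<bar> \<le> (K * h) * (K * h)" unfolding abs_mult by (intro mult_mono bi Kh) auto
        moreover have "\<bar>b $ i * W $ j\<bar> \<le> (K * h) * a" "\<bar>W $ i * b $ j\<bar> \<le> a * (K * h)"
          unfolding abs_mult by (intro mult_mono bi Wi Kh a; simp)+
        then have "\<bar>b $ i * W $ j + W $ i * b $ j\<bar> \<le> 2 * (K * h * a)" by (simp add: mult.commute)
        then have "\<bar>s0 * (b $ i * W $ j + W $ i * b $ j)\<bar> \<le> s0 * (2 * (K * h * a))"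
          unfolding abs_mult using s0 by (intro mult_mono) auto
        ultimately have "\<bar>b $ i * b $ j + s0 * (b $ i * W $ j + W $ i * b $ j)\<bar> \<le> (K * h) * (K * h) + s0 * (2 * (K * h * a))"
          by linarith
        also have "\<dots> = K * K * (r\<^sup>2 * r\<^sup>2) + 2 * s0 * K * (r\<^sup>2 * a)" by (simp add: r(3) ac_simps)
        also have "\<dots> \<le> K * K * P + 2 * s0 * K * P"
          using P K_nonneg s0 by (intro add_mono mult_left_mono) auto
        finally show ?thesis by (simp add: algebra_simps)
      qed
      have "\<bar>\<Sum>i\<in>UNIV. \<Sum>j\<in>UNIV. (b $ i * b $ j + s0 * (b $ i * W $ j + W $ i * b $ j)) * H i j x\<bar>
         \<le> (\<Sum>i\<in>(UNIV :: 'n set). n * ((K * K + 2 * s0 * K) * P * C))"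
        by (intro order_trans[OF sum_abs] sum_mono order_trans[OF abs_sum_mult_le[OF t H_bounded]])
           (use P K_nonneg s0 in \<open>auto simp: n_def\<close>)
      then have "\<bar>\<Sum>i\<in>UNIV. \<Sum>j\<in>UNIV. (b $ i * b $ j + s0 * (b $ i * W $ j + W $ i * b $ j)) * H i j x\<bar> \<le> n * (n * C) * (K * K + 2 * s0 * K) * P"
        by (simp add: n_def algebra_simps)
      then show ?thesis unfolding E3_def by simp
    qed
    have Qcont: "continuous_on {u..v} Q"
      unfolding Q_def by (intro continuous_intros L_X_continuous[OF \<omega>] continuous_drift contX)
    \<comment> \<open>The variation of the generator along the path: \<open>g\<close> and \<open>H\<close> are Lipschitz, and the norm of
      the increment of \<open>B\<close> is replaced by its square by means of the inequality
      \<open>a \<le> (r + a\<^sup>2 / r) / 2\<close>.\<close>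
    have Qb: "\<bar>integral {u..v} Q\<bar> \<le> c1 * (K + s0) * P"
    proof -
      let ?q = "\<lambda>s. c1 * (K * h + s0 / 2 * (r + (norm (B s \<omega> - B u \<omega>))\<^sup>2 / r))"
      have "norm (integral {u..v} Q) \<le> integral {u..v} ?q"
      proof (rule integral_norm_bound_integral)
        show "Q integrable_on {u..v}" by (rule integrable_continuous_interval[OF Qcont])
        show "?q integrable_on {u..v}" using r by (intro integrable_continuous_interval continuous_intros contB) auto
        fix s assume s: "s \<in> {u..v}"
        have Xs: "norm (X s \<omega> - x) \<le> K * h + s0 / 2 * (r + (norm (B s \<omega> - B u \<omega>))\<^sup>2 / r)"
        proof -
          have "norm (integral {u..s} (\<lambda>s. \<beta> s (X s \<omega>))) \<le> K * (s - u)"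
            using s by (intro integral_bound drift_bounded continuous_drift continuous_on_subset[OF contX]) auto
          also have "\<dots> \<le> K * h" using s by (intro mult_left_mono K_nonneg) (auto simp: h_def)
          finally have "norm (X s \<omega> - x) \<le> K * h + s0 * norm (B s \<omega> - B u \<omega>)"
            using X_increment[OF \<omega> uv(1), of s] s uv norm_triangle_ineq[of "integral {u..s} (\<lambda>s. \<beta> s (X s \<omega>))" "s0 *\<^sub>R (B s \<omega> - B u \<omega>)"] s0
            by (simp add: x_def s0_def)
          also have "s0 * norm (B s \<omega> - B u \<omega>) \<le> s0 * ((r + (norm (B s \<omega> - B u \<omega>))\<^sup>2 / r) / 2)"
            using half_power_bounds(5)[OF r(1,2), of "norm (B s \<omega> - B u \<omega>)"] s0 by (intro mult_left_mono) auto
          finally show ?thesis by simp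
        qed
        have "Q s = (\<Sum>i\<in>UNIV. \<beta> s (X s \<omega>) $ i * (g i (X s \<omega>) - g i x)) + hbar / 2 * (\<Sum>i\<in>UNIV. H i i (X s \<omega>) - H i i x)"
          unfolding Q_def L_def \<gamma>_def inner_vec_def by (simp add: sum_subtractf right_diff_distrib)
        also have "\<bar>\<dots>\<bar> \<le> n * (K * (C * norm (X s \<omega> - x))) + hbar / 2 * (n * (C * norm (X s \<omega> - x)))"
        proof (rule order_trans[OF abs_triangle_ineq add_mono])
          have "\<bar>\<beta> s (X s \<omega>) $ i\<bar> \<le> K" for i
            using component_le_norm_cart[of "\<beta> s (X s \<omega>)" i] drift_bounded[of s "X s \<omega>"] by linarith
          then show "\<bar>\<Sum>i\<in>UNIV. \<beta> s (X s \<omega>) $ i * (g i (X s \<omega>) - g i x)\<bar> \<le> n * (K * (C * norm (X s \<omega> - x)))"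
            unfolding n_def by (intro abs_sum_mult_le g_lipschitz K_nonneg)
          have "\<bar>\<Sum>i\<in>UNIV. H i i (X s \<omega>) - H i i x\<bar> \<le> n * (C * norm (X s \<omega> - x))"
            unfolding n_def by (intro order_trans[OF sum_abs] sum_bounded_above[THEN order_trans]) (auto intro: H_lipschitz)
          then show "\<bar>hbar / 2 * (\<Sum>i\<in>UNIV. H i i (X s \<omega>) - H i i x)\<bar> \<le> hbar / 2 * (n * (C * norm (X s \<omega> - x)))"
            using hbar by (simp add: abs_mult)
        qed
        also have "\<dots> = c1 * norm (X s \<omega> - x)" by (simp add: c1_def algebra_simps)
        also have "\<dots> \<le> ?q s" by (intro mult_left_mono Xs c1)
        finally show "norm (Q s) \<le> ?q s" by simp
      qed
      also have "integral {u..v} ?q = c1 * (K * h * h + s0 / 2 * (r * h + Y / r))"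
      proof -
        have "((\<lambda>s. (norm (B s \<omega> - B u \<omega>))\<^sup>2) has_integral Y) {u..v}"
          unfolding Y_def by (intro integrable_integral integrable_continuous_interval contB)
        then have "(?q has_integral c1 * (K * h * h + s0 / 2 * (r * h + Y / r))) {u..v}"
          using has_integral_const_real[of "K * h" u v] has_integral_const_real[of r u v] uv r
          by (intro has_integral_mult_right has_integral_add has_integral_divide) (auto simp: h_def mult.commute)
        then show ?thesis by (rule integral_unique)
      qed
      also have "\<dots> \<le> c1 * (K * P + s0 / 2 * (P + P))"
      proof (intro mult_left_mono add_mono c1)
        show "K * h * h \<le> K * P" using P(2) mult_left_mono[OF P(2) K_nonneg] by (simp add: r(3) mult.assoc)
        show "r * h \<le> P" "Y / r \<le> P" using P(5) nn by (simp_all add: r(3)[symmetric] mult.commute)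
      qed (use s0 in auto)
      also have "\<dots> = c1 * (K + s0) * P" by (simp add: algebra_simps)
      finally show ?thesis by simp
    qed
    have IL: "integral {u..v} (\<lambda>s. L s (X s \<omega>)) = integral {u..v} Q + b \<bullet> \<gamma> + hbar / 2 * (\<Sum>i\<in>UNIV. H i i x) * h"
    proof -
      have "((\<lambda>s. \<beta> s (X s \<omega>)) has_integral b) {u..v}"
        unfolding b_def by (intro integrable_integral integrable_continuous_interval continuous_drift contX)
      from has_integral_linear[OF this bounded_linear_inner_left[of \<gamma>]]
      have "((\<lambda>s. \<beta> s (X s \<omega>) \<bullet> \<gamma>) has_integral b \<bullet> \<gamma>) {u..v}" by (simp add: o_def)
      moreover have "(Q has_integral integral {u..v} Q) {u..v}"
        by (intro integrable_integral integrable_continuous_interval Qcont)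
      moreover have "((\<lambda>s. hbar / 2 * (\<Sum>i\<in>UNIV. H i i x)) has_integral hbar / 2 * (\<Sum>i\<in>UNIV. H i i x) * h) {u..v}"
        using has_integral_const_real[of "hbar / 2 * (\<Sum>i\<in>UNIV. H i i x)" u v] uv by (simp add: h_def mult.commute)
      ultimately have "((\<lambda>s. Q s + \<beta> s (X s \<omega>) \<bullet> \<gamma> + hbar / 2 * (\<Sum>i\<in>UNIV. H i i x)) has_integral
         integral {u..v} Q + b \<bullet> \<gamma> + hbar / 2 * (\<Sum>i\<in>UNIV. H i i x) * h) {u..v}"
        by (intro has_integral_add)
      then show ?thesis by (intro integral_unique) (simp add: Q_def)
    qed
    have NL: "N v \<omega> - N u \<omega> = f (x + D) - f x - integral {u..v} (\<lambda>s. L s (X s \<omega>))"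
      using Henstock_Kurzweil_Integration.integral_combine[OF uv(1) less_imp_le[OF uv(2)] integrable_continuous_interval[OF L_X_continuous[OF \<omega>]]]
      by (simp add: N_def D_def x_def)
    have s1: "(\<Sum>i\<in>UNIV. D $ i * g i x) = b \<bullet> \<gamma> + s0 * (\<Sum>i\<in>UNIV. g i x * W $ i)"
      by (simp add: D inner_vec_def \<gamma>_def sum_distrib_left sum.distrib[symmetric] algebra_simps)
    have s2: "(\<Sum>i\<in>UNIV. \<Sum>j\<in>UNIV. D $ i * D $ j * H i j x) / 2 = E3 + hbar / 2 * (\<Sum>i\<in>UNIV. \<Sum>j\<in>UNIV. H i j x * (W $ i * W $ j))"
    proof -
      have "D $ i * D $ j * H i j x = (b $ i * b $ j + s0 * (b $ i * W $ j + W $ i * b $ j)) * H i j x + hbar * (H i j x * (W $ i * W $ j))" for i j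
        unfolding D s0(2)[symmetric] by (simp add: algebra_simps)
      then show ?thesis
        unfolding E3_def by (simp add: sum.distrib sum_distrib_left[symmetric] add_divide_distrib)
    qed
    have s3: "main_part u v \<omega> = s0 * (\<Sum>i\<in>UNIV. g i x * W $ i) + hbar / 2 * (\<Sum>i\<in>UNIV. \<Sum>j\<in>UNIV. H i j x * (W $ i * W $ j)) - hbar / 2 * (\<Sum>i\<in>UNIV. H i i x) * h"
    proof -
      have "(\<Sum>i\<in>UNIV. \<Sum>j\<in>UNIV. H i j x * (W $ i * W $ j - (if i = j then h else 0))) =
         (\<Sum>i\<in>UNIV. \<Sum>j\<in>UNIV. H i j x * (W $ i * W $ j)) - (\<Sum>i\<in>UNIV. H i i x) * h"
        by (simp add: right_diff_distrib sum_subtractf sum_distrib_right if_distrib[of "\<lambda>y. _ * y"] cong: if_cong)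
      then show ?thesis
        unfolding main_part_def x_def[symmetric] W_def[symmetric] s0_def[symmetric] h_def[symmetric]
        by (simp only: right_diff_distrib mult.assoc)
    qed
    have "N v \<omega> - N u \<omega> - main_part u v \<omega> =
       (f (x + D) - f x - (\<Sum>i\<in>UNIV. D $ i * g i x) - (\<Sum>i\<in>UNIV. \<Sum>j\<in>UNIV. D $ i * D $ j * H i j x) / 2) + E3 - integral {u..v} Q"
      unfolding NL IL s1 s2 s3 by simp
    also have "\<bar>\<dots>\<bar> \<le> C * (4 * K ^ 3 + 4 * s0 ^ 3) * P + n * (n * C) * (K * K + 2 * s0 * K) / 2 * P + c1 * (K + s0) * P"
      using e1 E3 Qb by linarith
    also have "\<dots> = c * P" by (simp add: c_def algebra_simps)
    finally show ?thesis by (simp add: scale P_def)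
  qed
  with c0 show ?thesis by blast
qed

lemma B_increment_second_moment:
  assumes "t0 \<le> u" "u \<le> s" "s \<le> t0 + 1"
  shows "(\<integral>\<^sup>+\<omega>. ennreal ((norm (B s \<omega> - B u \<omega>))\<^sup>2) \<partial>M) = ennreal (real CARD('n) * (s - u))"
proof -
  let ?W = "\<lambda>i \<omega>. (B s \<omega> - B u \<omega>) $ i"
  have e: "(norm (B s \<omega> - B u \<omega>))\<^sup>2 = (\<Sum>i\<in>UNIV. ?W i \<omega> * ?W i \<omega>)" for \<omega>
    by (simp only: power2_norm_eq_inner inner_vec_def inner_real_def)
  have int: "integrable M (\<lambda>\<omega>. ?W i \<omega> * ?W i \<omega>)" for i
  proof (rule integrable_dominated[where c = 4])
    show "\<bar>?W i \<omega> * ?W i \<omega>\<bar> \<le> 4 * (1 + R \<omega>)" for \<omega>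
      using B_component_product[where v = s and u = u and \<omega> = \<omega> and i = i and j = i] by simp
  qed simp
  have v: "(\<integral>\<omega>. ?W i \<omega> * ?W i \<omega> \<partial>M) = s - u" for i
  proof -
    have "(\<integral>\<omega>. ?W i \<omega> * ?W i \<omega> \<partial>M) = (\<integral>\<omega>. indicator (space M) \<omega> * (?W i \<omega> * ?W i \<omega>) \<partial>M)"
      by (intro Bochner_Integration.integral_cong) auto
    also have "\<dots> = s - u"
      using B_covariance[OF assms, of "space M" i i] sets.top[of "F u"] by (simp add: prob_space)
    finally show ?thesis .
  qed
  have "(\<integral>\<^sup>+\<omega>. ennreal ((norm (B s \<omega> - B u \<omega>))\<^sup>2) \<partial>M) = ennreal (\<integral>\<omega>. (norm (B s \<omega> - B u \<omega>))\<^sup>2 \<partial>M)"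
    by (intro nn_integral_eq_integral) (auto simp only: e intro!: Bochner_Integration.integrable_sum int AE_I2 sum_nonneg zero_le_square)
  also have "(\<integral>\<omega>. (norm (B s \<omega> - B u \<omega>))\<^sup>2 \<partial>M) = real CARD('n) * (s - u)"
    unfolding e by (subst Bochner_Integration.integral_sum[OF int]) (simp only: v sum_constant)
  finally show ?thesis .
qed

lemma B_increment_fourth_moment:
  assumes "t0 \<le> u" "u \<le> s" "s \<le> t0 + 1"
  shows "(\<integral>\<^sup>+\<omega>. ennreal (norm (B s \<omega> - B u \<omega>) ^ 4) \<partial>M) \<le> ennreal (3 * (real CARD('n))\<^sup>2 * (s - u)\<^sup>2)"
proof -
  let ?n = "real CARD('n)"
  let ?W = "\<lambda>i \<omega>. (B s \<omega> - B u \<omega>) $ i"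
  have e: "norm (B s \<omega> - B u \<omega>) ^ 4 \<le> ?n * (\<Sum>i\<in>UNIV. ?W i \<omega> ^ 4)" for \<omega>
  proof -
    have "norm (B s \<omega> - B u \<omega>) ^ 4 = ((norm (B s \<omega> - B u \<omega>))\<^sup>2)\<^sup>2" by (simp add: power_mult[symmetric])
    also have "(norm (B s \<omega> - B u \<omega>))\<^sup>2 = (\<Sum>i\<in>UNIV. (?W i \<omega>)\<^sup>2)"
      by (simp only: power2_norm_eq_inner) (simp add: inner_vec_def power2_eq_square)
    also have "(\<Sum>i\<in>UNIV. (?W i \<omega>)\<^sup>2)\<^sup>2 \<le> (\<Sum>i\<in>UNIV. ((?W i \<omega>)\<^sup>2)\<^sup>2) * ?n"
      by (rule sum_squared_le_sum_of_squares)
    also have "\<dots> = ?n * (\<Sum>i\<in>UNIV. ?W i \<omega> ^ 4)"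
      unfolding power_mult[symmetric] by simp
    finally show ?thesis .
  qed
  have "(\<integral>\<^sup>+\<omega>. ennreal (norm (B s \<omega> - B u \<omega>) ^ 4) \<partial>M) \<le> (\<integral>\<^sup>+\<omega>. ennreal ?n * (\<Sum>i\<in>UNIV. ennreal (?W i \<omega> ^ 4)) \<partial>M)"
  proof (intro nn_integral_mono)
    fix \<omega>
    have "ennreal (norm (B s \<omega> - B u \<omega>) ^ 4) \<le> ennreal (?n * (\<Sum>i\<in>UNIV. ?W i \<omega> ^ 4))" by (intro ennreal_leI e)
    also have "\<dots> = ennreal ?n * (\<Sum>i\<in>UNIV. ennreal (?W i \<omega> ^ 4))"
      by (subst sum_ennreal) (auto simp: ennreal_mult[symmetric] sum_nonneg)
    finally show "ennreal (norm (B s \<omega> - B u \<omega>) ^ 4) \<le> ennreal ?n * (\<Sum>i\<in>UNIV. ennreal (?W i \<omega> ^ 4))" .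
  qed
  also have "\<dots> = ennreal ?n * (\<Sum>i\<in>UNIV. \<integral>\<^sup>+\<omega>. ennreal (?W i \<omega> ^ 4) \<partial>M)"
    by (subst nn_integral_cmult, measurable, subst nn_integral_sum, auto)
  also have "\<dots> \<le> ennreal ?n * (\<Sum>i\<in>(UNIV :: 'n set). ennreal (3 * (s - u)\<^sup>2))"
    by (intro mult_left_mono sum_mono B_fourth_moment[OF assms]) auto
  also have "\<dots> = ennreal (3 * ?n\<^sup>2 * (s - u)\<^sup>2)"
  proof -
    have "ennreal ?n * (\<Sum>i\<in>(UNIV :: 'n set). ennreal (3 * (s - u)\<^sup>2)) = ennreal (?n * (\<Sum>i\<in>(UNIV :: 'n set). 3 * (s - u)\<^sup>2))"
      by (subst sum_ennreal, simp, rule ennreal_mult[symmetric]) (auto intro: sum_nonneg)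
    also have "?n * (\<Sum>i\<in>(UNIV :: 'n set). 3 * (s - u)\<^sup>2) = 3 * ?n\<^sup>2 * (s - u)\<^sup>2"
      by (simp add: power2_eq_square)
    finally show ?thesis .
  qed
  finally show ?thesis .
qed

lemma B_jointly_measurable: "(\<lambda>(s, \<omega>). B s \<omega>) \<in> borel_measurable (borel \<Otimes>\<^sub>M M)"
  by (intro continuous_process_jointly_measurable B_measurable B_continuous)

lemma B_increment_integral_moment:
  assumes uv: "t0 \<le> u" "u \<le> v" "v \<le> t0 + 1"
  defines "Y \<equiv> \<lambda>\<omega>. integral {u..v} (\<lambda>s. (norm (B s \<omega> - B u \<omega>))\<^sup>2)"
  shows "Y \<in> borel_measurable M" "(\<integral>\<^sup>+\<omega>. ennreal (Y \<omega>) \<partial>M) \<le> ennreal (real CARD('n) * (v - u)\<^sup>2)"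
    "\<And>\<omega>. \<omega> \<in> space M \<Longrightarrow> 0 \<le> Y \<omega>"
proof -
  let ?n = "real CARD('n)"
  have j: "(\<lambda>(s, \<omega>). (norm (B s \<omega> - B u \<omega>))\<^sup>2) \<in> borel_measurable (borel \<Otimes>\<^sub>M M)"
    using B_jointly_measurable unfolding split_beta' by measurable
  have c: "continuous_on S (\<lambda>s. (norm (B s \<omega> - B u \<omega>))\<^sup>2)" if "\<omega> \<in> space M" for \<omega> S
    by (intro continuous_intros continuous_on_subset[OF B_continuous[OF that]]) auto
  show "Y \<in> borel_measurable M"
    unfolding Y_def by (rule measurable_integral_process[OF j c])
  have Ynn: "ennreal (Y \<omega>) = (\<integral>\<^sup>+s. ennreal (indicator {u..v} s * (norm (B s \<omega> - B u \<omega>))\<^sup>2) \<partial>lborel)" and Y0: "0 \<le> Y \<omega>"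
    if \<omega>: "\<omega> \<in> space M" for \<omega>
  proof -
    have i: "set_integrable lborel {u..v} (\<lambda>s. (norm (B s \<omega> - B u \<omega>))\<^sup>2)"
      by (rule borel_integrable_atLeastAtMost'[OF c[OF \<omega>]])
    have "(\<integral>\<^sup>+s. ennreal (indicator {u..v} s * (norm (B s \<omega> - B u \<omega>))\<^sup>2) \<partial>lborel) = ennreal (\<integral>s. indicator {u..v} s * (norm (B s \<omega> - B u \<omega>))\<^sup>2 \<partial>lborel)"
      using i by (intro nn_integral_eq_integral) (auto simp: set_integrable_def)
    also have "(\<integral>s. indicator {u..v} s * (norm (B s \<omega> - B u \<omega>))\<^sup>2 \<partial>lborel) = Y \<omega>"
      using set_borel_integral_eq_integral(2)[OF i] by (simp add: set_lebesgue_integral_def Y_def)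
    finally show "ennreal (Y \<omega>) = (\<integral>\<^sup>+s. ennreal (indicator {u..v} s * (norm (B s \<omega> - B u \<omega>))\<^sup>2) \<partial>lborel)" ..
    show "0 \<le> Y \<omega>" unfolding Y_def by (intro integral_nonneg integrable_continuous_interval c \<omega>) auto
  qed
  then show "\<And>\<omega>. \<omega> \<in> space M \<Longrightarrow> 0 \<le> Y \<omega>" by blast
  interpret LM: pair_sigma_finite lborel M ..
  have "(\<integral>\<^sup>+\<omega>. ennreal (Y \<omega>) \<partial>M) = (\<integral>\<^sup>+\<omega>. \<integral>\<^sup>+s. ennreal (indicator {u..v} s * (norm (B s \<omega> - B u \<omega>))\<^sup>2) \<partial>lborel \<partial>M)"
    by (intro nn_integral_cong Ynn)
  also have "\<dots> = (\<integral>\<^sup>+s. \<integral>\<^sup>+\<omega>. ennreal (indicator {u..v} s * (norm (B s \<omega> - B u \<omega>))\<^sup>2) \<partial>M \<partial>lborel)"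
    using j by (intro LM.Fubini') (simp add: split_beta')
  also have "\<dots> \<le> (\<integral>\<^sup>+s. ennreal (?n * (v - u)) * indicator {u..v} s \<partial>lborel)"
  proof (intro nn_integral_mono)
    fix s
    show "(\<integral>\<^sup>+\<omega>. ennreal (indicator {u..v} s * (norm (B s \<omega> - B u \<omega>))\<^sup>2) \<partial>M) \<le> ennreal (?n * (v - u)) * indicator {u..v} s"
    proof (cases "s \<in> {u..v}")
      case True
      then have "(\<integral>\<^sup>+\<omega>. ennreal (indicator {u..v} s * (norm (B s \<omega> - B u \<omega>))\<^sup>2) \<partial>M) = ennreal (?n * (s - u))"
        using uv by (simp add: B_increment_second_moment)
      also have "\<dots> \<le> ennreal (?n * (v - u))" using True by (intro ennreal_leI mult_left_mono) auto
      finally show ?thesis using True by simp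
    qed simp
  qed
  also have "\<dots> = ennreal (?n * (v - u)) * ennreal (v - u)"
    using uv by (simp add: nn_integral_cmult_indicator)
  also have "\<dots> = ennreal (?n * (v - u)\<^sup>2)"
    using uv by (simp add: ennreal_mult[symmetric] power2_eq_square mult.assoc)
  finally show "(\<integral>\<^sup>+\<omega>. ennreal (Y \<omega>) \<partial>M) \<le> ennreal (?n * (v - u)\<^sup>2)" .
qed

lemma increment_scale_moment:
  assumes uv: "t0 \<le> u" "u < v" "v \<le> t0 + 1"
  shows "(\<integral>\<^sup>+\<omega>. ennreal (increment_scale u v \<omega>) \<partial>M) \<le>
    ennreal ((1 + 2 * real CARD('n) + 3 * (real CARD('n))\<^sup>2) * ((v - u) * sqrt (v - u)))"
proof -
  let ?n = "real CARD('n)"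
  define h where "h = v - u"
  define r where "r = sqrt h"
  have h: "0 < h" and r: "0 < r" "r * r = h" using uv by (auto simp: h_def r_def)
  define Y where "Y \<omega> = integral {u..v} (\<lambda>s. (norm (B s \<omega> - B u \<omega>))\<^sup>2)" for \<omega>
  note Y = B_increment_integral_moment[OF uv(1) less_imp_le[OF uv(2)] uv(3), folded Y_def h_def]
  note [measurable] = Y(1)
  let ?a = "\<lambda>\<omega>. norm (B v \<omega> - B u \<omega>)"
  have "(\<integral>\<^sup>+\<omega>. ennreal (increment_scale u v \<omega>) \<partial>M) =
    (\<integral>\<^sup>+\<omega>. ennreal (h * r) + ennreal r * ennreal ((?a \<omega>)\<^sup>2) + ennreal (1 / r) * ennreal (?a \<omega> ^ 4) + ennreal (1 / r) * ennreal (Y \<omega>) \<partial>M)"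
  proof (intro nn_integral_cong)
    fix \<omega> assume "\<omega> \<in> space M"
    then have "0 \<le> Y \<omega>" by (rule Y(3))
    then show "ennreal (increment_scale u v \<omega>) = ennreal (h * r) + ennreal r * ennreal ((?a \<omega>)\<^sup>2) + ennreal (1 / r) * ennreal (?a \<omega> ^ 4) + ennreal (1 / r) * ennreal (Y \<omega>)"
      using h r unfolding increment_scale_def Y_def[symmetric] h_def[symmetric] r_def[symmetric]
      by (simp add: ennreal_mult[symmetric] ennreal_plus[symmetric] del: ennreal_plus)
  qed
  also have "\<dots> = ennreal (h * r) + ennreal r * (\<integral>\<^sup>+\<omega>. ennreal ((?a \<omega>)\<^sup>2) \<partial>M) + ennreal (1 / r) * (\<integral>\<^sup>+\<omega>. ennreal (?a \<omega> ^ 4) \<partial>M) + ennreal (1 / r) * (\<integral>\<^sup>+\<omega>. ennreal (Y \<omega>) \<partial>M)"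
    by (simp add: nn_integral_add nn_integral_cmult emeasure_space_1)
  also have "\<dots> \<le> ennreal (h * r) + ennreal r * ennreal (?n * h) + ennreal (1 / r) * ennreal (3 * ?n\<^sup>2 * h\<^sup>2) + ennreal (1 / r) * ennreal (?n * h\<^sup>2)"
    using B_increment_second_moment[OF uv(1) less_imp_le[OF uv(2)] uv(3)]
      B_increment_fourth_moment[OF uv(1) less_imp_le[OF uv(2)] uv(3)] Y(2)
    by (intro add_mono mult_left_mono) (auto simp: h_def)
  also have "\<dots> = ennreal (h * r + r * (?n * h) + 1 / r * (3 * ?n\<^sup>2 * h\<^sup>2) + 1 / r * (?n * h\<^sup>2))"
    using h r by (simp add: ennreal_mult[symmetric] ennreal_plus[symmetric] del: ennreal_plus)
  also have "h * r + r * (?n * h) + 1 / r * (3 * ?n\<^sup>2 * h\<^sup>2) + 1 / r * (?n * h\<^sup>2) = (1 + 2 * ?n + 3 * ?n\<^sup>2) * (h * r)"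
  proof -
    have "h\<^sup>2 / r = h * r" using r by (simp add: power2_eq_square r(2)[symmetric])
    then have "1 / r * (x * h\<^sup>2) = x * (h * r)" for x by (metis times_divide_eq_right mult.left_commute mult_1_left times_divide_eq_left)
    from this[of "3 * ?n\<^sup>2"] this[of ?n] show ?thesis by (simp only:) (simp add: algebra_simps)
  qed
  finally show ?thesis by (simp add: h_def r_def)
qed

lemma N_increment_bound:
  "\<exists>c\<ge>0. \<forall>u v A. t0 \<le> u \<and> u < v \<and> v \<le> T \<and> A \<in> sets (F u) \<longrightarrow>
     \<bar>\<integral>\<omega>. indicator A \<omega> * (N v \<omega> - N u \<omega>) \<partial>M\<bar> \<le> c * ((v - u) * sqrt (v - u))"
proof -
  obtain c where c: "c \<ge> 0" "\<And>\<omega> u v. \<omega> \<in> space M \<Longrightarrow> t0 \<le> u \<Longrightarrow> u < v \<Longrightarrow> v \<le> T \<Longrightarrow>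
     \<bar>N v \<omega> - N u \<omega> - main_part u v \<omega>\<bar> \<le> c * increment_scale u v \<omega>"
    using remainder_bound by blast
  let ?k = "1 + 2 * real CARD('n) + 3 * (real CARD('n))\<^sup>2"
  have "\<bar>\<integral>\<omega>. indicator A \<omega> * (N v \<omega> - N u \<omega>) \<partial>M\<bar> \<le> (c * ?k) * ((v - u) * sqrt (v - u))"
    if uv: "t0 \<le> u" "u < v" "v \<le> T" and A: "A \<in> sets (F u)" for u v A
  proof -
    let ?\<rho> = "\<lambda>\<omega>. indicator A \<omega> * (N v \<omega> - N u \<omega>) - indicator A \<omega> * main_part u v \<omega>"
    have A': "A \<in> sets M" using A sets_F_subset by auto
    note m = main_part_orthogonal[OF uv(1) less_imp_le[OF uv(2)] uv(3) A]
    have iN: "integrable M (\<lambda>\<omega>. indicator A \<omega> * (N v \<omega> - N u \<omega>))"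
      using integrable_mult_indicator[OF A', of "\<lambda>\<omega>. N v \<omega> - N u \<omega>"] N_integrable[of u] N_integrable[of v] uv by simp
    then have i\<rho>: "integrable M ?\<rho>" using m(1) by (rule Bochner_Integration.integrable_diff)
    have eq: "(\<integral>\<omega>. indicator A \<omega> * (N v \<omega> - N u \<omega>) \<partial>M) = (\<integral>\<omega>. ?\<rho> \<omega> \<partial>M)"
      by (subst Bochner_Integration.integral_diff[OF iN m(1)]) (simp add: m(2))
    have "ennreal (\<bar>\<integral>\<omega>. ?\<rho> \<omega> \<partial>M\<bar>) \<le> (\<integral>\<^sup>+\<omega>. ennreal \<bar>?\<rho> \<omega>\<bar> \<partial>M)"
      using integral_norm_bound_ennreal[OF i\<rho>] by simp
    also have "\<dots> \<le> (\<integral>\<^sup>+\<omega>. ennreal c * ennreal (increment_scale u v \<omega>) \<partial>M)"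
    proof (intro nn_integral_mono)
      fix \<omega> assume \<omega>: "\<omega> \<in> space M"
      have "\<bar>?\<rho> \<omega>\<bar> \<le> \<bar>N v \<omega> - N u \<omega> - main_part u v \<omega>\<bar>" by (simp add: indicator_def)
      also have "\<dots> \<le> c * increment_scale u v \<omega>" using c(2)[OF \<omega> uv] .
      finally show "ennreal \<bar>?\<rho> \<omega>\<bar> \<le> ennreal c * ennreal (increment_scale u v \<omega>)"
        using c(1) by (simp add: ennreal_mult'[symmetric] ennreal_leI)
    qed
    also have "\<dots> = ennreal c * (\<integral>\<^sup>+\<omega>. ennreal (increment_scale u v \<omega>) \<partial>M)"
    proof (rule nn_integral_cmult)
      have [measurable]: "(\<lambda>\<omega>. integral {u..v} (\<lambda>s. (norm (B s \<omega> - B u \<omega>))\<^sup>2)) \<in> borel_measurable M"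
        using uv \<delta> by (intro B_increment_integral_moment(1)) auto
      show "(\<lambda>\<omega>. ennreal (increment_scale u v \<omega>)) \<in> borel_measurable M"
        unfolding increment_scale_def by measurable
    qed
    also have "\<dots> \<le> ennreal c * ennreal (?k * ((v - u) * sqrt (v - u)))"
      using uv \<delta> by (intro mult_left_mono increment_scale_moment) auto
    also have "\<dots> = ennreal (c * ?k * ((v - u) * sqrt (v - u)))"
      using c(1) by (simp add: ennreal_mult'[symmetric] mult.assoc)
    finally have "ennreal \<bar>\<integral>\<omega>. ?\<rho> \<omega> \<partial>M\<bar> \<le> ennreal (c * ?k * ((v - u) * sqrt (v - u)))" .
    then show ?thesis
      unfolding eq using c(1) uv by (subst (asm) ennreal_le_iff) auto
  qed
  moreover have "0 \<le> c * ?k" using c(1) by simp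
  ultimately show ?thesis by blast
qed

text \<open>Over a partition of \<open>[s, t]\<close> into pieces of length \<open>d\<close>, the increments contribute at most
  a constant times \<open>d sqrt d\<close> each, hence \<open>(t - s) sqrt d\<close> in total, which tends to 0.\<close>

lemma N_martingale:
  assumes st: "t0 \<le> s" "s \<le> t" "t \<le> T" and A: "A \<in> sets (F s)"
  shows "(\<integral>\<omega>. indicator A \<omega> * (N t \<omega> - N s \<omega>) \<partial>M) = 0"
proof (cases "s = t")
  case False
  then have lt: "s < t" using st by simp
  obtain c where c: "c \<ge> 0" "\<And>u v A. t0 \<le> u \<Longrightarrow> u < v \<Longrightarrow> v \<le> T \<Longrightarrow> A \<in> sets (F u) \<Longrightarrow>
     \<bar>\<integral>\<omega>. indicator A \<omega> * (N v \<omega> - N u \<omega>) \<partial>M\<bar> \<le> c * ((v - u) * sqrt (v - u))"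
    using N_increment_bound by blast
  have A': "A \<in> sets M" using A sets_F_subset by auto
  let ?I = "\<bar>\<integral>\<omega>. indicator A \<omega> * (N t \<omega> - N s \<omega>) \<partial>M\<bar>"
  have bound: "?I \<le> c * (t - s) * sqrt ((t - s) * inverse (real (Suc m)))" for m
  proof -
    define k where "k = real (Suc m)"
    define d where "d = (t - s) * inverse k"
    define p where "p l = s + real l * d" for l
    have k: "0 < k" by (simp add: k_def)
    have d: "0 < d" "k * d = t - s" using lt k by (auto simp: d_def)
    have p_end: "p 0 = s" "p (Suc m) = t" using d(2) by (auto simp: p_def k_def)
    have p_range: "t0 \<le> p l" "s \<le> p l" for l using st d(1) by (auto simp: p_def intro: add_increasing2)
    have p_top: "p l \<le> T" if "l \<le> Suc m" for l
    proof -
      have "real l * d \<le> k * d" using that d(1) by (intro mult_right_mono) (auto simp: k_def)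
      then show ?thesis using d(2) st by (simp add: p_def)
    qed
    have p_step: "p (Suc l) - p l = d" for l by (simp add: p_def algebra_simps)
    have int: "integrable M (\<lambda>\<omega>. indicator A \<omega> * (N (p (Suc l)) \<omega> - N (p l) \<omega>))" if "l < Suc m" for l
      using integrable_mult_indicator[OF A', of "\<lambda>\<omega>. N (p (Suc l)) \<omega> - N (p l) \<omega>"] N_integrable[of "p l"] N_integrable[of "p (Suc l)"]
        p_range p_top[of l] p_top[of "Suc l"] that by simp
    have "(\<integral>\<omega>. indicator A \<omega> * (N t \<omega> - N s \<omega>) \<partial>M) = (\<integral>\<omega>. (\<Sum>l<Suc m. indicator A \<omega> * (N (p (Suc l)) \<omega> - N (p l) \<omega>)) \<partial>M)"
      unfolding sum_distrib_left[symmetric] sum_lessThan_telescope[of "\<lambda>l. N (p l) _"] p_end ..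
    also have "\<dots> = (\<Sum>l<Suc m. \<integral>\<omega>. indicator A \<omega> * (N (p (Suc l)) \<omega> - N (p l) \<omega>) \<partial>M)"
      by (intro Bochner_Integration.integral_sum int) simp
    finally have "?I = \<bar>\<Sum>l<Suc m. \<integral>\<omega>. indicator A \<omega> * (N (p (Suc l)) \<omega> - N (p l) \<omega>) \<partial>M\<bar>"
      by (rule arg_cong[where f = abs])
    also have "\<dots> \<le> (\<Sum>l<Suc m. c * (d * sqrt d))"
    proof (intro order_trans[OF sum_abs] sum_mono)
      fix l assume "l \<in> {..<Suc m}"
      then have l: "l < Suc m" by simp
      have "A \<in> sets (F (p l))" using A sets_F_mono[OF p_range(2)[of l]] by auto
      moreover have "p l < p (Suc l)" using d(1) p_step[of l] by linarith
      moreover have "p (Suc l) \<le> T" by (rule p_top) (use l in simp)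
      ultimately have "\<bar>\<integral>\<omega>. indicator A \<omega> * (N (p (Suc l)) \<omega> - N (p l) \<omega>) \<partial>M\<bar> \<le> c * ((p (Suc l) - p l) * sqrt (p (Suc l) - p l))"
        using p_range(1)[of l] by (intro c(2))
      then show "\<bar>\<integral>\<omega>. indicator A \<omega> * (N (p (Suc l)) \<omega> - N (p l) \<omega>) \<partial>M\<bar> \<le> c * (d * sqrt d)"
        by (simp only: p_step)
    qed
    also have "\<dots> = c * (k * d) * sqrt d" by (simp add: k_def mult.assoc mult.left_commute)
    finally show ?thesis unfolding d(2) by (simp add: d_def k_def)
  qed
  have "(\<lambda>m. c * (t - s) * sqrt ((t - s) * inverse (real (Suc m)))) \<longlonglongrightarrow> c * (t - s) * sqrt ((t - s) * 0)"
    by (intro tendsto_intros LIMSEQ_inverse_real_of_nat)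
  then have "?I \<le> c * (t - s) * sqrt ((t - s) * 0)"
    by (rule LIMSEQ_le_const) (use bound in blast)
  then show ?thesis by simp
qed simp

end

section \<open>Optional stopping\<close>

text \<open>\<open>L m\<close> is the index of the first grid point that is not before \<open>\<sigma>\<close>, capped at the last one.
  Stopping there is decided by the values \<open>p m l < \<sigma>\<close>, which are known at the time \<open>p m l\<close>.\<close>

lemma grid_stop_limit:
  fixes s t \<sigma> :: real
  assumes st: "s < t"
  defines "p \<equiv> \<lambda>m l. s + real l * ((t - s) / real (Suc m))"
  defines "L \<equiv> \<lambda>m. min (Suc m) (nat \<lceil>(\<sigma> - s) / ((t - s) / real (Suc m))\<rceil>)"
  shows "l < Suc m \<Longrightarrow> p m l < \<sigma> \<longleftrightarrow> l < L m"
    and "(\<lambda>m. p m (L m)) \<longlonglongrightarrow> max s (min t \<sigma>)"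
    and "s \<le> p m (L m)" "p m (L m) \<le> t"
proof -
  define d where "d m = (t - s) / real (Suc m)" for m
  have d: "0 < d m" for m using st by (simp add: d_def)
  have kd: "real (Suc m) * d m = t - s" for m by (simp add: d_def)
  show "p m l < \<sigma> \<longleftrightarrow> l < L m" if "l < Suc m"
  proof -
    have "p m l < \<sigma> \<longleftrightarrow> real l < (\<sigma> - s) / d m"
      unfolding p_def d_def[symmetric] using d[of m] by (simp add: pos_less_divide_eq algebra_simps)
    also have "\<dots> \<longleftrightarrow> int l < \<lceil>(\<sigma> - s) / d m\<rceil>"
      by (simp add: less_ceiling_iff)
    also have "\<dots> \<longleftrightarrow> l < L m" using that unfolding L_def d_def[symmetric] by auto
    finally show ?thesis .
  qed
  show "s \<le> p m (L m)" unfolding p_def d_def[symmetric] using d[of m] by simp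
  show "p m (L m) \<le> t"
  proof -
    have "real (L m) * d m \<le> real (Suc m) * d m" using d[of m] by (intro mult_right_mono) (auto simp: L_def)
    then show ?thesis unfolding kd by (simp add: p_def d_def)
  qed
  have near: "\<bar>p m (L m) - max s (min t \<sigma>)\<bar> \<le> d m" for m
  proof -
    define x where "x = (\<sigma> - s) / d m"
    have \<sigma>: "\<sigma> = s + x * d m" using d[of m] by (simp add: x_def)
    have "t = s + real (Suc m) * d m" unfolding kd by simp
    then have mm: "max s (min t \<sigma>) = s + max 0 (min (real (Suc m)) x) * d m"
      using d[of m] unfolding \<sigma> by (auto simp: max_def min_def mult_le_0_iff zero_le_mult_iff)
    have "\<bar>real (L m) - max 0 (min (real (Suc m)) x)\<bar> \<le> 1"
      unfolding L_def d_def[symmetric] x_def[symmetric] by (cases "0 \<le> \<lceil>x\<rceil>") (auto simp: min_def max_def, linarith+)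
    then have "\<bar>real (L m) - max 0 (min (real (Suc m)) x)\<bar> * d m \<le> 1 * d m"
      using d[of m] by (intro mult_right_mono) auto
    moreover have "p m (L m) - max s (min t \<sigma>) = (real (L m) - max 0 (min (real (Suc m)) x)) * d m"
      unfolding mm p_def d_def[symmetric] by (simp add: algebra_simps)
    ultimately show ?thesis using d[of m] by (simp add: abs_mult)
  qed
  have "d \<longlonglongrightarrow> 0"
    using tendsto_mult[OF tendsto_const[of "t - s"] LIMSEQ_inverse_real_of_nat] by (simp add: d_def[abs_def] divide_inverse)
  then have "(\<lambda>m. p m (L m) - max s (min t \<sigma>)) \<longlonglongrightarrow> 0"
    by (rule Lim_null_comparison[rotated]) (use near in auto)
  then show "(\<lambda>m. p m (L m)) \<longlonglongrightarrow> max s (min t \<sigma>)" by (simp add: LIM_zero_iff)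
qed

text \<open>The increment of \<open>N\<close> stopped at the first grid point not before \<open>\<sigma>\<close> is the sum of the grid
  increments that start before \<open>\<sigma>\<close>, and each of these is orthogonal to \<open>A\<close> intersected with the
  event that \<open>\<sigma>\<close> has not occurred. Refining the grid and dominated convergence give the claim.\<close>

lemma (in usual_filtered_space) optional_stopping:
  fixes N :: "real \<Rightarrow> 'w \<Rightarrow> real"
  assumes N: "\<And>t. t \<in> {a..b} \<Longrightarrow> integrable M (N t)"
    and cont: "\<And>\<omega>. \<omega> \<in> space M \<Longrightarrow> continuous_on {a..b} (\<lambda>t. N t \<omega>)"
    and D: "integrable M D" "\<And>t \<omega>. t \<in> {a..b} \<Longrightarrow> \<omega> \<in> space M \<Longrightarrow> \<bar>N t \<omega>\<bar> \<le> D \<omega>"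
    and mart: "\<And>s t A. a \<le> s \<Longrightarrow> s \<le> t \<Longrightarrow> t \<le> b \<Longrightarrow> A \<in> sets (F s) \<Longrightarrow> (\<integral>\<omega>. indicator A \<omega> * (N t \<omega> - N s \<omega>) \<partial>M) = 0"
    and \<sigma>: "stopping_time F \<sigma>"
    and st: "a \<le> s" "s \<le> t" "t \<le> b" and A: "A \<in> sets (F s)"
  shows "(\<integral>\<omega>. indicator A \<omega> * (N (min t (\<sigma> \<omega>)) \<omega> - N (min s (\<sigma> \<omega>)) \<omega>) \<partial>M) = 0"
proof (cases "s = t")
  case False
  then have lt: "s < t" using st by simp
  have FM: "sets (F u) \<subseteq> sets M" "space (F u) = space M" for u
    using filtration_subalgebra[of u] by (auto simp: subalgebra_def)
  have [measurable]: "A \<in> sets M" using A FM by auto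
  define p where "p m l = s + real l * ((t - s) / real (Suc m))" for m l
  define Z where "Z m \<omega> = (\<Sum>l<Suc m. (if p m l < \<sigma> \<omega> then N (p m (Suc l)) \<omega> - N (p m l) \<omega> else 0))" for m \<omega>
  define Lm where "Lm m \<omega> = min (Suc m) (nat \<lceil>(\<sigma> \<omega> - s) / ((t - s) / real (Suc m))\<rceil>)" for m \<omega>
  have p_range: "p m l \<in> {s..t}" if "l \<le> Suc m" for m l
  proof -
    have "real l * ((t - s) / real (Suc m)) \<le> real (Suc m) * ((t - s) / real (Suc m))"
      using that lt by (intro mult_right_mono) auto
    then show ?thesis using lt by (simp add: p_def)
  qed
  have p_ab: "p m l \<in> {a..b}" if "l \<le> Suc m" for m l using p_range[OF that] st by auto
  \<comment> \<open>The indicators of \<open>p m l < \<sigma>\<close> are those of \<open>l < Lm m\<close>, so the sum telescopes.\<close>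
  have Z_eq: "Z m \<omega> = N (p m (Lm m \<omega>)) \<omega> - N s \<omega>" for m \<omega>
  proof -
    have "Z m \<omega> = (\<Sum>l<Suc m. (if l < Lm m \<omega> then N (p m (Suc l)) \<omega> - N (p m l) \<omega> else 0))"
      unfolding Z_def Lm_def p_def using grid_stop_limit(1)[OF lt, of _ m "\<sigma> \<omega>"] by (intro sum.cong refl) simp
    also have "\<dots> = (\<Sum>l\<in>{..<Suc m} \<inter> {..<Lm m \<omega>}. N (p m (Suc l)) \<omega> - N (p m l) \<omega>)"
      by (subst sum.inter_restrict) auto
    also have "{..<Suc m} \<inter> {..<Lm m \<omega>} = {..<Lm m \<omega>}" by (auto simp: Lm_def)
    also have "(\<Sum>l<Lm m \<omega>. N (p m (Suc l)) \<omega> - N (p m l) \<omega>) = N (p m (Lm m \<omega>)) \<omega> - N (p m 0) \<omega>"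
      by (rule sum_lessThan_telescope)
    finally show ?thesis by (simp add: p_def)
  qed
  have stop_set: "A \<inter> {\<omega> \<in> space M. p m l < \<sigma> \<omega>} \<in> sets (F (p m l))" if "l \<le> Suc m" for m l
  proof -
    have "{\<omega> \<in> space (F (p m l)). p m l < \<sigma> \<omega>} \<in> sets (F (p m l))"
      using stopping_timeD2[OF \<sigma>, of "p m l"] by (simp add: pred_def)
    moreover have "A \<in> sets (F (p m l))" using A sets_F_mono[of s "p m l"] p_range[OF that] by auto
    ultimately show ?thesis using FM(2) by auto
  qed
  have term_eq: "indicator A \<omega> * (if p m l < \<sigma> \<omega> then y else 0) = indicator (A \<inter> {\<omega> \<in> space M. p m l < \<sigma> \<omega>}) \<omega> * y"
    if "\<omega> \<in> space M" for m l \<omega> and y :: real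
    using that by (simp add: indicator_def)
  have term_int: "integrable M (\<lambda>\<omega>. indicator (A \<inter> {\<omega> \<in> space M. p m l < \<sigma> \<omega>}) \<omega> * (N (p m (Suc l)) \<omega> - N (p m l) \<omega>))" if "l < Suc m" for m l
    using integrable_mult_indicator[OF subsetD[OF FM(1) stop_set[of l m]], of "\<lambda>\<omega>. N (p m (Suc l)) \<omega> - N (p m l) \<omega>"]
      N[OF p_ab[of l m]] N[OF p_ab[of "Suc l" m]] that by simp
  have AZ: "indicator A \<omega> * Z m \<omega> = (\<Sum>l<Suc m. indicator (A \<inter> {\<omega> \<in> space M. p m l < \<sigma> \<omega>}) \<omega> * (N (p m (Suc l)) \<omega> - N (p m l) \<omega>))"
    if "\<omega> \<in> space M" for m \<omega>
    unfolding Z_def sum_distrib_left by (intro sum.cong refl term_eq that)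
  have Z0: "(\<integral>\<omega>. indicator A \<omega> * Z m \<omega> \<partial>M) = 0" for m
  proof -
    have "(\<integral>\<omega>. indicator A \<omega> * Z m \<omega> \<partial>M) = (\<integral>\<omega>. (\<Sum>l<Suc m. indicator (A \<inter> {\<omega> \<in> space M. p m l < \<sigma> \<omega>}) \<omega> * (N (p m (Suc l)) \<omega> - N (p m l) \<omega>)) \<partial>M)"
      by (intro Bochner_Integration.integral_cong refl AZ)
    also have "\<dots> = (\<Sum>l<Suc m. \<integral>\<omega>. indicator (A \<inter> {\<omega> \<in> space M. p m l < \<sigma> \<omega>}) \<omega> * (N (p m (Suc l)) \<omega> - N (p m l) \<omega>) \<partial>M)"
      by (intro Bochner_Integration.integral_sum term_int) simp
    also have "\<dots> = 0"
    proof (intro sum.neutral ballI)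
      fix l assume "l \<in> {..<Suc m}"
      then have l: "l \<le> Suc m" "Suc l \<le> Suc m" by auto
      have "p m l \<le> p m (Suc l)" using lt by (simp add: p_def divide_right_mono mult_right_mono)
      then show "(\<integral>\<omega>. indicator (A \<inter> {\<omega> \<in> space M. p m l < \<sigma> \<omega>}) \<omega> * (N (p m (Suc l)) \<omega> - N (p m l) \<omega>) \<partial>M) = 0"
        using p_ab[OF l(1)] p_ab[OF l(2)] by (intro mart stop_set l) auto
    qed
    finally show ?thesis .
  qed
  have Z_lim: "(\<lambda>m. Z m \<omega>) \<longlonglongrightarrow> N (min t (\<sigma> \<omega>)) \<omega> - N (min s (\<sigma> \<omega>)) \<omega>" if \<omega>: "\<omega> \<in> space M" for \<omega>
  proof -
    have "(\<lambda>m. p m (Lm m \<omega>)) \<longlonglongrightarrow> max s (min t (\<sigma> \<omega>))"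
      unfolding p_def Lm_def by (rule grid_stop_limit(2)[OF lt])
    moreover have "max s (min t (\<sigma> \<omega>)) \<in> {a..b}" using st by auto
    moreover have "p m (Lm m \<omega>) \<in> {a..b}" for m by (intro p_ab) (simp add: Lm_def)
    ultimately have "(\<lambda>m. N (p m (Lm m \<omega>)) \<omega>) \<longlonglongrightarrow> N (max s (min t (\<sigma> \<omega>))) \<omega>"
      using cont[OF \<omega>] by (auto simp: continuous_on_sequentially o_def)
    then have "(\<lambda>m. Z m \<omega>) \<longlonglongrightarrow> N (max s (min t (\<sigma> \<omega>))) \<omega> - N s \<omega>"
      unfolding Z_eq by (intro tendsto_intros)
    moreover have "N (max s (min t (\<sigma> \<omega>))) \<omega> - N s \<omega> = N (min t (\<sigma> \<omega>)) \<omega> - N (min s (\<sigma> \<omega>)) \<omega>"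
      using lt by (cases "s \<le> \<sigma> \<omega>") (auto simp: max_def min_def)
    ultimately show ?thesis by simp
  qed
  have Z_meas: "(\<lambda>\<omega>. indicator A \<omega> * Z m \<omega>) \<in> borel_measurable M" for m
  proof -
    have "(\<lambda>\<omega>. (\<Sum>l<Suc m. indicator (A \<inter> {\<omega> \<in> space M. p m l < \<sigma> \<omega>}) \<omega> * (N (p m (Suc l)) \<omega> - N (p m l) \<omega>))) \<in> borel_measurable M"
      by (intro borel_measurable_sum borel_measurable_integrable[OF term_int]) simp
    then show ?thesis by (subst measurable_cong[OF AZ])
  qed
  have AZ_lim: "(\<lambda>m. indicator A \<omega> * Z m \<omega>) \<longlonglongrightarrow> indicator A \<omega> * (N (min t (\<sigma> \<omega>)) \<omega> - N (min s (\<sigma> \<omega>)) \<omega>)" if "\<omega> \<in> space M" for \<omega>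
    by (intro tendsto_mult tendsto_const Z_lim that)
  have "(\<lambda>m. \<integral>\<omega>. indicator A \<omega> * Z m \<omega> \<partial>M) \<longlonglongrightarrow> (\<integral>\<omega>. indicator A \<omega> * (N (min t (\<sigma> \<omega>)) \<omega> - N (min s (\<sigma> \<omega>)) \<omega>) \<partial>M)"
  proof (rule integral_dominated_convergence[where w = "\<lambda>\<omega>. 2 * D \<omega>"])
    show "(\<lambda>\<omega>. indicator A \<omega> * (N (min t (\<sigma> \<omega>)) \<omega> - N (min s (\<sigma> \<omega>)) \<omega>)) \<in> borel_measurable M"
      by (rule borel_measurable_LIMSEQ_real[OF AZ_lim Z_meas])
    show "AE \<omega> in M. norm (indicator A \<omega> * Z m \<omega>) \<le> 2 * D \<omega>" for m
    proof (intro AE_I2)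
      fix \<omega> assume \<omega>: "\<omega> \<in> space M"
      have "\<bar>Z m \<omega>\<bar> \<le> 2 * D \<omega>"
        unfolding Z_eq using D(2)[OF p_ab \<omega>, of "Lm m \<omega>" m] D(2)[of s \<omega>] \<omega> st by (simp add: Lm_def)
      then show "norm (indicator A \<omega> * Z m \<omega>) \<le> 2 * D \<omega>"
        using order_trans[OF abs_ge_zero, of "Z m \<omega>" "2 * D \<omega>"] by (simp add: indicator_def)
    qed
  qed (use D(1) Z_meas AZ_lim in auto)
  then show ?thesis unfolding Z0 by (simp add: LIMSEQ_const_iff)
qed simp

section \<open>Test functions\<close>

lemma finite_uniform_bound:
  fixes P :: "'i::finite \<Rightarrow> 'b \<Rightarrow> real"
  assumes "\<And>i. \<exists>c\<ge>0. \<forall>x. P i x \<le> c"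
  shows "\<exists>c\<ge>0. \<forall>i x. P i x \<le> c"
proof -
  have "\<forall>i. \<exists>c. 0 \<le> c \<and> (\<forall>x. P i x \<le> c)" using assms by blast
  from choice[OF this] obtain c where c: "\<forall>i. 0 \<le> c i \<and> (\<forall>x. P i x \<le> c i)" by (rule exE)
  have "P i x \<le> (\<Sum>i\<in>UNIV. c i)" for i x
  proof -
    have "c i \<le> (\<Sum>i\<in>UNIV. c i)" using c by (intro member_le_sum) auto
    with c show ?thesis by (meson order_trans)
  qed
  moreover have "0 \<le> (\<Sum>i\<in>UNIV. c i)" using c by (intro sum_nonneg) auto
  ultimately show ?thesis by blast
qed

lemma smooth_vanishing_dd:
  assumes "smooth f" "compact K" "\<And>x. x \<notin> K \<Longrightarrow> f x = 0" "x \<notin> K"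
  shows "dd e f x = 0"
proof -
  have "((\<lambda>_. 0) has_derivative (\<lambda>_. 0)) (at x)" by (rule has_derivative_const)
  then have "(f has_derivative (\<lambda>_. 0)) (at x)"
    by (rule has_derivative_transform_within_open[of _ _ _ _ "- K"])
       (use assms in \<open>auto simp: open_Compl compact_imp_closed\<close>)
  from frechet_derivative_at[OF this] show ?thesis by (simp add: dd_def fun_eq_iff)
qed

lemma smooth_compact_bounded:
  assumes "smooth f" "compact K" "\<And>x. x \<notin> K \<Longrightarrow> f x = 0"
  shows "\<exists>c\<ge>0. \<forall>x. \<bar>f x\<bar> \<le> c"
proof -
  have "compact (f ` K)"
    by (rule compact_continuous_image[OF continuous_on_subset[OF smooth_continuous[OF assms(1)] subset_UNIV] assms(2)])
  from compact_imp_bounded[OF this] obtain b where "\<forall>y\<in>f ` K. norm y \<le> b"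
    unfolding bounded_iff by (rule exE)
  then have b: "\<bar>f x\<bar> \<le> b" if "x \<in> K" for x
    using that by simp
  have "\<bar>f x\<bar> \<le> \<bar>b\<bar>" for x
    using b[of x] assms(3)[of x] by (cases "x \<in> K") auto
  then show ?thesis by (intro exI[of _ "\<bar>b\<bar>"]) auto
qed

lemma partial_dd: "partial i f = dd (axis i 1) f"
  by (auto simp: partial_def dd_def)

lemma smooth_partial: "smooth f \<Longrightarrow> smooth (partial i f)"
  unfolding partial_dd by (rule smooth_dd) (auto simp: axis_in_Basis_iff)

lemma dd_partial_sum:
  fixes f :: "real^'n \<Rightarrow> real"
  assumes "smooth f"
  shows "dd v f x = (\<Sum>i\<in>UNIV. v $ i * partial i f x)"
proof -
  have v: "v = (\<Sum>i\<in>UNIV. (v $ i) *\<^sub>R axis i 1)"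
    using basis_expansion[of v] by (simp add: scalar_mult_eq_scaleR)
  interpret linear "\<lambda>v. dd v f x" by (rule dd_linear[OF assms])
  show ?thesis
    by (subst v) (simp only: sum scaleR real_scaleR_def partial_dd)
qed

lemma smooth_partial_line_derivative:
  fixes f :: "real^'n \<Rightarrow> real"
  assumes "smooth f"
  shows "((\<lambda>s. f (x + s *\<^sub>R v)) has_real_derivative (\<Sum>i\<in>UNIV. v $ i * partial i f (x + s *\<^sub>R v))) (at s within A)"
  using smooth_line_derivative[OF assms, of x v s A] by (simp add: dd_partial_sum[OF assms])

lemma abs_vec_sum_le:
  fixes v :: "real^'n"
  assumes "\<And>i. \<bar>a i\<bar> \<le> c"
  shows "\<bar>\<Sum>i\<in>UNIV. v $ i * a i\<bar> \<le> real CARD('n) * (norm v * c)"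
  by (rule abs_sum_mult_le) (auto intro: component_le_norm_cart assms)

lemma smooth_lipschitz:
  fixes f :: "real^'n \<Rightarrow> real"
  assumes f: "smooth f" and c: "\<And>i x. \<bar>partial i f x\<bar> \<le> c"
  shows "\<bar>f x - f y\<bar> \<le> (real CARD('n) * c) * norm (x - y)"
proof -
  let ?\<phi> = "\<lambda>s. f (y + s *\<^sub>R (x - y))"
  have "\<exists>s>0. s < 1 \<and> ?\<phi> 1 - ?\<phi> 0 = (1 - 0) * (\<Sum>i\<in>UNIV. (x - y) $ i * partial i f (y + s *\<^sub>R (x - y)))"
    by (rule MVT2) (simp, rule smooth_partial_line_derivative[OF f])
  then obtain s where s: "?\<phi> 1 - ?\<phi> 0 = (1 - 0) * (\<Sum>i\<in>UNIV. (x - y) $ i * partial i f (y + s *\<^sub>R (x - y)))"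
    by (elim exE conjE)
  then have "f x - f y = (\<Sum>i\<in>UNIV. (x - y) $ i * partial i f (y + s *\<^sub>R (x - y)))" by simp
  then show ?thesis
    using abs_vec_sum_le[OF c, of "x - y" "\<lambda>i. i" "\<lambda>_. y + s *\<^sub>R (x - y)"] by (simp add: mult_ac)
qed

text \<open>Taylor's formula on the segment from \<open>x\<close> to \<open>x + v\<close>, with the second derivative taken at
  an intermediate point. The Lipschitz constant of the second derivatives turns that into a
  cubic error.\<close>

lemma smooth_test_function:
  fixes f :: "real^'n \<Rightarrow> real"
  assumes f: "smooth f" and K: "compact K" "\<And>x. x \<notin> K \<Longrightarrow> f x = 0"
  shows "\<exists>C. test_function f (\<lambda>i. partial i f) (\<lambda>i j. partial i (partial j f)) C"
proof -
  let ?n = "real CARD('n)"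
  have f1: "smooth (partial i f)" for i by (rule smooth_partial[OF f])
  have f2: "smooth (partial i (partial j f))" for i j by (rule smooth_partial[OF f1])
  have f3: "smooth (partial k (partial i (partial j f)))" for i j k by (rule smooth_partial[OF f2])
  have v1: "partial i f x = 0" if "x \<notin> K" for i x
    unfolding partial_dd by (rule smooth_vanishing_dd[OF f K that])
  have v2: "partial i (partial j f) x = 0" if "x \<notin> K" for i j x
    unfolding partial_dd[of i] by (rule smooth_vanishing_dd[OF f1 K(1) v1 that])
  have v3: "partial k (partial i (partial j f)) x = 0" if "x \<notin> K" for i j k x
    unfolding partial_dd[of k] by (rule smooth_vanishing_dd[OF f2 K(1) v2 that])
  obtain c0 where c0': "c0 \<ge> 0" "\<forall>x. \<bar>f x\<bar> \<le> c0" using smooth_compact_bounded[OF f K(1)] K(2) by blast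
  have c0: "c0 \<ge> 0" "\<bar>f x\<bar> \<le> c0" for x using c0' by auto
  have "\<exists>c\<ge>0. \<forall>p x. \<bar>partial (fst p) (partial (snd p) f) x\<bar> \<le> c"
    by (rule finite_uniform_bound, rule smooth_compact_bounded[OF f2 K(1) v2])
  then obtain c2 where c2': "c2 \<ge> 0" "\<forall>p x. \<bar>partial (fst p) (partial (snd p) f) x\<bar> \<le> c2" by (elim exE conjE)
  have c2: "c2 \<ge> 0" "\<bar>partial i (partial j f) x\<bar> \<le> c2" for i j x
    using c2'(1) c2'(2)[rule_format, of "(i, j)" x] by auto
  have "\<exists>c\<ge>0. \<forall>p x. \<bar>partial (fst p) (partial (fst (snd p)) (partial (snd (snd p)) f)) x\<bar> \<le> c"
    by (rule finite_uniform_bound, rule smooth_compact_bounded[OF f3 K(1) v3])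
  then obtain c3 where c3': "c3 \<ge> 0" "\<forall>p x. \<bar>partial (fst p) (partial (fst (snd p)) (partial (snd (snd p)) f)) x\<bar> \<le> c3" by (elim exE conjE)
  have c3: "c3 \<ge> 0" "\<bar>partial k (partial i (partial j f)) x\<bar> \<le> c3" for k i j x
    using c3'(1) c3'(2)[rule_format, of "(k, i, j)" x] by auto
  define C where "C = c0 + c2 + ?n * c2 + ?n * c3 + ?n * (?n * (?n * c3))"
  have nn: "0 \<le> ?n * c2" "0 \<le> ?n * c3" "0 \<le> ?n * (?n * (?n * c3))" using c2 c3 by auto
  have C: "0 \<le> C" "c0 \<le> C" "c2 \<le> C" "?n * c2 \<le> C" "?n * c3 \<le> C" "?n * (?n * (?n * c3)) \<le> C"
    unfolding C_def using nn c0(1) c2(1) by linarith+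
  have gl: "\<bar>partial i f x - partial i f y\<bar> \<le> (?n * c2) * norm (x - y)" for i x y
    by (rule smooth_lipschitz[OF f1 c2(2)])
  have Hl: "\<bar>partial i (partial j f) x - partial i (partial j f) y\<bar> \<le> (?n * c3) * norm (x - y)" for i j x y
    by (rule smooth_lipschitz[OF f2 c3(2)])
  have "test_function f (\<lambda>i. partial i f) (\<lambda>i j. partial i (partial j f)) C"
  proof
    fix x v :: "real^'n"
    define \<phi>0 where "\<phi>0 s = f (x + s *\<^sub>R v)" for s
    define \<phi>1 where "\<phi>1 s = (\<Sum>i\<in>UNIV. v $ i * partial i f (x + s *\<^sub>R v))" for s
    define \<phi>2 where "\<phi>2 s = (\<Sum>i\<in>UNIV. v $ i * (\<Sum>j\<in>UNIV. v $ j * partial j (partial i f) (x + s *\<^sub>R v)))" for s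
    have d0: "(\<phi>0 has_real_derivative \<phi>1 s) (at s)" for s
      unfolding \<phi>0_def \<phi>1_def by (rule smooth_partial_line_derivative[OF f])
    have d1: "(\<phi>1 has_real_derivative \<phi>2 s) (at s)" for s
      unfolding \<phi>1_def \<phi>2_def by (intro DERIV_sum DERIV_cmult smooth_partial_line_derivative f1)
    have "\<exists>t>0. t < 1 \<and> \<phi>0 1 = (\<Sum>m<2. (\<lambda>k. [\<phi>0, \<phi>1, \<phi>2] ! k) m 0 / fact m * 1 ^ m) + (\<lambda>k. [\<phi>0, \<phi>1, \<phi>2] ! k) 2 t / fact 2 * 1 ^ 2"
      by (rule Maclaurin) (auto simp: less_Suc_eq numeral_2_eq_2 d0 d1)
    then obtain t where t: "0 < t" "t < 1" "\<phi>0 1 = \<phi>0 0 + \<phi>1 0 + \<phi>2 t / 2"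
      by (auto simp: numeral_2_eq_2)
    have dt: "\<bar>\<phi>2 t - \<phi>2 0\<bar> \<le> ?n * (?n * (?n * c3)) * norm v ^ 3"
    proof -
      have "\<phi>2 t - \<phi>2 0 = (\<Sum>i\<in>UNIV. v $ i * (\<Sum>j\<in>UNIV. v $ j * (partial j (partial i f) (x + t *\<^sub>R v) - partial j (partial i f) x)))"
        unfolding \<phi>2_def by (simp add: sum_subtractf right_diff_distrib)
      also have "\<bar>\<dots>\<bar> \<le> ?n * (norm v * (?n * (norm v * (?n * c3 * norm v))))"
      proof (intro abs_vec_sum_le)
        fix i j
        have "\<bar>partial j (partial i f) (x + t *\<^sub>R v) - partial j (partial i f) x\<bar> \<le> (?n * c3) * norm (t *\<^sub>R v)"
          using Hl[of j i "x + t *\<^sub>R v" x] by simp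
        also have "\<dots> \<le> ?n * c3 * norm v"
          using t c3(1) mult_right_mono[of t 1 "norm v"] by (intro mult_left_mono) auto
        finally show "\<bar>partial j (partial i f) (x + t *\<^sub>R v) - partial j (partial i f) x\<bar> \<le> ?n * c3 * norm v" .
      qed
      finally show ?thesis by (simp add: power3_eq_cube mult_ac)
    qed
    \<comment> \<open>\<open>\<phi>2\<close> differentiates in the opposite order from the Hessian entries; the double sum over
      \<open>i\<close> and \<open>j\<close> is symmetric.\<close>
    have H0: "(\<Sum>i\<in>UNIV. \<Sum>j\<in>UNIV. v $ i * v $ j * partial i (partial j f) x) = \<phi>2 0"
      unfolding \<phi>2_def by (subst sum.swap) (simp add: sum_distrib_left mult_ac)
    have "f (x + v) - f x - (\<Sum>i\<in>UNIV. v $ i * partial i f x) - (\<Sum>i\<in>UNIV. \<Sum>j\<in>UNIV. v $ i * v $ j * partial i (partial j f) x) / 2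
        = (\<phi>2 t - \<phi>2 0) / 2"
      using t(3) by (simp add: H0 \<phi>0_def \<phi>1_def diff_divide_distrib)
    moreover have "\<bar>(\<phi>2 t - \<phi>2 0) / 2\<bar> \<le> C * norm v ^ 3"
    proof -
      have "\<bar>(\<phi>2 t - \<phi>2 0) / 2\<bar> \<le> \<bar>\<phi>2 t - \<phi>2 0\<bar>" by simp
      also have "\<dots> \<le> C * norm v ^ 3" by (rule order_trans[OF dt mult_right_mono[OF C(6)]]) simp
      finally show ?thesis .
    qed
    ultimately show "\<bar>f (x + v) - f x - (\<Sum>i\<in>UNIV. v $ i * partial i f x) - (\<Sum>i\<in>UNIV. \<Sum>j\<in>UNIV. v $ i * v $ j * partial i (partial j f) x) / 2\<bar> \<le> C * norm v ^ 3"
      by simp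
  next
    fix i j and x y :: "real^'n"
    show "\<bar>partial i f x - partial i f y\<bar> \<le> C * norm (x - y)"
      by (rule order_trans[OF gl mult_right_mono[OF C(4)]]) simp
    show "\<bar>partial i (partial j f) x - partial i (partial j f) y\<bar> \<le> C * norm (x - y)"
      by (rule order_trans[OF Hl mult_right_mono[OF C(5)]]) simp
    show "\<bar>partial i (partial j f) x\<bar> \<le> C" using c2(2)[of i j x] C(3) by linarith
    have "C * 1 \<le> C * (1 + (norm x)\<^sup>2)" using C(1) by (intro mult_left_mono) auto
    then show "\<bar>f x\<bar> \<le> C * (1 + (norm x)\<^sup>2)" using c0(2)[of x] C(2) by linarith
  qed (auto intro: C smooth_continuous[OF f])
  then show ?thesis by blast
qed

lemma norm_le_square: "norm x \<le> 1 + (norm x)\<^sup>2"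
proof -
  have "2 * norm x \<le> 1 + (norm x)\<^sup>2" using zero_le_power2[of "norm x - 1"] by (simp add: power2_diff)
  with norm_ge_zero[of x] show ?thesis by linarith
qed

lemma coordinate_test_function:
  "test_function (\<lambda>x :: real^'n. x $ k) (\<lambda>i x. if i = k then 1 else 0) (\<lambda>_ _ _. 0) 1"
proof
  fix x v :: "real^'n"
  show "\<bar>(x + v) $ k - x $ k - (\<Sum>i\<in>UNIV. v $ i * (if i = k then 1 else 0)) - (\<Sum>i\<in>UNIV. \<Sum>j\<in>UNIV. v $ i * v $ j * 0) / 2\<bar> \<le> 1 * norm v ^ 3"
    by (simp add: if_distrib[of "\<lambda>y. _ * y"] cong: if_cong)
  show "\<bar>x $ k\<bar> \<le> 1 * (1 + (norm x)\<^sup>2)"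
    using order_trans[OF component_le_norm_cart norm_le_square] by simp
qed (auto intro!: continuous_intros)

text \<open>A quadratic polynomial equals its second-order Taylor expansion.\<close>

lemma product_test_function:
  "test_function (\<lambda>x :: real^'n. x $ k * x $ l) (\<lambda>i x. (if i = k then x $ l else 0) + (if i = l then x $ k else 0))
     (\<lambda>i j _. (if i = k \<and> j = l then 1 else 0) + (if i = l \<and> j = k then 1 else 0)) 2"
proof
  fix x v :: "real^'n"
  have if1: "(\<Sum>i\<in>UNIV. v $ i * ((if i = k then x $ l else 0) + (if i = l then x $ k else 0))) = v $ k * x $ l + v $ l * x $ k"
    by (simp add: distrib_left sum.distrib if_distrib[of "\<lambda>y. _ * y"] cong: if_cong)
  have if2: "(\<Sum>i\<in>UNIV. \<Sum>j\<in>UNIV. v $ i * v $ j * ((if i = k' \<and> j = l' then 1 else 0))) = v $ k' * v $ l'" for k' l'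
  proof -
    have "v $ i * v $ j * (if i = k' \<and> j = l' then 1 else 0) = (if i = k' then (if j = l' then v $ k' * v $ l' else 0) else 0)" for i j
      by simp
    moreover have "(\<Sum>j\<in>UNIV. if i = k' then (if j = l' then v $ k' * v $ l' else 0) else 0) = (if i = k' then v $ k' * v $ l' else 0)" for i
      by (cases "i = k'") simp_all
    ultimately show ?thesis by simp
  qed
  have if3: "(\<Sum>i\<in>UNIV. \<Sum>j\<in>UNIV. v $ i * v $ j * ((if i = k \<and> j = l then 1 else 0) + (if i = l \<and> j = k then 1 else 0))) = v $ k * v $ l + v $ l * v $ k"
    by (simp only: distrib_left sum.distrib if2)
  show "\<bar>(x + v) $ k * (x + v) $ l - x $ k * x $ l - (\<Sum>i\<in>UNIV. v $ i * ((if i = k then x $ l else 0) + (if i = l then x $ k else 0)))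
     - (\<Sum>i\<in>UNIV. \<Sum>j\<in>UNIV. v $ i * v $ j * ((if i = k \<and> j = l then 1 else 0) + (if i = l \<and> j = k then 1 else 0))) / 2\<bar> \<le> 2 * norm v ^ 3"
    unfolding if1 if3 by (simp add: algebra_simps)
  have "\<bar>x $ k * x $ l\<bar> \<le> norm x * norm x" unfolding abs_mult by (intro mult_mono component_le_norm_cart) auto
  then show "\<bar>x $ k * x $ l\<bar> \<le> 2 * (1 + (norm x)\<^sup>2)" by (simp add: power2_eq_square)
  fix y :: "real^'n" and i
  have "\<bar>x $ j - y $ j\<bar> \<le> norm (x - y)" for j using component_le_norm_cart[of "x - y" j] by simp
  from this[of k] this[of l]
  show "\<bar>((if i = k then x $ l else 0) + (if i = l then x $ k else 0)) - ((if i = k then y $ l else 0) + (if i = l then y $ k else 0))\<bar> \<le> 2 * norm (x - y)"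
    by auto
  show "continuous_on UNIV (\<lambda>x :: real^'n. x $ k * x $ l)" by (intro continuous_intros)
  fix j
  let ?H = "(if i = k \<and> j = l then 1 else 0) + (if i = l \<and> j = k then 1 else 0) :: real"
  show "\<bar>?H - ?H\<bar> \<le> 2 * norm (x - y)" by (simp only: diff_self abs_zero) simp
  have "\<bar>(if a then 1 else 0) + (if b then 1 else 0)\<bar> \<le> (2 :: real)" for a b by simp
  then show "\<bar>?H\<bar> \<le> 2" .
qed simp

section \<open>Localization before the exit from a space-time cylinder\<close>

context brownian_drift
begin

text \<open>How far the space-time path has advanced towards the boundary of the cylinder
  \<open>[t0, T] \<times> cball x0 1\<close>: it is 0 at the start and at least 1 once the boundary has been
  reached. Including the time makes the exit happen no later than \<open>T\<close>, whatever the path does.\<close>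

definition depth :: "real \<Rightarrow> 'w \<Rightarrow> real" where
  "depth t \<omega> = max (norm (X t \<omega> - x0)) ((t - t0) / \<delta>)"

definition hit :: "real \<Rightarrow> 'w \<Rightarrow> real" where
  "hit c \<omega> = Inf {t \<in> {t0..T}. c \<le> depth t \<omega>}"

lemma continuous_depth: "\<omega> \<in> space M \<Longrightarrow> continuous_on S (\<lambda>t. depth t \<omega>)"
  unfolding depth_def using \<delta> by (intro continuous_intros continuous_on_subset[OF continuous_X]) auto

lemma depth_start: "\<omega> \<in> space M \<Longrightarrow> depth t0 \<omega> = 0"
  by (simp add: depth_def X_start)

lemma depth_end: "1 \<le> depth T \<omega>"
  using \<delta> by (simp add: depth_def)

context
  fixes c :: real
  assumes c: "0 < c" "c \<le> 1"
begin

lemma hit_attained: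
  assumes \<omega>: "\<omega> \<in> space M"
  shows "t0 \<le> hit c \<omega>" "hit c \<omega> \<le> T" "c \<le> depth (hit c \<omega>) \<omega>"
proof -
  let ?S = "{t \<in> {t0..T}. c \<le> depth t \<omega>}"
  have T: "T \<in> ?S" using depth_end[of \<omega>] c \<delta> by auto
  have "closed ({t0..T} \<inter> (\<lambda>t. depth t \<omega>) -` {c..})"
    by (intro continuous_closed_preimage continuous_depth[OF \<omega>]) auto
  moreover have "{t0..T} \<inter> (\<lambda>t. depth t \<omega>) -` {c..} = ?S" by auto
  ultimately have "hit c \<omega> \<in> ?S"
    unfolding hit_def using T by (intro closed_contains_Inf) (auto intro: bdd_belowI[of _ t0])
  then show "t0 \<le> hit c \<omega>" "hit c \<omega> \<le> T" "c \<le> depth (hit c \<omega>) \<omega>" by auto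
qed

lemma hit_least: "t \<in> {t0..T} \<Longrightarrow> c \<le> depth t \<omega> \<Longrightarrow> hit c \<omega> \<le> t"
  unfolding hit_def by (rule cInf_lower) (auto intro: bdd_belowI[of _ t0])

lemma depth_before_hit: "t \<in> {t0..T} \<Longrightarrow> t < hit c \<omega> \<Longrightarrow> depth t \<omega> < c"
  using hit_least[of t \<omega>] by (meson linorder_not_le)

lemma X_near_before_hit:
  assumes \<omega>: "\<omega> \<in> space M" and t: "t0 \<le> t" "t < hit c \<omega>"
  shows "norm (X t \<omega> - x0) \<le> 1"
  using depth_before_hit[of t \<omega>] hit_attained[OF \<omega>] t c by (auto simp: depth_def)

text \<open>By continuity, \<open>hit c \<omega> \<le> t\<close> is expressed by countably many values of the path up to time
  \<open>t\<close>.\<close>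

lemma hit_le_iff:
  assumes \<omega>: "\<omega> \<in> space M" and t: "t0 \<le> t" "t \<le> T"
  shows "hit c \<omega> \<le> t \<longleftrightarrow> (\<forall>e::nat. \<exists>m k::nat. k \<le> Suc m \<and> c - 1 / Suc e < depth (t0 + (t - t0) * (real k / Suc m)) \<omega>)"
    (is "_ \<longleftrightarrow> ?rhs")
proof
  assume le: "hit c \<omega> \<le> t"
  define s where "s = hit c \<omega>"
  have s: "t0 \<le> s" "s \<le> t" "c \<le> depth s \<omega>" using hit_attained[OF \<omega>] le by (auto simp: s_def)
  \<comment> \<open>The relative position of the hitting time in \<open>[t0, t]\<close>, approximated from below by
    fractions; for \<open>t = t0\<close> the hitting time is \<open>t0\<close> as well.\<close>
  define y where "y = (if t = t0 then 0 else (s - t0) / (t - t0))"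
  have y: "0 \<le> y" "y \<le> 1" "t0 + (t - t0) * y = s" using s t by (auto simp: y_def)
  have "(\<lambda>m. t0 + (t - t0) * (of_int \<lfloor>real (Suc m) * y\<rfloor> / real (Suc m))) \<longlonglongrightarrow> s"
    unfolding y(3)[symmetric] by (intro tendsto_intros floor_grid_tendsto)
  moreover have "isCont (\<lambda>t. depth t \<omega>) s" using continuous_depth[OF \<omega>, of UNIV] by (simp add: continuous_on_eq_continuous_at)
  ultimately have lim: "(\<lambda>m. depth (t0 + (t - t0) * (of_int \<lfloor>real (Suc m) * y\<rfloor> / real (Suc m))) \<omega>) \<longlonglongrightarrow> depth s \<omega>"
    by (rule isCont_tendsto_compose[rotated])
  show ?rhs
  proof
    fix e :: nat
    have "c - 1 / Suc e < depth s \<omega>" using s(3) by (smt (verit) divide_pos_pos of_nat_0_less_iff zero_less_Suc)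
    from order_tendstoD(1)[OF lim this] obtain m
      where m: "c - 1 / Suc e < depth (t0 + (t - t0) * (of_int \<lfloor>real (Suc m) * y\<rfloor> / real (Suc m))) \<omega>"
      by (auto simp: eventually_sequentially)
    have nn: "0 \<le> \<lfloor>real (Suc m) * y\<rfloor>" using y by simp
    have "real (Suc m) * y \<le> real (Suc m)" using y by (simp add: mult_left_le)
    then have "\<lfloor>real (Suc m) * y\<rfloor> \<le> int (Suc m)" by linarith
    with nn m show "\<exists>m k::nat. k \<le> Suc m \<and> c - 1 / Suc e < depth (t0 + (t - t0) * (real k / Suc m)) \<omega>"
      by (intro exI[of _ m] exI[of _ "nat \<lfloor>real (Suc m) * y\<rfloor>"]) auto
  qed
next
  assume rhs: ?rhs
  obtain s where s: "s \<in> {t0..t}" "\<And>r. r \<in> {t0..t} \<Longrightarrow> depth r \<omega> \<le> depth s \<omega>"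
    using continuous_attains_sup[OF _ _ continuous_depth[OF \<omega>, of "{t0..t}"]] t by auto
  have "c - 1 / Suc e \<le> depth s \<omega>" for e :: nat
  proof -
    obtain m k :: nat where mk: "k \<le> Suc m" "c - 1 / Suc e < depth (t0 + (t - t0) * (real k / Suc m)) \<omega>"
      using rhs by blast
    have "real k / Suc m \<le> 1" using mk(1) by simp
    then have "(t - t0) * (real k / Suc m) \<le> t - t0" using t by (intro mult_left_le) auto
    then have "t0 + (t - t0) * (real k / Suc m) \<in> {t0..t}" using t by auto
    from s(2)[OF this] mk(2) show ?thesis by linarith
  qed
  moreover have "(\<lambda>e. c - 1 / real (Suc e)) \<longlonglongrightarrow> c - 0"
    using LIMSEQ_inverse_real_of_nat by (intro tendsto_diff tendsto_const) (simp add: inverse_eq_divide)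
  ultimately have "c \<le> depth s \<omega>" by (intro LIMSEQ_le_const2[of "\<lambda>e. c - 1 / real (Suc e)" c]) auto
  then show "hit c \<omega> \<le> t" using hit_least[of s \<omega>] s(1) t by auto
qed

lemma depth_adapted: "t0 \<le> t \<Longrightarrow> depth t \<in> borel_measurable (F t)"
  unfolding depth_def[abs_def] using X_adapted[of t] by measurable

lemma stopping_time_hit: "stopping_time F (hit c)"
proof
  fix t
  consider "t < t0" | "t0 \<le> t" "t \<le> T" | "T < t" by linarith
  then show "Measurable.pred (F t) (\<lambda>\<omega>. hit c \<omega> \<le> t)"
  proof cases
    case 1
    then have "(hit c \<omega> \<le> t) = False" if "\<omega> \<in> space (F t)" for \<omega>
      using hit_attained(1)[of \<omega>] that by auto
    then show ?thesis by (rule measurable_cong[THEN iffD2]) simp_all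
  next
    case 2
    have D: "depth (t0 + (t - t0) * (real k / Suc m)) \<in> borel_measurable (F t)" if "k \<le> Suc m" for k m :: nat
    proof (rule F_measurable_mono[OF _ depth_adapted])
      have "real k / Suc m \<le> 1" using that by simp
      then show "t0 + (t - t0) * (real k / Suc m) \<le> t" using mult_left_le[of "real k / Suc m" "t - t0"] 2 by linarith
      show "t0 \<le> t0 + (t - t0) * (real k / Suc m)" using 2 by simp
    qed
    have "Measurable.pred (F t) (\<lambda>\<omega>. k \<le> Suc m \<and> c - 1 / Suc e < depth (t0 + (t - t0) * (real k / Suc m)) \<omega>)" for k m e :: nat
    proof (cases "k \<le> Suc m")
      case True
      have "Measurable.pred (F t) (\<lambda>\<omega>. c - 1 / Suc e < depth (t0 + (t - t0) * (real k / Suc m)) \<omega>)"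
        using borel_measurable_less[OF borel_measurable_const D[OF True]] by (simp add: pred_def)
      with True show ?thesis by (simp only: simp_thms)
    qed simp
    then have pred: "Measurable.pred (F t) (\<lambda>\<omega>. \<forall>e::nat. \<exists>m k::nat. k \<le> Suc m \<and> c - 1 / Suc e < depth (t0 + (t - t0) * (real k / Suc m)) \<omega>)"
      by (intro pred_intros_countable)
    have "(hit c \<omega> \<le> t) = (\<forall>e::nat. \<exists>m k::nat. k \<le> Suc m \<and> c - 1 / Suc e < depth (t0 + (t - t0) * (real k / Suc m)) \<omega>)"
      if "\<omega> \<in> space (F t)" for \<omega>
      using that by (intro hit_le_iff 2) simp
    then show ?thesis by (rule measurable_cong[THEN iffD2]) (assumption, rule pred)
  next
    case 3
    then have "(hit c \<omega> \<le> t) = True" if "\<omega> \<in> space (F t)" for \<omega>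
      using hit_attained(2)[of \<omega>] that by auto
    then show ?thesis by (rule measurable_cong[THEN iffD2]) simp_all
  qed
qed

end

lemma hit_strict_mono:
  assumes c: "0 < c" "c < c'" "c' \<le> 1" and \<omega>: "\<omega> \<in> space M"
  shows "hit c \<omega> < hit c' \<omega>"
proof -
  have h: "t0 \<le> hit c' \<omega>" "hit c' \<omega> \<le> T" "c' \<le> depth (hit c' \<omega>) \<omega>"
    using hit_attained[OF _ c(3) \<omega>] c by auto
  obtain s where s: "t0 \<le> s" "s \<le> hit c' \<omega>" "depth s \<omega> = c"
    using IVT'[of "\<lambda>t. depth t \<omega>" t0 c "hit c' \<omega>"] depth_start[OF \<omega>] h c continuous_depth[OF \<omega>] by auto
  have "hit c \<omega> \<le> s" using s h c by (intro hit_least) auto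
  moreover have "s \<noteq> hit c' \<omega>" using s(3) h(3) c(2) by auto
  ultimately show ?thesis using s(2) by simp
qed

text \<open>The exits from the smaller cylinders of these sizes announce the exit from the full one.\<close>

definition level :: "nat \<Rightarrow> real" where
  "level k = 1 - 1 / (real k + 2)"

lemma level: "0 < level k" "level k < 1" "level k < level (Suc k)" "level \<longlonglongrightarrow> 1"
proof -
  show "0 < level k" "level k < 1" by (simp_all add: level_def)
  show "level k < level (Suc k)" by (simp add: level_def divide_strict_left_mono)
  have "(\<lambda>k. inverse (real (Suc (Suc k)))) \<longlonglongrightarrow> 0" using LIMSEQ_Suc[OF LIMSEQ_inverse_real_of_nat] .
  then have "(\<lambda>k. 1 - inverse (real (Suc (Suc k)))) \<longlonglongrightarrow> 1 - 0" by (intro tendsto_diff tendsto_const)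
  then show "level \<longlonglongrightarrow> 1" by (simp add: level_def[abs_def] inverse_eq_divide add.commute)
qed

text \<open>The limit \<open>s\<close> of the hitting times has depth at least 1 by continuity, so it is not before
  \<open>hit 1\<close>. The times are strictly smaller than \<open>hit 1\<close> by the intermediate value theorem
  (\<open>hit_strict_mono\<close>).\<close>

lemma localizing_hit: "localizing M F t0 (\<lambda>\<omega>. ereal (hit 1 \<omega>)) (\<lambda>k. hit (level k))"
  unfolding localizing_def
proof (intro conjI allI ballI)
  show "stopping_time F (hit (level k))" for k
    using level(1-3)[of k] by (intro stopping_time_hit) auto
  fix \<omega> assume \<omega>: "\<omega> \<in> space M"
  show "t0 \<le> hit (level k) \<omega>" for k using level(1-3)[of k] \<omega> by (intro hit_attained) auto
  show "ereal (hit (level k) \<omega>) < ereal (hit 1 \<omega>)" for k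
    using level(1-3)[of k] hit_strict_mono[OF _ _ _ \<omega>, of "level k" 1] by simp
  show inc: "incseq (\<lambda>k. hit (level k) \<omega>)"
    by (rule incseq_SucI) (use level level(2) in \<open>auto intro!: less_imp_le hit_strict_mono \<omega>\<close>)
  have top: "hit (level k) \<omega> \<le> hit 1 \<omega>" for k
    using level(1-3)[of k] hit_strict_mono[OF _ _ _ \<omega>, of "level k" 1] by simp
  obtain s where s: "(\<lambda>k. hit (level k) \<omega>) \<longlonglongrightarrow> s" "\<And>k. hit (level k) \<omega> \<le> s"
    using incseq_convergent[OF inc, of "hit 1 \<omega>"] top by blast
  have "isCont (\<lambda>t. depth t \<omega>) s" using continuous_depth[OF \<omega>, of UNIV] by (simp add: continuous_on_eq_continuous_at)
  from isCont_tendsto_compose[OF this s(1)] have d: "(\<lambda>k. depth (hit (level k) \<omega>) \<omega>) \<longlonglongrightarrow> depth s \<omega>" .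
  have "1 \<le> depth s \<omega>"
    by (rule LIMSEQ_le[OF level(4) d]) (use level in \<open>auto intro!: exI[of _ 0] hit_attained(3) \<omega> less_imp_le[OF level(2)]\<close>)
  moreover have s1: "s \<le> hit 1 \<omega>" by (rule LIMSEQ_le_const2[OF s(1)]) (use top in auto)
  moreover have "t0 \<le> s" using hit_attained(1)[OF _ _ \<omega>, of "level 0"] level(1-3)[of 0] s(2)[of 0] by linarith
  ultimately have "hit 1 \<omega> \<le> s" using hit_attained(2)[OF _ _ \<omega>, of 1] by (intro hit_least) auto
  with s1 s(1) show "(\<lambda>k. ereal (hit (level k) \<omega>)) \<longlonglongrightarrow> ereal (hit 1 \<omega>)" by simp
qed

section \<open>Mean derivatives of the solution\<close>

text \<open>A continuous adapted process is evaluated at the \<open>F t\<close>-measurable time \<open>min t (hit c)\<close>,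
  through its joint measurability.\<close>

lemma stopped_measurable:
  fixes Y :: "real \<Rightarrow> 'w \<Rightarrow> real"
  assumes c: "0 < c" "c \<le> 1" and t: "t0 \<le> t"
    and Y: "\<And>r. t0 \<le> r \<Longrightarrow> r \<le> T \<Longrightarrow> Y r \<in> borel_measurable (F r)"
    and cont: "\<And>\<omega>. \<omega> \<in> space M \<Longrightarrow> continuous_on {t0..T} (\<lambda>r. Y r \<omega>)"
  shows "(\<lambda>\<omega>. Y (min t (hit c \<omega>)) \<omega>) \<in> borel_measurable (F t)"
proof -
  let ?clip = "\<lambda>r. max t0 (min r (min t T))"
  have T: "t0 \<le> T" using \<delta> by simp
  have "(\<lambda>(r, \<omega>). Y (?clip r) \<omega>) \<in> borel_measurable (borel \<Otimes>\<^sub>M F t)"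
  proof (rule continuous_process_jointly_measurable)
    show "Y (?clip r) \<in> borel_measurable (F t)" for r
      using t T by (intro F_measurable_mono[OF _ Y]) auto
    show "continuous_on UNIV (\<lambda>r. Y (?clip r) \<omega>)" if "\<omega> \<in> space (F t)" for \<omega>
      by (rule continuous_on_compose2[OF cont]) (use that T in \<open>auto intro!: continuous_intros\<close>)
  qed
  moreover have "(\<lambda>\<omega>. min t (hit c \<omega>)) \<in> borel_measurable (F t)"
  proof (rule borel_measurableI_le)
    fix r
    show "{\<omega> \<in> space (F t). min t (hit c \<omega>) \<le> r} \<in> sets (F t)"
    proof (cases "t \<le> r")
      case False
      then have "{\<omega> \<in> space (F t). min t (hit c \<omega>) \<le> r} = {\<omega> \<in> space (F r). hit c \<omega> \<le> r}" by auto
      moreover have "\<dots> \<in> sets (F r)" using stopping_timeD[OF stopping_time_hit[OF c], of r] by (simp add: pred_def)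
      ultimately show ?thesis using sets_F_mono[of r t] False by auto
    next
      case True
      then have "{\<omega> \<in> space (F t). min t (hit c \<omega>) \<le> r} = space (F t)" by auto
      then show ?thesis by (simp only: sets.top)
    qed
  qed
  ultimately have "(\<lambda>\<omega>. Y (?clip (min t (hit c \<omega>))) \<omega>) \<in> borel_measurable (F t)"
    using measurable_compose[OF measurable_Pair[OF _ measurable_ident]] by fastforce
  moreover have "Y (?clip (min t (hit c \<omega>))) \<omega> = Y (min t (hit c \<omega>)) \<omega>" if "\<omega> \<in> space (F t)" for \<omega>
  proof -
    have "?clip (min t (hit c \<omega>)) = min t (hit c \<omega>)"
      using hit_attained[OF c, of \<omega>] that t by auto
    then show ?thesis by (rule arg_cong)
  qed
  ultimately show ?thesis by (rule measurable_cong[THEN iffD1, rotated])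
qed

lemma stopped_event:
  assumes "0 < c" "c \<le> 1"
  shows "{\<omega> \<in> space M. t < hit c \<omega>} \<in> sets (F t)"
  using stopping_timeD2[OF stopping_time_hit[OF assms], of t] by (simp add: pred_def)

text \<open>If \<open>Y h\<close> has, given the past, the same conditional mean as the integral of \<open>\<psi>\<close> over
  \<open>[t, t + h]\<close> stopped at the hitting time, then its rate is \<open>\<psi> t\<close>: conditional expectations
  contract the \<open>L\<^sup>1\<close> distance, and the averages of \<open>\<psi>\<close> converge to \<open>\<psi> t\<close> boundedly.\<close>

lemma cond_rate_hit:
  fixes Y :: "real \<Rightarrow> 'w \<Rightarrow> real" and \<psi> :: "real \<Rightarrow> 'w \<Rightarrow> real" and V :: "'w \<Rightarrow> real"
  assumes c: "0 < c" "c \<le> 1" and t: "t0 \<le> t"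
  defines "I \<equiv> \<lambda>h \<omega>. integral {min t (hit c \<omega>)..min (t + h) (hit c \<omega>)} (\<lambda>s. \<psi> s \<omega>)"
  assumes Y: "\<And>h. 0 < h \<Longrightarrow> integrable M (Y h)" and I: "\<And>h. 0 < h \<Longrightarrow> integrable M (I h)"
    and YI: "\<And>h E. 0 < h \<Longrightarrow> E \<in> sets (F t) \<Longrightarrow> (\<integral>\<omega>. indicator E \<omega> * (Y h \<omega> - I h \<omega>) \<partial>M) = 0"
    and \<psi>_cont: "\<And>\<omega>. \<omega> \<in> space M \<Longrightarrow> continuous_on {t0..T} (\<lambda>s. \<psi> s \<omega>)"
    and \<psi>_bound: "\<And>\<omega> s. \<omega> \<in> space M \<Longrightarrow> t \<le> s \<Longrightarrow> s < hit c \<omega> \<Longrightarrow> \<bar>\<psi> s \<omega>\<bar> \<le> b"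
    and \<psi>_meas: "\<psi> t \<in> borel_measurable (F t)"
    and V: "\<And>\<omega>. \<omega> \<in> space M \<Longrightarrow> t < hit c \<omega> \<Longrightarrow> V \<omega> = \<psi> t \<omega>"
  shows "cond_rate M (F t) {\<omega>. t < hit c \<omega>} Y V"
  unfolding cond_rate_def
proof (intro conjI allI impI)
  fix h :: real assume "0 < h" then show "integrable M (Y h)" by (rule Y)
next
  interpret sub: finite_measure_subalgebra M "F t"
    by unfold_locales (rule filtration_subalgebra)
  define A where "A = {\<omega> \<in> space M. t < hit c \<omega>}"
  have A[measurable]: "A \<in> sets (F t)" unfolding A_def by (rule stopped_event[OF c])
  have A'[measurable]: "A \<in> sets M" by (rule subsetD[OF sets_F_subset A])
  note [measurable] = \<psi>_meas F_measurable_M[OF \<psi>_meas]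
  have range: "\<omega> \<in> A \<Longrightarrow> t \<in> {t0..T} \<and> hit c \<omega> \<le> T \<and> \<omega> \<in> space M \<and> t < hit c \<omega>" for \<omega>
    using hit_attained(2)[OF c, of \<omega>] t by (auto simp: A_def)
  have b: "0 \<le> b" if "\<omega> \<in> A" for \<omega>
    using \<psi>_bound[of \<omega> t] range[OF that] by force
  have A\<psi>: "\<bar>indicator A \<omega> * \<psi> t \<omega>\<bar> \<le> \<bar>b\<bar>" for \<omega>
    using \<psi>_bound[of \<omega> t] range[of \<omega>] by (cases "\<omega> \<in> A") (force simp: indicator_def)+
  have iA\<psi>: "integrable M (\<lambda>\<omega>. indicator A \<omega> * \<psi> t \<omega>)"
    by (rule integrable_const_bound[where B = "\<bar>b\<bar>"]) (use A\<psi> in auto)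
  have Ib: "\<bar>I h \<omega> / h\<bar> \<le> b" if h: "0 < h" and \<omega>: "\<omega> \<in> A" for h \<omega>
  proof -
    note r = range[OF \<omega>]
    define v where "v = min (t + h) (hit c \<omega>)"
    have v: "t \<le> v" "v \<le> t + h" "v \<le> T" using r h by (auto simp: v_def)
    have "continuous_on {t..v} (\<lambda>s. \<psi> s \<omega>)"
      using r v by (intro continuous_on_subset[OF \<psi>_cont]) auto
    moreover have "\<bar>\<psi> s \<omega>\<bar> \<le> b" if s: "s \<in> {t..v}" for s
    proof (cases "s < hit c \<omega>")
      case True
      with \<psi>_bound[of \<omega> s] r s show ?thesis by auto
    next
      case False
      then have sh: "s = hit c \<omega>" using s by (auto simp: v_def)
      have cl: "closure {t..<s} = {t..s}" using False r by (intro closure_atLeastLessThan) auto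
      have "continuous_on (closure {t..<s}) (\<lambda>s. \<bar>\<psi> s \<omega>\<bar>)"
        unfolding cl using r sh by (intro continuous_intros continuous_on_subset[OF \<psi>_cont]) auto
      then show ?thesis
        by (rule continuous_le_on_closure) (use r sh cl s \<psi>_bound in auto)
    qed
    ultimately have "norm (integral {t..v} (\<lambda>s. \<psi> s \<omega>)) \<le> b * (v - t)"
      using v by (intro integral_bound) auto
    also have "\<dots> \<le> b * h" using v b[OF \<omega>] by (intro mult_left_mono) auto
    finally have "\<bar>I h \<omega>\<bar> \<le> b * h" using r by (simp add: I_def v_def)
    then show ?thesis using h by (simp add: pos_divide_le_eq)
  qed
  \<comment> \<open>Before the hitting time the stopped integral is the integral over all of \<open>[t, t + h]\<close>, so
    the averages converge by continuity of \<open>\<psi>\<close>.\<close>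
  have lim: "(\<lambda>n. I (S n) \<omega> / S n) \<longlonglongrightarrow> \<psi> t \<omega>"
    if S: "\<And>n. 0 < S n" "S \<longlonglongrightarrow> 0" and \<omega>: "\<omega> \<in> A" for S \<omega>
  proof (rule metric_LIMSEQ_I)
    fix e :: real assume e: "0 < e"
    note r = range[OF \<omega>]
    obtain d where d: "0 < d" "\<And>s. s \<in> {t0..T} \<Longrightarrow> dist s t < d \<Longrightarrow> dist (\<psi> s \<omega>) (\<psi> t \<omega>) < e / 2"
      using \<psi>_cont[of \<omega>] r e unfolding continuous_on_iff by (metis half_gt_zero)
    have "0 < min d (hit c \<omega> - t)" using d r by simp
    from order_tendstoD(2)[OF S(2) this] obtain n0 where n0: "\<And>n. n \<ge> n0 \<Longrightarrow> S n < min d (hit c \<omega> - t)"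
      by (auto simp: eventually_sequentially)
    have "dist (I (S n) \<omega> / S n) (\<psi> t \<omega>) < e" if n: "n \<ge> n0" for n
    proof -
      have s: "0 < S n" "S n < d" "t + S n < hit c \<omega>" using S(1)[of n] n0[OF n] by auto
      have sub: "{t..t + S n} \<subseteq> {t0..T}" using s r by auto
      have ci: "continuous_on {t..t + S n} (\<lambda>s. \<psi> s \<omega>)" using r by (intro continuous_on_subset[OF \<psi>_cont _] sub) auto
      have "I (S n) \<omega> - \<psi> t \<omega> * S n = integral {t..t + S n} (\<lambda>s. \<psi> s \<omega> - \<psi> t \<omega>)"
        using s r by (subst integral_diff[OF integrable_continuous_interval[OF ci]]) (auto simp: I_def min_def)
      also have "norm \<dots> \<le> e / 2 * (t + S n - t)"
      proof (rule integral_bound)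
        fix s' assume s': "s' \<in> {t..t + S n}"
        then have "dist s' t < d" using s by (auto simp: dist_real_def)
        from d(2)[OF _ this] s' sub show "norm (\<psi> s' \<omega> - \<psi> t \<omega>) \<le> e / 2" by (auto simp: dist_norm)
      qed (use s ci in \<open>auto intro!: continuous_intros\<close>)
      finally have k: "\<bar>I (S n) \<omega> - \<psi> t \<omega> * S n\<bar> \<le> e / 2 * S n" by simp
      have "I (S n) \<omega> / S n - \<psi> t \<omega> = (I (S n) \<omega> - \<psi> t \<omega> * S n) / S n" using s by (simp add: field_simps)
      then have "\<bar>I (S n) \<omega> / S n - \<psi> t \<omega>\<bar> \<le> e / 2" using k s by (simp add: pos_divide_le_eq)
      then show ?thesis using e by (simp add: dist_real_def)
    qed
    then show "\<exists>n0. \<forall>n\<ge>n0. dist (I (S n) \<omega> / S n) (\<psi> t \<omega>) < e" by blast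
  qed
  have diff_bound: "norm (indicator A \<omega> * \<bar>I h \<omega> / h - \<psi> t \<omega>\<bar>) \<le> 2 * \<bar>b\<bar>" if h: "0 < h" for h \<omega>
  proof (cases "\<omega> \<in> A")
    case True
    have "\<bar>\<psi> t \<omega>\<bar> \<le> \<bar>b\<bar>" using A\<psi>[of \<omega>] True by simp
    moreover have "\<bar>I h \<omega> / h\<bar> \<le> \<bar>b\<bar>" using Ib[OF h True] by linarith
    ultimately have "\<bar>I h \<omega> / h - \<psi> t \<omega>\<bar> \<le> 2 * \<bar>b\<bar>" by linarith
    with True show ?thesis by simp
  qed simp
  define G where "G h = (\<integral>\<omega>. indicator A \<omega> * \<bar>I h \<omega> / h - \<psi> t \<omega>\<bar> \<partial>M)" for h
  have Im: "I h \<in> borel_measurable M" if "0 < h" for h using I[OF that] by (rule borel_measurable_integrable)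
  have iG: "integrable M (\<lambda>\<omega>. indicator A \<omega> * \<bar>I h \<omega> / h - \<psi> t \<omega>\<bar>)" if h: "0 < h" for h
  proof -
    note [measurable] = Im[OF h]
    show ?thesis
    proof (rule integrable_const_bound[where B = "2 * \<bar>b\<bar>"])
      show "AE \<omega> in M. norm (indicator A \<omega> * \<bar>I h \<omega> / h - \<psi> t \<omega>\<bar>) \<le> 2 * \<bar>b\<bar>"
      proof (intro AE_I2)
        fix \<omega>
        show "norm (indicator A \<omega> * \<bar>I h \<omega> / h - \<psi> t \<omega>\<bar>) \<le> 2 * \<bar>b\<bar>"
          by (rule diff_bound[OF h])
      qed
    qed measurable
  qed
  have G_seq: "(\<lambda>n. G (S n)) \<longlonglongrightarrow> 0" if S: "\<And>n. 0 < S n" "S \<longlonglongrightarrow> 0" for S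
  proof -
    have "(\<lambda>n. \<integral>\<omega>. indicator A \<omega> * \<bar>I (S n) \<omega> / S n - \<psi> t \<omega>\<bar> \<partial>M) \<longlonglongrightarrow> (\<integral>\<omega>. 0 \<partial>M)"
    proof (rule integral_dominated_convergence[where w = "\<lambda>_. 2 * \<bar>b\<bar>"])
      show "AE \<omega> in M. (\<lambda>n. indicator A \<omega> * \<bar>I (S n) \<omega> / S n - \<psi> t \<omega>\<bar>) \<longlonglongrightarrow> 0"
      proof (intro AE_I2)
        fix \<omega>
        show "(\<lambda>n. indicator A \<omega> * \<bar>I (S n) \<omega> / S n - \<psi> t \<omega>\<bar>) \<longlonglongrightarrow> 0"
        proof (cases "\<omega> \<in> A")
          case True
          have "(\<lambda>n. I (S n) \<omega> / S n - \<psi> t \<omega>) \<longlonglongrightarrow> 0"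
            using lim[OF S True] by (simp add: LIM_zero_iff)
          with True show ?thesis by (simp add: tendsto_rabs_zero_iff)
        qed simp
      qed
      show "AE \<omega> in M. norm (indicator A \<omega> * \<bar>I (S n) \<omega> / S n - \<psi> t \<omega>\<bar>) \<le> 2 * \<bar>b\<bar>" for n
      proof (intro AE_I2)
        fix \<omega>
        show "norm (indicator A \<omega> * \<bar>I (S n) \<omega> / S n - \<psi> t \<omega>\<bar>) \<le> 2 * \<bar>b\<bar>"
          by (rule diff_bound[OF S(1)])
      qed
    qed (use iG[OF S(1)] in \<open>auto intro: borel_measurable_integrable\<close>)
    then show ?thesis by (simp add: G_def)
  qed
  have G_lim: "(G \<longlongrightarrow> 0) (at_right 0)"
    by (rule tendsto_at_right_sequentially[of 0 1]) (auto intro: G_seq)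
  have le: "(\<integral>\<^sup>+\<omega>. ennreal \<bar>real_cond_exp M (F t) (\<lambda>\<omega>. Y h \<omega> / h) \<omega> - V \<omega>\<bar> * indicator {\<omega>. t < hit c \<omega>} \<omega> \<partial>M) \<le> ennreal (G h)"
    if h: "0 < h" for h
  proof -
    define C where "C = real_cond_exp M (F t) (\<lambda>\<omega>. Y h \<omega> / h)"
    define U where "U \<omega> = indicator A \<omega> * C \<omega> - indicator A \<omega> * \<psi> t \<omega>" for \<omega>
    have Yh: "integrable M (\<lambda>\<omega>. Y h \<omega> / h)" using Y[OF h] by simp
    have C: "integrable M C" unfolding C_def by (rule sub.real_cond_exp_int(1)[OF Yh])
    have Cm[measurable]: "C \<in> borel_measurable (F t)" unfolding C_def by (rule borel_measurable_cond_exp)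
    have iAC: "integrable M (\<lambda>\<omega>. indicator A \<omega> * C \<omega>)" using integrable_mult_indicator[OF A' C] by simp
    have U: "integrable M U" unfolding U_def by (intro Bochner_Integration.integrable_diff iAC iA\<psi>)
    have Um[measurable]: "U \<in> borel_measurable (F t)" unfolding U_def by measurable
    have part: "(\<integral>\<omega>. indicator E \<omega> * U \<omega> \<partial>M) = (\<integral>\<omega>. indicator E \<omega> * (indicator A \<omega> * (I h \<omega> / h - \<psi> t \<omega>)) \<partial>M)"
      if E: "E \<in> sets (F t)" for E
    proof -
      have E': "E \<in> sets M" using E sets_F_subset by auto
      have EA: "E \<inter> A \<in> sets (F t)" "E \<inter> A \<in> sets M" using E A E' A' by auto
      have i1: "integrable M (\<lambda>\<omega>. indicator (E \<inter> A) \<omega> * C \<omega>)" "integrable M (\<lambda>\<omega>. indicator (E \<inter> A) \<omega> * (Y h \<omega> / h))"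
          "integrable M (\<lambda>\<omega>. indicator (E \<inter> A) \<omega> * (I h \<omega> / h))" "integrable M (\<lambda>\<omega>. indicator E \<omega> * (indicator A \<omega> * \<psi> t \<omega>))"
          "integrable M (\<lambda>\<omega>. indicator (E \<inter> A) \<omega> * Y h \<omega>)" "integrable M (\<lambda>\<omega>. indicator (E \<inter> A) \<omega> * I h \<omega>)"
        using integrable_mult_indicator[OF EA(2) C] integrable_mult_indicator[OF EA(2) Yh] integrable_mult_indicator[OF EA(2), of "\<lambda>\<omega>. I h \<omega> / h"] I[OF h]
          integrable_mult_indicator[OF E' iA\<psi>] integrable_mult_indicator[OF EA(2) Y[OF h]] integrable_mult_indicator[OF EA(2) I[OF h]] by simp_all
      have "(\<integral>\<omega>. indicator (E \<inter> A) \<omega> * C \<omega> \<partial>M) = (\<integral>\<omega>. indicator (E \<inter> A) \<omega> * (Y h \<omega> / h) \<partial>M)"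
        unfolding C_def using sub.real_cond_exp_intg(2)[OF i1(2)] EA(1) borel_measurable_integrable[OF Yh] by simp
      also have "\<dots> = (\<integral>\<omega>. indicator (E \<inter> A) \<omega> * Y h \<omega> \<partial>M) / h" by simp
      also have "(\<integral>\<omega>. indicator (E \<inter> A) \<omega> * Y h \<omega> \<partial>M) = (\<integral>\<omega>. indicator (E \<inter> A) \<omega> * I h \<omega> \<partial>M)"
        using YI[OF h EA(1)] Bochner_Integration.integral_diff[OF i1(5,6)] by (simp add: right_diff_distrib)
      finally have CI: "(\<integral>\<omega>. indicator (E \<inter> A) \<omega> * C \<omega> \<partial>M) = (\<integral>\<omega>. indicator (E \<inter> A) \<omega> * (I h \<omega> / h) \<partial>M)" by simp
      have "(\<integral>\<omega>. indicator E \<omega> * U \<omega> \<partial>M) = (\<integral>\<omega>. indicator (E \<inter> A) \<omega> * C \<omega> - indicator E \<omega> * (indicator A \<omega> * \<psi> t \<omega>) \<partial>M)"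
        by (intro Bochner_Integration.integral_cong refl) (simp add: U_def indicator_inter_arith right_diff_distrib mult.assoc)
      also have "\<dots> = (\<integral>\<omega>. indicator (E \<inter> A) \<omega> * (I h \<omega> / h) - indicator E \<omega> * (indicator A \<omega> * \<psi> t \<omega>) \<partial>M)"
        by (simp only: Bochner_Integration.integral_diff[OF i1(1,4)] Bochner_Integration.integral_diff[OF i1(3,4)] CI)
      also have "\<dots> = (\<integral>\<omega>. indicator E \<omega> * (indicator A \<omega> * (I h \<omega> / h - \<psi> t \<omega>)) \<partial>M)"
        by (intro Bochner_Integration.integral_cong refl) (simp add: indicator_inter_arith right_diff_distrib mult.assoc)
      finally show ?thesis .
    qed
    \<comment> \<open>\<open>U\<close> is measurable with respect to the past, hence so are the events where it is positive
      and where it is negative, and testing on them gives its \<open>L\<^sup>1\<close> norm.\<close>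
    define P where "P = {\<omega> \<in> space M. 0 < U \<omega>}"
    define N' where "N' = {\<omega> \<in> space M. U \<omega> < 0}"
    have "{\<omega> \<in> space (F t). 0 < U \<omega>} \<in> sets (F t)" "{\<omega> \<in> space (F t). U \<omega> < 0} \<in> sets (F t)" by measurable
    then have PN: "P \<in> sets (F t)" "N' \<in> sets (F t)" by (auto simp: P_def N'_def)
    have PN': "P \<in> sets M" "N' \<in> sets M" using PN sets_F_subset by auto
    let ?J = "\<lambda>\<omega>. indicator A \<omega> * (I h \<omega> / h - \<psi> t \<omega>)"
    have iJ: "integrable M ?J"
    proof -
      have "integrable M (\<lambda>\<omega>. indicator A \<omega> * (I h \<omega> / h))"
        using integrable_mult_indicator[OF A', of "\<lambda>\<omega>. I h \<omega> / h"] I[OF h] by simp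
      from Bochner_Integration.integrable_diff[OF this iA\<psi>] show ?thesis by (simp add: right_diff_distrib)
    qed
    have iPU: "integrable M (\<lambda>\<omega>. indicator P \<omega> * U \<omega>)" "integrable M (\<lambda>\<omega>. indicator N' \<omega> * U \<omega>)"
      "integrable M (\<lambda>\<omega>. indicator P \<omega> * ?J \<omega>)" "integrable M (\<lambda>\<omega>. indicator N' \<omega> * ?J \<omega>)"
      using integrable_mult_indicator[OF PN'(1) U] integrable_mult_indicator[OF PN'(2) U]
        integrable_mult_indicator[OF PN'(1) iJ] integrable_mult_indicator[OF PN'(2) iJ] by simp_all
    have "(\<integral>\<omega>. \<bar>U \<omega>\<bar> \<partial>M) = (\<integral>\<omega>. indicator P \<omega> * U \<omega> - indicator N' \<omega> * U \<omega> \<partial>M)"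
      by (intro Bochner_Integration.integral_cong refl) (auto simp: P_def N'_def indicator_def)
    also have "\<dots> = (\<integral>\<omega>. indicator P \<omega> * ?J \<omega> \<partial>M) - (\<integral>\<omega>. indicator N' \<omega> * ?J \<omega> \<partial>M)"
      by (simp only: Bochner_Integration.integral_diff[OF iPU(1,2)] part[OF PN(1)] part[OF PN(2)])
    also have "\<dots> = (\<integral>\<omega>. indicator P \<omega> * ?J \<omega> - indicator N' \<omega> * ?J \<omega> \<partial>M)"
      by (rule Bochner_Integration.integral_diff[OF iPU(3,4), symmetric])
    also have "\<dots> \<le> G h"
      unfolding G_def
      by (rule integral_mono[OF Bochner_Integration.integrable_diff[OF iPU(3,4)] iG[OF h]])
         (auto simp: P_def N'_def indicator_def)
    finally have UG: "(\<integral>\<omega>. \<bar>U \<omega>\<bar> \<partial>M) \<le> G h" .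
    have "(\<integral>\<^sup>+\<omega>. ennreal \<bar>C \<omega> - V \<omega>\<bar> * indicator {\<omega>. t < hit c \<omega>} \<omega> \<partial>M) = (\<integral>\<^sup>+\<omega>. ennreal \<bar>U \<omega>\<bar> \<partial>M)"
      by (intro nn_integral_cong) (auto simp: U_def A_def indicator_def V)
    also have "\<dots> = ennreal (\<integral>\<omega>. \<bar>U \<omega>\<bar> \<partial>M)" using U by (intro nn_integral_eq_integral) auto
    also have "\<dots> \<le> ennreal (G h)" by (rule ennreal_leI[OF UG])
    finally show ?thesis unfolding C_def .
  qed
  show "((\<lambda>h. \<integral>\<^sup>+\<omega>. ennreal \<bar>real_cond_exp M (F t) (\<lambda>\<omega>. Y h \<omega> / h) \<omega> - V \<omega>\<bar> * indicator {\<omega>. t < hit c \<omega>} \<omega> \<partial>M) \<longlongrightarrow> 0) (at_right 0)"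
  proof (rule tendsto_sandwich[where f = "\<lambda>_. 0" and h = "\<lambda>h. ennreal (G h)"])
    show "((\<lambda>h. ennreal (G h)) \<longlongrightarrow> 0) (at_right 0)"
      using tendsto_ennrealI[OF G_lim] by simp
    show "\<forall>\<^sub>F h in at_right 0. (\<integral>\<^sup>+\<omega>. ennreal \<bar>real_cond_exp M (F t) (\<lambda>\<omega>. Y h \<omega> / h) \<omega> - V \<omega>\<bar> * indicator {\<omega>. t < hit c \<omega>} \<omega> \<partial>M) \<le> ennreal (G h)"
      using eventually_at_right_less[of "0 :: real"] by eventually_elim (rule le)
  qed auto
qed

end

context martingale_problem
begin

context
  fixes c :: real
  assumes c: "0 < c" "c \<le> 1"
begin

lemma stopped_N_measurable: "t0 \<le> t \<Longrightarrow> (\<lambda>\<omega>. N (min t (hit c \<omega>)) \<omega>) \<in> borel_measurable (F t)"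
  by (rule stopped_measurable[OF c]) (auto intro: N_adapted N_continuous)

lemma stopped_N_integrable:
  assumes "t0 \<le> t"
  shows "integrable M (\<lambda>\<omega>. N (min t (hit c \<omega>)) \<omega>)"
proof -
  obtain b where b: "\<And>\<omega> t. \<omega> \<in> space M \<Longrightarrow> t \<in> {t0..T} \<Longrightarrow> \<bar>N t \<omega>\<bar> \<le> b * (1 + R \<omega>)" using N_bound by blast
  show ?thesis
  proof (rule integrable_dominated[OF F_measurable_M[OF stopped_N_measurable[OF assms]]])
    fix \<omega> assume \<omega>: "\<omega> \<in> space M"
    show "\<bar>N (min t (hit c \<omega>)) \<omega>\<bar> \<le> b * (1 + R \<omega>)"
      using hit_attained[OF c \<omega>] assms by (intro b[OF \<omega>]) auto
  qed
qed

lemma stopped_N_martingale: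
  assumes st: "t0 \<le> s" "s \<le> t" and E: "E \<in> sets (F s)"
  shows "(\<integral>\<omega>. indicator E \<omega> * (N (min t (hit c \<omega>)) \<omega> - N (min s (hit c \<omega>)) \<omega>) \<partial>M) = 0"
proof (cases "s \<le> T")
  case True
  obtain b where b: "\<And>\<omega> t. \<omega> \<in> space M \<Longrightarrow> t \<in> {t0..T} \<Longrightarrow> \<bar>N t \<omega>\<bar> \<le> b * (1 + R \<omega>)" using N_bound by blast
  have "(\<integral>\<omega>. indicator E \<omega> * (N (min (min t T) (hit c \<omega>)) \<omega> - N (min s (hit c \<omega>)) \<omega>) \<partial>M) = 0"
  proof (rule optional_stopping[where N = N and a = t0 and b = T and D = "\<lambda>\<omega>. b * (1 + R \<omega>)"])
    show "integrable M (\<lambda>\<omega>. b * (1 + R \<omega>))" using R_integrable by simp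
  qed (use st E True in \<open>auto intro: N_integrable N_continuous b N_martingale stopping_time_hit c\<close>)
  moreover have "min (min t T) (hit c \<omega>) = min t (hit c \<omega>)" if "\<omega> \<in> space M" for \<omega>
    using hit_attained(2)[OF c that] by auto
  ultimately show ?thesis by (simp cong: Bochner_Integration.integral_cong)
next
  case False
  have "indicator E \<omega> * (N (min t (hit c \<omega>)) \<omega> - N (min s (hit c \<omega>)) \<omega>) = 0" if "\<omega> \<in> space M" for \<omega>
    using hit_attained(2)[OF c that] False st by (simp add: min_def)
  then have "(\<integral>\<omega>. indicator E \<omega> * (N (min t (hit c \<omega>)) \<omega> - N (min s (hit c \<omega>)) \<omega>) \<partial>M) = (\<integral>\<omega>. 0 \<partial>M)"
    by (intro Bochner_Integration.integral_cong refl)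
  then show ?thesis by simp
qed

lemma stopped_N_increment:
  assumes \<omega>: "\<omega> \<in> space M" and "t0 \<le> t" "0 \<le> h"
  shows "N (min (t + h) (hit c \<omega>)) \<omega> - N (min t (hit c \<omega>)) \<omega> =
    f (X (min (t + h) (hit c \<omega>)) \<omega>) - f (X (min t (hit c \<omega>)) \<omega>)
    - integral {min t (hit c \<omega>)..min (t + h) (hit c \<omega>)} (\<lambda>s. L s (X s \<omega>))"
proof -
  have "t0 \<le> min t (hit c \<omega>)" "min t (hit c \<omega>) \<le> min (t + h) (hit c \<omega>)"
    using hit_attained(1)[OF c \<omega>] assms by auto
  from Henstock_Kurzweil_Integration.integral_combine[OF this integrable_continuous_interval[OF L_X_continuous[OF \<omega>]]]
  show ?thesis by (simp add: N_def)
qed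

end

end

lemma sum_hbar_mat:
  fixes a :: "'n::finite \<Rightarrow> 'n \<Rightarrow> real"
  shows "(\<Sum>i\<in>UNIV. \<Sum>j\<in>UNIV. (hbar *\<^sub>R mat 1 :: real^'n^'n) $ i $ j * a i j) / 2 = hbar / 2 * (\<Sum>i\<in>UNIV. a i i)"
proof -
  have "(\<Sum>j\<in>UNIV. (hbar *\<^sub>R mat 1 :: real^'n^'n) $ i $ j * a i j) = hbar * a i i" for i
  proof -
    have "(\<Sum>j\<in>UNIV. (hbar *\<^sub>R mat 1 :: real^'n^'n) $ i $ j * a i j) = (\<Sum>j\<in>UNIV. if j = i then hbar * a i i else 0)"
      by (intro sum.cong refl) (auto simp: mat_def)
    then show ?thesis by simp
  qed
  then show ?thesis by (simp add: sum_distrib_left[symmetric])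
qed

context brownian_drift
begin

lemma coordinate_problem: "martingale_problem M F t0 B R \<beta> K \<Lambda> \<delta> hbar (\<lambda>x. x $ k) (\<lambda>i x. if i = k then 1 else 0) (\<lambda>_ _ _. 0) 1"
  by (intro martingale_problem.intro brownian_drift_axioms coordinate_test_function)

lemma product_problem: "martingale_problem M F t0 B R \<beta> K \<Lambda> \<delta> hbar (\<lambda>x. x $ k * x $ l)
   (\<lambda>i x. (if i = k then x $ l else 0) + (if i = l then x $ k else 0))
   (\<lambda>i j _. (if i = k \<and> j = l then 1 else 0) + (if i = l \<and> j = k then 1 else 0)) 2"
  by (intro martingale_problem.intro brownian_drift_axioms product_test_function)

lemma drift_X_adapted: "t0 \<le> t \<Longrightarrow> (\<lambda>\<omega>. \<beta> t (X t \<omega>) $ i) \<in> borel_measurable (F t)"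
  using measurable_compose[OF measurable_Pair[OF measurable_const[of t] X_adapted[of t]] measurable_drift]
  by (intro measurable_compose[OF _ vec_nth_measurable]) simp

lemma drift_component_bound: "\<bar>\<beta> t x $ i\<bar> \<le> K"
  using component_le_norm_cart[of "\<beta> t x" i] drift_bounded[of t x] by linarith

lemma continuous_X_component: "\<omega> \<in> space M \<Longrightarrow> continuous_on S (\<lambda>s. X s \<omega> $ i)"
  by (intro continuous_intros continuous_on_subset[OF continuous_X]) auto

lemma continuous_drift_component: "\<omega> \<in> space M \<Longrightarrow> continuous_on S (\<lambda>s. \<beta> s (X s \<omega>) $ i)"
  by (intro continuous_intros continuous_drift continuous_on_subset[OF continuous_X]) auto

context
  fixes c :: real
  assumes c: "0 < c" "c \<le> 1"
begin

lemma stopped_X_measurable: "t0 \<le> t \<Longrightarrow> (\<lambda>\<omega>. X (min t (hit c \<omega>)) \<omega> $ i) \<in> borel_measurable (F t)"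
  by (rule stopped_measurable[OF c, of t "\<lambda>t \<omega>. X t \<omega> $ i"])
     (auto intro: continuous_X_component measurable_compose[OF X_adapted vec_nth_measurable])

text \<open>For a coordinate function the generator gives the corresponding component of the drift,
  and \<open>N\<close> is the coordinate minus the integrated drift.\<close>

lemma mean_rate:
  assumes t: "t0 \<le> t"
    and V: "\<And>\<omega>. \<omega> \<in> space M \<Longrightarrow> t < hit c \<omega> \<Longrightarrow> V \<omega> = \<beta> t (X t \<omega>) $ i"
  shows "cond_rate M (F t) {\<omega>. t < hit c \<omega>} (\<lambda>h \<omega>. stopped_increment X (hit c) t h \<omega> $ i) V"
proof -
  interpret P: martingale_problem M F t0 B R \<beta> K \<Lambda> \<delta> x0 hbar "\<lambda>x. x $ i" "\<lambda>k x. if k = i then 1 else 0" "\<lambda>_ _ _. 0" 1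
    by (rule coordinate_problem)
  let ?I = "\<lambda>h \<omega>. integral {min t (hit c \<omega>)..min (t + h) (hit c \<omega>)} (\<lambda>s. \<beta> s (X s \<omega>) $ i)"
  have L: "P.L s x = \<beta> s x $ i" for s x
    by (simp add: P.L_def if_distrib[of "\<lambda>y. _ * y"] cong: if_cong)
  have inc: "stopped_increment X (hit c) t h \<omega> $ i - ?I h \<omega> = P.N (min (t + h) (hit c \<omega>)) \<omega> - P.N (min t (hit c \<omega>)) \<omega>"
    if "\<omega> \<in> space M" "0 < h" for \<omega> h
    using P.stopped_N_increment[OF c that(1) t less_imp_le[OF that(2)]] by (simp add: stopped_increment_def L)
  obtain b where b: "\<And>\<omega> t. \<omega> \<in> space M \<Longrightarrow> (norm (X t \<omega>))\<^sup>2 \<le> b * (1 + R \<omega>)" using P.X_bound by blast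
  have Xint: "integrable M (\<lambda>\<omega>. X (min s (hit c \<omega>)) \<omega> $ i)" if s: "t0 \<le> s" for s
  proof (rule P.integrable_dominated[OF F_measurable_M[OF stopped_X_measurable[OF s]]])
    fix \<omega> assume \<omega>: "\<omega> \<in> space M"
    show "\<bar>X (min s (hit c \<omega>)) \<omega> $ i\<bar> \<le> (1 + b) * (1 + R \<omega>)"
      using b[OF \<omega>, of "min s (hit c \<omega>)"] order_trans[OF component_le_norm_cart norm_le_square, of "X (min s (hit c \<omega>)) \<omega>" i] P.R_nonneg[of \<omega>]
      by (simp add: algebra_simps)
  qed
  have Yint: "integrable M (\<lambda>\<omega>. stopped_increment X (hit c) t h \<omega> $ i)" if "0 < h" for h
    unfolding stopped_increment_def vector_minus_component using t that by (intro Bochner_Integration.integrable_diff Xint) auto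
  have Nint: "integrable M (\<lambda>\<omega>. P.N (min (t + h) (hit c \<omega>)) \<omega> - P.N (min t (hit c \<omega>)) \<omega>)" if "0 < h" for h
    using t that by (intro Bochner_Integration.integrable_diff P.stopped_N_integrable[OF c]) auto
  show ?thesis
  proof (rule cond_rate_hit[OF c t, where \<psi> = "\<lambda>s \<omega>. \<beta> s (X s \<omega>) $ i" and b = K])
    fix h :: real assume h: "0 < h"
    show "integrable M (\<lambda>\<omega>. stopped_increment X (hit c) t h \<omega> $ i)" by (rule Yint[OF h])
    have "integrable M (\<lambda>\<omega>. stopped_increment X (hit c) t h \<omega> $ i - (P.N (min (t + h) (hit c \<omega>)) \<omega> - P.N (min t (hit c \<omega>)) \<omega>))"
      by (intro Bochner_Integration.integrable_diff Yint Nint h)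
    moreover have "stopped_increment X (hit c) t h \<omega> $ i - (P.N (min (t + h) (hit c \<omega>)) \<omega> - P.N (min t (hit c \<omega>)) \<omega>) = ?I h \<omega>"
      if "\<omega> \<in> space M" for \<omega>
      using inc[OF that h] by linarith
    ultimately show "integrable M (?I h)"
      by (rule Bochner_Integration.integrable_cong[OF refl, THEN iffD1, rotated])
    fix E assume E: "E \<in> sets (F t)"
    have "(\<integral>\<omega>. indicator E \<omega> * (stopped_increment X (hit c) t h \<omega> $ i - ?I h \<omega>) \<partial>M) =
       (\<integral>\<omega>. indicator E \<omega> * (P.N (min (t + h) (hit c \<omega>)) \<omega> - P.N (min t (hit c \<omega>)) \<omega>) \<partial>M)"
      by (intro Bochner_Integration.integral_cong refl) (simp only: inc h)
    also have "\<dots> = 0" using h by (intro P.stopped_N_martingale[OF c t _ E]) simp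
    finally show "(\<integral>\<omega>. indicator E \<omega> * (stopped_increment X (hit c) t h \<omega> $ i - ?I h \<omega>) \<partial>M) = 0" .
  qed (use V t in \<open>auto intro: continuous_drift_component drift_component_bound drift_X_adapted\<close>)
qed

text \<open>With the values \<open>U\<close> of the coordinates at the time \<open>min t (hit c)\<close>, the product of the
  increments is \<open>\<Delta>(x\<^sub>i x\<^sub>j) - U\<^sub>i \<Delta>x\<^sub>j - U\<^sub>j \<Delta>x\<^sub>i\<close>. Up to martingale increments multiplied by
  variables of the past, it is therefore the integral of \<open>\<psi>\<close>, obtained by combining the three
  generators in the same way. At \<open>s = t\<close> the drift terms of \<open>\<psi>\<close> cancel and only the covariance
  \<open>hbar \<delta>\<^sub>i\<^sub>j\<close> remains.\<close>

lemma quadratic_mean_rate: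
  assumes t: "t0 \<le> t"
  shows "cond_rate M (F t) {\<omega>. t < hit c \<omega>}
     (\<lambda>h \<omega>. stopped_increment X (hit c) t h \<omega> $ i * stopped_increment X (hit c) t h \<omega> $ j) (\<lambda>\<omega>. (hbar *\<^sub>R mat 1 :: real^'n^'n) $ i $ j)"
proof -
  interpret Pi: martingale_problem M F t0 B R \<beta> K \<Lambda> \<delta> x0 hbar "\<lambda>x. x $ i" "\<lambda>k x. if k = i then 1 else 0" "\<lambda>_ _ _. 0" 1
    by (rule coordinate_problem)
  interpret Pj: martingale_problem M F t0 B R \<beta> K \<Lambda> \<delta> x0 hbar "\<lambda>x. x $ j" "\<lambda>k x. if k = j then 1 else 0" "\<lambda>_ _ _. 0" 1
    by (rule coordinate_problem)
  interpret P: martingale_problem M F t0 B R \<beta> K \<Lambda> \<delta> x0 hbar "\<lambda>x. x $ i * x $ j"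
     "\<lambda>k x. (if k = i then x $ j else 0) + (if k = j then x $ i else 0)"
     "\<lambda>k l _. (if k = i \<and> l = j then 1 else 0) + (if k = j \<and> l = i then 1 else 0)" 2
    by (rule product_problem)
  define \<kappa> where "\<kappa> = (if i = j then hbar else 0)"
  define U where "U k \<omega> = X (min t (hit c \<omega>)) \<omega> $ k" for k \<omega>
  define D where "D h k \<omega> = stopped_increment X (hit c) t h \<omega> $ k" for h k \<omega>
  define \<psi> where "\<psi> s \<omega> = \<beta> s (X s \<omega>) $ i * (X s \<omega> $ j - U j \<omega>) + \<beta> s (X s \<omega>) $ j * (X s \<omega> $ i - U i \<omega>) + \<kappa>" for s \<omega>
  define v where "v h \<omega> = min (t + h) (hit c \<omega>)" for h \<omega>
  define u where "u \<omega> = min t (hit c \<omega>)" for \<omega>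
  let ?I = "\<lambda>h \<omega>. integral {u \<omega>..v h \<omega>} (\<lambda>s. \<psi> s \<omega>)"
  have Li: "Pi.L s x = \<beta> s x $ i" and Lj: "Pj.L s x = \<beta> s x $ j" for s x
    by (simp_all add: Pi.L_def Pj.L_def if_distrib[of "\<lambda>y. _ * y"] cong: if_cong)
  have L: "P.L s x = \<beta> s x $ i * x $ j + \<beta> s x $ j * x $ i + \<kappa>" for s x
  proof -
    have "(\<Sum>k\<in>UNIV. (if k = i \<and> k = j then 1 else 0) + (if k = j \<and> k = i then 1 else 0)) = (\<Sum>k\<in>UNIV. if k = i then (if i = j then 2 else 0) else (0::real))"
    proof (intro sum.cong refl)
      fix k
      show "(if k = i \<and> k = j then 1 else 0) + (if k = j \<and> k = i then 1 else 0) = (if k = i then (if i = j then 2 else 0) else (0::real))"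
        by (cases "k = i"; cases "k = j") simp_all
    qed
    then have "hbar / 2 * (\<Sum>k\<in>UNIV. (if k = i \<and> k = j then 1 else 0) + (if k = j \<and> k = i then 1 else 0)) = \<kappa>"
      by (simp only:) (simp add: \<kappa>_def)
    moreover have "(\<Sum>k\<in>UNIV. \<beta> s x $ k * ((if k = i then x $ j else 0) + (if k = j then x $ i else 0))) = \<beta> s x $ i * x $ j + \<beta> s x $ j * x $ i"
      by (simp add: distrib_left sum.distrib if_distrib[of "\<lambda>y. _ * y"] cong: if_cong)
    ultimately show ?thesis unfolding P.L_def by (simp only:)
  qed
  have uv: "t0 \<le> u \<omega>" "u \<omega> \<le> v h \<omega>" "v h \<omega> \<le> T" if "\<omega> \<in> space M" "0 < h" for \<omega> h
    using hit_attained[OF c that(1)] t that(2) by (auto simp: u_def v_def)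
  let ?\<Delta> = "\<lambda>N h \<omega>. N (v h \<omega>) \<omega> - N (u \<omega>) \<omega> :: real"
  have \<psi>_cont: "continuous_on S (\<lambda>s. \<psi> s \<omega>)" if "\<omega> \<in> space M" for \<omega> S
    unfolding \<psi>_def by (intro continuous_intros continuous_X_component continuous_drift_component that)
  have inc: "D h i \<omega> * D h j \<omega> - ?I h \<omega> = ?\<Delta> P.N h \<omega> - U i \<omega> * ?\<Delta> Pj.N h \<omega> - U j \<omega> * ?\<Delta> Pi.N h \<omega>"
    if \<omega>: "\<omega> \<in> space M" and h: "0 < h" for \<omega> h
  proof -
    note N = P.stopped_N_increment[OF c \<omega> t less_imp_le[OF h], folded u_def v_def]
      Pi.stopped_N_increment[OF c \<omega> t less_imp_le[OF h], folded u_def v_def] Pj.stopped_N_increment[OF c \<omega> t less_imp_le[OF h], folded u_def v_def]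
    have i1: "(\<lambda>s. \<beta> s (X s \<omega>) $ i * X s \<omega> $ j + \<beta> s (X s \<omega>) $ j * X s \<omega> $ i + \<kappa>) integrable_on {u \<omega>..v h \<omega>}"
      "(\<lambda>s. \<beta> s (X s \<omega>) $ i) integrable_on {u \<omega>..v h \<omega>}" "(\<lambda>s. \<beta> s (X s \<omega>) $ j) integrable_on {u \<omega>..v h \<omega>}"
      by (intro integrable_continuous_interval continuous_intros continuous_X_component continuous_drift_component \<omega>)+
    have "((\<lambda>s. (\<beta> s (X s \<omega>) $ i * X s \<omega> $ j + \<beta> s (X s \<omega>) $ j * X s \<omega> $ i + \<kappa>) - U j \<omega> * \<beta> s (X s \<omega>) $ i - U i \<omega> * \<beta> s (X s \<omega>) $ j) has_integral
       integral {u \<omega>..v h \<omega>} (\<lambda>s. \<beta> s (X s \<omega>) $ i * X s \<omega> $ j + \<beta> s (X s \<omega>) $ j * X s \<omega> $ i + \<kappa>)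
        - U j \<omega> * integral {u \<omega>..v h \<omega>} (\<lambda>s. \<beta> s (X s \<omega>) $ i) - U i \<omega> * integral {u \<omega>..v h \<omega>} (\<lambda>s. \<beta> s (X s \<omega>) $ j)) {u \<omega>..v h \<omega>}"
      by (intro has_integral_diff has_integral_mult_right integrable_integral i1)
    from integral_unique[OF this]
    have I: "?I h \<omega> = integral {u \<omega>..v h \<omega>} (\<lambda>s. \<beta> s (X s \<omega>) $ i * X s \<omega> $ j + \<beta> s (X s \<omega>) $ j * X s \<omega> $ i + \<kappa>)
        - U j \<omega> * integral {u \<omega>..v h \<omega>} (\<lambda>s. \<beta> s (X s \<omega>) $ i) - U i \<omega> * integral {u \<omega>..v h \<omega>} (\<lambda>s. \<beta> s (X s \<omega>) $ j)"
      unfolding \<psi>_def by (simp add: algebra_simps)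
    have D: "D h k \<omega> = X (v h \<omega>) \<omega> $ k - U k \<omega>" for k
      by (simp add: D_def stopped_increment_def U_def v_def)
    have Uu: "U k \<omega> = X (u \<omega>) \<omega> $ k" for k by (simp add: U_def u_def)
    show ?thesis unfolding N I L Li Lj D Uu by (simp add: algebra_simps)
  qed
  obtain b where b: "0 \<le> b" "\<And>\<omega> t. \<omega> \<in> space M \<Longrightarrow> (norm (X t \<omega>))\<^sup>2 \<le> b * (1 + R \<omega>)" using P.X_bound by blast
  have Um: "U k \<in> borel_measurable (F t)" for k unfolding U_def[abs_def] by (rule stopped_X_measurable[OF t])
  have Dm: "D h k \<in> borel_measurable M" if "0 < h" for h k
    unfolding D_def[abs_def] stopped_increment_def vector_minus_component using t that
    by (intro borel_measurable_diff F_measurable_M[OF stopped_X_measurable]) auto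
  have comp: "(X s \<omega> $ k)\<^sup>2 \<le> b * (1 + R \<omega>)" if "\<omega> \<in> space M" for s k \<omega>
  proof -
    have "\<bar>X s \<omega> $ k\<bar>\<^sup>2 \<le> (norm (X s \<omega>))\<^sup>2" by (intro power_mono component_le_norm_cart) auto
    with b(2)[OF that, of s] show ?thesis by simp
  qed
  have prod_le: "\<bar>p * q\<bar> \<le> y" if "p\<^sup>2 \<le> y" "q\<^sup>2 \<le> y" for p q y :: real
  proof -
    have "0 \<le> (\<bar>p\<bar> - \<bar>q\<bar>)\<^sup>2" by simp
    then have "2 * \<bar>p * q\<bar> \<le> p\<^sup>2 + q\<^sup>2" by (simp add: power2_diff abs_mult)
    with that show ?thesis by linarith
  qed
  have Dsq: "(D h k \<omega>)\<^sup>2 \<le> 4 * b * (1 + R \<omega>)" if "\<omega> \<in> space M" for h k \<omega>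
  proof -
    have "(D h k \<omega>)\<^sup>2 \<le> 2 * (X (v h \<omega>) \<omega> $ k)\<^sup>2 + 2 * (X (u \<omega>) \<omega> $ k)\<^sup>2"
      using square_sum_le[of "X (v h \<omega>) \<omega> $ k" "- (X (u \<omega>) \<omega> $ k)"] by (simp add: D_def stopped_increment_def u_def v_def)
    with comp[OF that, of "v h \<omega>" k] comp[OF that, of "u \<omega>" k] show ?thesis by (simp add: algebra_simps)
  qed
  have Yint: "integrable M (\<lambda>\<omega>. D h i \<omega> * D h j \<omega>)" if h: "0 < h" for h
    by (rule P.integrable_dominated[of _ "4 * b"]) (auto intro!: borel_measurable_times Dm h prod_le Dsq)
  have \<Delta>int: "integrable M (?\<Delta> N h)" if "0 < h" "\<And>s. t0 \<le> s \<Longrightarrow> integrable M (\<lambda>\<omega>. N (min s (hit c \<omega>)) \<omega>)" for N h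
    unfolding u_def v_def using t that(1) by (intro Bochner_Integration.integrable_diff that(2)) auto
  have \<Delta>ints: "integrable M (?\<Delta> P.N h)" "integrable M (?\<Delta> Pi.N h)" "integrable M (?\<Delta> Pj.N h)" if "0 < h" for h
    using that by (auto intro!: \<Delta>int P.stopped_N_integrable[OF c] Pi.stopped_N_integrable[OF c] Pj.stopped_N_integrable[OF c])
  have coord_sq: "(?\<Delta> N h \<omega>)\<^sup>2 \<le> (8 * b + 2 * K\<^sup>2) * (1 + R \<omega>)"
    if \<omega>: "\<omega> \<in> space M" and h: "0 < h" and N: "?\<Delta> N h \<omega> = D h k \<omega> - integral {u \<omega>..v h \<omega>} (\<lambda>s. \<beta> s (X s \<omega>) $ k)" for N h \<omega> k
  proof -
    have "norm (integral {u \<omega>..v h \<omega>} (\<lambda>s. \<beta> s (X s \<omega>) $ k)) \<le> K * (v h \<omega> - u \<omega>)"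
      using uv[OF \<omega> h] drift_component_bound by (intro integral_bound continuous_drift_component[OF \<omega>]) auto
    also have "\<dots> \<le> K * 1" using uv[OF \<omega> h] \<delta> by (intro mult_left_mono K_nonneg) auto
    finally have "\<bar>integral {u \<omega>..v h \<omega>} (\<lambda>s. \<beta> s (X s \<omega>) $ k)\<bar>\<^sup>2 \<le> K\<^sup>2" by (intro power_mono) auto
    moreover have "(?\<Delta> N h \<omega>)\<^sup>2 \<le> 2 * (D h k \<omega>)\<^sup>2 + 2 * (integral {u \<omega>..v h \<omega>} (\<lambda>s. \<beta> s (X s \<omega>) $ k))\<^sup>2"
      unfolding N using square_sum_le[of "D h k \<omega>" "- integral {u \<omega>..v h \<omega>} (\<lambda>s. \<beta> s (X s \<omega>) $ k)"] by simp
    ultimately have "(?\<Delta> N h \<omega>)\<^sup>2 \<le> 2 * (4 * b * (1 + R \<omega>)) + 2 * K\<^sup>2" using Dsq[OF \<omega>, of h k] by simp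
    also have "\<dots> \<le> (8 * b + 2 * K\<^sup>2) * (1 + R \<omega>)" using P.R_nonneg[of \<omega>] by (simp add: algebra_simps)
    finally show ?thesis .
  qed
  have Ni: "?\<Delta> Pi.N h \<omega> = D h i \<omega> - integral {u \<omega>..v h \<omega>} (\<lambda>s. \<beta> s (X s \<omega>) $ i)"
    and Nj: "?\<Delta> Pj.N h \<omega> = D h j \<omega> - integral {u \<omega>..v h \<omega>} (\<lambda>s. \<beta> s (X s \<omega>) $ j)" if "\<omega> \<in> space M" "0 < h" for h \<omega>
    using Pi.stopped_N_increment[OF c that(1) t less_imp_le[OF that(2)], folded u_def v_def]
      Pj.stopped_N_increment[OF c that(1) t less_imp_le[OF that(2)], folded u_def v_def]
    by (simp_all add: D_def stopped_increment_def u_def v_def Li Lj)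
  have UN: "integrable M (\<lambda>\<omega>. \<Phi> \<omega> * ?\<Delta> N h \<omega>)"
    if h: "0 < h" and m: "\<Phi> \<in> borel_measurable M" "?\<Delta> N h \<in> borel_measurable M"
      and \<Phi>: "\<And>\<omega>. \<omega> \<in> space M \<Longrightarrow> (\<Phi> \<omega>)\<^sup>2 \<le> b * (1 + R \<omega>)"
      and N: "\<And>\<omega>. \<omega> \<in> space M \<Longrightarrow> ?\<Delta> N h \<omega> = D h k \<omega> - integral {u \<omega>..v h \<omega>} (\<lambda>s. \<beta> s (X s \<omega>) $ k)" for \<Phi> N h k
  proof (rule P.integrable_dominated[of _ "8 * b + 2 * K\<^sup>2"])
    fix \<omega> assume \<omega>: "\<omega> \<in> space M"
    have "b * (1 + R \<omega>) \<le> (8 * b + 2 * K\<^sup>2) * (1 + R \<omega>)"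
      using P.R_nonneg[of \<omega>] b(1) by (intro mult_right_mono) auto
    moreover have "(?\<Delta> N h \<omega>)\<^sup>2 \<le> (8 * b + 2 * K\<^sup>2) * (1 + R \<omega>)"
      using \<omega> h N[OF \<omega>] by (rule coord_sq)
    ultimately show "\<bar>\<Phi> \<omega> * ?\<Delta> N h \<omega>\<bar> \<le> (8 * b + 2 * K\<^sup>2) * (1 + R \<omega>)"
      using \<Phi>[OF \<omega>] by (intro prod_le) auto
  qed (intro borel_measurable_times m)
  have U2: "(U k \<omega>)\<^sup>2 \<le> b * (1 + R \<omega>)" if "\<omega> \<in> space M" for k \<omega> unfolding U_def by (rule comp[OF that])
  have UNint: "integrable M (\<lambda>\<omega>. U i \<omega> * ?\<Delta> Pj.N h \<omega>)" "integrable M (\<lambda>\<omega>. U j \<omega> * ?\<Delta> Pi.N h \<omega>)" if h: "0 < h" for h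
    by (rule UN[OF h _ _ U2 Nj], simp_all add: F_measurable_M[OF Um] borel_measurable_integrable[OF \<Delta>ints(3)[OF h]] h)
       (rule UN[OF h _ _ U2 Ni], simp_all add: F_measurable_M[OF Um] borel_measurable_integrable[OF \<Delta>ints(2)[OF h]] h)
  have "cond_rate M (F t) {\<omega>. t < hit c \<omega>} (\<lambda>h \<omega>. D h i \<omega> * D h j \<omega>) (\<lambda>\<omega>. \<kappa>)"
  proof (rule cond_rate_hit[OF c t, where \<psi> = \<psi> and b = "K * 2 + K * 2 + \<bar>\<kappa>\<bar>", folded u_def v_def])
    fix h :: real assume h: "0 < h"
    show "integrable M (\<lambda>\<omega>. D h i \<omega> * D h j \<omega>)" by (rule Yint[OF h])
    have "integrable M (\<lambda>\<omega>. D h i \<omega> * D h j \<omega> - (?\<Delta> P.N h \<omega> - U i \<omega> * ?\<Delta> Pj.N h \<omega> - U j \<omega> * ?\<Delta> Pi.N h \<omega>))"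
      by (intro Bochner_Integration.integrable_diff Yint[OF h] \<Delta>ints(1)[OF h] UNint[OF h])
    moreover have "D h i \<omega> * D h j \<omega> - (?\<Delta> P.N h \<omega> - U i \<omega> * ?\<Delta> Pj.N h \<omega> - U j \<omega> * ?\<Delta> Pi.N h \<omega>) = ?I h \<omega>" if "\<omega> \<in> space M" for \<omega>
      using inc[OF that h] by linarith
    ultimately show "integrable M (?I h)"
      by (rule Bochner_Integration.integrable_cong[OF refl, THEN iffD1, rotated])
    fix E assume E: "E \<in> sets (F t)"
    have E': "E \<in> sets M" by (rule subsetD[OF sets_F_subset E])
    have orth: "(\<integral>\<omega>. (indicator E \<omega> * U k \<omega>) * ?\<Delta> N h \<omega> \<partial>M) = 0" and orth_int: "integrable M (\<lambda>\<omega>. (indicator E \<omega> * U k \<omega>) * ?\<Delta> N h \<omega>)"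
      if iN: "integrable M (?\<Delta> N h)" and iUN: "integrable M (\<lambda>\<omega>. U k \<omega> * ?\<Delta> N h \<omega>)"
        and z: "\<And>A. A \<in> sets (F t) \<Longrightarrow> (\<integral>\<omega>. indicator A \<omega> * ?\<Delta> N h \<omega> \<partial>M) = 0" for k N
    proof -
      show i: "integrable M (\<lambda>\<omega>. (indicator E \<omega> * U k \<omega>) * ?\<Delta> N h \<omega>)"
        using integrable_mult_indicator[OF E' iUN] by (simp add: mult.assoc)
      have "(\<lambda>\<omega>. indicator E \<omega> * U k \<omega>) \<in> borel_measurable (F t)"
        using E by (intro borel_measurable_times borel_measurable_indicator Um)
      from P.orthogonal_to_past[OF iN z this i] show "(\<integral>\<omega>. (indicator E \<omega> * U k \<omega>) * ?\<Delta> N h \<omega> \<partial>M) = 0" .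
    qed
    have z: "(\<integral>\<omega>. indicator A \<omega> * ?\<Delta> P.N h \<omega> \<partial>M) = 0" "(\<integral>\<omega>. indicator A \<omega> * ?\<Delta> Pi.N h \<omega> \<partial>M) = 0" "(\<integral>\<omega>. indicator A \<omega> * ?\<Delta> Pj.N h \<omega> \<partial>M) = 0"
      if A: "A \<in> sets (F t)" for A
      using h P.stopped_N_martingale[OF c t _ A, of "t + h"] Pi.stopped_N_martingale[OF c t _ A, of "t + h"] Pj.stopped_N_martingale[OF c t _ A, of "t + h"]
      by (simp_all add: u_def v_def)
    have iE: "integrable M (\<lambda>\<omega>. indicator E \<omega> * ?\<Delta> P.N h \<omega>)"
      using integrable_mult_indicator[OF E' \<Delta>ints(1)[OF h]] by simp
    note o1 = orth[OF \<Delta>ints(3)[OF h] UNint(1)[OF h] z(3)] orth_int[OF \<Delta>ints(3)[OF h] UNint(1)[OF h] z(3)]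
    note o2 = orth[OF \<Delta>ints(2)[OF h] UNint(2)[OF h] z(2)] orth_int[OF \<Delta>ints(2)[OF h] UNint(2)[OF h] z(2)]
    have "(\<integral>\<omega>. indicator E \<omega> * (D h i \<omega> * D h j \<omega> - ?I h \<omega>) \<partial>M) =
      (\<integral>\<omega>. indicator E \<omega> * ?\<Delta> P.N h \<omega> - (indicator E \<omega> * U i \<omega>) * ?\<Delta> Pj.N h \<omega> - (indicator E \<omega> * U j \<omega>) * ?\<Delta> Pi.N h \<omega> \<partial>M)"
      by (intro Bochner_Integration.integral_cong refl, subst inc[OF _ h]) (simp_all only: right_diff_distrib mult.assoc)
    also have "\<dots> = 0"
      by (simp only: Bochner_Integration.integral_diff[OF Bochner_Integration.integrable_diff[OF iE o1(2)] o2(2)]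
        Bochner_Integration.integral_diff[OF iE o1(2)] o1(1) o2(1) z(1)[OF E] diff_self diff_zero)
    finally show "(\<integral>\<omega>. indicator E \<omega> * (D h i \<omega> * D h j \<omega> - ?I h \<omega>) \<partial>M) = 0" .
  next
    fix \<omega> assume \<omega>: "\<omega> \<in> space M"
    show "continuous_on {t0..T} (\<lambda>s. \<psi> s \<omega>)" by (rule \<psi>_cont[OF \<omega>])
    fix s assume s: "t \<le> s" "s < hit c \<omega>"
    have ut: "u \<omega> = t" using s by (simp add: u_def)
    have near: "\<bar>X s \<omega> $ k - U k \<omega>\<bar> \<le> 2" for k
    proof -
      have "norm (X s \<omega> - X t \<omega>) \<le> norm (X s \<omega> - x0) + norm (X t \<omega> - x0)"
        using norm_triangle_ineq4[of "X s \<omega> - x0" "X t \<omega> - x0"] by simp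
      also have "\<dots> \<le> 2" using X_near_before_hit[OF c \<omega>, of s] X_near_before_hit[OF c \<omega>, of t] s t by simp
      finally have "norm (X s \<omega> - X t \<omega>) \<le> 2" .
      with component_le_norm_cart[of "X s \<omega> - X t \<omega>" k] show ?thesis
        using ut by (simp add: U_def u_def)
    qed
    have bd: "\<bar>\<beta> s (X s \<omega>) $ k * (X s \<omega> $ l - U l \<omega>)\<bar> \<le> K * 2" for k l
      unfolding abs_mult by (intro mult_mono drift_component_bound near K_nonneg) auto
    show "\<bar>\<psi> s \<omega>\<bar> \<le> K * 2 + K * 2 + \<bar>\<kappa>\<bar>"
      unfolding \<psi>_def by (intro order_trans[OF abs_triangle_ineq] add_mono bd order.refl)
  next
    show "\<psi> t \<in> borel_measurable (F t)"
      unfolding \<psi>_def[abs_def] using t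
      by (intro borel_measurable_add borel_measurable_times borel_measurable_diff drift_X_adapted Um borel_measurable_const
        measurable_compose[OF X_adapted vec_nth_measurable]) auto
    fix \<omega> assume "t < hit c \<omega>"
    then show "\<kappa> = \<psi> t \<omega>" by (simp add: \<psi>_def U_def)
  qed
  moreover have "(hbar *\<^sub>R mat 1 :: real^'n^'n) $ i $ j = \<kappa>" by (simp add: mat_def \<kappa>_def)
  ultimately show ?thesis unfolding D_def by simp
qed

end

lemma has_mean_derivative_X:
  assumes V: "\<And>t \<omega>. t0 \<le> t \<Longrightarrow> \<omega> \<in> space M \<Longrightarrow> t < hit 1 \<omega> \<Longrightarrow> V t \<omega> = \<beta> t (X t \<omega>)"
  shows "has_mean_derivative M F t0 (\<lambda>\<omega>. ereal (hit 1 \<omega>)) X V"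
  unfolding has_mean_derivative_def
proof (intro exI[of _ "\<lambda>k. hit (level k)"] conjI localizing_hit allI impI)
  fix k t i assume t: "t0 \<le> t"
  have "hit (level k) \<omega> < hit 1 \<omega>" if "\<omega> \<in> space M" for \<omega>
    using hit_strict_mono[OF level(1,2) order.refl that] by simp
  then show "cond_rate M (F t) {\<omega>. t < hit (level k) \<omega>} (\<lambda>h \<omega>. stopped_increment X (hit (level k)) t h \<omega> $ i) (\<lambda>\<omega>. V t \<omega> $ i)"
    using V[OF t] by (intro mean_rate level(1) less_imp_le[OF level(2)] t) fastforce
qed

lemma has_quadratic_mean_derivative_X:
  "has_quadratic_mean_derivative M F t0 (\<lambda>\<omega>. ereal (hit 1 \<omega>)) X (\<lambda>t \<omega>. hbar *\<^sub>R mat 1)"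
  unfolding has_quadratic_mean_derivative_def
  by (intro exI[of _ "\<lambda>k. hit (level k)"] conjI localizing_hit allI impI quadratic_mean_rate level(1) less_imp_le[OF level(2)])

lemma admissible_drift: "admissible_coefficients \<beta> (\<lambda>_ _. hbar *\<^sub>R mat 1)"
  unfolding admissible_coefficients_def
proof (intro conjI allI impI)
  show "(\<lambda>(t, x). \<beta> t x) \<in> borel_measurable borel"
    by (rule borel_measurable_continuous_onI[OF drift_continuous])
  fix S :: "(real \<times> (real^'n)) set"
  show "bounded ((\<lambda>(t, x). \<beta> t x) ` S)"
    unfolding bounded_iff using drift_bounded by (intro exI[of _ K]) auto
  show "bounded ((\<lambda>(t, x). hbar *\<^sub>R mat 1 :: real^'n^'n) ` S)"
    by (rule bounded_subset[of "{hbar *\<^sub>R mat 1}"]) auto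
next
  show "transpose (hbar *\<^sub>R mat 1 :: real^'n^'n) = hbar *\<^sub>R mat 1"
    by (simp add: transpose_scalar transpose_mat)
  show "0 \<le> v \<bullet> ((hbar *\<^sub>R mat 1 :: real^'n^'n) *v v)" for v
    using hbar by (simp add: scaleR_matrix_vector_assoc[symmetric])
qed (simp add: split_beta')

lemma diffusion_X: "diffusion M F t0 (\<lambda>\<omega>. ereal (hit 1 \<omega>)) X"
  unfolding diffusion_def
proof (intro conjI allI impI ballI exI)
  fix t assume t: "t0 \<le> t"
  show "(\<lambda>\<omega>. if ereal t < ereal (hit 1 \<omega>) then X t \<omega> else 0) \<in> borel_measurable (F t)"
    by (rule measurable_If[OF X_adapted[OF t]]) (use stopped_event[of 1 t] in simp_all)
next
  fix \<omega> assume "\<omega> \<in> space M"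
  then show "continuous_on {t. t0 \<le> t \<and> ereal t < ereal (hit 1 \<omega>)} (\<lambda>t. X t \<omega>)"
    by (intro continuous_on_subset[OF continuous_X]) auto
next
  show "admissible_coefficients \<beta> (\<lambda>_ _. hbar *\<^sub>R mat 1)" by (rule admissible_drift)
  show "localizing M F t0 (\<lambda>\<omega>. ereal (hit 1 \<omega>)) (\<lambda>k. hit (level k))" by (rule localizing_hit)
  fix f :: "real^'n \<Rightarrow> real" and Ks k
  assume f: "smooth f \<and> compact Ks \<and> (\<forall>x. x \<notin> Ks \<longrightarrow> f x = 0)"
  define c where "c = level k"
  have c: "0 < c" "c \<le> 1" using level(1,2)[of k] by (auto simp: c_def)
  obtain C where C: "test_function f (\<lambda>i. partial i f) (\<lambda>i j. partial i (partial j f)) C"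
    using smooth_test_function[of f Ks] f by auto
  interpret P: martingale_problem M F t0 B R \<beta> K \<Lambda> \<delta> x0 hbar f "\<lambda>i. partial i f" "\<lambda>i j. partial i (partial j f)" C
    by (intro martingale_problem.intro brownian_drift_axioms C)
  have op: "diffusion_operator \<beta> (\<lambda>_ _. hbar *\<^sub>R mat 1) s f x = P.L s x" for s x
    unfolding diffusion_operator_def P.L_def sum_hbar_mat ..
  define Y where "Y t \<omega> = f (X (min t (hit c \<omega>)) \<omega>) -
     (LINT s:{t0..min t (hit c \<omega>)}|lborel. diffusion_operator \<beta> (\<lambda>_ _. hbar *\<^sub>R mat 1) s f (X s \<omega>))" for t \<omega>
  have Y: "Y t \<omega> = P.N (min t (hit c \<omega>)) \<omega>" if "\<omega> \<in> space M" for t \<omega>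
    unfolding Y_def P.N_def op
    by (subst set_borel_integral_eq_integral(2)[OF borel_integrable_atLeastAtMost'[OF P.L_X_continuous[OF that]]]) simp
  have Ym: "Y t \<in> borel_measurable (F t)" if "t0 \<le> t" for t
    by (rule measurable_cong[THEN iffD2, OF _ P.stopped_N_measurable[OF c that]]) (simp add: Y)
  have Yi: "integrable M (Y t)" if "t0 \<le> t" for t
    by (rule Bochner_Integration.integrable_cong[OF refl, THEN iffD2, OF _ P.stopped_N_integrable[OF c that]]) (rule Y)
  have "martingale_from M F t0 Y"
    unfolding martingale_from_def
  proof (intro conjI allI impI)
    fix s t assume st: "t0 \<le> s \<and> s \<le> t"
    interpret sub: finite_measure_subalgebra M "F s"
      by unfold_locales (rule filtration_subalgebra)
    have i: "integrable M (Y s)" "integrable M (Y t)" using st by (auto intro: Yi)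
    show "AE \<omega> in M. real_cond_exp M (F s) (Y t) \<omega> = Y s \<omega>"
    proof (rule sub.real_cond_exp_charact)
      fix A assume A: "A \<in> sets (F s)"
      have A': "A \<in> sets M" by (rule subsetD[OF sets_F_subset A])
      have "(\<integral>\<omega>. indicator A \<omega> * Y t \<omega> - indicator A \<omega> * Y s \<omega> \<partial>M) = (\<integral>\<omega>. indicator A \<omega> * (P.N (min t (hit c \<omega>)) \<omega> - P.N (min s (hit c \<omega>)) \<omega>) \<partial>M)"
        by (intro Bochner_Integration.integral_cong refl) (simp add: Y right_diff_distrib)
      also have "\<dots> = 0" using st by (intro P.stopped_N_martingale[OF c _ _ A]) auto
      finally have "(\<integral>\<omega>. indicator A \<omega> * Y t \<omega> - indicator A \<omega> * Y s \<omega> \<partial>M) = 0" .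
      moreover have "integrable M (\<lambda>\<omega>. indicator A \<omega> * Y t \<omega>)" "integrable M (\<lambda>\<omega>. indicator A \<omega> * Y s \<omega>)"
        using integrable_mult_indicator[OF A' i(1)] integrable_mult_indicator[OF A' i(2)] by simp_all
      ultimately show "(LINT \<omega>:A|M. Y t \<omega>) = (LINT \<omega>:A|M. Y s \<omega>)"
        by (simp add: set_lebesgue_integral_def)
    qed (use st i Ym in auto)
  qed (auto intro: Ym Yi)
  then show "martingale_from M F t0 (\<lambda>t \<omega>. f (X (min t (hit (level k) \<omega>)) \<omega>) -
     (LINT s:{t0..min t (hit (level k) \<omega>)}|lborel. diffusion_operator \<beta> (\<lambda>_ _. hbar *\<^sub>R mat 1) s f (X s \<omega>)))"
    unfolding Y_def c_def .
qed

end

section \<open>The drift of the Hamiltonian, frozen outside a cylinder\<close>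

text \<open>On a compact set the first derivatives are bounded, and convexity allows the mean value
  theorem along segments.\<close>

lemma smooth_lipschitz_on:
  assumes f: "smooth f" and S: "convex S" "compact S"
  shows "\<exists>c\<ge>0. \<forall>x\<in>S. \<forall>y\<in>S. \<bar>f x - f y\<bar> \<le> c * norm (x - y)"
proof -
  let ?g = "\<lambda>x. \<Sum>e\<in>Basis. \<bar>dd e f x\<bar>"
  have "continuous_on S ?g"
    by (rule continuous_on_subset[OF _ subset_UNIV]) (intro continuous_on_sum continuous_on_rabs smooth_continuous smooth_dd f)
  from compact_imp_bounded[OF compact_continuous_image[OF this S(2)]] obtain b where "\<forall>y\<in>?g ` S. norm y \<le> b"
    unfolding bounded_iff by (rule exE)
  then have b: "?g x \<le> \<bar>b\<bar>" if "x \<in> S" for x using that by fastforce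
  have dv: "\<bar>dd v f x\<bar> \<le> \<bar>b\<bar> * norm v" if "x \<in> S" for v x
  proof -
    have "dd v f x = (\<Sum>e\<in>Basis. (v \<bullet> e) * dd e f x)"
      unfolding dd_def[of v] by (simp add: frechet_derivative_at[OF smooth_has_derivative[OF f, of x], symmetric])
    also have "\<bar>\<dots>\<bar> \<le> (\<Sum>e\<in>Basis. norm v * \<bar>dd e f x\<bar>)"
      by (intro order_trans[OF sum_abs] sum_mono) (auto simp: abs_mult intro!: mult_right_mono Basis_le_norm)
    also have "\<dots> = norm v * ?g x" by (rule sum_distrib_left[symmetric])
    also have "\<dots> \<le> norm v * \<bar>b\<bar>" by (intro mult_left_mono b that) simp
    finally show ?thesis by (simp add: mult.commute)
  qed
  have "\<bar>f x - f y\<bar> \<le> \<bar>b\<bar> * norm (x - y)" if xy: "x \<in> S" "y \<in> S" for x y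
  proof -
    have "\<exists>s>0. s < 1 \<and> f (y + 1 *\<^sub>R (x - y)) - f (y + 0 *\<^sub>R (x - y)) = (1 - 0) * dd (x - y) f (y + s *\<^sub>R (x - y))"
      by (rule MVT2) (simp, rule smooth_line_derivative[OF f])
    then obtain s where s: "0 < s" "s < 1" "f x - f y = dd (x - y) f (y + s *\<^sub>R (x - y))" by auto
    have "y + s *\<^sub>R (x - y) = (1 - s) *\<^sub>R y + s *\<^sub>R x" by (simp add: algebra_simps)
    then have "y + s *\<^sub>R (x - y) \<in> S" using S(1) xy s by (simp add: convexD)
    from dv[OF this] show ?thesis unfolding s(3) .
  qed
  then show ?thesis by (intro exI[of _ "\<bar>b\<bar>"]) auto
qed

lemma norm_vec_le_card:
  fixes v :: "real^'n"
  assumes "\<And>i. \<bar>v $ i\<bar> \<le> c"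
  shows "norm v \<le> real CARD('n) * c"
  using order_trans[OF norm_le_l1_cart sum_bounded_above[of UNIV "\<lambda>i. \<bar>v $ i\<bar>" c]] assms by simp

definition Hamilton_drift :: "(real^'n \<Rightarrow> real^'n \<Rightarrow> real \<Rightarrow> real) \<Rightarrow> (real \<Rightarrow> real^'n \<Rightarrow> real) \<Rightarrow> real \<Rightarrow> real^'n \<Rightarrow> real^'n" where
  "Hamilton_drift H0 S t x = grad (\<lambda>p. H0 x p t) (grad (S t) x)"

context
  fixes H0 :: "real^'n \<Rightarrow> real^'n \<Rightarrow> real \<Rightarrow> real" and S :: "real \<Rightarrow> real^'n \<Rightarrow> real"
  assumes H0: "smooth (\<lambda>(x, p, t). H0 x p t)" and S: "smooth (\<lambda>(t, x). S t x)"
begin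

lemma momentum_component: "grad (S t) x $ i = dd (0, axis i 1) (\<lambda>(t, x). S t x) (t, x)"
  using partial_slice[OF S, of i t x] by (simp add: grad_def)

lemma Hamilton_drift_component:
  "Hamilton_drift H0 S t x $ i = dd (0, axis i 1, 0) (\<lambda>(x, p, t). H0 x p t) (x, grad (S t) x, t)"
  using partial_slice_momentum[OF H0, of i x t "grad (S t) x"] by (simp add: Hamilton_drift_def grad_def)

lemma axis_Basis_triple: "(0, axis i 1, 0) \<in> (Basis :: ((real^'n) \<times> (real^'n) \<times> real) set)"
  by (auto simp: Basis_prod_def Basis_vec_def axis_eq_axis)

lemma continuous_momentum: "continuous_on UNIV (\<lambda>(t, x). grad (S t) x)"
proof -
  have "continuous_on UNIV (\<lambda>z. \<chi> i. dd (0, axis i 1) (\<lambda>(t, x). S t x) z)"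
    by (intro continuous_on_vec_lambda smooth_continuous smooth_dd S axis_Basis_prod)
  moreover have "(\<lambda>z. \<chi> i. dd (0, axis i 1) (\<lambda>(t, x). S t x) z) = (\<lambda>(t, x). grad (S t) x)"
    by (auto simp: vec_eq_iff momentum_component fun_eq_iff)
  ultimately show ?thesis by (rule back_subst[where P = "continuous_on UNIV"])
qed

lemma continuous_Hamilton_drift: "continuous_on UNIV (\<lambda>(t, x). Hamilton_drift H0 S t x)"
proof -
  have "continuous_on UNIV (\<lambda>z :: real \<times> (real^'n). (snd z, (\<lambda>(t, x). grad (S t) x) z, fst z))"
    by (intro continuous_on_Pair continuous_on_snd continuous_on_fst continuous_on_id continuous_momentum)
  then have "continuous_on UNIV (\<lambda>z. \<chi> i. dd (0, axis i 1, 0) (\<lambda>(x, p, t). H0 x p t) (snd z, (\<lambda>(t, x). grad (S t) x) z, fst z))"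
    by (intro continuous_on_vec_lambda continuous_on_compose2[OF smooth_continuous[OF smooth_dd[OF H0 axis_Basis_triple]]]) auto
  moreover have "(\<lambda>z. \<chi> i. dd (0, axis i 1, 0) (\<lambda>(x, p, t). H0 x p t) (snd z, (\<lambda>(t, x). grad (S t) x) z, fst z)) = (\<lambda>(t, x). Hamilton_drift H0 S t x)"
    by (auto simp: vec_eq_iff Hamilton_drift_component fun_eq_iff)
  ultimately show ?thesis by (rule back_subst[where P = "continuous_on UNIV"])
qed

text \<open>The drift is a derivative of \<open>H0\<close> evaluated at \<open>(x, \<nabla>S, t)\<close>. The momentum is Lipschitz in
  \<open>x\<close> and stays in a ball for \<open>(t, x)\<close> in a compact set, and on the product of these sets the
  derivative of \<open>H0\<close> is Lipschitz.\<close>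

lemma Hamilton_drift_lipschitz:
  assumes Q: "convex Q" "compact Q"
  shows "\<exists>c\<ge>0. \<forall>t\<in>{a..b}. \<forall>x\<in>Q. \<forall>y\<in>Q. norm (Hamilton_drift H0 S t x - Hamilton_drift H0 S t y) \<le> c * norm (x - y)"
proof -
  let ?n = "real CARD('n)"
  let ?P = "\<lambda>i. dd (0, axis i 1) (\<lambda>(t, x). S t x)"
  let ?H = "\<lambda>i. dd (0, axis i 1, 0) (\<lambda>(x, p, t). H0 x p t)"
  have "\<exists>c\<ge>0. \<forall>z w. z \<in> {a..b} \<times> Q \<longrightarrow> w \<in> {a..b} \<times> Q \<longrightarrow> \<bar>?P i z - ?P i w\<bar> \<le> c * norm (z - w)" for i
    using smooth_lipschitz_on[OF smooth_dd[OF S axis_Basis_prod(1)[of i]], of "{a..b} \<times> Q"] Q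
    by (auto simp: convex_Times compact_Times)
  then obtain cP where cP: "\<And>i. 0 \<le> cP i" "\<And>i z w. z \<in> {a..b} \<times> Q \<Longrightarrow> w \<in> {a..b} \<times> Q \<Longrightarrow> \<bar>?P i z - ?P i w\<bar> \<le> cP i * norm (z - w)"
    by metis
  define c1 where "c1 = (\<Sum>i\<in>UNIV. cP i)"
  have c1: "0 \<le> c1" "cP i \<le> c1" for i
    unfolding c1_def using cP(1) by (auto intro!: sum_nonneg member_le_sum)
  have p: "norm (grad (S t) x - grad (S t) y) \<le> ?n * (c1 * norm (x - y))" if "t \<in> {a..b}" "x \<in> Q" "y \<in> Q" for t x y
  proof (rule norm_vec_le_card)
    fix i
    have "\<bar>?P i (t, x) - ?P i (t, y)\<bar> \<le> cP i * norm ((t, x) - (t, y))" using that by (intro cP(2)) auto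
    also have "\<dots> \<le> c1 * norm (x - y)" using c1(2)[of i] by (simp add: norm_Pair mult_right_mono)
    finally show "\<bar>(grad (S t) x - grad (S t) y) $ i\<bar> \<le> c1 * norm (x - y)" by (simp add: momentum_component)
  qed
  have "compact ((\<lambda>(t, x). grad (S t) x) ` ({a..b} \<times> Q))"
    using Q by (intro compact_continuous_image continuous_on_subset[OF continuous_momentum subset_UNIV] compact_Times) auto
  from compact_imp_bounded[OF this] obtain r where "\<forall>y\<in>(\<lambda>(t, x). grad (S t) x) ` ({a..b} \<times> Q). norm y \<le> r"
    unfolding bounded_iff by (rule exE)
  then have r: "grad (S t) x \<in> cball 0 r" if "t \<in> {a..b}" "x \<in> Q" for t x using that by fastforce
  let ?D = "Q \<times> cball (0 :: real^'n) r \<times> {a..b}"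
  have D: "convex ?D" "compact ?D" using Q by (auto intro!: convex_Times compact_Times)
  have "\<exists>c\<ge>0. \<forall>z w. z \<in> ?D \<longrightarrow> w \<in> ?D \<longrightarrow> \<bar>?H i z - ?H i w\<bar> \<le> c * norm (z - w)" for i
    using smooth_lipschitz_on[OF smooth_dd[OF H0 axis_Basis_triple[of i]] D] by blast
  then obtain cH where cH: "\<And>i. 0 \<le> cH i" "\<And>i z w. z \<in> ?D \<Longrightarrow> w \<in> ?D \<Longrightarrow> \<bar>?H i z - ?H i w\<bar> \<le> cH i * norm (z - w)"
    by metis
  define c2 where "c2 = (\<Sum>i\<in>UNIV. cH i)"
  have c2: "0 \<le> c2" "cH i \<le> c2" for i
    unfolding c2_def using cH(1) by (auto intro!: sum_nonneg member_le_sum)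
  have "norm (Hamilton_drift H0 S t x - Hamilton_drift H0 S t y) \<le> (?n * (c2 * (1 + ?n * c1))) * norm (x - y)"
    if txy: "t \<in> {a..b}" "x \<in> Q" "y \<in> Q" for t x y
  proof -
    have "norm (Hamilton_drift H0 S t x - Hamilton_drift H0 S t y) \<le> ?n * (c2 * ((1 + ?n * c1) * norm (x - y)))"
    proof (rule norm_vec_le_card)
      fix i
      have "\<bar>?H i (x, grad (S t) x, t) - ?H i (y, grad (S t) y, t)\<bar> \<le> cH i * norm ((x, grad (S t) x, t) - (y, grad (S t) y, t))"
        using txy r by (intro cH(2)) auto
      also have "\<dots> \<le> c2 * ((1 + ?n * c1) * norm (x - y))"
      proof (intro mult_mono c2)
        have "norm ((x, grad (S t) x, t) - (y, grad (S t) y, t)) \<le> norm (x - y) + norm (grad (S t) x - grad (S t) y, 0 :: real)"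
          unfolding diff_Pair by (metis norm_Pair_le diff_self)
        also have "\<dots> \<le> norm (x - y) + ?n * (c1 * norm (x - y))"
          using p[OF txy] by (simp add: norm_Pair)
        finally show "norm ((x, grad (S t) x, t) - (y, grad (S t) y, t)) \<le> (1 + ?n * c1) * norm (x - y)"
          by (simp add: algebra_simps)
      qed auto
      finally show "\<bar>(Hamilton_drift H0 S t x - Hamilton_drift H0 S t y) $ i\<bar> \<le> c2 * ((1 + ?n * c1) * norm (x - y))"
        by (simp add: Hamilton_drift_component)
    qed
    then show ?thesis by (simp add: mult.assoc)
  qed
  moreover have "0 \<le> ?n * (c2 * (1 + ?n * c1))" using c1(1) c2(1) by simp
  ultimately show ?thesis by blast
qed

text \<open>Time is clamped to \<open>[t0, t0 + 1]\<close> and space is projected to the nearest point of the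
  closed unit ball around \<open>x0\<close>. The projection does not increase distances, so the frozen drift
  inherits the Lipschitz constant of the original one on the cylinder. The horizon \<open>\<delta>\<close> is then
  chosen in terms of that constant.\<close>

lemma frozen_drift:
  fixes t0 :: real and x0 :: "real^'n"
  shows "\<exists>\<beta> K \<Lambda> \<delta>. lipschitz_drift \<beta> K \<Lambda> \<delta> \<and> (\<forall>t\<in>{t0..t0 + \<delta>}. \<forall>x\<in>cball x0 1. \<beta> t x = Hamilton_drift H0 S t x)"
proof -
  let ?b = "Hamilton_drift H0 S"
  define \<tau> where "\<tau> t = max t0 (min t (t0 + 1))" for t
  define \<pi> where "\<pi> = closest_point (cball x0 (1::real))"
  have \<tau>: "\<tau> t \<in> {t0..t0 + 1}" for t by (auto simp: \<tau>_def)
  have \<pi>: "\<pi> x \<in> cball x0 1" for x unfolding \<pi>_def by (rule closest_point_in_set) auto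
  obtain c where c: "c \<ge> 0" "\<And>t x y. t \<in> {t0..t0 + 1} \<Longrightarrow> x \<in> cball x0 1 \<Longrightarrow> y \<in> cball x0 1 \<Longrightarrow> norm (?b t x - ?b t y) \<le> c * norm (x - y)"
    using Hamilton_drift_lipschitz[of "cball x0 1" t0 "t0 + 1"] by (auto simp: Ball_def)
  have "compact ((\<lambda>(t, x). ?b t x) ` ({t0..t0 + 1} \<times> cball x0 1))"
    by (intro compact_continuous_image continuous_on_subset[OF continuous_Hamilton_drift subset_UNIV] compact_Times) auto
  from compact_imp_bounded[OF this] obtain K where "\<forall>y\<in>(\<lambda>(t, x). ?b t x) ` ({t0..t0 + 1} \<times> cball x0 1). norm y \<le> K"
    unfolding bounded_iff by (rule exE)
  then have K: "norm (?b t x) \<le> K" if "t \<in> {t0..t0 + 1}" "x \<in> cball x0 1" for t x using that by fastforce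
  \<comment> \<open>The contraction condition \<open>c \<delta> \<le> 1 / 2\<close>; adding 1 covers the case \<open>c = 0\<close> and gives
    \<open>\<delta> \<le> 1\<close>.\<close>
  define \<delta> where "\<delta> = 1 / (2 * (c + 1))"
  have \<delta>: "0 < \<delta>" "\<delta> \<le> 1" "c * \<delta> \<le> 1 / 2" using c(1) by (auto simp: \<delta>_def field_simps)
  have "lipschitz_drift (\<lambda>t x. ?b (\<tau> t) (\<pi> x)) K c \<delta>"
  proof
    have "continuous_on UNIV (\<lambda>z :: real \<times> (real^'n). (\<tau> (fst z), \<pi> (snd z)))"
      unfolding \<tau>_def \<pi>_def
      by (intro continuous_intros continuous_on_compose2[OF continuous_on_closest_point]) auto
    from continuous_on_compose2[OF continuous_Hamilton_drift this]
    show "continuous_on UNIV (\<lambda>(t, x). ?b (\<tau> t) (\<pi> x))" by (simp add: split_beta')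
    show "norm (?b (\<tau> t) (\<pi> x)) \<le> K" for t x by (intro K \<tau> \<pi>)
    show "norm (?b (\<tau> t) (\<pi> x) - ?b (\<tau> t) (\<pi> y)) \<le> c * norm (x - y)" for t x y
    proof -
      have "dist (\<pi> x) (\<pi> y) \<le> dist x y" unfolding \<pi>_def by (intro closest_point_lipschitz) auto
      then have "c * norm (\<pi> x - \<pi> y) \<le> c * norm (x - y)" using c(1) by (intro mult_left_mono) (auto simp: dist_norm)
      with c(2)[OF \<tau> \<pi> \<pi>, of t x y] show ?thesis by linarith
    qed
  qed (use c(1) \<delta> in auto)
  moreover have "?b (\<tau> t) (\<pi> x) = ?b t x" if "t \<in> {t0..t0 + \<delta>}" "x \<in> cball x0 1" for t x
  proof -
    have "\<tau> t = t" using that \<delta> by (auto simp: \<tau>_def)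
    moreover have "\<pi> x = x" unfolding \<pi>_def by (rule closest_point_self[OF that(2)])
    ultimately show ?thesis by simp
  qed
  ultimately show ?thesis by blast
qed

text \<open>The diffusion with the frozen drift, followed until it leaves the cylinder, is one of
  those considered in (a), since the two drifts agree there. The equation at time \<open>t0\<close> holds
  almost surely, hence for some sample, and at time \<open>t0\<close> every sample is at \<open>x0\<close>.\<close>

lemma Hamilton_equation_at_start:
  fixes t0 :: real and x0 :: "real^'n"
  assumes hbar: "0 < hbar" and w: "(UNIV :: real set) \<lesssim> (UNIV :: 'w set)"
    and a: "\<And>(M :: 'w measure) F t0 \<tau> (X :: real \<Rightarrow> 'w \<Rightarrow> real^'n).
        usual_filtered_space M F \<Longrightarrow> diffusion M F t0 \<tau> X \<Longrightarrow>
        has_mean_derivative M F t0 \<tau> X (\<lambda>t \<omega>. Hamilton_drift H0 S t (X t \<omega>)) \<Longrightarrow>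
        has_quadratic_mean_derivative M F t0 \<tau> X (\<lambda>t \<omega>. hbar *\<^sub>R mat 1) \<Longrightarrow>
        solves_stochastic_Hamilton hbar H0 M F t0 \<tau> X (\<lambda>t x. grad (S t) x)"
  shows "total_mean_derivative hbar (grad (\<lambda>q. H0 x0 q t0) (grad (S t0) x0)) (\<lambda>t x. grad (S t) x) t0 x0 =
    - grad (\<lambda>y. H0 y (grad (S t0) x0) t0) x0"
proof -
  obtain \<beta> K \<Lambda> \<delta> where \<beta>: "lipschitz_drift \<beta> K \<Lambda> \<delta>"
    and eq: "\<And>t x. t \<in> {t0..t0 + \<delta>} \<Longrightarrow> x \<in> cball x0 1 \<Longrightarrow> \<beta> t x = Hamilton_drift H0 S t x"
    using frozen_drift[of t0 x0] by blast
  obtain M :: "'w measure" and F and B :: "real \<Rightarrow> 'w \<Rightarrow> real^'n" and R where B: "brownian M F t0 B R"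
    using brownian_exists[OF w] by blast
  interpret D: brownian_drift M F t0 B R \<beta> K \<Lambda> \<delta> x0 hbar
    by (intro brownian_drift.intro brownian_drift_axioms.intro B \<beta> hbar)
  have V: "Hamilton_drift H0 S t (D.X t \<omega>) = \<beta> t (D.X t \<omega>)"
    if t: "t0 \<le> t" "t < D.hit 1 \<omega>" and \<omega>: "\<omega> \<in> space M" for t \<omega>
  proof (rule eq[symmetric])
    show "t \<in> {t0..t0 + \<delta>}" using t D.hit_attained(2)[OF _ _ \<omega>, of 1] by simp
    show "D.X t \<omega> \<in> cball x0 1"
      using D.X_near_before_hit[OF _ _ \<omega> t] by (simp add: dist_norm norm_minus_commute)
  qed
  have "solves_stochastic_Hamilton hbar H0 M F t0 (\<lambda>\<omega>. ereal (D.hit 1 \<omega>)) D.X (\<lambda>t x. grad (S t) x)"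
    by (intro a D.usual_filtered_space_axioms D.diffusion_X D.has_mean_derivative_X D.has_quadratic_mean_derivative_X V)
  then obtain V' where "AE \<omega> in M. ereal t0 < ereal (D.hit 1 \<omega>) \<longrightarrow>
      (let x = D.X t0 \<omega>; p = grad (S t0) x in
         V' t0 \<omega> = grad (\<lambda>q. H0 x q t0) p \<and>
         total_mean_derivative hbar (V' t0 \<omega>) (\<lambda>t x. grad (S t) x) t0 x = - grad (\<lambda>y. H0 y p t0) x)"
    unfolding solves_stochastic_Hamilton_def by blast
  then have "AE \<omega> in M. \<omega> \<in> space M \<and> (ereal t0 < ereal (D.hit 1 \<omega>) \<longrightarrow>
      (let x = D.X t0 \<omega>; p = grad (S t0) x in
         V' t0 \<omega> = grad (\<lambda>q. H0 x q t0) p \<and>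
         total_mean_derivative hbar (V' t0 \<omega>) (\<lambda>t x. grad (S t) x) t0 x = - grad (\<lambda>y. H0 y p t0) x))"
    by (intro AE_conjI AE_space)
  from eventually_happens'[OF D.ae_filter_bot this] obtain \<omega> where \<omega>: "\<omega> \<in> space M"
    and E: "t0 < D.hit 1 \<omega> \<Longrightarrow> V' t0 \<omega> = grad (\<lambda>q. H0 (D.X t0 \<omega>) q t0) (grad (S t0) (D.X t0 \<omega>)) \<and>
         total_mean_derivative hbar (V' t0 \<omega>) (\<lambda>t x. grad (S t) x) t0 (D.X t0 \<omega>) = - grad (\<lambda>y. H0 y (grad (S t0) (D.X t0 \<omega>)) t0) (D.X t0 \<omega>)"
    by (auto simp: Let_def)
  \<comment> \<open>The lifetime is strictly after \<open>t0\<close>: the intermediate depth 1/2 is reached before.\<close>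
  have "D.hit (1 / 2) \<omega> < D.hit 1 \<omega>" by (rule D.hit_strict_mono[OF _ _ _ \<omega>]) auto
  moreover have "t0 \<le> D.hit (1 / 2) \<omega>" by (rule D.hit_attained(1)[OF _ _ \<omega>]) auto
  ultimately have "t0 < D.hit 1 \<omega>" by simp
  with E D.X_start[OF order.refl \<omega>] show ?thesis by metis
qed

end

theorem theorem3p5:
  fixes hbar :: real
    and H0 :: "real^'n \<Rightarrow> real^'n \<Rightarrow> real \<Rightarrow> real"
    and S :: "real \<Rightarrow> real^'n \<Rightarrow> real"
  assumes "hbar > 0"
    and "smooth (\<lambda>(x, p, t). H0 x p t)"
    and "smooth (\<lambda>(t, x). S t x)"
    and "(UNIV :: real set) \<lesssim> (UNIV :: 'w set)"
  shows
    "(\<forall>(M :: 'w measure) F t0 \<tau> (X :: real \<Rightarrow> 'w \<Rightarrow> real^'n).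
        usual_filtered_space M F \<and> diffusion M F t0 \<tau> X \<and>
        has_mean_derivative M F t0 \<tau> X
          (\<lambda>t \<omega>. grad (\<lambda>p. H0 (X t \<omega>) p t) (grad (S t) (X t \<omega>))) \<and>
        has_quadratic_mean_derivative M F t0 \<tau> X (\<lambda>t \<omega>. hbar *\<^sub>R mat 1) \<longrightarrow>
        solves_stochastic_Hamilton hbar H0 M F t0 \<tau> X (\<lambda>t x. grad (S t) x))
     \<longleftrightarrow>
     (\<exists>f :: real \<Rightarrow> real. \<forall>t x.
        deriv (\<lambda>s. S s x) t + H0 x (grad (S t) x) t + hbar / 2 * laplacian (S t) x = f t)"
    (is "?a \<longleftrightarrow> ?b")
proof
  let ?E = "\<lambda>t x. total_mean_derivative hbar (grad (\<lambda>q. H0 x q t) (grad (S t) x)) (\<lambda>t x. grad (S t) x) t x + grad (\<lambda>y. H0 y (grad (S t) x) t) x"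
  let ?G = "\<lambda>t x. deriv (\<lambda>s. S s x) t + H0 x (grad (S t) x) t + hbar / 2 * laplacian (S t) x"
  note HJ = Hamilton_Jacobi_has_derivative[OF assms(2,3), where hbar = hbar]
  {
    assume ?a
    have E: "?E t x = 0" for t x
      using Hamilton_equation_at_start[OF assms(2,3,1,4), where ?t0.0 = t and ?x0.0 = x] \<open>?a\<close> by (simp add: Hamilton_drift_def)
    have "\<exists>c. \<forall>x\<in>UNIV. ?G t x = c" for t
      by (rule has_derivative_zero_constant[OF convex_UNIV]) (use HJ[where t = t] in \<open>simp only: E inner_zero_right\<close>)
    then have "\<forall>t. \<exists>c. \<forall>x. ?G t x = c" by simp
    from choice[OF this] show ?b .
  next
    assume ?b
    then obtain f where f: "?G t x = f t" for t x by blast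
    have E: "?E t x = 0" for t x
    proof -
      have "((\<lambda>x. f t) has_derivative (\<lambda>v. v \<bullet> ?E t x)) (at x)"
        using HJ[where t = t and x = x] by (simp only: f)
      then have "(\<lambda>v. v \<bullet> ?E t x) = (\<lambda>v. 0)"
        by (rule has_derivative_unique[OF _ has_derivative_const])
      then have "?E t x \<bullet> ?E t x = 0" by (rule fun_cong)
      then show ?thesis by simp
    qed
    have E': "total_mean_derivative hbar (grad (\<lambda>q. H0 x q t) (grad (S t) x)) (\<lambda>t x. grad (S t) x) t x = - grad (\<lambda>y. H0 y (grad (S t) x) t) x" for t x
      using E[where t = t and x = x] by (simp add: eq_neg_iff_add_eq_0)
    show ?a
    proof (intro allI impI, elim conjE)
      fix M :: "'w measure" and F t0 \<tau> and X :: "real \<Rightarrow> 'w \<Rightarrow> real^'n"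
      assume D: "has_mean_derivative M F t0 \<tau> X (\<lambda>t \<omega>. grad (\<lambda>p. H0 (X t \<omega>) p t) (grad (S t) (X t \<omega>)))"
        and Q: "has_quadratic_mean_derivative M F t0 \<tau> X (\<lambda>t \<omega>. hbar *\<^sub>R mat 1)"
      show "solves_stochastic_Hamilton hbar H0 M F t0 \<tau> X (\<lambda>t x. grad (S t) x)"
        unfolding solves_stochastic_Hamilton_def Let_def
        by (intro conjI Q exI[of _ "\<lambda>t \<omega>. grad (\<lambda>p. H0 (X t \<omega>) p t) (grad (S t) (X t \<omega>))"] D allI impI AE_I2 refl E')
    qed
  }
qed

end
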